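(* Let $D=((a_n),(b_n))$ be an almost periodic divisor with a regular indexing, with $a_n\neq0$, $b_n\neq0$ for all $n$. Then $D$ is the divisor of some $f\in{\cal AE}$ if and only if: (a) $\inf_{n,k}|a_n-b_k|>0$; (b) there exist $\beta\in\mathbb{C}$ and $C<\infty$ such that for every convex bounded set $E\subset\mathbb{C}$, $$\big|\nu_D(E)-\bar\beta\, m_2(E)/(2\pi)\big|\le C\,(m_1(\partial E)+1);$$ (c) there is $C<\infty$ such that for every $z\in\mathbb{C}$, $$\limsup_{r\to\infty}\Big|\int_{1\le|w|\le r}\frac{d\nu_D^z(w)-d\nu_D(w)}{w}\Big|<C.$$ In this case, with $\beta$ from (b), the function $f$ is, up to a constant factor, $$f(z)=e^{\beta z/2}\lim_{r\to\infty}\prod_{n:|c_n|<r}\frac{b_n(a_n-z)}{a_n(b_n-z)},\qquad c_n=(a_n+b_n)/2.$$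
   Context: $\rho_S$ is the spherical metric. A nonconstant meromorphic function $f$ on $\mathbb{C}$ is almost elliptic ($f\in{\cal AE}$) if for every $\varepsilon>0$ there is $L<\infty$ such that every disc $B(c,L)=\{z:|z-c|<L\}$ contains a point $\tau$ with $\rho_S(f(z+\tau),f(z))<\varepsilon$ for all $z\in\mathbb{C}$. A divisor $D=((a_n)_{n\in\mathbb{N}},(b_n)_{n\in\mathbb{N}})$ lists zeros $a_n$ and poles $b_n$ with multiplicity (the divisor of $f$: zeros and poles of $f$ with multiplicities). A number $\tau$ is an $\varepsilon$-almost period of $D$ if there are bijections $\sigma,\sigma':\mathbb{N}\to\mathbb{N}$ with $|a_n+\tau-a_{\sigma(n)}|<\varepsilon$ and $|b_n+\tau-b_{\sigma'(n)}|<\varepsilon$ for all $n$; $D$ is almost periodic if for every $\varepsilon>0$ there is $L$ such that every disc of radius $L$ contains an $\varepsilon$-almost period of $D$; $D$ is almost periodic with a regular indexing if moreover for every $\varepsilon$ these almost periods can be taken with $\sigma=\sigma'$. (For such $D$ one has $\sup_n|a_n-b_n|<\infty$.) $\nu_D$ is the complex discrete measure $\sum_n(a_n-b_n)\delta_{c_n}$ with $c_n=(a_n+b_n)/2$; for a measure $\nu$, $\nu^z(E)=\nu(E+z)$. $m_2$ is planar Lebesgue measure and $m_1$ is one-dimensional Hausdorff measure (length). *)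

theory Defs
  imports "HOL-Analysis.Analysis" "HOL-Library.Liminf_Limsup"
begin

text \<open>Points of the Riemann sphere: Some w is a finite point, None is infinity.
  The spherical (chordal) metric.\<close>
definition rhoS :: "complex option \<Rightarrow> complex option \<Rightarrow> real" where
  "rhoS x y = (case (x, y) of
      (Some u, Some v) \<Rightarrow> 2 * norm (u - v) / (sqrt (1 + (norm u)^2) * sqrt (1 + (norm v)^2))
    | (Some u, None) \<Rightarrow> 2 / sqrt (1 + (norm u)^2)
    | (None, Some v) \<Rightarrow> 2 / sqrt (1 + (norm v)^2)
    | (None, None) \<Rightarrow> 0)"

definition mero_local :: "(complex \<Rightarrow> complex option) \<Rightarrow> complex \<Rightarrow> int \<Rightarrow> bool" where
  "mero_local f w k \<longleftrightarrow> (\<exists>r g. r > 0 \<and> g holomorphic_on ball w r \<and> (\<forall>z\<in>ball w r. g z \<noteq> 0)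
      \<and> (\<forall>z\<in>ball w r - {w}. f z = Some ((z - w) powi k * g z))
      \<and> f w = (if k < 0 then None else if k = 0 then Some (g w) else Some 0))"

text \<open>Meromorphic on the whole plane (and not identically zero).\<close>
definition meromorphic_C :: "(complex \<Rightarrow> complex option) \<Rightarrow> bool" where
  "meromorphic_C f \<longleftrightarrow> (\<forall>w. \<exists>k. mero_local f w k)"

definition mero_order :: "(complex \<Rightarrow> complex option) \<Rightarrow> complex \<Rightarrow> int" where
  "mero_order f w = (THE k. mero_local f w k)"

definition almost_elliptic :: "(complex \<Rightarrow> complex option) \<Rightarrow> bool" where
  "almost_elliptic f \<longleftrightarrow> meromorphic_C f \<and> (\<exists>z1 z2. f z1 \<noteq> f z2) \<and>
     (\<forall>\<epsilon>>0. \<exists>L. \<forall>c. \<exists>\<tau>\<in>ball c L. \<forall>z. rhoS (f (z + \<tau>)) (f z) < \<epsilon>)"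

definition divisor_of :: "(complex \<Rightarrow> complex option) \<Rightarrow> (nat \<Rightarrow> complex) \<Rightarrow> (nat \<Rightarrow> complex) \<Rightarrow> bool" where
  "divisor_of f a b \<longleftrightarrow> (\<forall>w. finite {n. a n = w} \<and> finite {n. b n = w}
      \<and> card {n. a n = w} = nat (mero_order f w) \<and> card {n. b n = w} = nat (- mero_order f w))"

definition locally_finite_div :: "(nat \<Rightarrow> complex) \<Rightarrow> (nat \<Rightarrow> complex) \<Rightarrow> bool" where
  "locally_finite_div a b \<longleftrightarrow> (\<forall>R::real. finite {n. norm (a n) \<le> R} \<and> finite {n. norm (b n) \<le> R})"

definition almost_period_div :: "(nat \<Rightarrow> complex) \<Rightarrow> (nat \<Rightarrow> complex) \<Rightarrow> real \<Rightarrow> complex \<Rightarrow> bool" where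
  "almost_period_div a b \<epsilon> \<tau> \<longleftrightarrow> (\<exists>\<sigma> \<sigma>'. bij (\<sigma>::nat\<Rightarrow>nat) \<and> bij (\<sigma>'::nat\<Rightarrow>nat) \<and>
      (\<forall>n. norm (a n + \<tau> - a (\<sigma> n)) < \<epsilon> \<and> norm (b n + \<tau> - b (\<sigma>' n)) < \<epsilon>))"

definition almost_periodic_div :: "(nat \<Rightarrow> complex) \<Rightarrow> (nat \<Rightarrow> complex) \<Rightarrow> bool" where
  "almost_periodic_div a b \<longleftrightarrow> (\<forall>\<epsilon>>0. \<exists>L. \<forall>c. \<exists>\<tau>\<in>ball c L. almost_period_div a b \<epsilon> \<tau>)"

definition almost_periodic_regular :: "(nat \<Rightarrow> complex) \<Rightarrow> (nat \<Rightarrow> complex) \<Rightarrow> bool" where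
  "almost_periodic_regular a b \<longleftrightarrow> almost_periodic_div a b \<and>
     (\<forall>\<epsilon>>0. \<exists>L. \<forall>c. \<exists>\<tau>\<in>ball c L. \<exists>\<sigma>. bij (\<sigma>::nat\<Rightarrow>nat) \<and>
        (\<forall>n. norm (a n + \<tau> - a (\<sigma> n)) < \<epsilon> \<and> norm (b n + \<tau> - b (\<sigma> n)) < \<epsilon>))"

definition nuD :: "(nat \<Rightarrow> complex) \<Rightarrow> (nat \<Rightarrow> complex) \<Rightarrow> complex set \<Rightarrow> complex" where
  "nuD a b E = (\<Sum>n\<in>{n. (a n + b n) / 2 \<in> E}. a n - b n)"

text \<open>Integral of dnu_D^z(w)/w over 1 \<le> |w| \<le> r, where nu_D^z(E) = nu_D(E + z).\<close>
definition nuD_shift_int :: "(nat \<Rightarrow> complex) \<Rightarrow> (nat \<Rightarrow> complex) \<Rightarrow> complex \<Rightarrow> real \<Rightarrow> complex" where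
  "nuD_shift_int a b z r = (\<Sum>n\<in>{n. 1 \<le> norm ((a n + b n) / 2 - z) \<and> norm ((a n + b n) / 2 - z) \<le> r}.
       (a n - b n) / ((a n + b n) / 2 - z))"

definition hausdorff1 :: "complex set \<Rightarrow> ennreal" where
  "hausdorff1 A = (SUP \<delta>\<in>{0::real<..}. INF U\<in>{U::nat \<Rightarrow> complex set. A \<subseteq> (\<Union>i. U i) \<and>
       (\<forall>i. bounded (U i) \<and> diameter (U i) \<le> \<delta>)}. (\<Sum>i. ennreal (diameter (U i))))"

end

theory Submission
 imports Defs "HOL-Complex_Analysis.Complex_Analysis"
begin

text \<open>Write the zeros and poles as \<open>c n + d n / 2\<close> and \<open>c n - d n / 2\<close>. A bounded continuous kernel \<open>kap\<close> that
 agrees with \<open>log ((w + d/2) / (w - d/2))\<close> far from the pair splits the desired product into a locally finite,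
 almost periodic product \<open>PP\<close> and the exponential of a conditionally convergent potential \<open>TT\<close>. The area
 bound (b) makes \<open>TT\<close> converge and, since the Cauchy transform of a disc is linear, identifies it up to a bounded error
 with the shifted integrals in (c), minus an antiholomorphic linear term that the factor \<open>exp (\<beta> z / 2)\<close> turns into a phase.
 If (c) holds, Bohr's argument shows that the resulting bounded exponent is almost periodic.

 Conversely, an almost elliptic \<open>f\<close> equals \<open>E * PP\<close> with \<open>E\<close> zero-free. Spherical uniform continuity bounds \<open>E\<close>
 above and below, and common almost periods make \<open>log E\<close> additive up to a bounded error, so that
 \<open>log E = i Im (\<beta> z) + k\<close> with \<open>k\<close> bounded. Integrating \<open>log E\<close> over unit circles and then over a convex set gives (b), and
 Liouville's theorem with an averaging argument identifies \<open>k\<close> with the potential up to a constant.\<close>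

subsection \<open>Counting\<close>

text \<open>Taking \<open>c n\<close> as midpoint makes the logarithm of a pair an odd function of w
  = \<open>c n\<close> - z, that is \<open>d n\<close> / w plus a cubic error and no quadratic term.
  A disc of radius r holds O(r^2) pairs, so cubic terms sum absolutely, while the terms
  \<open>d n\<close> z / \<open>c n\<close>^2 that remain in the potential converge only
  conditionally. They are controlled by averaging (b) over squares of side s: the discrepancy costs
  1/s, the oscillation of 1/w^2 over a square costs s/\<rho>, and s = sqrt \<rho> balances both;
  hence the tails of order 1/sqrt \<rho>. All constants depend only on bounds shared by the
  translates of the divisor. Boundedness of the kernel is paid for by holomorphy: neither
  \<open>PP\<close> nor \<open>E\<close> is holomorphic, only \<open>E\<close> with the nearby
  kernels removed is, and the maximum principle is applied to that. In the converse, zeros may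
  cluster among themselves, and so may poles; estimates are therefore made on circles that avoid all
  of them by a fixed distance and are then carried inside.\<close>

lemma cball_cover_unit:
 fixes z :: complex
 assumes "R \<ge> 1"
 obtains P where "finite P" "real (card P) <= 25 * R^2" "cball z R \<subseteq> (\<Union>p\<in>P. cball p 1)"
proof -
 define m where "m = \<lceil>R\<rceil>"
 define P where "P = (%(j,k). z + Complex (of_int j) (of_int k)) ` ({-m..m} \<times> {-m..m})"
 have m: "R <= m" "m < R + 1" unfolding m_def by linarith+
 have "card P <= card ({-m..m} \<times> {-m..m})"
  unfolding P_def by (rule card_image_le) auto
 also have "... = (nat (2*m+1))^2" by (simp add: card_cartesian_product power2_eq_square)
 finally have "real (card P) <= (real (nat (2*m+1)))^2"
  by (metis of_nat_le_iff of_nat_power)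
 also have "real (nat (2*m+1)) = 2 * real_of_int m + 1" using m assms by (simp add: of_nat_nat)
 \<comment> \<open>From m < R + 1: 2m + 1 < 2R + 3 <= 5R because R >= 1; this is the origin of the
   constant 25.\<close>
 also have "(2 * real_of_int m + 1)^2 <= (5*R)^2"
  using m assms by (intro power_mono) linarith+
 finally have card: "real (card P) <= 25 * R^2" by (simp add: power_mult_distrib)
 have "cball z R \<subseteq> (\<Union>p\<in>P. cball p 1)"
 proof
  fix w assume "w \<in> cball z R"
  hence w: "norm (w - z) <= R" by (simp add: dist_norm norm_minus_commute)
  define j where "j = round (Re (w - z))"
  define k where "k = round (Im (w - z))"
  have j: "\<bar>of_int j - Re (w - z)\<bar> <= 1/2" and k: "\<bar>of_int k - Im (w - z)\<bar> <= 1/2"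
   unfolding j_def k_def by (rule of_int_round_abs_le)+
  have a1: "\<bar>Re (w - z)\<bar> <= m" "\<bar>Im (w - z)\<bar> <= m"
   using abs_Re_le_cmod[of "w-z"] abs_Im_le_cmod[of "w-z"] w m by linarith+
  have "real_of_int j < of_int (m+1)" "real_of_int k < of_int (m+1)"
    "real_of_int (-m-1) < of_int j" "real_of_int (-m-1) < of_int k"
   using a1 j k by linarith+
  hence jk: "j \<in> {-m..m}" "k \<in> {-m..m}" unfolding of_int_less_iff by auto
  have "z + Complex (of_int j) (of_int k) \<in> P" unfolding P_def using jk by auto
  moreover have "norm (z + Complex (of_int j) (of_int k) - w) <= 1"
  proof -
   have "norm (z + Complex (of_int j) (of_int k) - w) <= \<bar>Re (z + Complex (of_int j) (of_int k) - w)\<bar> + \<bar>Im (z + Complex (of_int j) (of_int k) - w)\<bar>"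
    by (rule cmod_le)
   also have "... <= 1" using j k unfolding plus_complex.sel minus_complex.sel complex.sel by linarith
   finally show ?thesis .
  qed
  ultimately show "w \<in> (\<Union>p\<in>P. cball p 1)" by (auto simp: dist_norm)
 qed
 moreover have "finite P" unfolding P_def by auto
 ultimately show ?thesis using card that by blast
qed

text \<open>The pairs are recorded by centres \<open>c n\<close> and differences \<open>d n\<close>, i.e. the zeros are
 \<open>c n + d n / 2\<close> and the poles \<open>c n - d n / 2\<close>; a translation then only affects \<open>c\<close>.\<close>
definition pairs :: "(nat => complex) => (nat => complex) => real => real => bool" where
 "pairs c d M N \<longleftrightarrow> 1 <= M \<and> 1 <= N \<and> (\<forall>n. norm (d n) <= M) \<and>
   (\<forall>z. finite {n. norm (c n - z) <= 1} \<and> real (card {n. norm (c n - z) <= 1}) <= N)"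

lemma pairsD:
 assumes "pairs c d M N"
 shows "1 <= M" "1 <= N" "norm (d n) <= M" "finite {n. norm (c n - z) <= 1}"
  "real (card {n. norm (c n - z) <= 1}) <= N"
 using assms unfolding pairs_def by auto

lemma pairs_shift:
 assumes "pairs c d M N" shows "pairs (%n. c n - x) d M N"
proof -
 have "{n. norm (c n - x - z) <= 1} = {n. norm (c n - (x + z)) <= 1}" for z
  by (simp add: algebra_simps)
 thus ?thesis using assms by (simp add: pairs_def)
qed

lemma pairs_card_cover:
 assumes p: "pairs c d M N" and P: "finite P" and S: "!!n. n \<in> S ==> \<exists>p\<in>P. norm (c n - p) <= 1"
 shows "finite S" "real (card S) <= real (card P) * N"
proof -
 have sub: "S \<subseteq> (\<Union>p\<in>P. {n. norm (c n - p) <= 1})" using S by blast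
 have fin: "finite (\<Union>p\<in>P. {n. norm (c n - p) <= 1})" using P pairsD(4)[OF p] by blast
 thus "finite S" using sub by (rule rev_finite_subset)
 have "card S <= card (\<Union>p\<in>P. {n. norm (c n - p) <= 1})" using sub fin by (rule card_mono[rotated])
 also have "... <= (\<Sum>p\<in>P. card {n. norm (c n - p) <= 1})" using P by (rule card_UN_le)
 finally have "real (card S) <= real (\<Sum>p\<in>P. card {n. norm (c n - p) <= 1})"
  by (simp only: of_nat_le_iff)
 also have "... = (\<Sum>p\<in>P. real (card {n. norm (c n - p) <= 1}))" by simp
 also have "... <= (\<Sum>p\<in>P. N)" using pairsD(5)[OF p] by (intro sum_mono)
 finally show "real (card S) <= real (card P) * N" by simp
qed

lemma pairs_count:
 assumes p: "pairs c d M N" and R: "R \<ge> 1" and S: "!!n. n \<in> S ==> norm (c n - z) <= R"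
 shows "finite S" "real (card S) <= 25 * N * R^2"
proof -
 obtain P where P: "finite P" "real (card P) <= 25 * R^2" "cball z R \<subseteq> (\<Union>p\<in>P. cball p 1)"
  using cball_cover_unit[OF R] by blast
 have *: "\<exists>q\<in>P. norm (c n - q) <= 1" if "n \<in> S" for n
 proof -
  have "c n \<in> cball z R" using S[OF that] by (simp add: dist_norm norm_minus_commute)
  thus ?thesis using P(3) by (force simp: dist_norm norm_minus_commute)
 qed
 show "finite S" using pairs_card_cover[OF p P(1) *] by blast
 have "real (card S) <= real (card P) * N" using pairs_card_cover[OF p P(1) *] by blast
 also have "... <= 25 * R^2 * N" using P(2) pairsD(2)[OF p] by (intro mult_right_mono) auto
 finally show "real (card S) <= 25 * N * R^2" by (simp add: mult_ac)
qed

lemma pairs_finite: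
 assumes "pairs c d M N" shows "finite {n. norm (c n - z) <= R}" "finite {n. norm (c n - z) < R}"
proof -
 have "finite {n. norm (c n - z) <= max 1 R}" using pairs_count(1)[OF assms, of "max 1 R" "{n. norm (c n - z) <= max 1 R}" z] by auto
 thus "finite {n. norm (c n - z) <= R}" "finite {n. norm (c n - z) < R}"
  by (auto elim!: finite_subset[rotated])
qed

text \<open>Dyadic summation in finite form: \<open>B\<close> bounds the contribution of one shell
  [r, 2r), and the inequalities for \<open>A\<close> say that it dominates B(r) + B(2r) + ... A
  finite set meets finitely many shells, so induction on their number replaces an infinite
  series.\<close>

lemma dyadic_bound:
 fixes F :: "nat set => real" and u :: "nat => real" and A B :: "real => real" and r rmin :: real
 assumes base: "!!S r. finite S ==> r \<ge> rmin ==> (!!n. n \<in> S ==> r <= u n \<and> u n < 2*r) ==> F S <= B r"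
  and sub: "!!S T. finite S ==> finite T ==> S \<inter> T = {} ==> F (S \<union> T) <= F S + F T"
  and B: "!!r. r \<ge> rmin ==> B r + A (2*r) <= A r" "!!r. r \<ge> rmin ==> B r <= A r"
  and "rmin > 0" "finite S" "r \<ge> rmin" "!!n. n \<in> S ==> r <= u n"
 shows "F S <= A r"
proof -
 have claim: "!!r S. r \<ge> rmin ==> finite S ==> (!!n. n \<in> S ==> r <= u n \<and> u n < 2^Suc k*r) ==> F S <= A r" for k
 proof (induction k)
  case 0
  thus ?case using base[of S r] B(2)[of r] by force
 next
  case (Suc k)
  define S1 where "S1 = {n\<in>S. u n < 2*r}"
  define S2 where "S2 = {n\<in>S. 2*r <= u n}"
  have S: "S = S1 \<union> S2" "S1 \<inter> S2 = {}" unfolding S1_def S2_def by auto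
  have fin: "finite S1" "finite S2" using Suc.prems(2) unfolding S1_def S2_def by auto
  have "F S <= F S1 + F S2" using sub[OF fin S(2)] S(1) by simp
  also have "F S1 <= B r" using Suc.prems fin(1) by (intro base) (auto simp: S1_def)
  also have "F S2 <= A (2*r)"
   using Suc.prems fin(2) \<open>rmin > 0\<close> by (intro Suc.IH) (auto simp: S2_def mult_ac)
  also have "B r + A (2*r) <= A r" using B Suc.prems by blast
  finally show ?case by simp
 qed
 have "\<exists>k. \<forall>n\<in>S. u n < 2^k"
 proof -
  have X: "u n <= Max (u ` S)" if "n \<in> S" for n using \<open>finite S\<close> that by simp
  obtain k where "Max (u ` S) < 2^k" using real_arch_pow[of 2 "Max (u ` S)"] by auto
  thus ?thesis using X by (meson le_less_trans)
 qed
 then obtain k where k: "!!n. n \<in> S ==> u n < 2^k" by blast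
 obtain k' where k': "1/r < 2^k'" using real_arch_pow[of 2 "1/r"] by auto
 have "u n < 2^Suc (k+k') * r" if "n \<in> S" for n
 proof -
  have "1 < 2^k' * r" using k' assms(5,7) by (simp add: field_simps)
  hence "(2::real)^k * 1 <= 2^k * (2^k' * r)" by (intro mult_left_mono) auto
  also have "... <= 2^Suc (k+k') * r" using assms(5,7) by (simp add: power_add)
  finally show ?thesis using k[OF that] by linarith
 qed
 thus ?thesis using assms(5,7,8) by (intro claim[of r S "k+k'"] conjI assms(6)) auto
qed

text \<open>A shell [r, 2r) holds at most 100 N r^2 points, each contributing at most r^-3; the
  bounds 100 N / r of successive shells form a geometric series with sum 200 N / r.\<close>

lemma pairs_sum_cube:
 assumes p: "pairs c d M N" and \<rho>: "\<rho> \<ge> 1" and "finite S"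
  and S: "!!n. n \<in> S ==> \<rho> <= norm (c n - z)"
 shows "(\<Sum>n\<in>S. 1 / norm (c n - z)^3) <= 200 * N / \<rho>"
proof -
 let ?F = "%S. \<Sum>n\<in>S. 1 / norm (c n - z)^3"
 note D = dyadic_bound[where F = ?F and rmin=1 and u = "%n. norm (c n - z)" and B = "%r. 100*N/r" and A = "%r. 200*N/r" and r = \<rho> and S = S]
 have base: "?F S <= 100 * N / r" if f: "finite S" and r: "r \<ge> (1::real)" and h: "!!n. n \<in> S ==> r <= norm (c n - z) \<and> norm (c n - z) < 2*r" for S r
 proof -
 have "real (card S) <= 25 * N * (2*r)^2"
  using h r by (intro pairs_count(2)[OF p]) (auto intro: less_imp_le)
 moreover have "(\<Sum>n\<in>S. 1 / norm (c n - z)^3) <= (\<Sum>n\<in>S. 1 / r^3)"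
  using h r by (intro sum_mono divide_left_mono power_mono mult_pos_pos zero_less_power) force+
 moreover have "(\<Sum>n\<in>S. 1 / r^3) = real (card S) * (1/r^3)" by simp
 ultimately have "(\<Sum>n\<in>S. 1 / norm (c n - z)^3) <= real (card S) * (1/r^3)"
   "real (card S) * (1/r^3) <= 25 * N * (2*r)^2 * (1/r^3)"
  using r by (auto intro!: mult_right_mono divide_right_mono)
 hence "(\<Sum>n\<in>S. 1 / norm (c n - z)^3) <= 25 * N * (2*r)^2 * (1/r^3)" by (rule order_trans)
 also have "... = 100 * N / r" using r by (simp add: field_simps power2_eq_square power3_eq_cube)
 finally show "(\<Sum>n\<in>S. 1 / norm (c n - z)^3) <= 100 * N / r" .
 qed
 show ?thesis
  using assms pairsD(2)[OF p] base by (intro D) (auto simp: sum.union_disjoint field_simps)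
qed

section \<open>Coverings of the boundary of a convex set\<close>

lemma norm_cis_diff: "norm (cis x - cis y) <= \<bar>x - y\<bar>"
proof -
 have "norm (cis x - cis y)^2 = (cos x - cos y)^2 + (sin x - sin y)^2" by (simp add: cmod_power2)
 also have "... = 2 - 2 * cos (x - y)"
 proof -
  have "(cos x)^2+(sin x)^2 = 1" "(cos y)^2+(sin y)^2 = 1" by auto
  thus ?thesis unfolding cos_diff power2_eq_square by algebra
 qed
 also have "... = 4 * (sin ((x-y)/2))^2"
 proof -
  have "cos (2 * ((x-y)/2)) = 1 - 2 * (sin ((x-y)/2))^2" by (rule cos_double_sin)
  moreover have "2 * ((x-y)/2) = x - y" by simp
  ultimately have "cos (x-y) = 1 - 2 * (sin ((x-y)/2))^2" by (simp only:)
  thus ?thesis by linarith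
 qed
 also have "... <= \<bar>x - y\<bar>^2"
 proof -
  have "\<bar>sin ((x-y)/2)\<bar> <= \<bar>(x-y)/2\<bar>" by (rule abs_sin_x_le_abs_x)
  hence "\<bar>sin ((x-y)/2)\<bar>^2 <= \<bar>(x-y)/2\<bar>^2" by (rule power_mono) auto
  thus ?thesis by (simp add: power_divide)
 qed
 finally show ?thesis by (rule power2_le_imp_le) auto
qed

text \<open>If \<open>E\<close> has no interior it lies in a line, whose normal serves; otherwise
  \<open>p\<close> is separated from the interior, and the closure of the interior is the closure of
  \<open>E\<close>.\<close>

lemma convex_frontier_normal:
 fixes E :: "complex set"
 assumes E: "convex E" and p: "p \<in> frontier E"
 obtains a where "a ~= 0" "!!y. y \<in> closure E ==> inner a y <= inner a p"
proof (cases "interior E = {}")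
 case True
 obtain a b where a: "a ~= 0" "E \<subseteq> {x. inner a x = b}"
  using empty_interior_subset_hyperplane[OF E True] by metis
 have "closure E \<subseteq> {x. inner a x = b}" using a(2) closed_hyperplane by (rule closure_minimal)
 hence "inner a y = b" if "y \<in> closure E" for y using that by blast
 thus ?thesis using p that[of a] a(1) by (simp add: frontier_def)
next
 case False
 have "p \<notin> interior E" using p by (simp add: frontier_def)
 then obtain a b where a: "a ~= 0" "\<forall>x\<in>interior E. inner a x <= b" "\<forall>x\<in>{p}. inner a x \<ge> b"
  using separating_hyperplane_sets[of "interior E" "{p}"] False E by (auto simp: convex_interior)
 have "closure (interior E) \<subseteq> {x. inner a x <= b}"
  using a(2) closed_halfspace_le by (intro closure_minimal) auto
 moreover have "closure (interior E) = closure E" using convex_closure_interior[OF E False] .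
 ultimately show ?thesis using that[of a] a by force
qed

text \<open>The nearest-point retraction onto the closure of \<open>E\<close> is 1-Lipschitz and maps a circle
 around \<open>E\<close> onto the frontier.\<close>
lemma convex_frontier_cover:
 fixes E :: "complex set"
 assumes E: "convex E" "E \<subseteq> cball x s" and s: "s > 0" and K: "K > (0::nat)"
 obtains q where "frontier E \<subseteq> (\<Union>j<K. cball (q j) (4 * pi * s / K))"
proof (cases "E = {}")
 case True
 thus ?thesis using that[of "%_. 0"] by simp
next
 case False
 define S where "S = closure E"
 have S: "convex S" "closed S" "S ~= {}" "S \<subseteq> cball x s"
  unfolding S_def using E False by (auto simp: convex_closure closure_minimal)
 define q where "q = (%j::nat. closest_point S (x + 2 * s * cis (2 * pi * j / K)))"
 have "frontier E \<subseteq> (\<Union>j<K. cball (q j) (4 * pi * s / K))"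
 proof
  fix p assume p: "p \<in> frontier E"
  hence pS: "p \<in> S" by (simp add: S_def frontier_def)
  obtain a where a: "a ~= 0" "!!y. y \<in> S ==> inner a y <= inner a p"
   using convex_frontier_normal[OF E(1) p] unfolding S_def by metis
  have px: "norm (p - x) <= s" using pS S(4) by (auto simp: dist_norm norm_minus_commute)
  define T where "T = 3 * s / norm a"
  \<comment> \<open>The normal ray from \<open>p\<close> starts inside the circle of radius 2s about
    \<open>x\<close> and is outside or on it at t = T, because 3s - s >= 2s.\<close>
  have "\<exists>t\<ge>0. t <= T \<and> norm (p + t *\<^sub>R a - x) = 2 * s"
  proof (rule IVT')
   show "norm (p + 0 *\<^sub>R a - x) <= 2 * s" using px s by simp
   have "norm (T *\<^sub>R a) = 3 * s" using a(1) s by (simp add: T_def)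
   thus "2 * s <= norm (p + T *\<^sub>R a - x)"
    using px norm_triangle_ineq2[of "T *\<^sub>R a" "x - p"] by (simp add: algebra_simps norm_minus_commute)
   show "0 <= T" using s by (simp add: T_def)
   show "continuous_on {0..T} (%t. norm (p + t *\<^sub>R a - x))" by (intro continuous_intros)
  qed
  then obtain t where t: "t \<ge> 0" "norm (p + t *\<^sub>R a - x) = 2 * s" by blast
  \<comment> \<open>The cross term \<open>2 * t * inner a (p - y)\<close> is nonnegative by the
    choice of \<open>a\<close>, so no point of \<open>S\<close> is closer to the ray point than
    \<open>p\<close>.\<close>
  have cp: "p = closest_point S (p + t *\<^sub>R a)"
  proof (rule closest_point_unique[OF S(1,2) pS], intro ballI)
   fix y assume y: "y \<in> S"
   have "(norm (p + t *\<^sub>R a - y))^2 = (norm (p - y))^2 + 2 * t * inner a (p - y) + (norm (t *\<^sub>R a))^2"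
    unfolding power2_norm_eq_inner by (simp add: inner_simps algebra_simps inner_commute)
   also have "... \<ge> (norm (t *\<^sub>R a))^2" using t(1) a(2)[OF y] by (simp add: inner_diff_right)
   finally have "norm (t *\<^sub>R a) <= norm (p + t *\<^sub>R a - y)" by (rule power2_le_imp_le) auto
   thus "dist (p + t *\<^sub>R a) p <= dist (p + t *\<^sub>R a) y" by (simp add: dist_norm)
  qed
  define \<theta> where "\<theta> = Arg2pi (p + t *\<^sub>R a - x)"
  have \<theta>: "0 <= \<theta>" "\<theta> < 2 * pi" unfolding \<theta>_def by (auto simp: Arg2pi)
  have pe: "p + t *\<^sub>R a = x + 2 * s * cis \<theta>"
   using Arg2pi[of "p + t *\<^sub>R a - x"] t(2) by (simp add: \<theta>_def is_Arg_def cis_conv_exp algebra_simps)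
  define j where "j = nat \<lfloor>\<theta> * K / (2*pi)\<rfloor>"
  have nn: "0 <= \<theta> * K / (2*pi)" using \<theta> by simp
  hence j: "real j <= \<theta> * K / (2*pi)" "\<theta> * K / (2*pi) < real j + 1" unfolding j_def by linarith+
  have "\<theta> * K / (2*pi) < K" using \<theta> K by (simp add: field_simps)
  hence jK: "j < K" using j by linarith
  have "real j * (2 * pi / K) <= \<theta>" "\<theta> <= real j * (2 * pi / K) + 2 * pi / K"
   using j K pi_gt_zero by (simp_all add: field_simps)
  hence "\<bar>\<theta> - 2 * pi * j / K\<bar> <= 2 * pi / K"
   by (simp add: abs_le_iff mult_ac)
  hence "norm (cis \<theta> - cis (2 * pi * j / K)) <= 2 * pi / K" using norm_cis_diff order_trans by blast
  hence "2 * s * norm (cis \<theta> - cis (2 * pi * j / K)) <= 2 * s * (2 * pi / K)"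
   using s by (intro mult_left_mono) auto
  moreover have "dist (x + 2 * s * cis (2 * pi * j / K)) (x + 2 * s * cis \<theta>) = 2 * s * norm (cis \<theta> - cis (2 * pi * j / K))"
  proof -
   have "(x + 2 * s * cis (2 * pi * j / K)) - (x + 2 * s * cis \<theta>) = (2 * of_real s) * (cis (2 * pi * j / K) - cis \<theta>)"
    by (simp add: algebra_simps)
   thus ?thesis using s by (simp add: dist_norm norm_mult norm_minus_commute)
  qed
  ultimately have "dist (q j) p <= 4 * pi * s / K"
   using closest_point_lipschitz[OF S(1-3), of "x + 2 * s * cis (2 * pi * j / K)" "p + t *\<^sub>R a"] cp
   unfolding q_def pe by (simp add: mult_ac)
  thus "p \<in> (\<Union>j<K. cball (q j) (4 * pi * s / K))" using jK by auto
 qed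
 thus ?thesis using that by blast
qed

text \<open>With K = ceiling (4 pi s) points the covering radius 4 pi s / K is at most 1, and K < 4
  pi s + 1 <= 14 s because 4 pi < 13.\<close>

lemma frontier_cover_unit:
 fixes E :: "complex set"
 assumes E: "convex E" "E \<subseteq> cball x s" and s: "s \<ge> 1"
 obtains P where "finite P" "real (card P) <= 14 * s" "frontier E \<subseteq> (\<Union>p\<in>P. cball p 1)"
proof -
 define K where "K = nat \<lceil>4 * pi * s\<rceil>"
 have pp: "4 * pi * s > 0" using s by simp
 have K: "4 * pi * s <= K" "K < 4 * pi * s + 1" unfolding K_def using pp by linarith+
 have K0: "K > 0" using K pp by (cases K) auto
 obtain q where q: "frontier E \<subseteq> (\<Union>j<K. cball (q j) (4 * pi * s / K))"
  using convex_frontier_cover[OF E _ K0] s by (metis less_le_trans zero_less_one)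
 have r: "4 * pi * s / K <= 1" using K K0 by (simp add: field_simps)
 have "cball (q j) (4 * pi * s / K) \<subseteq> cball (q j) 1" for j using r by (rule subset_cball)
 hence "(\<Union>j<K. cball (q j) (4 * pi * s / K)) \<subseteq> (\<Union>p\<in>q ` {..<K}. cball p 1)" by fastforce
 hence "frontier E \<subseteq> (\<Union>p\<in>q ` {..<K}. cball p 1)" using q by (rule subset_trans[rotated])
 moreover have "real (card (q ` {..<K})) <= 14 * s"
 proof -
  have "card (q ` {..<K}) <= card {..<K}" by (rule card_image_le) auto
  hence "card (q ` {..<K}) <= K" by simp
  moreover have "4 * pi * s <= 13 * s" using pi_approx s by (intro mult_right_mono) auto
  ultimately show ?thesis using K s by linarith
 qed
 ultimately show ?thesis using that[of "q ` {..<K}"] by blast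
qed

text \<open>The bound is linear in \<open>s\<close>, whereas a disc of radius \<open>s\<close> may
  hold of the order of s^2 centres: pairs near the boundary are of lower order. The constant 350 is
  14 * 25.\<close>

lemma pairs_count_frontier:
 fixes E :: "complex set"
 assumes p: "pairs c d M N" and E: "convex E" "E \<subseteq> cball x s" and s: "s \<ge> 1" and t: "t \<ge> 0"
  and S: "!!n. n \<in> S ==> \<exists>p\<in>frontier E. norm (c n - p) <= t"
 shows "finite S" "real (card S) <= 350 * N * (t+1)^2 * s"
proof -
 obtain P where P: "finite P" "real (card P) <= 14 * s" "frontier E \<subseteq> (\<Union>p\<in>P. cball p 1)"
  using frontier_cover_unit[OF E s] by blast
 have sub: "S \<subseteq> (\<Union>p\<in>P. {n. norm (c n - p) <= t + 1})"
 proof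
  fix n assume "n \<in> S"
  then obtain y where y: "y \<in> frontier E" "norm (c n - y) <= t" using S by blast
  then obtain p where "p \<in> P" "norm (y - p) <= 1" using P(3) by (force simp: dist_norm norm_minus_commute)
  thus "n \<in> (\<Union>p\<in>P. {n. norm (c n - p) <= t + 1})"
   using y norm_triangle_ineq[of "c n - y" "y - p"] by force
 qed
 have fin: "finite (\<Union>p\<in>P. {n. norm (c n - p) <= t + 1})" using P(1) pairs_finite[OF p] by blast
 show "finite S" using sub fin by (rule finite_subset)
 have "card S <= card (\<Union>p\<in>P. {n. norm (c n - p) <= t + 1})" using sub fin by (rule card_mono[rotated])
 also have "... <= (\<Sum>p\<in>P. card {n. norm (c n - p) <= t + 1})" using P(1) by (rule card_UN_le)
 finally have "real (card S) <= real (\<Sum>p\<in>P. card {n. norm (c n - p) <= t + 1})"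
  by (simp only: of_nat_le_iff)
 also have "... = (\<Sum>p\<in>P. real (card {n. norm (c n - p) <= t + 1}))" by simp
 also have "... <= (\<Sum>p\<in>P. 25 * N * (t+1)^2)" using t by (intro sum_mono pairs_count(2)[OF p]) auto
 also have "... = real (card P) * (25 * N * (t+1)^2)" by simp
 also have "... <= (14 * s) * (25 * N * (t+1)^2)"
  using P(2) pairsD(2)[OF p] by (intro mult_right_mono) auto
 finally show "real (card S) <= 350 * N * (t+1)^2 * s" by (simp add: mult_ac)
qed

lemma content_cball_complex: "r \<ge> 0 ==> measure lborel (cball (x::complex) r) = pi * r^2"
 by (simp add: content_cball unit_ball_vol_2)

lemma content_ball_complex: "r \<ge> 0 ==> measure lborel (ball (x::complex) r) = pi * r^2"
 by (simp add: content_ball unit_ball_vol_2)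

lemma area_near_frontier:
 fixes E :: "complex set"
 assumes E: "convex E" "E \<subseteq> cball x s" and s: "s \<ge> 1" and t: "t \<ge> 0" and A: "A \<in> sets borel"
  and S: "!!z. z \<in> A ==> \<exists>p\<in>frontier E. norm (z - p) <= t"
 shows "measure lborel A <= 56 * (t+1)^2 * s" "emeasure lborel A < \<infinity>"
proof -
 obtain P where P: "finite P" "real (card P) <= 14 * s" "frontier E \<subseteq> (\<Union>p\<in>P. cball p 1)"
  using frontier_cover_unit[OF E s] by blast
 have sub: "A \<subseteq> (\<Union>p\<in>P. cball p (t+1))"
 proof
  fix z assume "z \<in> A"
  then obtain y where y: "y \<in> frontier E" "norm (z - y) <= t" using S by blast
  then obtain p where "p \<in> P" "norm (y - p) <= 1" using P(3) by (force simp: dist_norm norm_minus_commute)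
  thus "z \<in> (\<Union>p\<in>P. cball p (t+1))"
   using y norm_triangle_ineq[of "z - y" "y - p"] by (force simp: dist_norm norm_minus_commute)
 qed
 have comp: "compact (\<Union>p\<in>P. cball p (t+1))" using P(1) by (intro compact_UN) auto
 have fm: "(\<Union>p\<in>P. cball p (t+1)) \<in> fmeasurable lborel" using comp by (rule fmeasurable_compact)
 hence "A \<in> fmeasurable lborel" using A sub by (auto intro: fmeasurableI2)
 thus "emeasure lborel A < \<infinity>" by (simp add: fmeasurable_def)
 have "measure lborel A <= measure lborel (\<Union>p\<in>P. cball p (t+1))"
  using sub A fm by (intro measure_mono_fmeasurable) auto
 also have "... <= (\<Sum>p\<in>P. measure lborel (cball p (t+1)))"
  using P(1) by (intro measure_UNION_le) auto
 also have "... = real (card P) * (pi * (t+1)^2)" using t by (simp add: content_cball_complex)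
 also have "... <= (14 * s) * (4 * (t+1)^2)"
  using P(2) pi_less_4 by (intro mult_mono mult_right_mono) auto
 finally show "measure lborel A <= 56 * (t+1)^2 * s" by (simp add: mult_ac)
qed

subsection \<open>Length of the frontier of a convex set\<close>

text \<open>\<open>K\<close> discs of radius 4 pi s / K have total diameter 8 pi s whatever
  \<open>K\<close> is, so one bound serves every \<delta>.\<close>

lemma hausdorff1_frontier_le:
 fixes E :: "complex set"
 assumes E: "convex E" "E \<subseteq> cball x s" and s: "s > 0"
 shows "hausdorff1 (frontier E) <= ennreal (8 * pi * s)"
 unfolding hausdorff1_def
proof (rule SUP_least)
 fix \<delta> :: real assume "\<delta> \<in> {0<..}"
 hence \<delta>: "\<delta> > 0" by simp
 obtain K :: nat where K: "8 * pi * s / \<delta> < K" using reals_Archimedean2 by blast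
 have "0 < 8 * pi * s / \<delta>" using s \<delta> by simp
 hence K0: "K > 0" using K by (cases K) auto
 have r: "2 * (4 * pi * s / K) <= \<delta>" using K K0 \<delta> by (simp add: field_simps)
 have rp: "0 <= 4 * pi * s / K" using s by simp
 obtain q where q: "frontier E \<subseteq> (\<Union>j<K. cball (q j) (4 * pi * s / K))"
  using convex_frontier_cover[OF E s K0] by blast
 define U where "U = (%i. if i < K then cball (q i) (4 * pi * s / K) else {})"
 have U: "U \<in> {U. frontier E \<subseteq> (\<Union>i. U i) \<and> (\<forall>i. bounded (U i) \<and> diameter (U i) <= \<delta>)}"
  using q r rp \<delta> by (auto simp: U_def split: if_splits)
 have "(\<Sum>i. ennreal (diameter (U i))) = (\<Sum>i<K. ennreal (diameter (U i)))"
  by (rule suminf_finite) (auto simp: U_def)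
 also have "... = (\<Sum>i<K. ennreal (2 * (4 * pi * s / K)))"
  using rp by (intro sum.cong) (auto simp: U_def)
 also have "... = ennreal (8 * pi * s)"
  using rp K0 by (simp add: ennreal_of_nat_eq_real_of_nat mult.assoc flip: ennreal_mult)
 finally show "(INF U\<in>{U. frontier E \<subseteq> (\<Union>i. U i) \<and> (\<forall>i. bounded (U i) \<and> diameter (U i) <= \<delta>)}. \<Sum>i. ennreal (diameter (U i)))
    <= ennreal (8 * pi * s)"
  using U by (intro INF_lower2[of U]) auto
qed

text \<open>Each line g = t between the two values meets \<open>E\<close> by convexity and leaves it
  by boundedness, so the image of the frontier under \<open>g\<close> contains the whole interval.
  As \<open>g\<close> is 1-Lipschitz, a cover of the frontier projects to a cover of the interval.
  The factor 2 appears because \<open>U i\<close> is projected into an interval of half-length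
  \<open>diameter (U i)\<close> about one of its points.\<close>

lemma hausdorff1_frontier_ge_proj:
 fixes E :: "complex set" and g :: "complex => real"
 assumes E: "convex E" "bounded E" and g: "linear g" "!!z. \<bar>g z\<bar> <= norm z" "g v = 0" "v ~= 0"
  and pq: "p \<in> E" "q \<in> E" "g p <= g q"
 shows "ennreal (g q - g p) <= 2 * hausdorff1 (frontier E)"
proof -
 have meets: "\<exists>y\<in>frontier E. g y = t" if t: "g p <= t" "t <= g q" for t
 proof -
  obtain e where e: "e \<in> E" "g e = t"
  proof (cases "g p = g q")
   case True thus ?thesis using t that pq by force
  next
   case False
   define u where "u = (t - g p) / (g q - g p)"
   have u: "0 <= u" "u <= 1" using t False pq(3) by (auto simp: u_def field_simps)
   have "g ((1 - u) *\<^sub>R p + u *\<^sub>R q) = g p + u * (g q - g p)"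
    unfolding linear_add[OF g(1)] linear_scale[OF g(1)] by (simp add: algebra_simps)
   also have "... = t" using False by (simp add: u_def)
   finally show ?thesis using that[of "(1 - u) *\<^sub>R p + u *\<^sub>R q"] E(1) pq u by (simp add: convex_alt)
  qed
  let ?l = "(%s. e + s *\<^sub>R v) ` UNIV"
  have con: "connected ?l" by (intro connected_continuous_image continuous_intros) auto
  have "\<not> ?l \<subseteq> E"
  proof
   assume "?l \<subseteq> E"
   hence b: "bounded ?l" using E(2) bounded_subset by blast
   obtain B where B: "!!s. norm (e + s *\<^sub>R v) <= B" using b unfolding bounded_iff by auto
   have "norm (((B + norm e + 1) / norm v) *\<^sub>R v) <= B + norm e"
    using B[of "(B + norm e + 1) / norm v"] norm_triangle_ineq4[of "e + ((B + norm e + 1) / norm v) *\<^sub>R v" e] by simp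
   moreover have "norm (((B + norm e + 1) / norm v) *\<^sub>R v) = \<bar>B + norm e + 1\<bar>"
    using g(4) by simp
   ultimately show False by linarith
  qed
  moreover have "e \<in> ?l" by (rule image_eqI[of _ _ 0]) auto
  ultimately obtain y where "y \<in> ?l" "y \<in> frontier E"
   using connected_Int_frontier[OF con, of E] e(1) by blast
  moreover have "g y = t" if "y \<in> ?l" for y
   using that e(2) g(1,3) by (auto simp: linear_add linear_scale)
  ultimately show ?thesis by blast
 qed
 have main: "ennreal (g q - g p) <= 2 * (\<Sum>i. ennreal (diameter (U i)))"
  if U: "frontier E \<subseteq> (\<Union>i. U i)" "!!i. bounded (U i)" for U :: "nat => complex set"
 proof -
  define I where "I = (%i. if U i = {} then {} else
    {g (SOME x. x \<in> U i) - diameter (U i) .. g (SOME x. x \<in> U i) + diameter (U i)})"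
  have "{g p..g q} \<subseteq> (\<Union>i. I i)"
  proof
   fix t assume "t \<in> {g p..g q}"
   then obtain y where y: "y \<in> frontier E" "g y = t" using meets by force
   then obtain i where i: "y \<in> U i" using U by blast
   have s: "(SOME x. x \<in> U i) \<in> U i" using i by (rule someI)
   have "\<bar>g y - g (SOME x. x \<in> U i)\<bar> <= norm (y - (SOME x. x \<in> U i))"
    using g(2)[of "y - (SOME x. x \<in> U i)"] g(1) by (simp add: linear_diff)
   also have "... <= diameter (U i)" using diameter_bounded_bound[OF U(2) i s] by (simp add: dist_norm)
   finally have "t \<in> I i" using y i unfolding I_def by auto
   thus "t \<in> (\<Union>i. I i)" by blast
  qed
  hence "emeasure lborel {g p..g q} <= emeasure lborel (\<Union>i. I i)"
   by (intro emeasure_mono) (auto simp: I_def intro!: sets.countable_UN)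
  also have "... <= (\<Sum>i. emeasure lborel (I i))"
   by (intro emeasure_subadditive_countably) (auto simp: I_def)
  also have "... <= (\<Sum>i. 2 * ennreal (diameter (U i)))"
  proof (intro suminf_le summableI)
   fix i
   have "0 <= diameter (U i)" using U(2) by (rule diameter_ge_0)
   thus "emeasure lborel (I i) <= 2 * ennreal (diameter (U i))"
    by (auto simp: I_def ennreal_mult)
  qed
  also have "... = 2 * (\<Sum>i. ennreal (diameter (U i)))" by (rule ennreal_suminf_cmult)
  finally show ?thesis using pq(3) by simp
 qed
 have "ennreal (g q - g p) / 2 <= (INF U\<in>{U. frontier E \<subseteq> (\<Union>i. U i) \<and> (\<forall>i. bounded (U i) \<and> diameter (U i) <= 1)}. \<Sum>i. ennreal (diameter (U i)))"
  using main by (intro INF_greatest) (auto simp: divide_le_posI_ennreal mult.commute)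
 also have "... <= hausdorff1 (frontier E)"
  unfolding hausdorff1_def by (rule SUP_upper) auto
 finally have "ennreal ((g q - g p) / 2) <= hausdorff1 (frontier E)"
  using divide_ennreal[of "g q - g p" 2] pq(3) by simp
 hence "2 * ennreal ((g q - g p) / 2) <= 2 * hausdorff1 (frontier E)" by (rule mult_left_mono) auto
 moreover have "ennreal (g q - g p) = 2 * ennreal ((g q - g p) / 2)"
  using ennreal_mult[of 2 "(g q - g p) / 2"] pq(3) by (simp only: times_divide_eq_right nonzero_mult_div_cancel_left) simp
 ultimately show ?thesis by simp
qed

text \<open>Puts a convex set into a disc of radius comparable with its boundary length, so that
  length and radius can be exchanged in (b). The projections to the two axes cost a factor 2
  each.\<close>

lemma norm_le_hausdorff1_frontier:
 fixes E :: "complex set"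
 assumes E: "convex E" "bounded E" and pq: "p \<in> E" "q \<in> E"
 shows "norm (p - q) <= 4 * enn2real (hausdorff1 (frontier E))"
proof -
 obtain s where "E \<subseteq> cball 0 s" "s > 0" using bounded_subset_ballD[OF E(2), of 0] by (meson ball_subset_cball subset_trans)
 \<comment> \<open>\<open>enn2real\<close> sends infinity to 0, so the length must be known to be
   finite.\<close>
 hence fin: "hausdorff1 (frontier E) ~= top"
  using hausdorff1_frontier_le[OF E(1)] by (metis ennreal_less_top leD top.not_eq_extremum)
 have *: "\<bar>g p - g q\<bar> <= 2 * enn2real (hausdorff1 (frontier E))"
  if g: "linear g" "!!z. \<bar>g z\<bar> <= norm z" "g v = 0" "v ~= 0" for g :: "complex => real" and v
 proof -
  have "g q' - g p' <= 2 * enn2real (hausdorff1 (frontier E))" if "p' \<in> E" "q' \<in> E" for p' q'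
  proof (cases "g p' <= g q'")
   case True
   have "ennreal (g q' - g p') <= 2 * hausdorff1 (frontier E)"
    using hausdorff1_frontier_ge_proj[OF E g that True] .
   also have "... = ennreal (2 * enn2real (hausdorff1 (frontier E)))"
    using fin by (simp add: ennreal_mult top.not_eq_extremum)
   finally show ?thesis by (simp add: ennreal_le_iff)
  qed (auto intro: order_trans[of _ 0])
  from this[of p q] this[of q p] pq show ?thesis by linarith
 qed
 have "norm (p - q) <= \<bar>Re p - Re q\<bar> + \<bar>Im p - Im q\<bar>" using cmod_le[of "p - q"] by simp
 moreover have "\<bar>Re p - Re q\<bar> <= 2 * enn2real (hausdorff1 (frontier E))"
  by (rule *[of Re \<i>]) (auto simp: abs_Re_le_cmod bounded_linear.linear bounded_linear_Re)
 moreover have "\<bar>Im p - Im q\<bar> <= 2 * enn2real (hausdorff1 (frontier E))"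
  by (rule *[of Im 1]) (auto simp: abs_Im_le_cmod bounded_linear.linear bounded_linear_Im)
 ultimately show ?thesis by linarith
qed

subsection \<open>A regularised logarithm of \<open>(w + d/2) / (w - d/2)\<close>\<close>

text \<open>This is 2 artanh on the unit disc. Being odd, it expands as 2x + O(x^3) without a
  quadratic term, which makes the errors below summable over the pairs.\<close>

definition Lq :: "complex => complex" where "Lq x = Ln (1 + x) - Ln (1 - x)"

lemma one_plus_nonpos_Reals:
 assumes "norm (x::complex) < 1" shows "1 + x \<notin> \<real>\<^sub>\<le>\<^sub>0" "1 - x \<notin> \<real>\<^sub>\<le>\<^sub>0"
 using assms abs_Re_le_cmod[of x] by (auto simp: complex_nonpos_Reals_iff)

lemma Lq_deriv:
 assumes "norm x < 1" shows "(Lq has_field_derivative 1 / (1 + x) + 1 / (1 - x)) (at x within S)"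
 unfolding Lq_def[abs_def] using one_plus_nonpos_Reals[OF assms]
 by (auto intro!: derivative_eq_intros simp: divide_simps)

lemma Lq_minus: "Lq (- x) = - Lq x" and Lq_0 [simp]: "Lq 0 = 0"
 by (auto simp: Lq_def)

lemma exp_Lq:
 assumes "norm x < 1" shows "exp (Lq x) = (1 + x) / (1 - x)"
proof -
 have "1 + x ~= 0" "1 - x ~= 0" using one_plus_nonpos_Reals[OF assms] by auto
 thus ?thesis by (simp add: Lq_def exp_diff)
qed

lemma one_minus_sq_ge:
 assumes "norm (x::complex) <= 1/2" shows "norm (1 - x^2) \<ge> 3/4" "1 + x ~= 0" "1 - x ~= 0"
proof -
 have "norm (x^2) <= (1/2)^2" unfolding norm_power using assms by (intro power_mono) auto
 thus "norm (1 - x^2) \<ge> 3/4" using norm_triangle_ineq2[of 1 "x^2"] by (simp add: power2_eq_square)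
 show "1 + x ~= 0" "1 - x ~= 0" using one_plus_nonpos_Reals[of x] assms by auto
qed

lemma Lq_lipschitz:
 assumes "norm x <= 1/2" "norm y <= 1/2" shows "norm (Lq x - Lq y) <= 3 * norm (x - y)"
proof (rule field_differentiable_bound[of "cball 0 (1/2)"])
 fix z :: complex assume "z \<in> cball 0 (1/2)"
 hence z: "norm z <= 1/2" by simp
 show "(Lq has_field_derivative 1 / (1 + z) + 1 / (1 - z)) (at z within cball 0 (1/2))"
  by (rule Lq_deriv) (use z in auto)
 have "1 / (1 + z) + 1 / (1 - z) = 2 / (1 - z^2)" using one_minus_sq_ge[OF z]
  by (simp add: field_simps power2_eq_square)
 moreover have "norm (2 / (1 - z^2)) <= 2 / (3/4)"
  unfolding norm_divide using one_minus_sq_ge(1)[OF z] by (intro frac_le) auto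
 ultimately have "norm (1 / (1 + z) + 1 / (1 - z)) <= 2 / (3/4)" by (simp only:)
 thus "norm (1 / (1 + z) + 1 / (1 - z)) <= 3" by (rule order_trans) simp
qed (use assms in auto)

text \<open>The derivative of the difference is 2 z^2 / (1 - z^2), and the denominator has modulus
  at least 3/4.\<close>

lemma Lq_approx:
 assumes "norm x <= 1/2" shows "norm (Lq x - 2 * x) <= 3 * norm x ^ 3"
proof -
 have "norm ((Lq x - 2 * x) - (Lq 0 - 2 * 0)) <= 3 * norm x ^ 2 * norm (x - 0)"
 proof (rule field_differentiable_bound[of "cball 0 (norm x)"])
  fix z :: complex assume "z \<in> cball 0 (norm x)"
  hence z: "norm z <= norm x" by simp
  hence z2: "norm z <= 1/2" using assms by simp
  show "((%x. Lq x - 2 * x) has_field_derivative 1 / (1 + z) + 1 / (1 - z) - 2) (at z within cball 0 (norm x))"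
   by (rule derivative_eq_intros Lq_deriv refl | use z2 in simp)+
  have nz: "1 - z^2 ~= 0" using one_minus_sq_ge(1)[OF z2] by auto
  have "1 / (1 + z) + 1 / (1 - z) = 2 / (1 - z^2)" using one_minus_sq_ge[OF z2]
   by (simp add: field_simps power2_eq_square)
  hence "1 / (1 + z) + 1 / (1 - z) - 2 = 2 * z^2 / (1 - z^2)" using nz by (simp add: field_simps)
  moreover have "norm (2 * z^2 / (1 - z^2)) <= (2 * norm x ^ 2) / (3/4)"
   unfolding norm_divide norm_mult norm_power using one_minus_sq_ge(1)[OF z2] z
   by (intro frac_le mult_mono power_mono) auto
  moreover have "(2 * norm x ^ 2) / (3/4) <= 3 * norm x ^ 2" by simp
  ultimately show "norm (1 / (1 + z) + 1 / (1 - z) - 2) <= 3 * norm x ^ 2" by (simp only:)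
 qed auto
 thus ?thesis by (simp add: power2_eq_square power3_eq_cube)
qed

text \<open>The Cauchy transform of the uniform probability measure on the disc of radius 2M: 1 / w
  outside the disc and cnj w / (4 M^2) inside. It is a Lipschitz substitute for 1 / w without a
  pole.\<close>

definition phi :: "real => complex => complex" where
 "phi M w = cnj w / of_real ((max (2*M) (norm w))^2)"

lemma phi_far:
 assumes "2 * M <= norm w" "1 <= M" shows "phi M w = 1 / w"
proof -
 have "w ~= 0" using assms by auto
 moreover have "phi M w = cnj w / (w * cnj w)"
  using assms by (simp add: phi_def max_absorb2 complex_norm_square del: of_real_power)
 ultimately show ?thesis by simp
qed

lemma phi_near: "norm w <= 2 * M ==> phi M w = cnj w / of_real (4*M^2)"
 unfolding phi_def by (auto simp: max_def power2_eq_square)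

lemma phi_minus: "phi M (- w) = - phi M w" and phi_0 [simp]: "phi M 0 = 0" by (auto simp: phi_def)

lemma norm_phi:
 assumes "1 <= M" shows "norm (phi M w) <= 1 / (2*M)" "norm (phi M w) * norm w <= 1"
proof -
 have m: "max (2*M) (norm w) > 0" using assms by (simp add: less_max_iff_disj)
 have "norm (phi M w) = norm w / (max (2*M) (norm w))^2" by (simp add: phi_def norm_divide del: of_real_power)
 also have "... <= max (2*M) (norm w) / (max (2*M) (norm w))^2" by (intro divide_right_mono) auto
 also have "... = 1 / max (2*M) (norm w)" using m by (simp add: power2_eq_square)
 finally have 1: "norm (phi M w) <= 1 / max (2*M) (norm w)" .
 also have "... <= 1 / (2*M)" using assms m by (intro divide_left_mono) auto
 finally show "norm (phi M w) <= 1 / (2*M)" .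
 have "norm (phi M w) * norm w <= 1 / max (2*M) (norm w) * max (2*M) (norm w)"
  using 1 m by (intro mult_mono) auto
 thus "norm (phi M w) * norm w <= 1" using m by simp
qed

lemma phi_lipschitz:
 assumes M: "1 <= M" shows "norm (phi M w - phi M w') <= norm (w - w') / M^2"
proof -
 \<comment> \<open>For points on different sides of the circle of radius 2M, the inner formula is
   extended to \<open>w\<close>; its defect there is controlled by norm w - 2M <= norm (w -
   w').\<close>
 have mixed: "norm (phi M w - phi M w') <= norm (w - w') / M^2" if w: "2*M <= norm w" "norm w' <= 2*M" for w w'
 proof -
  have nz: "norm w > 0" "4*M^2 > 0" "M > 0" using w M by auto
  have "phi M w - phi M w' = cnj w * of_real (1/(norm w)^2 - 1/(4*M^2)) + cnj (w - w') / of_real (4*M^2)"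
   using w by (simp add: phi_near phi_def max_absorb2 right_diff_distrib diff_divide_distrib)
  hence "norm (phi M w - phi M w') <= norm w * \<bar>1/(norm w)^2 - 1/(4*M^2)\<bar> + norm (w - w') / (4*M^2)"
   using nz(2) by (simp only:) (rule order_trans[OF norm_triangle_ineq], simp add: norm_mult norm_divide norm_power del: complex_cnj_diff of_real_diff of_real_divide)
  moreover have "norm w * \<bar>1/(norm w)^2 - 1/(4*M^2)\<bar> <= 2 * norm (w - w') / (4*M^2)"
  proof -
   have "(2*M)^2 <= (norm w)^2" using w M by (intro power_mono) auto
   hence "1/(norm w)^2 <= 1/(4*M^2)" using nz by (intro divide_left_mono) (auto simp: power_mult_distrib)
   hence "norm w * \<bar>1/(norm w)^2 - 1/(4*M^2)\<bar> = norm w * (1/(4*M^2) - 1/(norm w)^2)" by simp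
   also have "... = ((norm w)^2 - (2*M)^2) / (norm w * (4*M^2))"
    using nz by (simp add: field_simps power2_eq_square)
   also have "... = (norm w - 2*M) * (norm w + 2*M) / (norm w * (4*M^2))"
    by (simp add: power2_eq_square algebra_simps)
   also have "... <= norm (w - w') * (2 * norm w) / (norm w * (4*M^2))"
    using w nz norm_triangle_ineq2[of w w'] by (intro divide_right_mono mult_mono) auto
   also have "... = 2 * norm (w - w') / (4*M^2)" using nz by simp
   finally show ?thesis .
  qed
  ultimately have "norm (phi M w - phi M w') <= 3 * norm (w - w') / (4*M^2)" by (simp add: add_divide_distrib[symmetric])
  also have "... <= norm (w - w') / M^2" using nz by (simp add: field_simps)
  finally show ?thesis .
 qed
 consider "2*M <= norm w" "norm w' <= 2*M" | "2*M <= norm w'" "norm w <= 2*M"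
  | "2*M <= norm w" "2*M <= norm w'" | "norm w <= 2*M" "norm w' <= 2*M" by linarith
 thus ?thesis
 proof cases
  case 1 thus ?thesis by (rule mixed)
 next
  case 2 thus ?thesis using mixed[of w' w] by (simp add: norm_minus_commute)
 next
  case 3
  hence nz: "w ~= 0" "w' ~= 0" using M by auto
  have "phi M w - phi M w' = (w' - w) / (w * w')" using 3 M nz by (simp add: phi_far field_simps)
  hence "norm (phi M w - phi M w') = norm (w - w') / (norm w * norm w')"
   by (simp add: norm_divide norm_mult norm_minus_commute)
  also have "... <= norm (w - w') / (M * M)" using 3 M by (intro divide_left_mono mult_mono mult_pos_pos) auto
  finally show ?thesis by (simp add: power2_eq_square)
 next
  case 4
  hence "phi M w - phi M w' = cnj (w - w') / of_real (4*M^2)" by (simp add: phi_near diff_divide_distrib)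
  hence "norm (phi M w - phi M w') = norm (w - w') / (4*M^2)" by (simp add: norm_divide norm_power del: complex_cnj_diff)
  also have "... <= norm (w - w') / M^2" using M by (intro divide_left_mono) auto
  finally show ?thesis .
 qed
qed

text \<open>The threshold 2M keeps the argument of \<open>Lq\<close> below 1/4 when
  \<open>norm d <= M\<close>, so the kernel is bounded and Lipschitz everywhere, and it is the exact
  logarithm as soon as \<open>phi M w = 1 / w\<close>. Holomorphy in \<open>w\<close> holds only
  outside the disc of radius 2M.\<close>

definition kap :: "real => complex => complex => complex" where
 "kap M d w = Lq (d * phi M w / 2)"

abbreviation kapS :: "real => (nat => complex) => (nat => complex) => nat set => complex => complex" where
 "kapS M c d F z \<equiv> \<Sum>n\<in>F. kap M (d n) (c n - z)"

abbreviation apart :: "real => (nat => complex) => (nat => complex) => nat => complex => bool" where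
 "apart r c d n z \<equiv> r <= norm (c n + d n / 2 - z) \<and> r <= norm (c n - d n / 2 - z)"

lemma kap_arg:
 assumes "1 <= M" "norm d <= M" shows "norm (d * phi M w / 2) <= 1/4"
proof -
 have "norm d * norm (phi M w) <= M * (1/(2*M))" using assms norm_phi(1)[OF assms(1)] by (intro mult_mono) auto
 thus ?thesis using assms by (simp add: norm_mult)
qed

lemma kap_minus: "kap M d (- w) = - kap M d w" by (simp add: kap_def phi_minus Lq_minus)

lemma exp_kap:
 assumes "1 <= M" "norm d <= M" "2 * M <= norm w"
 shows "exp (kap M d w) = (w + d/2) / (w - d/2)" "w + d/2 ~= 0" "w - d/2 ~= 0"
proof -
 have w: "w ~= 0" using assms by auto
 have "norm (d/2) < norm w" using assms by (simp add: norm_divide)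
 thus nz: "w + d/2 ~= 0" "w - d/2 ~= 0" by (auto simp: add_eq_0_iff2)
 have "exp (kap M d w) = (1 + d * phi M w / 2) / (1 - d * phi M w / 2)"
  unfolding kap_def by (rule exp_Lq) (use kap_arg[OF assms(1,2), of w] in auto)
 also have "d * phi M w / 2 = (d/2) / w" using assms by (simp add: phi_far)
 also have "(1 + (d/2) / w) / (1 - (d/2) / w) = (w + d/2) / (w - d/2)"
  using w nz by (simp add: field_simps)
 finally show "exp (kap M d w) = (w + d/2) / (w - d/2)" .
qed

text \<open>The constant does not depend on the pair, so closeness of two configurations of pairs
  passes to their kernel sums.\<close>

lemma kap_lipschitz:
 assumes M: "1 <= M" "norm d <= M" "norm d' <= M"
 shows "norm (kap M d w - kap M d' w') <= 2 * (norm (w - w') + norm (d - d'))"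
proof -
 have "norm (kap M d w - kap M d' w') <= 3 * norm (d * phi M w / 2 - d' * phi M w' / 2)"
  unfolding kap_def using kap_arg[OF M(1,2), of w] kap_arg[OF M(1,3), of w'] by (intro Lq_lipschitz) linarith+
 also have "d * phi M w / 2 - d' * phi M w' / 2 = (d * (phi M w - phi M w') + (d - d') * phi M w') / 2"
  by (simp add: algebra_simps diff_divide_distrib)
 also have "norm ... <= (norm (w - w') + norm (d - d')) / 2"
 proof -
  have "norm (d * (phi M w - phi M w')) <= M * (norm (w - w') / M^2)"
   unfolding norm_mult using M phi_lipschitz[OF M(1)] by (intro mult_mono) auto
  also have "... <= norm (w - w')" using M mult_right_mono[of 1 M "norm (w - w')"] by (simp add: power2_eq_square field_simps)
  finally have 1: "norm (d * (phi M w - phi M w')) <= norm (w - w')" .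
  have "norm ((d - d') * phi M w') <= norm (d - d') * (1/(2*M))"
   unfolding norm_mult using norm_phi(1)[OF M(1)] by (intro mult_left_mono) auto
  also have "... <= norm (d - d') * 1" using M by (intro mult_left_mono) auto
  finally have 2: "norm ((d - d') * phi M w') <= norm (d - d')" by simp
  show ?thesis using 1 2 norm_triangle_ineq[of "d * (phi M w - phi M w')" "(d - d') * phi M w'"] by simp
 qed
 finally have *: "norm (kap M d w - kap M d' w') <= 3 * ((norm (w - w') + norm (d - d')) / 2)" by simp
 show ?thesis by (rule order_trans[OF *]) simp
qed

lemma continuous_kap [continuous_intros]:
 assumes "1 <= M" "norm d <= M" "continuous_on S f" shows "continuous_on S (%x. kap M d (f x))"
proof -
 have "continuous_on UNIV (kap M d)" unfolding continuous_on_iff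
 proof (intro ballI allI impI)
  fix x :: complex and e :: real assume "e > 0"
  thus "\<exists>\<delta>>0. \<forall>x'\<in>UNIV. dist x' x < \<delta> \<longrightarrow> dist (kap M d x') (kap M d x) < e"
  proof (intro exI[of _ "e/2"] conjI ballI impI)
   fix x' assume "dist x' x < e/2"
   thus "dist (kap M d x') (kap M d x) < e"
    using kap_lipschitz[OF assms(1,2,2), of x' x] by (simp add: dist_norm)
  qed simp
 qed
 thus ?thesis using assms(3) by (rule continuous_on_compose2) auto
qed

lemma norm_kap_le:
 assumes "1 <= M" "norm d <= M" shows "norm (kap M d w) <= 1"
 using Lq_lipschitz[of "d * phi M w / 2" 0] kap_arg[OF assms, of w] by (simp add: kap_def)

lemma kap_approx_phi:
 assumes "1 <= M" "norm d <= M"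
 shows "norm (kap M d w - d * phi M w) <= M^3 * norm (phi M w) ^ 3"
proof -
 have "norm (kap M d w - d * phi M w) <= 3 * norm (d * phi M w / 2) ^ 3"
  using Lq_approx[of "d * phi M w / 2"] kap_arg[OF assms, of w] by (simp add: kap_def)
 also have "norm (d * phi M w / 2) ^ 3 = (norm d)^3 * norm (phi M w) ^ 3 / 8"
  by (simp add: norm_mult norm_divide power_mult_distrib power_divide)
 also have "3 * ((norm d)^3 * norm (phi M w) ^ 3 / 8) <= 1 * ((norm d)^3 * norm (phi M w) ^ 3)" by simp
 also have "... <= M^3 * norm (phi M w) ^ 3" using assms by (simp add: mult_right_mono power_mono)
 finally show ?thesis .
qed

lemma kap_approx:
 assumes "1 <= M" "norm d <= M" "2 * M <= norm w"
 shows "norm (kap M d w - d / w) <= M^3 / norm w ^ 3"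
 using kap_approx_phi[OF assms(1,2), of w] assms by (simp add: phi_far norm_divide power_divide)

lemma holomorphic_kap:
 assumes M: "1 <= M" "norm d <= M" and f: "f holomorphic_on S" "!!z. z \<in> S ==> norm (f z) > 2 * M"
 shows "(%z. kap M d (f z)) holomorphic_on S"
proof -
 have "(%z. Lq (d * (1 / f z) / 2)) holomorphic_on S"
 proof -
  have "Lq holomorphic_on ball 0 1" using Lq_deriv unfolding holomorphic_on_def field_differentiable_def
   by (metis dist_0_norm mem_ball)
  moreover have "(%z. d * (1 / f z) / 2) holomorphic_on S" using f M by (intro holomorphic_intros) force+
  moreover have "(%z. d * (1 / f z) / 2) ` S \<subseteq> ball 0 1"
  proof (intro image_subsetI)
   fix z assume "z \<in> S"
   hence "norm (d * phi M (f z) / 2) <= 1/4" "phi M (f z) = 1 / f z"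
    using kap_arg[OF M, of "f z"] f(2)[of z] M by (auto intro: phi_far)
   hence "norm (d * (1 / f z) / 2) <= 1/4" by (simp only:)
   thus "d * (1 / f z) / 2 \<in> ball 0 1" unfolding mem_ball_0 by linarith
  qed
  ultimately show ?thesis using holomorphic_on_compose_gen[of "%z. d * (1 / f z) / 2" S Lq "ball 0 1"]
   by (simp add: o_def)
 qed
 thus ?thesis
  by (rule holomorphic_transform) (use f(2) M in \<open>simp add: kap_def phi_far less_imp_le\<close>)
qed

subsection \<open>Planar integrals\<close>

abbreviation SI :: "complex set => (complex => complex) => complex" where
 "SI A f \<equiv> (LINT w:A|lborel. f w)"

lemma SI_integrable:
 fixes f :: "complex => complex"
 assumes "A \<in> sets borel" "bounded A" "f \<in> borel_measurable borel" "!!w. w \<in> A ==> norm (f w) <= B"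
 shows "set_integrable lborel A f"
 unfolding set_integrable_def
 by (rule integrableI_bounded_set_indicator[of _ _ _ B])
   (use assms emeasure_bounded_finite[OF assms(2)] in auto)

lemma complex_indicator_integral:
 assumes "A \<in> sets borel" "bounded (A :: complex set)"
 shows "integrable lborel (%w. indicator A w :: complex)"
  "(\<integral>w. indicator A w \<partial>lborel) = (of_real (measure lborel A) :: complex)"
proof -
 have fin: "emeasure lborel A < \<infinity>" using assms(2) by (rule emeasure_bounded_finite)
 have eq: "(%w. indicator A w :: complex) = (%w. indicator A w *\<^sub>R 1)" by (auto simp: indicator_def)
 have i: "integrable lborel (indicator A :: complex => real)" using assms(1) fin by simp
 show "integrable lborel (%w. indicator A w :: complex)" unfolding eq using i by simp
 show "(\<integral>w. indicator A w \<partial>lborel) = (of_real (measure lborel A) :: complex)"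
  unfolding eq using i assms(1) by (simp add: scaleR_conv_of_real)
qed

lemma measure_lborel_mono:
 assumes "A \<in> sets borel" "B \<in> sets borel" "bounded B" "A \<subseteq> B"
 shows "measure lborel A <= measure lborel (B :: complex set)"
 using assms emeasure_bounded_finite[OF assms(3)]
 by (intro measure_mono_fmeasurable) (auto simp: fmeasurable_def)

lemma norm_SI_le:
 fixes f :: "complex => complex"
 assumes "A \<in> sets borel" "bounded A" "!!w. w \<in> A ==> norm (f w) <= B" "B \<ge> 0"
 shows "norm (SI A f) <= B * measure lborel A"
proof (cases "set_integrable lborel A f")
 case True
 have fin: "emeasure lborel A < \<infinity>" using emeasure_bounded_finite[OF assms(2)] by simp
 have "norm (SI A f) <= (\<integral>w. norm (indicator A w *\<^sub>R f w) \<partial>lborel)"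
  unfolding set_lebesgue_integral_def by (rule integral_norm_bound)
 also have "... <= (\<integral>w. indicator A w *\<^sub>R B \<partial>lborel)"
 proof (rule integral_mono)
  show "integrable lborel (%w. norm (indicator A w *\<^sub>R f w))"
   using True unfolding set_integrable_def by (rule integrable_norm)
  show "integrable lborel (%w. indicator A w *\<^sub>R B)" using assms fin
   by (intro integrableI_bounded_set_indicator[of _ _ _ B]) auto
 qed (use assms in \<open>auto simp: indicator_def\<close>)
 also have "... = B * measure lborel A" using assms fin by simp
 finally show ?thesis .
next
 case False
 hence "SI A f = 0" unfolding set_lebesgue_integral_def set_integrable_def by (rule not_integrable_integral_eq)
 thus ?thesis using assms by simp
qed

lemma SI_shift:
 fixes f :: "complex => complex"
 assumes [measurable]: "f \<in> borel_measurable borel" "A \<in> sets borel"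
 shows "SI A (%w. f (w + z)) = SI ((%w. w + z) ` A) f"
proof -
 have A: "(%w. w + z) ` A = (%w. w - z) -` A \<inter> space borel" by (auto simp: image_iff) (metis diff_add_cancel)
 have m: "(%w. w + z) ` A \<in> sets borel" unfolding A by measurable
 have "lebesgue_integral lborel (%w. indicator ((%w. w + z) ` A) w *\<^sub>R f w)
   = lebesgue_integral (distr lborel borel ((+) z)) (%w. indicator ((%w. w + z) ` A) w *\<^sub>R f w)"
  by (simp add: lborel_distr_plus)
 also have "... = lebesgue_integral lborel (%w. indicator ((%w. w + z) ` A) (z + w) *\<^sub>R f (z + w))"
  using m by (subst integral_distr) auto
 also have "... = lebesgue_integral lborel (%w. indicator A w *\<^sub>R f (w + z))"
  by (intro Bochner_Integration.integral_cong) (auto simp: indicator_def add.commute)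
 finally show ?thesis unfolding set_lebesgue_integral_def by simp
qed

text \<open>The quarter turn maps axis-parallel boxes to such boxes, so invariance of the measure
  can be checked on boxes. No other rotation is used: its square is w -> -w, which annihilates odd
  functions, and it reverses the sign of 1 / w^2.\<close>

lemma distr_rotate: "distr lborel borel (%w. \<i> * w) = (lborel :: complex measure)"
proof (rule lborel_eqI[symmetric])
 fix l u :: complex assume lu: "!!b. b \<in> Basis ==> l \<bullet> b <= u \<bullet> b"
 have lu': "Re l <= Re u" "Im l <= Im u" using lu[of 1] lu[of \<i>] by (auto simp: Basis_complex_def)
 have "emeasure (distr lborel borel (%w. \<i> * w)) (box l u) = emeasure lborel ((%w. \<i> * w) -` box l u)"
  by (subst emeasure_distr) auto
 also have "(%w. \<i> * w) -` box l u = box (Complex (Im l) (- Re u)) (Complex (Im u) (- Re l))"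
  by (auto simp: box_def Basis_complex_def)
 also have "emeasure lborel ... = ennreal ((Im u - Im l) * (Re u - Re l))"
  using lu' by (simp add: emeasure_lborel_box_eq Basis_complex_def inner_complex_def)
 also have "(Im u - Im l) * (Re u - Re l) = (\<Prod>b\<in>Basis. (u - l) \<bullet> b)"
  by (simp add: Basis_complex_def inner_complex_def)
 finally show "emeasure (distr lborel borel (%w. \<i> * w)) (box l u) = (\<Prod>b\<in>Basis. (u - l) \<bullet> b)" .
qed simp

lemma SI_rotate:
 fixes f :: "complex => complex"
 assumes [measurable]: "f \<in> borel_measurable borel" "A \<in> sets borel" and A: "!!w. \<i> * w \<in> A \<longleftrightarrow> w \<in> A"
 shows "SI A (%w. f (\<i> * w)) = SI A f"
proof -
 have "lebesgue_integral lborel (%w. indicator A w *\<^sub>R f w) = lebesgue_integral (distr lborel borel (%w. \<i> * w)) (%w. indicator A w *\<^sub>R f w)"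
  by (simp add: distr_rotate)
 also have "... = lebesgue_integral lborel (%w. indicator A (\<i> * w) *\<^sub>R f (\<i> * w))"
  by (subst integral_distr) auto
 also have "... = lebesgue_integral lborel (%w. indicator A w *\<^sub>R f (\<i> * w))"
  using A by (intro Bochner_Integration.integral_cong) (auto simp: indicator_def)
 finally show ?thesis unfolding set_lebesgue_integral_def by simp
qed

lemma SI_odd:
 fixes f :: "complex => complex"
 assumes [measurable]: "f \<in> borel_measurable borel" and odd: "!!w. f (- w) = - f w"
 shows "SI (cball 0 r) f = 0"
proof -
 have 1: "SI (cball 0 r) (%w. f (\<i> * w)) = SI (cball 0 r) f"
  by (rule SI_rotate) (auto simp: norm_mult)
 have 2: "SI (cball 0 r) (%w. f (\<i> * (\<i> * w))) = SI (cball 0 r) (%w. f (\<i> * w))"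
  by (rule SI_rotate) (auto simp: norm_mult)
 have "(%w. f (\<i> * (\<i> * w))) = (%w. - f w)" using odd by (auto simp: mult.assoc[symmetric])
 hence "SI (cball 0 r) f = - SI (cball 0 r) f" using 1 2 by (simp add: set_lebesgue_integral_def)
 thus ?thesis by (simp add: eq_neg_iff_add_eq_0)
qed

lemma SI_ring_inverse_square:
 "SI {w. \<rho> <= norm w \<and> norm w < r} (%w. 1 / w^2) = 0" (is "SI ?A _ = 0")
 and SI_ring_inverse_square': "SI {w. \<rho> <= norm w \<and> norm w <= r} (%w. 1 / w^2) = 0" (is "SI ?B _ = 0")
proof -
 have *: "SI A (%w. 1 / w^2) = 0" if A: "A \<in> sets borel" "!!w. \<i> * w \<in> A \<longleftrightarrow> w \<in> A" for A
 proof -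
  have "SI A (%w. 1 / (\<i> * w)^2) = SI A (%w. 1 / w^2)" by (rule SI_rotate) (use A in auto)
  moreover have "(%w. 1 / (\<i> * w)^2) = (%w. - (1 / w^2))" by (auto simp: power_mult_distrib)
  ultimately have "SI A (%w. 1 / w^2) = - SI A (%w. 1 / w^2)" by (simp add: set_lebesgue_integral_def)
  thus ?thesis by (simp add: eq_neg_iff_add_eq_0)
 qed
 have "{w::complex. \<rho> <= norm w \<and> norm w < r} \<in> sets borel" "{w::complex. \<rho> <= norm w \<and> norm w <= r} \<in> sets borel"
  by measurable
 thus "SI ?A (%w. 1 / w^2) = 0" "SI ?B (%w. 1 / w^2) = 0" using * by (auto simp: norm_mult)
qed

lemma measure_annulus:
 assumes "0 <= t" "t <= r"
 shows "measure lborel {w::complex. r - t <= norm w \<and> norm w <= r + t} <= 16 * r * t"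
   "{w::complex. r - t <= norm w \<and> norm w <= r + t} \<in> sets borel"
   "bounded {w::complex. r - t <= norm w \<and> norm w <= r + t}"
proof -
 have eq: "{w::complex. r - t <= norm w \<and> norm w <= r + t} = cball 0 (r+t) - ball 0 (r-t)" by auto
 have "measure lborel (cball 0 (r+t) - ball 0 (r-t) :: complex set)
   = measure lborel (cball 0 (r+t) :: complex set) - measure lborel (ball 0 (r-t) :: complex set)"
  using assms by (intro measure_Diff) (auto simp: top.not_eq_extremum emeasure_bounded_finite[unfolded infinity_ennreal_def])
 also have "... = pi * (r+t)^2 - pi * (r-t)^2" using assms by (simp add: content_ball_complex content_cball_complex)
 also have "... = pi * (4 * (r * t))" by (simp add: power2_eq_square algebra_simps)
 also have "... <= 4 * (4 * (r * t))" using pi_less_4 assms by (intro mult_right_mono) auto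
 finally show "measure lborel {w::complex. r - t <= norm w \<and> norm w <= r + t} <= 16 * r * t" unfolding eq by simp
 show "{w::complex. r - t <= norm w \<and> norm w <= r + t} \<in> sets borel" unfolding eq by auto
 show "bounded {w::complex. r - t <= norm w \<and> norm w <= r + t}" unfolding eq by (intro bounded_diff) auto
qed

lemma SI_split:
 fixes f :: "complex => complex"
 assumes "A \<in> sets borel" "B \<in> sets borel" "set_integrable lborel A f" "set_integrable lborel B f"
 shows "SI A f - SI B f = SI (A - B) f - SI (B - A) f"
proof -
 have sub: "set_integrable lborel (A - B) f" "set_integrable lborel (B - A) f" "set_integrable lborel (A \<inter> B) f"
  using assms by (auto intro: set_integrable_subset)
 have "SI ((A - B) \<union> (A \<inter> B)) f = SI (A - B) f + SI (A \<inter> B) f"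
  by (rule set_integral_Un) (use sub in auto)
 moreover have "SI ((B - A) \<union> (A \<inter> B)) f = SI (B - A) f + SI (A \<inter> B) f"
  by (rule set_integral_Un) (use sub in auto)
 moreover have "(A - B) \<union> (A \<inter> B) = A" "(B - A) \<union> (A \<inter> B) = B" by auto
 ultimately show ?thesis by simp
qed

text \<open>Both one-sided differences lie in the annulus of half-width \<open>R\<close> about the
  circle of radius \<rho>, of area at most 16 \<rho> R; two lunes give 32.\<close>

lemma SI_lune:
 fixes f :: "complex => complex"
 assumes f: "f \<in> borel_measurable borel" and B: "!!w. \<rho> - R <= norm w ==> norm w <= \<rho> + R ==> norm (f w) <= B"
  and z: "norm z <= R" "R <= \<rho>" and B0: "0 <= B"
 shows "norm (SI (cball z \<rho> - cball 0 \<rho>) f - SI (cball 0 \<rho> - cball z \<rho>) f) <= 32 * B * \<rho> * R"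
proof -
 let ?A = "{w::complex. \<rho> - R <= norm w \<and> norm w <= \<rho> + R}"
 have R: "0 <= R" using z norm_ge_zero order_trans by blast
 note ann = measure_annulus[OF R z(2)]
 have sub: "cball z \<rho> - cball 0 \<rho> \<subseteq> ?A" "cball 0 \<rho> - cball z \<rho> \<subseteq> ?A"
 proof (safe, simp_all add: dist_norm not_le)
  fix w assume "norm (z - w) <= \<rho>" "\<rho> < norm w"
  thus "\<rho> - R <= norm w" "norm w <= \<rho> + R" using z norm_triangle_ineq4[of z "z - w"] R by auto
 next
  fix w assume "\<rho> < norm (z - w)" "norm w <= \<rho>"
  thus "\<rho> - R <= norm w" "norm w <= \<rho> + R" using z norm_triangle_ineq4[of z w] R by auto
 qed
 have *: "norm (SI S f) <= B * (16 * \<rho> * R)" if "S \<subseteq> ?A" "S \<in> sets borel" for S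
 proof -
  have "norm (SI S f) <= B * measure lborel S"
   by (rule norm_SI_le) (use that ann(3) B B0 in \<open>auto intro: bounded_subset\<close>)
  also have "... <= B * measure lborel ?A"
   using that ann B0 by (intro mult_left_mono measure_lborel_mono) auto
  also have "... <= B * (16 * \<rho> * R)" using ann B0 by (intro mult_left_mono) auto
  finally show ?thesis .
 qed
 have m: "cball z \<rho> - cball 0 \<rho> \<in> sets borel" "cball 0 \<rho> - cball z \<rho> \<in> sets borel" by auto
 show ?thesis using *[OF sub(1) m(1)] *[OF sub(2) m(2)] norm_triangle_ineq4[of "SI (cball z \<rho> - cball 0 \<rho>) f" "SI (cball 0 \<rho> - cball z \<rho>) f"]
  by (simp add: algebra_simps)
qed

text \<open>Translating the integrand amounts to translating the disc, so only the size of
  \<open>f\<close> near the boundary circle enters.\<close>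

lemma SI_translate_diff:
 fixes f :: "complex => complex"
 assumes f: "f \<in> borel_measurable borel" and bd: "!!w. norm (f w) <= B'"
  and B: "!!w. \<rho> - R <= norm w ==> norm w <= \<rho> + R ==> norm (f w) <= B"
  and z: "norm z <= R" "R <= \<rho>" and B0: "0 <= B"
 shows "norm (SI (cball 0 \<rho>) (%w. f (w + z)) - SI (cball 0 \<rho>) f) <= 32 * B * \<rho> * R"
proof -
 have "SI (cball 0 \<rho>) (%w. f (w + z)) = SI ((%w. w + z) ` cball 0 \<rho>) f"
  using f by (intro SI_shift) auto
 also have "(%w. w + z) ` cball 0 \<rho> = cball z \<rho>"
  using cball_translation[of z 0 \<rho>] by (simp add: add.commute)
 finally have "SI (cball 0 \<rho>) (%w. f (w + z)) - SI (cball 0 \<rho>) f = SI (cball z \<rho>) f - SI (cball 0 \<rho>) f" by simp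
 also have "... = SI (cball z \<rho> - cball 0 \<rho>) f - SI (cball 0 \<rho> - cball z \<rho>) f"
  using f bd by (intro SI_split SI_integrable) auto
 finally show ?thesis using SI_lune[OF f B z B0] by simp
qed

subsection \<open>Densities and averaging over squares\<close>

definition nu :: "(nat => complex) => (nat => complex) => complex set => complex" where
 "nu c d E = (\<Sum>n\<in>{n. c n \<in> E}. d n)"

text \<open>Condition (b) with the boundary length replaced by the radius of an enclosing disc and
  \<gamma> in the role of conj \<beta> / (2 pi). Radii start at 1, which absorbs the summand 1 of
  (b).\<close>

definition dens :: "(nat => complex) => (nat => complex) => complex => real => bool" where
 "dens c d \<gamma> C \<longleftrightarrow> 0 <= C \<and> (\<forall>x s (E :: complex set). convex E \<and> E \<in> sets borel \<and> 1 <= s \<and> E \<subseteq> cball x s \<longrightarrow>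
   norm (nu c d E - \<gamma> * of_real (measure lborel E)) <= C * s)"

lemma densD:
 assumes "dens c d \<gamma> C" shows "0 <= C"
  "convex E ==> E \<in> sets borel ==> 1 <= s ==> E \<subseteq> cball x s ==> norm (nu c d E - \<gamma> * of_real (measure lborel E)) <= C * s"
 using assms unfolding dens_def by auto

lemma dens_shift:
 assumes "dens c d \<gamma> C" shows "dens (%n. c n - z) d \<gamma> C"
 unfolding dens_def
proof (intro conjI allI impI; (elim conjE)?)
 fix x s and E :: "complex set" assume E: "convex E" "E \<in> sets borel" "1 <= s" "E \<subseteq> cball x s"
 have A: "(%w. w + z) ` E = (%w. w - z) -` E \<inter> space borel" by (auto simp: image_iff) (metis diff_add_cancel)
 have m: "(%w. w + z) ` E \<in> sets borel" unfolding A using E(2) by measurable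
 have "nu (%n. c n - z) d E = nu c d ((%w. w + z) ` E)"
  unfolding nu_def by (intro sum.cong) (auto simp: image_iff, metis diff_add_cancel)
 moreover have "measure lborel ((%w. w + z) ` E) = measure lborel E"
  using measure_translation[of z E] E(2) m by (simp add: add.commute)
 moreover have "norm (nu c d ((%w. w + z) ` E) - \<gamma> * of_real (measure lborel ((%w. w + z) ` E))) <= C * s"
 proof (rule densD(2)[OF assms _ m E(3), of "x + z"])
  show "convex ((%w. w + z) ` E)" using convex_translation[OF E(1), of z] by (simp add: add.commute)
  show "(%w. w + z) ` E \<subseteq> cball (x + z) s" using E(4) by (auto simp: dist_norm)
 qed
 ultimately show "norm (nu (%n. c n - z) d E - \<gamma> * of_real (measure lborel E)) <= C * s" by simp
qed (use densD[OF assms] in auto)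

definition sq :: "real => complex => complex set" where
 "sq s u = cbox u (u + Complex s s)"

text \<open>Exchanges the roles of point and corner, so that one can integrate over the
  corner.\<close>

lemma sq_iff: "w \<in> sq s u \<longleftrightarrow> u \<in> cbox (w - Complex s s) w"
 by (auto simp: sq_def cbox_def Basis_complex_def)

lemma sq_self: "s \<ge> 0 ==> u \<in> sq s u" by (auto simp: sq_def cbox_def Basis_complex_def)

lemma sq_dist: "w \<in> sq s u ==> norm (w - u) <= 2 * s"
 using cmod_le[of "w - u"] by (auto simp: sq_def cbox_def Basis_complex_def)

lemma measure_square: "0 <= s ==> measure lborel (cbox u (u + Complex s s)) = s^2"
 by (simp add: measure_lborel_cbox_eq Basis_complex_def power2_eq_square inner_complex_def)

lemma measurable_sq_pred [measurable]:
 "(%x. indicator (sq s (fst x)) (snd x) :: complex) \<in> borel_measurable (borel \<Otimes>\<^sub>M borel)"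
proof -
 have "(%x. indicator (sq s (fst x)) (snd x) :: complex) =
   indicator {x \<in> space (borel \<Otimes>\<^sub>M borel). 0 <= Re (snd x - fst x) \<and> Re (snd x - fst x) <= s \<and> 0 <= Im (snd x - fst x) \<and> Im (snd x - fst x) <= s}"
  by (auto simp: indicator_def sq_def cbox_def Basis_complex_def space_pair_measure fun_eq_iff)
 also have "... \<in> borel_measurable (borel \<Otimes>\<^sub>M borel)" by measurable
 finally show ?thesis .
qed

text \<open>\<open>dens\<close> concerns unweighted sums over convex sets; here a weight
  \<open>g\<close> is added and differences of two convex sets are allowed, hence rings and lunes.
  The quantity \<open>Q\<close> to be bounded is averaged over all squares of side \<open>s\<close>.
  Inside one square \<open>g\<close> is replaced by its value at the corner, at a cost \<omega> per
  unit of mass, and what remains is the discrepancy of the convex sets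
  \<open>B1 \<inter> sq s u\<close> and \<open>B2 \<inter> sq s u\<close>. Larger squares diminish
  the first error and increase \<omega>.\<close>

lemma average_estimate:
 assumes p: "pairs c d M N" and D: "dens c d \<gamma> C"
 and B: "convex B1" "convex B2" "bounded B1" "bounded B2" "B1 \<in> sets borel" "B2 \<in> sets borel"
 and s: "s \<ge> 1" and g[measurable]: "g \<in> borel_measurable borel"
 and U: "U \<in> sets borel" "emeasure lborel U < \<infinity>"
 and G: "!!u. u \<in> U ==> norm (g u) <= G" "0 <= G" "0 <= \<omega>"
 and H: "!!u w. w \<in> sq s u ==> w \<in> (B1 - B2) \<union> (B2 - B1) ==> u \<in> U \<and> norm (g w - g u) <= \<omega>"
 shows "norm ((\<Sum>n\<in>{n. c n \<in> B1 - B2}. d n * g (c n)) - (\<Sum>n\<in>{n. c n \<in> B2 - B1}. d n * g (c n))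
   - \<gamma> * (SI (B1 - B2) g - SI (B2 - B1) g))
   <= measure lborel U * (4 * C * G / s + (100 * M * N + norm \<gamma>) * \<omega>)"
proof -
 note [measurable] = B(5,6) U(1)
 note MN = pairsD(1,2)[OF p]
 define i :: "complex => complex" where "i = (%w. indicator B1 w - indicator B2 w)"
 have i_m [measurable]: "i \<in> borel_measurable borel" unfolding i_def by measurable
 have i0: "i w = 0" if "w \<notin> (B1 - B2) \<union> (B2 - B1)" for w using that by (auto simp: i_def)
 have i1: "norm (i w) <= 1" for w by (auto simp: i_def indicator_def)
 obtain r where r: "B1 \<union> B2 \<subseteq> cball 0 r" "r > 0"
  using bounded_subset_ballD[of "B1 \<union> B2" 0] B by (meson ball_subset_cball bounded_Un subset_trans)
 define F where "F = {n. c n \<in> B1 \<union> B2}"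
 have fF: "finite F" by (rule finite_subset[OF _ pairs_finite(1)[OF p, of 0 r]]) (use r in \<open>auto simp: F_def\<close>)
 define \<xi> :: "complex => complex => complex" where "\<xi> = (%u w. indicator (sq s u) w)"
 have chi: "\<xi> u w = indicator (cbox (w - Complex s s) w) u" for u w
  unfolding \<xi>_def using sq_iff by (auto simp: indicator_def)
 have chi1: "norm (\<xi> u w) <= 1" for u w by (simp add: \<xi>_def indicator_def)
 have [measurable]: "(%x. \<xi> (fst x) (snd x)) \<in> borel_measurable (borel \<Otimes>\<^sub>M borel)" unfolding \<xi>_def by measurable
 have [measurable]: "(%u. \<xi> u w) \<in> borel_measurable borel" for w unfolding chi by simp
 have [measurable]: "(%u. \<xi> w u) \<in> borel_measurable borel" for w unfolding \<xi>_def sq_def by simp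
 define Q where "Q = (\<Sum>n\<in>F. d n * i (c n) * g (c n)) - \<gamma> * (\<integral>w. i w * g w \<partial>lborel)"
 have gb: "norm (g w) <= G" if "w \<in> (B1 - B2) \<union> (B2 - B1)" for w
  using H[OF sq_self that] G s by auto
 have Qeq: "Q = (\<Sum>n\<in>{n. c n \<in> B1 - B2}. d n * g (c n)) - (\<Sum>n\<in>{n. c n \<in> B2 - B1}. d n * g (c n))
   - \<gamma> * (SI (B1 - B2) g - SI (B2 - B1) g)"
 proof -
  have "(\<Sum>n\<in>F. d n * i (c n) * g (c n)) = (\<Sum>n\<in>F. (if c n \<in> B1 - B2 then d n * g (c n) else 0) - (if c n \<in> B2 - B1 then d n * g (c n) else 0))"
   by (intro sum.cong) (auto simp: i_def indicator_def)
  also have "... = (\<Sum>n\<in>{n\<in>F. c n \<in> B1 - B2}. d n * g (c n)) - (\<Sum>n\<in>{n\<in>F. c n \<in> B2 - B1}. d n * g (c n))"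
   using fF by (simp only: sum_subtractf sum.inter_filter)
  also have "{n\<in>F. c n \<in> B1 - B2} = {n. c n \<in> B1 - B2}" by (auto simp: F_def)
  also have "{n\<in>F. c n \<in> B2 - B1} = {n. c n \<in> B2 - B1}" by (auto simp: F_def)
  finally have 1: "(\<Sum>n\<in>F. d n * i (c n) * g (c n)) = (\<Sum>n\<in>{n. c n \<in> B1 - B2}. d n * g (c n)) - (\<Sum>n\<in>{n. c n \<in> B2 - B1}. d n * g (c n))" .
  have si: "set_integrable lborel (B1 - B2) g" "set_integrable lborel (B2 - B1) g"
   using gb B by (auto intro!: SI_integrable[of _ _ G] bounded_diff)
  have "(\<integral>w. i w * g w \<partial>lborel) = (\<integral>w. indicator (B1 - B2) w *\<^sub>R g w - indicator (B2 - B1) w *\<^sub>R g w \<partial>lborel)"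
   by (intro Bochner_Integration.integral_cong) (auto simp: i_def indicator_def)
  also have "... = SI (B1 - B2) g - SI (B2 - B1) g"
   unfolding set_lebesgue_integral_def using si unfolding set_integrable_def
   by (rule Bochner_Integration.integral_diff)
  finally show ?thesis unfolding Q_def 1 by simp
 qed
 \<comment> \<open>The part of \<open>Q\<close> seen by the square with corner \<open>u\<close>.
   Each point lies in the squares of a set of corners of area s^2, so \<open>h\<close> integrates to
   s^2 Q.\<close>
 define h where "h = (%u. (\<Sum>n\<in>F. d n * i (c n) * g (c n) * \<xi> u (c n)) - \<gamma> * (\<integral>w. i w * g w * \<xi> u w \<partial>lborel))"
 have cm: "(\<integral>u. \<xi> u w \<partial>lborel) = s^2" "integrable lborel (%u. \<xi> u w)" for w
 proof -
  have "(\<integral>u. \<xi> u w \<partial>lborel) = of_real (measure lborel (cbox (w - Complex s s) w))"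
  proof -
   have "(%u. \<xi> u w) = (%u. indicator (cbox (w - Complex s s) w) u *\<^sub>R (1::complex))"
    by (auto simp: chi indicator_def)
   thus ?thesis
    by (simp add: emeasure_bounded_finite[unfolded infinity_ennreal_def] integrable_indicator_iff scaleR_conv_of_real)
  qed
  also have "... = s^2" using measure_square[of s "w - Complex s s"] s by (simp add: algebra_simps)
  finally show "(\<integral>u. \<xi> u w \<partial>lborel) = s^2" .
  have "integrable lborel (%u. indicator (cbox (w - Complex s s) w) u *\<^sub>R (1::complex))"
   by (intro integrableI_bounded_set_indicator[of _ _ _ 1]) (auto simp: emeasure_bounded_finite[unfolded infinity_ennreal_def])
  moreover have "(%u. indicator (cbox (w - Complex s s) w) u *\<^sub>R (1::complex)) = (%u. \<xi> u w)"
   by (auto simp: chi indicator_def)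
  ultimately show "integrable lborel (%u. \<xi> u w)" by (simp only:)
 qed
 have cm': "(\<integral>w. norm (\<xi> u w) \<partial>lborel) = s^2" "integrable lborel (%w. \<xi> u w)" for u
 proof -
  have "(\<integral>w. norm (\<xi> u w) \<partial>lborel) = (\<integral>w. indicator (sq s u) w \<partial>lborel)"
   by (intro Bochner_Integration.integral_cong) (auto simp: \<xi>_def indicator_def)
  also have "... = s^2" using measure_square[of s u] s by (simp add: sq_def)
  finally show "(\<integral>w. norm (\<xi> u w) \<partial>lborel) = s^2" .
  have "integrable lborel (%w. indicator (cbox u (u + Complex s s)) w *\<^sub>R (1::complex))"
   by (intro integrableI_bounded_set_indicator[of _ _ _ 1]) (auto simp: emeasure_bounded_finite[unfolded infinity_ennreal_def])
  moreover have "(%w. indicator (cbox u (u + Complex s s)) w *\<^sub>R (1::complex)) = (%w. \<xi> u w)"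
   by (auto simp: \<xi>_def sq_def indicator_def)
  ultimately show "integrable lborel (%w. \<xi> u w)" by (simp only:)
 qed
 have igb: "norm (i w * g w * x) <= G" if "norm x <= 1" for w x
 proof (cases "w \<in> (B1 - B2) \<union> (B2 - B1)")
  case True
  have "norm (i w * g w * x) <= 1 * G * 1" unfolding norm_mult using i1 gb[OF True] that G(2)
   by (intro mult_mono) auto
  thus ?thesis by simp
 qed (use i0 G in auto)
 have kint: "integrable (lborel \<Otimes>\<^sub>M lborel) (%(u,w). i w * g w * \<xi> u w)"
 proof (rule integrableI_bounded_set[where A="cball 0 (r + 2 * s) \<times> cball 0 r" and B = G])
  show "emeasure (lborel \<Otimes>\<^sub>M lborel) (cball (0::complex) (r + 2 * s) \<times> cball (0::complex) r) < \<infinity>"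
   by (subst lborel.emeasure_pair_measure_Times) (auto simp: ennreal_mult_less_top emeasure_bounded_finite[unfolded infinity_ennreal_def])
  show "AE x in lborel \<Otimes>\<^sub>M lborel. x \<notin> cball 0 (r + 2 * s) \<times> cball 0 r \<longrightarrow> (case x of (u, w) => i w * g w * \<xi> u w) = 0"
  proof (intro AE_I2 impI)
   fix x assume "x \<notin> cball (0::complex) (r + 2 * s) \<times> cball (0::complex) r"
   then obtain u w where x: "x = (u, w)" "norm u > r + 2 * s \<or> norm w > r" by (cases x) auto
   show "(case x of (u, w) => i w * g w * \<xi> u w) = 0"
   proof (cases "norm w > r")
    case True hence "w \<notin> B1 \<union> B2" using r by auto
    thus ?thesis using x i0 by auto
   next
    case False
    hence "w \<notin> sq s u" using x(2) sq_dist[of w s u] norm_triangle_ineq2[of u w] by (auto simp: norm_minus_commute)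
    thus ?thesis using x by (simp add: \<xi>_def)
   qed
  qed
 qed (auto simp: igb[OF chi1] split: prod.splits)
 have inth: "(\<integral>u. h u \<partial>lborel) = s^2 * Q" "integrable lborel h"
 proof -
  have "(\<integral>u. (\<integral>w. i w * g w * \<xi> u w \<partial>lborel) \<partial>lborel) = (\<integral>w. (\<integral>u. i w * g w * \<xi> u w \<partial>lborel) \<partial>lborel)"
   using lborel_pair.Fubini_integral[OF kint] by simp
  also have "... = (\<integral>w. i w * g w * s^2 \<partial>lborel)" using cm by simp
  finally have 1: "(\<integral>u. (\<integral>w. i w * g w * \<xi> u w \<partial>lborel) \<partial>lborel) = (\<integral>w. i w * g w \<partial>lborel) * s^2" by simp
  have 2: "integrable lborel (%u. (\<integral>w. i w * g w * \<xi> u w \<partial>lborel))"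
   using lborel_pair.integrable_fst[OF kint] by simp
  have 3: "integrable lborel (%u. (\<Sum>n\<in>F. d n * i (c n) * g (c n) * \<xi> u (c n)))" using cm by auto
  have 4: "(\<integral>u. (\<Sum>n\<in>F. d n * i (c n) * g (c n) * \<xi> u (c n)) \<partial>lborel) = (\<Sum>n\<in>F. d n * i (c n) * g (c n)) * s^2"
   using cm by (simp add: Bochner_Integration.integral_sum sum_distrib_right)
  show "integrable lborel h" unfolding h_def using 2 3 by auto
  show "(\<integral>u. h u \<partial>lborel) = s^2 * Q" unfolding h_def Q_def using 1 2 3 4 by (simp add: algebra_simps)
 qed
 \<comment> \<open>Two convex sets in a disc of radius 2s have joint discrepancy 4 C s; a square
   contains at most 25 N (2s)^2 = 100 N s^2 centres.\<close>
 define K where "K = 4 * C * s * G + (100 * M * N * s^2 + norm \<gamma> * s^2) * \<omega>"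
 have K0: "0 <= K" unfolding K_def using densD(1)[OF D] G MN s by auto
 have hb: "norm (h u) <= indicator U u *\<^sub>R K" for u
 proof (cases "u \<in> U")
  case False
  have z: "i w * x * \<xi> u w = 0" for w x using H[of w u] i0[of w] False by (cases "w \<in> sq s u") (auto simp: \<xi>_def)
  hence "h u = 0" unfolding h_def by (simp add: mult.assoc) (simp add: mult.assoc[symmetric] z)
  thus ?thesis using False by simp
 next
  case True
  define P1 where "P1 = nu c d (B1 \<inter> sq s u) - \<gamma> * of_real (measure lborel (B1 \<inter> sq s u))"
  define P2 where "P2 = nu c d (B2 \<inter> sq s u) - \<gamma> * of_real (measure lborel (B2 \<inter> sq s u))"
  have sqb: "sq s u \<subseteq> cball u (2 * s)" using sq_dist by (auto simp: dist_norm norm_minus_commute)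
  have sqm [measurable]: "sq s u \<in> sets borel" "convex (sq s u)" unfolding sq_def by auto
  have "norm P1 <= C * (2 * s)" "norm P2 <= C * (2 * s)" unfolding P1_def P2_def
   using B sqm sqb s by (auto intro!: densD(2)[OF D, of _ _ u] convex_Int)
  hence P12: "norm (P1 - P2) <= 4 * C * s" using norm_triangle_ineq4[of P1 P2] by simp
  have im: "i w * \<xi> u w = indicator (B1 \<inter> sq s u) w - indicator (B2 \<inter> sq s u) w" for w
   by (auto simp: i_def \<xi>_def indicator_def)
  have s1: "(\<Sum>n\<in>F. d n * i (c n) * \<xi> u (c n)) = nu c d (B1 \<inter> sq s u) - nu c d (B2 \<inter> sq s u)"
  proof -
   have "(\<Sum>n\<in>F. d n * i (c n) * \<xi> u (c n)) = (\<Sum>n\<in>F. (if c n \<in> B1 \<inter> sq s u then d n else 0) - (if c n \<in> B2 \<inter> sq s u then d n else 0))"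
    by (intro sum.cong) (auto simp: mult.assoc im indicator_def)
   also have "... = (\<Sum>n\<in>{n\<in>F. c n \<in> B1 \<inter> sq s u}. d n) - (\<Sum>n\<in>{n\<in>F. c n \<in> B2 \<inter> sq s u}. d n)"
    using fF by (simp only: sum_subtractf sum.inter_filter)
   also have "{n\<in>F. c n \<in> B1 \<inter> sq s u} = {n. c n \<in> B1 \<inter> sq s u}" by (auto simp: F_def)
   also have "{n\<in>F. c n \<in> B2 \<inter> sq s u} = {n. c n \<in> B2 \<inter> sq s u}" by (auto simp: F_def)
   finally show ?thesis by (simp add: nu_def)
  qed
  have m: "B1 \<inter> sq s u \<in> sets borel" "B2 \<inter> sq s u \<in> sets borel"
   and b: "bounded (B1 \<inter> sq s u)" "bounded (B2 \<inter> sq s u)" using B by (auto intro: bounded_Int)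
  have ic: "integrable lborel (%w. i w * \<xi> u w)"
   unfolding im by (intro Bochner_Integration.integrable_diff complex_indicator_integral m b)
  have s2: "(\<integral>w. i w * \<xi> u w \<partial>lborel) = of_real (measure lborel (B1 \<inter> sq s u)) - of_real (measure lborel (B2 \<inter> sq s u))"
   unfolding im using complex_indicator_integral[OF m(1) b(1)] complex_indicator_integral[OF m(2) b(2)]
   by (subst Bochner_Integration.integral_diff) auto
  have gi: "integrable lborel (%w. i w * g w * \<xi> u w)"
  proof (rule integrableI_bounded_set[where A="cball 0 r" and B=G])
   show "AE w in lborel. w \<notin> cball 0 r \<longrightarrow> i w * g w * \<xi> u w = 0"
   proof (intro AE_I2 impI)
    fix w :: complex assume "w \<notin> cball 0 r"
    hence "w \<notin> B1 \<union> B2" using r by blast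
    thus "i w * g w * \<xi> u w = 0" using i0[of w] by simp
   qed
  qed (auto simp: igb[OF chi1] emeasure_bounded_finite[unfolded infinity_ennreal_def])
  have gi2: "integrable lborel (%w. i w * (g w - g u) * \<xi> u w)"
  proof -
   have "(%w. i w * (g w - g u) * \<xi> u w) = (%w. i w * g w * \<xi> u w - (i w * \<xi> u w) * g u)" by (auto simp: algebra_simps)
   thus ?thesis using gi ic by auto
  qed
  have "(\<integral>w. i w * g w * \<xi> u w \<partial>lborel) = (\<integral>w. (i w * \<xi> u w) * g u + i w * (g w - g u) * \<xi> u w \<partial>lborel)"
   by (intro Bochner_Integration.integral_cong) (auto simp: algebra_simps)
  also have "... = (\<integral>w. i w * \<xi> u w \<partial>lborel) * g u + (\<integral>w. i w * (g w - g u) * \<xi> u w \<partial>lborel)"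
   using ic gi2 by (subst Bochner_Integration.integral_add) auto
  finally have e2: "(\<integral>w. i w * g w * \<xi> u w \<partial>lborel) = (\<integral>w. i w * \<xi> u w \<partial>lborel) * g u + (\<integral>w. i w * (g w - g u) * \<xi> u w \<partial>lborel)" .
  have e1: "(\<Sum>n\<in>F. d n * i (c n) * g (c n) * \<xi> u (c n)) = (\<Sum>n\<in>F. d n * i (c n) * \<xi> u (c n)) * g u
    + (\<Sum>n\<in>F. d n * i (c n) * (g (c n) - g u) * \<xi> u (c n))"
   unfolding sum_distrib_right sum.distrib[symmetric] by (intro sum.cong) (auto simp: algebra_simps)
  have hu: "h u = (P1 - P2) * g u + (\<Sum>n\<in>F. d n * i (c n) * (g (c n) - g u) * \<xi> u (c n))
    - \<gamma> * (\<integral>w. i w * (g w - g u) * \<xi> u w \<partial>lborel)"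
   unfolding h_def e1 e2 s1 s2 P1_def P2_def by (simp add: algebra_simps)
  have osc: "norm (i w * (g w - g u) * \<xi> u w) <= \<omega> * norm (\<xi> u w)" for w
  proof (cases "w \<in> sq s u \<and> w \<in> (B1 - B2) \<union> (B2 - B1)")
   case True
   hence "norm (i w) * norm (g w - g u) <= 1 * \<omega>" using H i1 by (intro mult_mono) auto
   thus ?thesis unfolding norm_mult by (intro mult_right_mono) auto
  next
   case False
   hence "i w * (g w - g u) * \<xi> u w = 0" using i0 by (auto simp: \<xi>_def)
   thus ?thesis using G(3) by (simp only: norm_zero) simp
  qed
  have b3: "norm (\<integral>w. i w * (g w - g u) * \<xi> u w \<partial>lborel) <= \<omega> * s^2"
  proof -
   have "norm (\<integral>w. i w * (g w - g u) * \<xi> u w \<partial>lborel) <= (\<integral>w. norm (i w * (g w - g u) * \<xi> u w) \<partial>lborel)"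
    by (rule integral_norm_bound)
   also have "... <= (\<integral>w. \<omega> * norm (\<xi> u w) \<partial>lborel)"
    using gi2 cm' osc by (intro integral_mono) auto
   also have "... = \<omega> * s^2" using cm' by simp
   finally show ?thesis .
  qed
  have b2: "norm (\<Sum>n\<in>F. d n * i (c n) * (g (c n) - g u) * \<xi> u (c n)) <= 100 * M * N * s^2 * \<omega>"
  proof -
   let ?S = "{n\<in>F. c n \<in> sq s u}"
   have "(\<Sum>n\<in>F. d n * i (c n) * (g (c n) - g u) * \<xi> u (c n)) = (\<Sum>n\<in>?S. d n * i (c n) * (g (c n) - g u) * \<xi> u (c n))"
    using fF by (intro sum.mono_neutral_right) (auto simp: \<xi>_def)
   also have "norm ... <= (\<Sum>n\<in>?S. M * \<omega>)"
   proof (rule sum_norm_le)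
    fix n
    have "norm (i (c n) * (g (c n) - g u) * \<xi> u (c n)) <= \<omega>"
    using osc[of "c n"] mult_left_le[OF chi1[of u "c n"] G(3)] by linarith
    hence "norm (d n) * norm (i (c n) * (g (c n) - g u) * \<xi> u (c n)) <= M * \<omega>"
    using pairsD(3)[OF p] MN by (intro mult_mono) auto
    thus "norm (d n * i (c n) * (g (c n) - g u) * \<xi> u (c n)) <= M * \<omega>" by (simp add: norm_mult mult.assoc)
   qed
   also have "... = real (card ?S) * (M * \<omega>)" by simp
   also have "... <= (25 * N * (2 * s)^2) * (M * \<omega>)"
    using sqb s MN G by (intro mult_right_mono pairs_count(2)[OF p, of _ _ u]) (auto simp: sq_dist)
   finally show ?thesis by (simp add: power_mult_distrib mult_ac)
  qed
  have b1: "norm ((P1 - P2) * g u) <= 4 * C * s * G"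
   unfolding norm_mult using P12 G(1)[OF True] densD(1)[OF D] s by (intro mult_mono) auto
  have "norm (h u) <= 4 * C * s * G + 100 * M * N * s^2 * \<omega> + norm \<gamma> * (\<omega> * s^2)"
   unfolding hu using b1 b2 mult_left_mono[OF b3, of "norm \<gamma>"]
   by (intro order_trans[OF norm_triangle_ineq4] add_mono order_trans[OF norm_triangle_ineq]) (auto simp: norm_mult)
  thus ?thesis using True by (simp add: K_def algebra_simps)
 qed
 have "s^2 * norm Q = norm (\<integral>u. h u \<partial>lborel)" unfolding inth using s by (simp add: norm_mult norm_power)
 also have "... <= (\<integral>u. norm (h u) \<partial>lborel)" by (rule integral_norm_bound)
 also have "... <= (\<integral>u. indicator U u *\<^sub>R K \<partial>lborel)"
  using inth(2) hb U by (intro integral_mono integrableI_bounded_set_indicator[of _ _ _ K]) (auto simp: K0)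
 also have "... = measure lborel U * K" using U by simp
 finally have "s^2 * norm Q <= measure lborel U * K" .
 also have "measure lborel U * K = s^2 * (measure lborel U * (4 * C * G / s + (100 * M * N + norm \<gamma>) * \<omega>))"
  using s by (simp add: K_def field_simps power2_eq_square)
 finally have "norm Q <= measure lborel U * (4 * C * G / s + (100 * M * N + norm \<gamma>) * \<omega>)"
  using s by (simp add: mult_le_cancel_left_pos)
 thus ?thesis unfolding Qeq .
qed

subsection \<open>Conditional convergence from the density condition\<close>

text \<open>A point of the ring weighs about \<rho>^-2 and the ring has area about \<rho>^2. With
  squares of side \<open>s\<close> the discrepancy contributes C / s and the oscillation of 1 / w^2
  contributes s / \<rho>, which balance at s = sqrt \<rho>. The integral of 1 / w^2 over a ring
  vanishes, so \<gamma> enters only through the oscillation.\<close>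

lemma ring_sum_doubling:
 assumes p: "pairs c d M N" and D: "dens c d \<gamma> C" and \<rho>: "16 <= \<rho>" "\<rho> <= r" "r <= 2 * \<rho>"
 shows "norm (\<Sum>n\<in>{n. \<rho> <= norm (c n) \<and> norm (c n) < r}. d n * (1 / (c n)^2))
  <= (576 * C + 1440 * (100 * M * N + norm \<gamma>)) / sqrt \<rho>"
proof -
 define s where "s = sqrt \<rho>"
 have s: "s \<ge> 4" "s * s = \<rho>" using \<rho> unfolding s_def by (auto intro!: real_le_rsqrt)
 have s4: "4 * s <= \<rho>" using s by (metis mult_right_mono order_trans less_eq_real_def zero_le_numeral)
 define U where "U = cball (0::complex) (3 * \<rho>) - ball 0 (\<rho>/2)"
 have mU: "U \<in> sets borel" "bounded U" unfolding U_def by (auto intro: bounded_diff)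
 have UA: "measure lborel U <= 36 * \<rho>^2"
 proof -
  have "measure lborel U <= measure lborel (cball (0::complex) (3*\<rho>))"
   unfolding U_def by (rule measure_lborel_mono) auto
  also have "... = pi * (3*\<rho>)^2" using \<rho> by (intro content_cball_complex) auto
  also have "... <= 4 * (3*\<rho>)^2" using pi_less_4 by (intro mult_right_mono) auto
  finally show ?thesis by (simp add: power_mult_distrib)
 qed
 have S: "{n. c n \<in> ball 0 r - ball 0 \<rho>} = {n. \<rho> <= norm (c n) \<and> norm (c n) < r}" "{n. c n \<in> ball 0 \<rho> - ball 0 r} = {}"
  using \<rho> by auto
 have I: "SI (ball 0 r - ball 0 \<rho>) (%w. 1 / w^2) = 0" "SI (ball 0 \<rho> - ball 0 r) (%w. 1 / w^2) = 0"
 proof -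
  have "ball 0 r - ball 0 \<rho> = {w::complex. \<rho> <= norm w \<and> norm w < r}" by auto
  thus "SI (ball 0 r - ball 0 \<rho>) (%w. 1 / w^2) = 0" using SI_ring_inverse_square by simp
  have "ball 0 \<rho> - ball 0 r = ({}::complex set)" using \<rho> by auto
  thus "SI (ball 0 \<rho> - ball 0 r) (%w. 1 / w^2) = 0" by (simp only: set_lebesgue_integral_def) simp
 qed
 have "norm ((\<Sum>n\<in>{n. c n \<in> ball 0 r - ball 0 \<rho>}. d n * (1 / (c n)^2)) - (\<Sum>n\<in>{n. c n \<in> ball 0 \<rho> - ball 0 r}. d n * (1 / (c n)^2))
   - \<gamma> * (SI (ball 0 r - ball 0 \<rho>) (%w. 1 / w^2) - SI (ball 0 \<rho> - ball 0 r) (%w. 1 / w^2)))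
   <= measure lborel U * (4 * C * (4/\<rho>^2) / s + (100 * M * N + norm \<gamma>) * (40 * s / \<rho>^3))"
 proof (rule average_estimate[OF p D])
  show "emeasure lborel U < \<infinity>" using mU(2) by (rule emeasure_bounded_finite)
  show "norm (1 / u^2) <= 4 / \<rho>^2" if "u \<in> U" for u
  proof -
   have "(\<rho>/2)^2 <= (norm u)^2" using that \<rho> unfolding U_def by (intro power_mono) auto
   moreover have "u ~= 0" using that \<rho> unfolding U_def by auto
   ultimately have "1 / (norm u)^2 <= 1 / (\<rho>/2)^2" using \<rho> by (intro divide_left_mono) auto
   thus ?thesis by (simp add: norm_divide norm_power power_divide)
  qed
  show "u \<in> U \<and> norm (1 / w^2 - 1 / u^2) <= 40 * s / \<rho>^3"
   if w: "w \<in> sq s u" "w \<in> (ball 0 r - ball 0 \<rho>) \<union> (ball 0 \<rho> - ball 0 r)" for u w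
  proof -
   have wr: "\<rho> <= norm w" "norm w <= 2 * \<rho>" using w(2) \<rho> by auto
   have wu: "norm (w - u) <= 2 * s" using sq_dist[OF w(1)] .
   have ur: "\<rho>/2 <= norm u" "norm u <= 3 * \<rho>"
    using wu wr s4 norm_triangle_ineq2[of w u] norm_triangle_ineq2[of u w] by (auto simp: norm_minus_commute)
   have nz: "w ~= 0" "u ~= 0" using wr ur \<rho> by auto
   have "1 / w^2 - 1 / u^2 = (u - w) * (u + w) / (w^2 * u^2)" using nz
    by (simp add: field_simps power2_eq_square)
   hence "norm (1 / w^2 - 1 / u^2) = norm (w - u) * norm (u + w) / ((norm w)^2 * (norm u)^2)"
    by (simp add: norm_divide norm_mult norm_power norm_minus_commute)
   also have "... <= (2 * s) * (5 * \<rho>) / (\<rho>^2 * (\<rho>/2)^2)"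
    using wu wr ur \<rho> s norm_triangle_ineq[of u w] by (intro frac_le mult_mono power_mono) auto
   also have "... = 40 * s / \<rho>^3" using \<rho> by (simp add: field_simps power2_eq_square power3_eq_cube)
   finally show ?thesis using ur unfolding U_def by auto
  qed
 qed (use \<rho> s mU in auto)
 hence "norm (\<Sum>n\<in>{n. \<rho> <= norm (c n) \<and> norm (c n) < r}. d n * (1 / (c n)^2))
   <= measure lborel U * (4 * C * (4/\<rho>^2) / s + (100 * M * N + norm \<gamma>) * (40 * s / \<rho>^3))"
  unfolding S I by simp
 also have "... <= (36 * \<rho>^2) * (4 * C * (4/\<rho>^2) / s + (100 * M * N + norm \<gamma>) * (40 * s / \<rho>^3))"
  using UA densD(1)[OF D] pairsD(1,2)[OF p] \<rho> s by (intro mult_right_mono) auto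
 also have "... = (576 * C + 1440 * (100 * M * N + norm \<gamma>)) / s"
 proof -
  have "s ~= 0" using s by auto
  moreover have "\<rho> = s * s" using s by simp
  ultimately show ?thesis by (simp add: field_simps power2_eq_square power3_eq_cube)
 qed
 finally show ?thesis unfolding s_def .
qed

text \<open>Doubling rings produce a geometric series of ratio 1 / sqrt 2. The factor 4 survives the
  induction because 1 + 4 / sqrt 2 <= 4, which follows from sqrt 2 >= 4/3.\<close>

lemma ring_sum:
 assumes p: "pairs c d M N" and D: "dens c d \<gamma> C" and \<rho>: "16 <= \<rho>"
 shows "norm (\<Sum>n\<in>{n. \<rho> <= norm (c n) \<and> norm (c n) < r}. d n * (1 / (c n)^2))
  <= 4 * (576 * C + 1440 * (100 * M * N + norm \<gamma>)) / sqrt \<rho>"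
proof -
 define K where "K = 576 * C + 1440 * (100 * M * N + norm \<gamma>)"
 define F where "F = (%\<rho> r. \<Sum>n\<in>{n. \<rho> <= norm (c n) \<and> norm (c n) < r}. d n * (1 / (c n)^2))"
 have K0: "K \<ge> 0" unfolding K_def using densD(1)[OF D] pairsD(1,2)[OF p] by auto
 have claim: "16 <= \<rho> ==> r <= 2^k * \<rho> ==> norm (F \<rho> r) <= 4 * K / sqrt \<rho>" for k \<rho>
 proof (induction k arbitrary: \<rho>)
  case 0
  hence "{n. \<rho> <= norm (c n) \<and> norm (c n) < r} = {}" by auto
  hence "F \<rho> r = 0" unfolding F_def by (simp only: sum.empty)
  thus ?case using 0 K0 by simp
 next
  case (Suc k)
  show ?case
  proof (cases "r <= 2 * \<rho>")
   case True
   have "norm (F \<rho> r) <= K / sqrt \<rho>"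
   proof (cases "\<rho> <= r")
    case True
    thus ?thesis using ring_sum_doubling[OF p D Suc.prems(1)] \<open>r <= 2 * \<rho>\<close> unfolding F_def K_def by blast
   next
    case False
    hence "{n. \<rho> <= norm (c n) \<and> norm (c n) < r} = {}" by auto
    hence "F \<rho> r = 0" unfolding F_def by (simp only: sum.empty)
    thus ?thesis using Suc.prems K0 by simp
   qed
   also have "... <= 4 * K / sqrt \<rho>" using K0 Suc.prems by (intro divide_right_mono) auto
   finally show ?thesis .
  next
   case False
   have fin: "finite {n. norm (c n) < r}" for r using pairs_finite(2)[OF p, of 0 r] by simp
   have "F \<rho> r = F \<rho> (2*\<rho>) + F (2*\<rho>) r" unfolding F_def
   proof (subst sum.union_disjoint[symmetric])
    show "finite {n. \<rho> <= norm (c n) \<and> norm (c n) < 2 * \<rho>}" "finite {n. 2 * \<rho> <= norm (c n) \<and> norm (c n) < r}"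
    by (rule finite_subset[OF _ fin]; blast)+
    have "{n. \<rho> <= norm (c n) \<and> norm (c n) < r} = {n. \<rho> <= norm (c n) \<and> norm (c n) < 2 * \<rho>} \<union> {n. 2 * \<rho> <= norm (c n) \<and> norm (c n) < r}"
    using False Suc.prems by auto
    thus "(\<Sum>n\<in>{n. \<rho> <= norm (c n) \<and> norm (c n) < r}. d n * (1 / (c n)^2)) =
    (\<Sum>n\<in>{n. \<rho> <= norm (c n) \<and> norm (c n) < 2 * \<rho>} \<union> {n. 2 * \<rho> <= norm (c n) \<and> norm (c n) < r}. d n * (1 / (c n)^2))" by simp
   qed auto
   hence "norm (F \<rho> r) <= norm (F \<rho> (2*\<rho>)) + norm (F (2*\<rho>) r)" by (simp add: norm_triangle_ineq)
   also have "norm (F \<rho> (2*\<rho>)) <= K / sqrt \<rho>"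
    using ring_sum_doubling[OF p D Suc.prems(1), of "2*\<rho>"] Suc.prems unfolding F_def K_def by auto
   also have "norm (F (2*\<rho>) r) <= 4 * K / sqrt (2*\<rho>)" using Suc.prems by (intro Suc.IH) (auto simp: mult_ac)
   also have "4 * K / sqrt (2*\<rho>) <= 3 * K / sqrt \<rho>"
   proof -
    have "sqrt 2 \<ge> 4/3" by (rule real_le_rsqrt) (simp add: power2_eq_square)
    hence "4 * K <= 3 * K * sqrt 2" using K0 mult_left_mono[of "4/3" "sqrt 2" "3*K"] by simp
    moreover have "sqrt \<rho> > 0" using Suc.prems by simp
    ultimately show ?thesis by (simp add: real_sqrt_mult field_simps)
   qed
   finally show ?thesis by (simp add: add_divide_distrib[symmetric])
  qed
 qed
 obtain k where "r / \<rho> < 2^k" using real_arch_pow[of 2 "r/\<rho>"] by auto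
 hence "r <= 2^k * \<rho>" using \<rho> by (simp add: field_simps)
 from claim[OF \<rho> this] show ?thesis unfolding F_def K_def .
qed

text \<open>The increment of d / w has leading term d z / c^2. The coefficient 9 is 8 + 1: the cubic
  kernel error at c - z, where norm (c - z) >= norm c / 2, and the one at c.\<close>

lemma kap_expand:
 assumes M: "1 <= M" "norm d <= M" and c: "2 * norm z + 4 * M <= norm c"
 shows "norm (kap M d (c - z) - kap M d c - d * z * (1 / c^2)) <= (9 * M^3 + 2 * M * norm z ^ 2) * (1 / norm c ^ 3)"
proof -
 have cz: "norm c / 2 <= norm (c - z)" using c M norm_triangle_ineq2[of c z] by linarith
 have cz2: "2 * M <= norm (c - z)" "2 * M <= norm c" using c cz M norm_ge_zero[of z] by linarith+
 have nz: "c ~= 0" "c - z ~= 0" using cz2 M by auto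
 have c0: "norm c > 0" using nz by simp
 have "d / (c - z) - d / c - d * z * (1 / c^2) = d * z^2 / (c^2 * (c - z))"
  using nz by (simp add: divide_simps power2_eq_square) (simp add: algebra_simps)
 hence E: "kap M d (c - z) - kap M d c - d * z * (1 / c^2) =
   (kap M d (c - z) - d / (c - z)) - (kap M d c - d / c) + d * z^2 / (c^2 * (c - z))" by (simp add: algebra_simps)
 have 0: "norm (kap M d (c - z) - kap M d c - d * z * (1 / c^2)) <=
   norm (kap M d (c - z) - d / (c - z)) + norm (kap M d c - d / c) + norm (d * z^2 / (c^2 * (c - z)))"
  unfolding E using norm_triangle_ineq[of "(kap M d (c - z) - d / (c - z)) - (kap M d c - d / c)" "d * z^2 / (c^2 * (c - z))"]
   norm_triangle_ineq4[of "kap M d (c - z) - d / (c - z)" "kap M d c - d / c"] by simp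
 have "norm (kap M d (c - z) - d / (c - z)) <= M^3 / norm (c - z) ^ 3" by (rule kap_approx[OF M cz2(1)])
 also have "... <= M^3 / (norm c / 2)^3" using cz c0 M nz by (intro divide_left_mono power_mono) auto
 also have "... = 8 * (M^3 * (1 / norm c ^ 3))" by (simp add: power_divide)
 finally have 1: "norm (kap M d (c - z) - d / (c - z)) <= 8 * (M^3 * (1 / norm c ^ 3))" .
 have 2: "norm (kap M d c - d / c) <= M^3 * (1 / norm c ^ 3)" using kap_approx[OF M cz2(2)] by simp
 have "norm (d * z^2 / (c^2 * (c - z))) <= M * norm z ^ 2 / (norm c ^ 2 * (norm c / 2))"
  unfolding norm_divide norm_mult norm_power using M cz c0 by (intro frac_le mult_mono) auto
 also have "... = 2 * M * norm z ^ 2 * (1 / norm c ^ 3)" by (simp add: power2_eq_square power3_eq_cube)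
 finally have 3: "norm (d * z^2 / (c^2 * (c - z))) <= 2 * M * norm z ^ 2 * (1 / norm c ^ 3)" .
 show ?thesis using 0 1 2 3 unfolding distrib_right by linarith
qed

definition TS :: "real => (nat => complex) => (nat => complex) => nat set => complex => complex" where
 "TS M c d S z = (\<Sum>n\<in>S. kap M (d n) (c n - z) - kap M (d n) (c n))"

text \<open>The limit runs along integer radii, and \<open>lim\<close> is unspecified if there is
  none; under \<open>dens\<close> it exists, for real radii and for slightly deformed discs as well.
  Subtracting the kernel at the origin removes the leading part \<open>d n / c n\<close> and leaves
  terms of second order.\<close>

definition TT :: "real => (nat => complex) => (nat => complex) => complex => complex" where
 "TT M c d z = lim (%k. TS M c d {n. norm (c n) < real k} z)"

text \<open>The terms \<open>d n * z / (c n)^2\<close> are summed by \<open>ring_sum\<close>, the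
  cubic remainder absolutely.\<close>

lemma TS_ring:
 assumes p: "pairs c d M N" and D: "dens c d \<gamma> C" and z: "norm z <= R" and \<rho>: "2 * R + 16 * M <= \<rho>"
 shows "norm (TS M c d {n. \<rho> <= norm (c n) \<and> norm (c n) < r} z)
  <= (R * (4 * (576 * C + 1440 * (100 * M * N + norm \<gamma>))) + (9 * M^3 + 2 * M * R ^ 2) * (200 * N)) / sqrt \<rho>"
proof -
 note M = pairsD(1)[OF p] and N = pairsD(2)[OF p]
 have R: "0 <= R" using z norm_ge_zero order_trans by blast
 have \<rho>16: "16 <= \<rho>" "1 <= \<rho>" using \<rho> R M by linarith+
 let ?S = "{n. \<rho> <= norm (c n) \<and> norm (c n) < r}"
 have fin: "finite ?S" by (rule finite_subset[OF _ pairs_finite(2)[OF p, of 0 r]]) auto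
 have eq: "TS M c d ?S z = z * (\<Sum>n\<in>?S. d n * (1 / (c n)^2)) + (\<Sum>n\<in>?S. kap M (d n) (c n - z) - kap M (d n) (c n) - d n * z * (1 / (c n)^2))"
  unfolding TS_def sum_distrib_left sum.distrib[symmetric] by (intro sum.cong) (auto simp: mult_ac)
 have "norm (TS M c d ?S z) <= norm z * norm (\<Sum>n\<in>?S. d n * (1 / (c n)^2)) + norm (\<Sum>n\<in>?S. kap M (d n) (c n - z) - kap M (d n) (c n) - d n * z * (1 / (c n)^2))"
  unfolding eq norm_mult[symmetric] by (rule norm_triangle_ineq)
 also have "norm z * norm (\<Sum>n\<in>?S. d n * (1 / (c n)^2)) <= R * (4 * (576 * C + 1440 * (100 * M * N + norm \<gamma>)) / sqrt \<rho>)"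
  using ring_sum[OF p D \<rho>16(1)] z R by (intro mult_mono) auto
 also have "norm (\<Sum>n\<in>?S. kap M (d n) (c n - z) - kap M (d n) (c n) - d n * z * (1 / (c n)^2))
   <= (\<Sum>n\<in>?S. (9 * M^3 + 2 * M * R ^ 2) * (1 / norm (c n - 0) ^ 3))"
 proof (rule sum_norm_le)
  fix n assume "n \<in> ?S"
  hence "norm (kap M (d n) (c n - z) - kap M (d n) (c n) - d n * z * (1 / (c n)^2)) <= (9 * M^3 + 2 * M * norm z ^ 2) * (1 / norm (c n) ^ 3)"
   using z \<rho> M pairsD(3)[OF p] by (intro kap_expand) auto
  also have "... <= (9 * M^3 + 2 * M * R ^ 2) * (1 / norm (c n - 0) ^ 3)"
   using z M by (simp, intro divide_right_mono add_left_mono mult_left_mono power_mono) auto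
  finally show "norm (kap M (d n) (c n - z) - kap M (d n) (c n) - d n * z * (1 / (c n)^2)) <= ..." .
 qed
 also have "... = (9 * M^3 + 2 * M * R ^ 2) * (\<Sum>n\<in>?S. 1 / norm (c n - 0) ^ 3)" by (rule sum_distrib_left[symmetric])
 also have "... <= (9 * M^3 + 2 * M * R ^ 2) * (200 * N / \<rho>)"
  using fin M \<rho>16 by (intro mult_left_mono pairs_sum_cube[OF p]) auto
 also have "... <= (9 * M^3 + 2 * M * R ^ 2) * (200 * N / sqrt \<rho>)"
 proof (intro mult_left_mono divide_left_mono)
  show "sqrt \<rho> <= \<rho>" using \<rho>16 by (intro real_le_lsqrt) (auto simp: power2_eq_square)
 qed (use M N \<rho>16 in auto)
 finally have fin: "norm (TS M c d ?S z) <= R * (4 * (576 * C + 1440 * (100 * M * N + norm \<gamma>)) / sqrt \<rho>) +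
   (9 * M^3 + 2 * M * R ^ 2) * (200 * N / sqrt \<rho>)" by simp
 have "a * (x / s) + b * (y / s) = (a * x + b * y) / s" for a b x y s :: real by (simp add: add_divide_distrib)
 thus ?thesis using fin by (simp only:)
qed

text \<open>The constants are chosen before \<open>c\<close> and \<open>d\<close>, so the estimate
  is uniform over all translates of the divisor. The index set may be anything between the discs of
  radii \<rho> and \<rho> + 2; this slack admits images of discs under the permutations attached to
  almost periods. The O(\<rho>) extra indices contribute O(\<rho>^-2) each.\<close>

lemma TT_approx:
 assumes MN: "1 <= M" "1 <= N" "0 <= C" "0 <= R"
 obtains K \<rho>\<^sub>1 where "0 <= K" "1 <= \<rho>\<^sub>1" "!!c d z \<rho> S. pairs c d M N ==> dens c d \<gamma> C ==> norm z <= R ==> \<rho>\<^sub>1 <= \<rho> ==>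
   {n. norm (c n) < \<rho>} \<subseteq> S ==> S \<subseteq> {n. norm (c n) < \<rho> + 2} ==> norm (TT M c d z - TS M c d S z) <= K / sqrt \<rho>"
proof -
 define K1 where "K1 = R * (4 * (576 * C + 1440 * (100 * M * N + norm \<gamma>))) + (9 * M^3 + 2 * M * R ^ 2) * (200 * N)"
 define K2 where "K2 = 3150 * N * (M * R + 9 * M^3 + 2 * M * R^2)"
 have K10: "0 <= K1" "0 <= K2" unfolding K1_def K2_def using MN by auto
 show thesis
 proof (rule that[of "K1 + K2" "2 * R + 16 * M"])
  show "0 <= K1 + K2" "1 <= 2 * R + 16 * M" using K10 MN by auto
  fix c d :: "nat => complex" and z :: complex and \<rho> :: real and S :: "nat set"
  assume p: "pairs c d M N" and D: "dens c d \<gamma> C" and z: "norm z <= R" and \<rho>: "2 * R + 16 * M <= \<rho>"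
   and S: "{n. norm (c n) < \<rho>} \<subseteq> S" "S \<subseteq> {n. norm (c n) < \<rho> + 2}"
  have \<rho>1: "1 <= \<rho>" using \<rho> MN by linarith
  have fin: "finite {n. norm (c n) < r}" for r using pairs_finite(2)[OF p, of 0 r] by simp
  define u where "u = (%r. TS M c d {n. norm (c n) < r} z)"
  have u: "norm (u r' - u r) <= K1 / sqrt \<rho>'" if "r <= r'" "\<rho>' <= r" "2 * R + 16 * M <= \<rho>'" for r r' \<rho>'
  proof -
   have "u r' = u r + TS M c d {n. r <= norm (c n) \<and> norm (c n) < r'} z" unfolding u_def TS_def
   proof (subst sum.union_disjoint[symmetric])
    show "finite {n. r <= norm (c n) \<and> norm (c n) < r'}" by (rule finite_subset[OF _ fin[of r']]) auto
    have "{n. norm (c n) < r'} = {n. norm (c n) < r} \<union> {n. r <= norm (c n) \<and> norm (c n) < r'}" using that by auto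
    thus "(\<Sum>n\<in>{n. norm (c n) < r'}. kap M (d n) (c n - z) - kap M (d n) (c n)) =
    (\<Sum>n\<in>{n. norm (c n) < r} \<union> {n. r <= norm (c n) \<and> norm (c n) < r'}. kap M (d n) (c n - z) - kap M (d n) (c n))" by simp
   qed (use fin in auto)
   hence "norm (u r' - u r) <= K1 / sqrt r" using TS_ring[OF p D z, of r r'] that unfolding K1_def by simp
   also have "... <= K1 / sqrt \<rho>'" using that K10 MN by (intro divide_left_mono) auto
   finally show ?thesis .
  qed
  have lim0: "(%k::nat. K1 / sqrt (real k)) \<longlonglongrightarrow> 0"
   by (intro tendsto_divide_0[OF tendsto_const] filterlim_at_top_imp_at_infinity
    filterlim_compose[OF sqrt_at_top filterlim_real_sequentially])
  have "Cauchy (%k::nat. u (real k))"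
  proof (rule metric_CauchyI)
   fix e :: real assume "e > 0"
   hence "eventually (%k::nat. K1 / sqrt (real k) < e) sequentially"
    by (rule order_tendstoD(2)[OF lim0])
   moreover have "eventually (%k::nat. real k \<ge> 2 * R + 16 * M) sequentially"
    using filterlim_real_sequentially by (simp add: filterlim_at_top)
   ultimately have "eventually (%k::nat. K1 / sqrt (real k) < e \<and> real k \<ge> 2 * R + 16 * M) sequentially"
    by (rule eventually_conj)
   then obtain k0 where k0: "K1 / sqrt (real k0) < e" "real k0 \<ge> 2 * R + 16 * M"
    using eventually_happens'[OF sequentially_bot] by blast
   have "dist (u (real m)) (u (real n)) < e" if "m \<ge> k0" "n \<ge> k0" for m n
   proof (cases "m <= n")
    case True
    thus ?thesis using u[of "real m" "real n" "real k0"] that k0 by (simp add: dist_norm norm_minus_commute)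
   next
    case False
    thus ?thesis using u[of "real n" "real m" "real k0"] that k0 by (simp add: dist_norm)
   qed
   thus "\<exists>k0. \<forall>m\<ge>k0. \<forall>n\<ge>k0. dist (u (real m)) (u (real n)) < e" by blast
  qed
  hence conv: "(%k::nat. u (real k)) \<longlonglongrightarrow> TT M c d z"
   unfolding TT_def u_def by (simp add: Cauchy_convergent_iff convergent_LIMSEQ_iff)
  have "eventually (%k. norm (u (real k) - u \<rho>) <= K1 / sqrt \<rho>) sequentially"
   using eventually_ge_at_top[of "nat \<lceil>\<rho>\<rceil>"]
   by eventually_elim (rule u, use \<rho> in linarith, auto simp: \<rho>)
  moreover have "(%k. norm (u (real k) - u \<rho>)) \<longlonglongrightarrow> norm (TT M c d z - u \<rho>)" by (intro tendsto_intros conv)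
  ultimately have b1: "norm (TT M c d z - u \<rho>) <= K1 / sqrt \<rho>"
   by (intro tendsto_upperbound[of _ _ sequentially]) auto
  have finS: "finite S" using S(2) fin finite_subset by blast
  let ?A = "S - {n. norm (c n) < \<rho>}"
  have "TS M c d S z = u \<rho> + TS M c d ?A z" unfolding u_def TS_def using S finS
   by (metis (no_types, lifting) add.commute sum.subset_diff)
  moreover have "norm (TS M c d ?A z) <= K2 / sqrt \<rho>"
  proof -
   have card: "real (card ?A) <= 350 * N * (2+1)^2 * \<rho>"
   proof (rule pairs_count_frontier(2)[OF p convex_cball order_refl \<rho>1])
    fix n assume n: "n \<in> ?A"
    hence cn: "\<rho> <= norm (c n)" "norm (c n) < \<rho> + 2" using S(2) by auto
    define q where "q = (\<rho> / norm (c n)) *\<^sub>R c n"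
    have cn0: "norm (c n) > 0" using cn \<rho>1 by linarith
    have "norm q = \<rho>" using cn0 \<rho>1 by (simp add: q_def)
    moreover have "c n - q = ((norm (c n) - \<rho>) / norm (c n)) *\<^sub>R c n"
    using cn0 by (simp add: q_def diff_divide_distrib scaleR_diff_left)
    hence "norm (c n - q) = norm (c n) - \<rho>" using cn0 cn by simp
    ultimately show "\<exists>p\<in>frontier (cball 0 \<rho>). norm (c n - p) <= 2" using cn \<rho>1
    by (intro bexI[of _ q]) (auto simp: frontier_cball)
   qed auto
   have "norm (TS M c d ?A z) <= (\<Sum>n\<in>?A. (M * R + 9 * M^3 + 2 * M * R^2) / \<rho>^2)" unfolding TS_def
   proof (rule sum_norm_le)
    fix n assume "n \<in> ?A"
    hence cn: "\<rho> <= norm (c n)" by auto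
    hence cn0: "c n ~= 0" using \<rho>1 by auto
    have e: "norm (kap M (d n) (c n - z) - kap M (d n) (c n) - d n * z * (1 / (c n)^2)) <= (9 * M^3 + 2 * M * norm z ^ 2) * (1 / norm (c n) ^ 3)"
    using z \<rho> cn MN pairsD(3)[OF p] by (intro kap_expand) auto
    also have "... <= (9 * M^3 + 2 * M * R ^ 2) * (1 / \<rho>^2)"
    proof (intro mult_mono add_left_mono mult_left_mono power_mono divide_left_mono)
    have "\<rho>^2 <= \<rho>^3" using \<rho>1 by (intro power_increasing) auto
    also have "... <= norm (c n)^3" using cn \<rho>1 by (intro power_mono) auto
    finally show "\<rho>^2 <= norm (c n) ^ 3" .
    qed (use z MN \<rho>1 cn cn0 in auto)
    finally have 1: "norm (kap M (d n) (c n - z) - kap M (d n) (c n) - d n * z * (1 / (c n)^2)) <= (9 * M^3 + 2 * M * R ^ 2) * (1 / \<rho>^2)" .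
    have "norm (d n * z * (1 / (c n)^2)) = norm (d n) * norm z * (1 / norm (c n)^2)" by (simp add: norm_mult norm_divide norm_power)
    also have "... <= M * R * (1 / \<rho>^2)" using pairsD(3)[OF p] z MN cn \<rho>1
    cn0 by (intro mult_mono divide_left_mono power_mono) auto
    finally have 2: "norm (d n * z * (1 / (c n)^2)) <= M * R * (1 / \<rho>^2)" .
    have "norm (kap M (d n) (c n - z) - kap M (d n) (c n)) <= (9 * M^3 + 2 * M * R ^ 2) * (1 / \<rho>^2) + M * R * (1 / \<rho>^2)"
    using norm_triangle_ineq[of "kap M (d n) (c n - z) - kap M (d n) (c n) - d n * z * (1 / (c n)^2)" "d n * z * (1 / (c n)^2)"] 1 2 by simp
    thus "norm (kap M (d n) (c n - z) - kap M (d n) (c n)) <= (M * R + 9 * M^3 + 2 * M * R^2) / \<rho>^2"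
    by (simp add: add_divide_distrib algebra_simps)
   qed
   also have "... = real (card ?A) * ((M * R + 9 * M^3 + 2 * M * R^2) / \<rho>^2)" by simp
   also have "... <= (350 * N * (2+1)^2 * \<rho>) * ((M * R + 9 * M^3 + 2 * M * R^2) / \<rho>^2)"
    using card MN \<rho>1 by (intro mult_right_mono) auto
   also have "... = K2 / \<rho>" using \<rho>1 by (simp add: K2_def power2_eq_square field_simps)
   also have "... <= K2 / sqrt \<rho>"
   proof (rule divide_left_mono)
    show "sqrt \<rho> <= \<rho>" using \<rho>1 by (intro real_le_lsqrt) (auto simp: power2_eq_square)
   qed (use K10 \<rho>1 in auto)
   finally show ?thesis .
  qed
  ultimately have "norm (TT M c d z - TS M c d S z) <= K1 / sqrt \<rho> + K2 / sqrt \<rho>"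
   using b1 norm_triangle_ineq4[of "TT M c d z - u \<rho>" "TS M c d ?A z"] by (simp add: algebra_simps)
  thus "norm (TT M c d z - TS M c d S z) <= (K1 + K2) / sqrt \<rho>" by (simp add: add_divide_distrib)
 qed
qed

subsection \<open>The Cauchy transform of a disc\<close>

lemma phi_measurable [measurable]: "phi M \<in> borel_measurable borel"
proof -
 have [measurable]: "cnj \<in> borel_measurable borel" "(of_real :: real => complex) \<in> borel_measurable borel"
  by (intro borel_measurable_continuous_onI continuous_intros)+
 show ?thesis unfolding phi_def[abs_def] by measurable
qed

lemma kap_measurable:
 assumes "1 <= M" "norm d <= M" shows "kap M d \<in> borel_measurable borel"
 using continuous_kap[OF assms continuous_on_id, of UNIV] by (intro borel_measurable_continuous_onI) simp

text \<open>The derivative of \<open>phi\<close> in the direction -z.\<close>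

definition psi :: "real => complex => complex => complex" where
 "psi M z v = (if norm v < 2 * M then - cnj z / of_real (4 * M^2) else z / v^2)"

lemma psi_measurable [measurable]: "psi M z \<in> borel_measurable borel"
 unfolding psi_def[abs_def] by measurable

lemma norm_psi:
 assumes "1 <= M" shows "norm (psi M z v) <= norm z" "2 * M <= norm v ==> norm (psi M z v) = norm z / norm v ^ 2"
proof -
 show *: "2 * M <= norm v ==> norm (psi M z v) = norm z / norm v ^ 2"
  by (simp add: psi_def norm_divide norm_power)
 show "norm (psi M z v) <= norm z"
 proof (cases "norm v < 2 * M")
  case True
  have "1 <= 4 * M^2" using one_le_power[OF assms, of 2] by linarith
  hence "norm z / (4 * M^2) <= norm z / 1" by (intro divide_left_mono) auto
  thus ?thesis using True assms by (simp add: psi_def norm_divide norm_mult norm_power)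
 next
  case False
  hence "1 <= norm v" using assms by linarith
  hence "1 <= norm v ^ 2" by simp
  hence "norm z / norm v ^ 2 <= norm z / 1" by (intro divide_left_mono) (auto intro: mult_pos_pos)
  thus ?thesis using * False by simp
 qed
qed

text \<open>The fundamental theorem on the segment from \<open>w\<close> to \<open>w - z\<close>.
  Differentiability can fail only where the segment meets the circle of radius 2M; for nonzero
  \<open>z\<close> these parameters are roots of a nonzero quadratic polynomial.\<close>

lemma phi_has_integral:
 assumes M: "1 <= M"
 shows "((%t. psi M z (w - of_real t * z)) has_integral (phi M (w - z) - phi M w)) {0..1::real}"
proof (cases "z = 0")
 case True
 thus ?thesis by (simp add: psi_def)
next
 case False
 define g where "g = (%t::real. phi M (w - of_real t * z))"
 define S where "S = {t::real. norm (w - of_real t * z) = 2 * M}"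
 have sq: "norm (w - of_real t * z)^2 = poly [: norm w ^ 2 , - 2 * Re (w * cnj z), norm z ^ 2 :] t" for t :: real
  unfolding cmod_power2 by (simp add: power2_eq_square algebra_simps)
 have "S \<subseteq> {t. poly [: norm w ^ 2 - (2*M)^2 , - 2 * Re (w * cnj z), norm z ^ 2 :] t = 0}"
 proof
  fix t assume t: "t \<in> S"
  have "poly [: norm w ^ 2 - (2*M)^2 , - 2 * Re (w * cnj z), norm z ^ 2 :] t
    = poly [: norm w ^ 2 , - 2 * Re (w * cnj z), norm z ^ 2 :] t - (2*M)^2" by simp
  also have "... = 0" unfolding sq[of t, symmetric] using t by (simp add: S_def)
  finally show "t \<in> {t. poly [: norm w ^ 2 - (2*M)^2 , - 2 * Re (w * cnj z), norm z ^ 2 :] t = 0}" by simp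
 qed
 moreover have "finite {t. poly [: norm w ^ 2 - (2*M)^2 , - 2 * Re (w * cnj z), norm z ^ 2 :] t = 0}"
  using False by (intro poly_roots_finite) auto
 ultimately have fS: "finite S" by (rule finite_subset)
 have "((%t. psi M z (w - of_real t * z)) has_integral (g 1 - g 0)) {0..1}"
 proof (rule fundamental_theorem_of_calculus_strong[OF fS])
  show "continuous_on {0..1} g"
  proof -
   have "continuous_on UNIV (phi M)" unfolding phi_def[abs_def] using M
    by (intro continuous_intros) (auto simp: less_max_iff_disj max_def)
   thus ?thesis unfolding g_def by (rule continuous_on_compose2) (auto intro!: continuous_intros)
  qed
  fix t :: real assume t: "t \<in> {0..1} - S"
  hence ne: "norm (w - of_real t * z) ~= 2 * M" by (auto simp: S_def)
  show "(g has_vector_derivative psi M z (w - of_real t * z)) (at t)"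
  proof (cases "norm (w - of_real t * z) < 2 * M")
   case True
   have "((%t. cnj (w - of_real t * z) / of_real (4 * M^2)) has_vector_derivative - cnj z / of_real (4 * M^2)) (at t)"
    by (auto intro!: derivative_eq_intros)
   moreover have "open {t::real. norm (w - of_real t * z) < 2 * M}" by (intro open_Collect_less continuous_intros)
   ultimately have "(g has_vector_derivative - cnj z / of_real (4 * M^2)) (at t)"
    by (rule has_vector_derivative_transform_within_open) (use True in \<open>auto simp: g_def phi_near\<close>)
   thus ?thesis using True by (simp add: psi_def)
  next
   case False
   hence gt: "norm (w - of_real t * z) > 2 * M" using ne by simp
   hence nz: "w - of_real t * z ~= 0" using M by auto
   have "((%t. 1 / (w - of_real t * z)) has_vector_derivative z / (w - of_real t * z)^2) (at t)"
    by (rule has_vector_derivative_real_field[where f="%t. 1 / (w - t * z)"])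
    (use nz in \<open>auto intro!: derivative_eq_intros simp: power2_eq_square\<close>)
   moreover have "open {t::real. 2 * M < norm (w - of_real t * z)}" by (intro open_Collect_less continuous_intros)
   ultimately have "(g has_vector_derivative z / (w - of_real t * z)^2) (at t)"
    by (rule has_vector_derivative_transform_within_open) (use gt M in \<open>auto simp: g_def phi_far\<close>)
   thus ?thesis using False by (simp add: psi_def)
  qed
 qed simp
 thus ?thesis by (simp add: g_def)
qed

text \<open>The inner disc, of area 4 pi M^2, gives everything; on the ring the quarter turn cancels
  1 / w^2.\<close>

lemma SI_psi:
 assumes M: "1 <= M" and \<rho>: "2 * M <= \<rho>"
 shows "SI (cball 0 \<rho>) (psi M z) = - of_real pi * cnj z"
proof -
 let ?B = "ball (0::complex) (2 * M)" and ?R = "{w::complex. 2 * M <= norm w \<and> norm w <= \<rho>}"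
 have un: "cball 0 \<rho> = ?B \<union> ?R" using \<rho> by auto
 have mR: "?R \<in> sets borel" by measurable
 have "bounded ?R" by (rule bounded_subset[OF bounded_cball[of 0 \<rho>]]) auto
 hence i: "set_integrable lborel ?B (psi M z)" "set_integrable lborel ?R (psi M z)"
  using norm_psi(1)[OF M] mR by (auto intro!: SI_integrable)
 have "SI (cball 0 \<rho>) (psi M z) = SI ?B (psi M z) + SI ?R (psi M z)"
  unfolding un by (rule set_integral_Un) (use i in auto)
 also have "SI ?B (psi M z) = SI ?B (%_. - cnj z / of_real (4 * M^2))"
  by (intro set_lebesgue_integral_cong) (auto simp: psi_def)
 also have "... = of_real (measure lborel ?B) * (- cnj z / of_real (4 * M^2))"
  using complex_indicator_integral[of ?B]
  by (simp add: set_lebesgue_integral_def scaleR_conv_of_real emeasure_bounded_finite[unfolded infinity_ennreal_def])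
 also have "measure lborel ?B = pi * (2 * M)^2" using M by (intro content_ball_complex) auto
 also have "SI ?R (psi M z) = SI ?R (%w. z * (1 / w^2))"
  by (intro set_lebesgue_integral_cong) (use mR in \<open>auto simp: psi_def\<close>)
 also have "... = z * SI ?R (%w. 1 / w^2)" by (rule set_integral_mult_right)
 also have "... = 0" unfolding SI_ring_inverse_square' by simp
 finally show ?thesis using M by (simp add: power_mult_distrib)
qed

text \<open>\<open>phi M (w - z) - phi M w\<close> is written as an integral of \<open>psi\<close>
  along a segment and the two integrations are exchanged. The shift inside \<open>psi\<close> costs
  only a thin annulus, on which \<open>psi\<close> is O(R / \<rho>^2).\<close>

lemma SI_phi:
 assumes M: "1 <= M" and z: "norm z <= R" and \<rho>: "2 * R + 4 * M <= \<rho>"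
 shows "norm (SI (cball 0 \<rho>) (%w. phi M (w - z)) + of_real pi * cnj z) <= 128 * R^2 / \<rho>"
proof -
 have R: "0 <= R" using z norm_ge_zero order_trans by blast
 have \<rho>1: "\<rho> \<ge> 1" "R <= \<rho>" "2 * M <= \<rho>" using \<rho> M R by linarith+
 let ?B = "cball (0::complex) \<rho>"
 define k where "k = (%w (t::real). indicator ?B w *\<^sub>R (indicator {0..1} t *\<^sub>R psi M z (w - of_real t * z)))"
 have phib: "norm (phi M w) <= 1" for w :: complex
 proof -
  have "1 / (2*M) <= 1" using M by simp
  thus ?thesis using norm_phi(1)[OF M, of w] by linarith
 qed
 have int1: "set_integrable lborel {0..1::real} (%t. psi M z (w - of_real t * z))" for w
  unfolding set_integrable_def
  by (rule integrableI_bounded_set_indicator[of _ _ _ "norm z"]) (use norm_psi(1)[OF M] in auto)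
 have inner: "(\<integral>t. indicator {0..1} t *\<^sub>R psi M z (w - of_real t * z) \<partial>lborel) = phi M (w - z) - phi M w" for w
  using set_borel_integral_eq_integral(2)[OF int1, of w] integral_unique[OF phi_has_integral[OF M, of z w]]
  by (simp add: set_lebesgue_integral_def)
 have kint: "integrable (lborel \<Otimes>\<^sub>M lborel) (case_prod k)"
 proof (rule integrableI_bounded_set[where A="?B \<times> {0..1}" and B="norm z"])
  show "emeasure (lborel \<Otimes>\<^sub>M lborel) (?B \<times> {0..1::real}) < \<infinity>"
   by (subst lborel.emeasure_pair_measure_Times) (auto simp: ennreal_mult_less_top emeasure_bounded_finite[unfolded infinity_ennreal_def])
  have [measurable]: "cball (0::complex) \<rho> \<in> sets borel" by simp
  have [measurable]: "(%x. psi M z (fst x - of_real (snd x) * z)) \<in> borel_measurable (borel \<Otimes>\<^sub>M (borel :: real measure))"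
   by (rule measurable_compose[OF _ psi_measurable], unfold borel_prod)
    (intro borel_measurable_continuous_onI continuous_intros)
  have "(%x. indicator (cball 0 \<rho>) (fst x) *\<^sub>R (indicator {0..1} (snd x) *\<^sub>R psi M z (fst x - of_real (snd x) * z)))
    \<in> borel_measurable (borel \<Otimes>\<^sub>M (borel :: real measure))" by measurable
  thus "case_prod k \<in> borel_measurable (lborel \<Otimes>\<^sub>M lborel)"
   unfolding k_def case_prod_beta' by (simp cong: measurable_cong_sets sets_pair_measure_cong)
  show "AE x in lborel \<Otimes>\<^sub>M lborel. x \<in> ?B \<times> {0..1} \<longrightarrow> norm (case_prod k x) <= norm z"
   by (intro AE_I2) (auto simp: k_def norm_psi(1)[OF M])
  show "AE x in lborel \<Otimes>\<^sub>M lborel. x \<notin> ?B \<times> {0..1} \<longrightarrow> case_prod k x = 0"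
   by (intro AE_I2) (auto simp: k_def indicator_def)
 qed auto
 define J where "J = (%t::real. SI ?B (%w. psi M z (w - of_real t * z)))"
 have "(\<integral>w. (\<integral>t. k w t \<partial>lborel) \<partial>lborel) = (\<integral>t. (\<integral>w. k w t \<partial>lborel) \<partial>lborel)"
  using lborel_pair.Fubini_integral[OF kint] by simp
 also have "(%t. (\<integral>w. k w t \<partial>lborel)) = (%t. indicator {0..1} t *\<^sub>R J t)"
 proof
  fix t :: real
  show "(\<integral>w. k w t \<partial>lborel) = indicator {0..1} t *\<^sub>R J t"
   by (cases "t \<in> {0..1}") (simp_all add: J_def set_lebesgue_integral_def k_def)
 qed
 also have "(\<integral>w. (\<integral>t. k w t \<partial>lborel) \<partial>lborel) = SI ?B (%w. phi M (w - z) - phi M w)"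
 proof -
  have "(\<integral>t. k w t \<partial>lborel) = indicator ?B w *\<^sub>R (phi M (w - z) - phi M w)" for w
   by (cases "w \<in> ?B") (simp_all add: k_def inner)
  thus ?thesis by (simp add: set_lebesgue_integral_def)
 qed
 finally have eq: "SI ?B (%w. phi M (w - z) - phi M w) = (\<integral>t. indicator {0..1} t *\<^sub>R J t \<partial>lborel)" .
 have intJ: "integrable lborel (%t. indicator {0..1} t *\<^sub>R J t)"
 proof -
  have "integrable lborel (%t. (\<integral>w. k w t \<partial>lborel))" using lborel_pair.integrable_snd[OF kint] by simp
  thus ?thesis unfolding \<open>(%t. (\<integral>w. k w t \<partial>lborel)) = (%t. indicator {0..1} t *\<^sub>R J t)\<close> .
 qed
 have Jb: "norm (J t + of_real pi * cnj z) <= 128 * R^2 / \<rho>" if t: "t \<in> {0..1}" for t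
 proof -
  have tz: "norm (- (of_real t * z)) <= R" using t z mult_mono[of "\<bar>t\<bar>" 1 "norm z" R] by (auto simp: norm_mult)
  have "norm (SI ?B (%w. psi M z (w + (- (of_real t * z)))) - SI ?B (psi M z)) <= 32 * (4 * R / \<rho>^2) * \<rho> * R"
  proof (rule SI_translate_diff[OF psi_measurable norm_psi(1)[OF M] _ tz \<rho>1(2)])
   fix w :: complex assume w: "\<rho> - R <= norm w" "norm w <= \<rho> + R"
   hence w2: "2 * M <= norm w" "\<rho> / 2 <= norm w" using \<rho> M R by linarith+
   have "norm (psi M z w) = norm z / norm w ^ 2" using norm_psi(2)[OF M w2(1)] .
   also have "... <= R / (\<rho>/2)^2" using w2(2) z R \<rho>1 by (intro frac_le power_mono) auto
   finally show "norm (psi M z w) <= 4 * R / \<rho>^2" by (simp add: power_divide mult.commute)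
  qed (use R in auto)
  also have "32 * (4 * R / \<rho>^2) * \<rho> * R = 128 * R^2 / \<rho>" using \<rho>1 by (simp add: power2_eq_square)
  finally show ?thesis using SI_psi[OF M \<rho>1(3), of z] by (simp add: J_def)
 qed
 have c1: "(\<integral>t. indicator {0..1::real} t *\<^sub>R (of_real pi * cnj z) \<partial>lborel) = of_real pi * cnj z"
  by (simp add: scaleR_conv_of_real)
 have i1: "integrable lborel (%t. indicator {0..1::real} t *\<^sub>R (of_real pi * cnj z))"
  by (intro integrableI_bounded_set_indicator[of _ _ _ "norm (of_real pi * cnj z)"]) auto
 have "(\<integral>t. indicator {0..1} t *\<^sub>R J t \<partial>lborel) + of_real pi * cnj z
   = (\<integral>t. indicator {0..1} t *\<^sub>R (J t + of_real pi * cnj z) \<partial>lborel)"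
  using intJ i1 by (subst c1[symmetric], subst Bochner_Integration.integral_add[symmetric]) (auto simp: scaleR_add_right)
 also have "norm ... <= (\<integral>t. norm (indicator {0..1} t *\<^sub>R (J t + of_real pi * cnj z)) \<partial>lborel)"
  by (rule integral_norm_bound)
 also have "... <= (\<integral>t. indicator {0..1::real} t *\<^sub>R (128 * R^2 / \<rho>) \<partial>lborel)"
 proof (rule integral_mono)
  show "integrable lborel (%t. norm (indicator {0..1} t *\<^sub>R (J t + of_real pi * cnj z)))"
   using Bochner_Integration.integrable_add[OF intJ i1] by (intro integrable_norm) (simp add: scaleR_add_right)
  show "integrable lborel (%t. indicator {0..1::real} t *\<^sub>R (128 * R^2 / \<rho>))"
   by (intro integrableI_bounded_set_indicator[of _ _ _ "norm (128 * R^2 / \<rho>)"]) auto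
 qed (use Jb in \<open>auto simp: indicator_def\<close>)
 also have "... = 128 * R^2 / \<rho>" by simp
 finally have fin: "norm ((\<integral>t. indicator {0..1} t *\<^sub>R J t \<partial>lborel) + of_real pi * cnj z) <= 128 * R^2 / \<rho>" .
 have "SI ?B (%w. phi M (w - z) - phi M w) = SI ?B (%w. phi M (w - z)) - SI ?B (phi M)"
  using phib by (intro set_integral_diff SI_integrable[of _ _ 1]) auto
 also have "SI ?B (phi M) = 0" by (rule SI_odd) (auto simp: phi_minus)
 finally have "SI ?B (%w. phi M (w - z) - phi M w) = SI ?B (%w. phi M (w - z))" by simp
 thus ?thesis using fin eq by simp
qed

text \<open>\<open>kap\<close> differs from \<open>d * phi\<close> by an odd function of cubic
  decay: its integral over a centred disc is 0, and the translation error tends to 0.\<close>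

lemma SI_kap:
 assumes M: "1 <= M" "norm d <= M" and z: "norm z <= R" and \<rho>: "2 * R + 4 * M <= \<rho>"
 shows "norm (SI (cball 0 \<rho>) (%w. kap M d (w - z)) + of_real pi * d * cnj z) <= (128 * M * R^2 + 256 * M^3 * R) / \<rho>"
proof -
 have R: "0 <= R" using z norm_ge_zero order_trans by blast
 have \<rho>1: "\<rho> \<ge> 1" "R <= \<rho>" "2 * M <= \<rho>" using \<rho> M R by linarith+
 let ?B = "cball (0::complex) \<rho>"
 define g where "g = (%w. kap M d w - d * phi M w)"
 note [measurable] = kap_measurable[OF M]
 have gm [measurable]: "g \<in> borel_measurable borel" unfolding g_def by measurable
 have phib: "norm (phi M w) <= 1" for w :: complex
 proof -
  have "1 / (2*M) <= 1" using M by simp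
  thus ?thesis using norm_phi(1)[OF M(1), of w] by linarith
 qed
 have gb: "norm (g w) <= M^3 * norm (phi M w)^3" for w :: complex unfolding g_def by (rule kap_approx_phi[OF M])
 have gb1: "norm (g w) <= M^3" for w :: complex
 proof -
  have "M^3 * norm (phi M w)^3 <= M^3 * 1" using phib[of w] M by (intro mult_left_mono power_le_one) auto
  thus ?thesis using gb[of w] by linarith
 qed
 have g0: "SI ?B g = 0" by (rule SI_odd) (auto simp: g_def kap_minus phi_minus)
 have "norm (SI ?B (%w. g (w + (- z))) - SI ?B g) <= 32 * (8 * M^3 / \<rho>^3) * \<rho> * R"
 proof (rule SI_translate_diff[OF gm gb1 _ _ \<rho>1(2)])
  fix w :: complex assume w: "\<rho> - R <= norm w" "norm w <= \<rho> + R"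
  hence w2: "2 * M <= norm w" "\<rho> / 2 <= norm w" using \<rho> M R by linarith+
  have "norm (phi M w) = 1 / norm w" using w2 M by (simp add: phi_far norm_divide)
  also have "... <= 1 / (\<rho>/2)" using w2 \<rho>1 by (intro divide_left_mono mult_pos_pos) auto
  finally have "norm (phi M w)^3 <= (1 / (\<rho>/2))^3" by (intro power_mono) auto
  hence "M^3 * norm (phi M w)^3 <= M^3 * (1 / (\<rho>/2))^3" using M by (intro mult_left_mono) auto
  thus "norm (g w) <= 8 * M^3 / \<rho>^3" using gb[of w] by (simp add: power_divide mult_ac)
 qed (use z M \<rho>1 in auto)
 also have "32 * (8 * M^3 / \<rho>^3) * \<rho> * R = 256 * M^3 * R / \<rho>^2" using \<rho>1 by (simp add: power2_eq_square power3_eq_cube)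
 also have "... <= 256 * M^3 * R / \<rho>" using \<rho>1 M R by (intro divide_left_mono) (auto simp: power2_eq_square)
 finally have 1: "norm (SI ?B (%w. g (w - z))) <= 256 * M^3 * R / \<rho>" using g0 by simp
 have "SI ?B (%w. kap M d (w - z)) = SI ?B (%w. g (w - z) + d * phi M (w - z))" by (simp add: g_def)
 also have "... = SI ?B (%w. g (w - z)) + SI ?B (%w. d * phi M (w - z))"
 proof (intro set_integral_add)
  show "set_integrable lborel ?B (%w. g (w - z))" using gb1 by (intro SI_integrable[of _ _ "M^3"]) auto
  have "norm (d * phi M (w - z)) <= M * 1" for w unfolding norm_mult using M phib by (intro mult_mono) auto
  thus "set_integrable lborel ?B (%w. d * phi M (w - z))" by (intro SI_integrable[of _ _ "M * 1"]) auto
 qed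
 also have "SI ?B (%w. d * phi M (w - z)) = d * SI ?B (%w. phi M (w - z))" by simp
 finally have "SI ?B (%w. kap M d (w - z)) + of_real pi * d * cnj z
   = SI ?B (%w. g (w - z)) + d * (SI ?B (%w. phi M (w - z)) + of_real pi * cnj z)" by (simp add: algebra_simps)
 also have "norm ... <= 256 * M^3 * R / \<rho> + M * (128 * R^2 / \<rho>)"
 proof (rule order_trans[OF norm_triangle_ineq add_mono[OF 1]])
  show "norm (d * (SI ?B (%w. phi M (w - z)) + of_real pi * cnj z)) <= M * (128 * R^2 / \<rho>)"
   unfolding norm_mult[of d] using M SI_phi[OF M(1) z \<rho>] by (intro mult_mono) auto
 qed
 finally show ?thesis by (simp add: add_divide_distrib mult_ac)
qed

subsection \<open>Sums over two large discs with different centres\<close>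

text \<open>For two discs with the same kernel only the two lunes count. Their width is about |z|,
  so squares of side max 1 |z| are used; the discrepancy then stays below 512 C independently of
  \<open>z\<close>, and all other errors are made small by taking \<open>r\<close> large in terms of
  \<open>z\<close>. The main term is the Cauchy transform of the disc about 0.\<close>

lemma lune_sum:
 assumes p: "pairs c d M N" and D: "dens c d \<gamma> C"
 shows "eventually (%r. norm ((\<Sum>n\<in>{n. norm (c n - z) <= r}. kap M (d n) (c n - z)) - (\<Sum>n\<in>{n. norm (c n) <= r}. kap M (d n) (c n - z))
   - \<gamma> * of_real pi * cnj z) <= 512 * C + 3) at_top"
proof -
 note M = pairsD(1)[OF p] and N = pairsD(2)[OF p] and dM = pairsD(3)[OF p]
 define s where "s = max 1 (norm z)"
 have s: "1 <= s" "norm z <= s" by (auto simp: s_def)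
 define Q where "Q = 100 * M * N + norm \<gamma>"
 have Q0: "0 <= Q" using M N by (simp add: Q_def)
 \<comment> \<open>The first two summands are geometric. The other three bound the oscillation by 1,
   each of the two kernel errors by 1/2, and the error of the integral by 1.\<close>
 have ev: "eventually (%r. r \<ge> 10 * s + 8 * M + 512 * Q * s^2 + 800 * N * M^3 + norm \<gamma> * (128 * s^2)) at_top"
  by (rule eventually_ge_at_top)
 thus ?thesis
 proof eventually_elim
  fix r assume r0: "r \<ge> 10 * s + 8 * M + 512 * Q * s^2 + 800 * N * M^3 + norm \<gamma> * (128 * s^2)"
  have nn: "0 <= 512 * Q * s^2" "0 <= 800 * N * M^3" "0 <= norm \<gamma> * (128 * s^2)" using Q0 M N by auto
  have r: "r \<ge> 10 * s" "r \<ge> 8 * M" "r \<ge> 512 * Q * s^2" "r \<ge> 800 * N * M^3" "r \<ge> norm \<gamma> * (128 * s^2)" "r \<ge> 10 * s + 8 * M"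
   using r0 nn s M by linarith+
  have rpos: "r > 0" using r s by linarith
  let ?B1 = "cball z r" and ?B2 = "cball (0::complex) r"
  define g where "g = (%w. 1 / (w - z))"
  have lune: "r - s <= norm w \<and> norm w <= r + s \<and> r - s <= norm (w - z)" if "w \<in> (?B1 - ?B2) \<union> (?B2 - ?B1)" for w
  proof -
   have "(norm (w - z) <= r \<and> r < norm w) \<or> (norm w <= r \<and> r < norm (w - z))"
    using that by (auto simp: dist_norm norm_minus_commute not_le)
   moreover have "norm w <= norm (w - z) + norm z" "norm (w - z) <= norm w + norm z"
    using norm_triangle_ineq[of "w - z" z] norm_triangle_ineq4[of w z] by auto
   ultimately show ?thesis using s by auto
  qed
  define U where "U = {w::complex. r - 4 * s <= norm w \<and> norm w <= r + 4 * s}"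
  note ann = measure_annulus[of "4 * s" r, folded U_def]
  have UA: "measure lborel U <= 64 * r * s" "U \<in> sets borel" "bounded U" using ann s r by auto
  have est: "norm ((\<Sum>n\<in>{n. c n \<in> ?B1 - ?B2}. d n * g (c n)) - (\<Sum>n\<in>{n. c n \<in> ?B2 - ?B1}. d n * g (c n))
   - \<gamma> * (SI (?B1 - ?B2) g - SI (?B2 - ?B1) g))
   <= measure lborel U * (4 * C * (2/r) / s + (100 * M * N + norm \<gamma>) * (8 * s / r^2))"
  proof (rule average_estimate[OF p D])
   show "g \<in> borel_measurable borel" unfolding g_def by measurable
   show "emeasure lborel U < \<infinity>" using UA(3) by (rule emeasure_bounded_finite)
   show gu: "norm (g u) <= 2 / r" if "u \<in> U" for u
   proof -
    have "r / 2 <= norm (u - z)" using that norm_triangle_ineq2[of u z] s r unfolding U_def by auto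
    hence "1 / norm (u - z) <= 1 / (r/2)" using rpos by (intro divide_left_mono mult_pos_pos) auto
    thus ?thesis by (simp add: g_def norm_divide)
   qed
   fix u w assume w: "w \<in> sq s u" "w \<in> (?B1 - ?B2) \<union> (?B2 - ?B1)"
   have wu: "norm (w - u) <= 2 * s" by (rule sq_dist[OF w(1)])
   have uU: "u \<in> U" using lune[OF w(2)] wu norm_triangle_ineq2[of w u] norm_triangle_ineq2[of u w] s
    unfolding U_def by (auto simp: norm_minus_commute)
   have uz: "r / 2 <= norm (u - z)" using uU norm_triangle_ineq2[of u z] s r unfolding U_def by auto
   have wz: "r / 2 <= norm (w - z)" using lune[OF w(2)] s r by auto
   have nz: "u - z ~= 0" "w - z ~= 0" using uz wz rpos by auto
   have "g w - g u = (u - w) / ((w - z) * (u - z))" unfolding g_def using nz by (simp add: field_simps)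
   hence "norm (g w - g u) = norm (w - u) / (norm (w - z) * norm (u - z))"
    by (simp add: norm_divide norm_mult norm_minus_commute)
   also have "... <= (2 * s) / ((r/2) * (r/2))" using wu uz wz rpos s by (intro frac_le mult_mono) auto
   also have "... = 8 * s / r^2" by (simp add: power2_eq_square)
   finally show "u \<in> U \<and> norm (g w - g u) <= 8 * s / r^2" using uU by simp
  qed (use UA s rpos in auto)
  also have "... <= (64 * r * s) * (4 * C * (2/r) / s + Q * (8 * s / r^2))"
   unfolding Q_def[symmetric] using UA(1) densD(1)[OF D] Q0 s rpos by (intro mult_right_mono) auto
  also have "... = 512 * C + 512 * Q * s^2 / r" using s rpos by (simp add: field_simps power2_eq_square)
  also have "... <= 512 * C + 1" using r rpos by simp
  finally have est: "norm ((\<Sum>n\<in>{n. c n \<in> ?B1 - ?B2}. d n * g (c n)) - (\<Sum>n\<in>{n. c n \<in> ?B2 - ?B1}. d n * g (c n))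
   - \<gamma> * (SI (?B1 - ?B2) g - SI (?B2 - ?B1) g)) <= 512 * C + 1" .
  have SIg: "norm ((SI (?B1 - ?B2) g - SI (?B2 - ?B1) g) - of_real pi * cnj z) <= 128 * s^2 / r"
  proof -
   let ?f = "%w. phi M (w - z)"
   have phib: "norm (phi M w) <= 1" for w :: complex
   proof -
    have "1 / (2*M) <= 1" using M by simp
    thus ?thesis using norm_phi(1)[OF M, of w] by linarith
   qed
   have fg: "g w = ?f w" if "w \<in> (?B1 - ?B2) \<union> (?B2 - ?B1)" for w
    using lune[OF that] r s M unfolding g_def by (subst phi_far) auto
   have "SI (?B1 - ?B2) g = SI (?B1 - ?B2) ?f" "SI (?B2 - ?B1) g = SI (?B2 - ?B1) ?f"
    using fg by (intro set_lebesgue_integral_cong; auto)+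
   hence "SI (?B1 - ?B2) g - SI (?B2 - ?B1) g = SI ?B1 ?f - SI ?B2 ?f"
    using phib by (subst SI_split) (auto intro!: SI_integrable[of _ _ 1])
   also have "SI ?B1 ?f = 0"
   proof -
    have "SI (cball 0 r) (%w. ?f (w + z)) = SI ((%w. w + z) ` cball 0 r) ?f" by (rule SI_shift) auto
    moreover have "(%w. w + z) ` cball 0 r = cball z r"
    using cball_translation[of z 0 r] by (simp add: add.commute)
    moreover have "SI (cball 0 r) (phi M) = 0" by (rule SI_odd) (auto simp: phi_minus)
    ultimately show ?thesis by simp
   qed
   finally have e: "SI (?B1 - ?B2) g - SI (?B2 - ?B1) g = - SI ?B2 ?f" by simp
   have "norm (SI ?B2 ?f + of_real pi * cnj z) <= 128 * s^2 / r"
    by (rule SI_phi[OF M s(2)]) (use r s M in linarith)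
   thus ?thesis unfolding e by (metis minus_add_distrib norm_minus_cancel uminus_add_conv_diff add.commute)
  qed
  define S1 where "S1 = {n. c n \<in> ?B1 - ?B2}"
  define S2 where "S2 = {n. c n \<in> ?B2 - ?B1}"
  have f1: "finite {n. norm (c n - z) <= r}" "finite {n. norm (c n) <= r}"
   using pairs_finite(1)[OF p, of z r] pairs_finite(1)[OF p, of 0 r] by auto
  have S1': "S1 = {n. norm (c n - z) <= r} - {n. norm (c n) <= r}" and S2': "S2 = {n. norm (c n) <= r} - {n. norm (c n - z) <= r}"
   unfolding S1_def S2_def by (auto simp: dist_norm norm_minus_commute)
  have fS: "finite S1" "finite S2" unfolding S1' S2' using f1 by auto
  have errb: "norm ((kapS M c d S z) - (\<Sum>n\<in>S. d n * g (c n))) <= 1/2"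
   if S: "finite S" "!!n. n \<in> S ==> c n \<in> (?B1 - ?B2) \<union> (?B2 - ?B1)" for S
  proof -
   have "(kapS M c d S z) - (\<Sum>n\<in>S. d n * g (c n)) = (\<Sum>n\<in>S. kap M (d n) (c n - z) - d n / (c n - z))"
    by (simp add: sum_subtractf g_def)
   also have "norm ... <= (\<Sum>n\<in>S. M^3 * (1 / norm (c n - z)^3))"
   proof (rule sum_norm_le)
    fix n assume "n \<in> S"
    hence "2 * M <= norm (c n - z)" using lune[OF S(2)] r s M by fastforce
    thus "norm (kap M (d n) (c n - z) - d n / (c n - z)) <= M^3 * (1 / norm (c n - z)^3)"
    using kap_approx[OF M dM] by simp
   qed
   also have "... = M^3 * (\<Sum>n\<in>S. 1 / norm (c n - z)^3)" by (rule sum_distrib_left[symmetric])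
   also have "... <= M^3 * (200 * N / (r/2))"
   proof (intro mult_left_mono pairs_sum_cube[OF p _ S(1)])
    fix n assume "n \<in> S"
    thus "r / 2 <= norm (c n - z)" using lune[OF S(2)] r s by fastforce
   qed (use r s M in auto)
   also have "... <= 1/2" using r(4) rpos by (simp add: field_simps)
   finally show ?thesis .
  qed
  define X where "X = (%S. (kapS M c d S z))"
  have "X {n. norm (c n - z) <= r} - X {n. norm (c n) <= r} = X S1 - X S2"
  proof -
   have "X {n. norm (c n - z) <= r} = X S1 + X ({n. norm (c n - z) <= r} \<inter> {n. norm (c n) <= r})"
    unfolding X_def S1' by (subst sum.Int_Diff[OF f1(1), of _ "{n. norm (c n) <= r}"]) (rule add.commute)
   moreover have "X {n. norm (c n) <= r} = X S2 + X ({n. norm (c n - z) <= r} \<inter> {n. norm (c n) <= r})"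
    unfolding X_def S2' by (subst sum.Int_Diff[OF f1(2), of _ "{n. norm (c n - z) <= r}"], subst Int_commute) (rule add.commute)
   ultimately show ?thesis by simp
  qed
  moreover have "norm (X S1 - X S2 - \<gamma> * of_real pi * cnj z) <= 512 * C + 3"
  proof -
   define G1 where "G1 = (\<Sum>n\<in>S1. d n * g (c n))"
   define G2 where "G2 = (\<Sum>n\<in>S2. d n * g (c n))"
   define I where "I = SI (?B1 - ?B2) g - SI (?B2 - ?B1) g"
   have a: "norm (X S1 - G1) <= 1/2" unfolding X_def G1_def by (rule errb[OF fS(1)]) (auto simp: S1_def)
   have a2: "norm (X S2 - G2) <= 1/2" unfolding X_def G2_def by (rule errb[OF fS(2)]) (auto simp: S2_def)
   have b: "norm (G1 - G2 - \<gamma> * I) <= 512 * C + 1" using est unfolding G1_def G2_def S1_def S2_def I_def .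
   have "norm (\<gamma> * (I - of_real pi * cnj z)) <= norm \<gamma> * (128 * s^2 / r)"
    unfolding norm_mult using SIg unfolding I_def by (intro mult_left_mono) auto
   also have "... <= 1" using r(5) rpos by (simp add: field_simps)
   finally have c: "norm (\<gamma> * (I - of_real pi * cnj z)) <= 1" .
   have "X S1 - X S2 - \<gamma> * of_real pi * cnj z = (X S1 - G1) - (X S2 - G2) + ((G1 - G2 - \<gamma> * I) + \<gamma> * (I - of_real pi * cnj z))"
    by (simp add: algebra_simps)
   also have "norm ... <= norm (X S1 - G1) + norm (X S2 - G2) + (norm (G1 - G2 - \<gamma> * I) + norm (\<gamma> * (I - of_real pi * cnj z)))"
    by (intro norm_triangle_le add_mono norm_triangle_ineq4 norm_triangle_ineq)
   finally show ?thesis using a a2 b c by linarith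
  qed
  ultimately show "norm ((\<Sum>n\<in>{n. norm (c n - z) <= r}. kap M (d n) (c n - z)) - (\<Sum>n\<in>{n. norm (c n) <= r}. kap M (d n) (c n - z))
   - \<gamma> * of_real pi * cnj z) <= 512 * C + 3" by (simp add: X_def)
 qed
qed

subsection \<open>The convergent potential and its almost periodicity\<close>

lemma TT_tendsto:
 assumes p: "pairs c d M N" and D: "dens c d \<gamma> C"
  and S: "!!r. {n. norm (c n) < r} \<subseteq> S r" "!!r. S r \<subseteq> {n. norm (c n) < r + 2}"
 shows "((%r. TS M c d (S r) z) \<longlongrightarrow> TT M c d z) at_top"
proof -
 obtain K r1 where K: "0 <= K" "1 <= r1" "!!c d z' \<rho> S. pairs c d M N ==> dens c d \<gamma> C ==> norm z' <= norm z ==> r1 <= \<rho> ==>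
   {n. norm (c n) < \<rho>} \<subseteq> S ==> S \<subseteq> {n. norm (c n) < \<rho> + 2} ==> norm (TT M c d z' - TS M c d S z') <= K / sqrt \<rho>"
  by (rule TT_approx[OF pairsD(1,2)[OF p] densD(1)[OF D] norm_ge_zero, of \<gamma> z]) blast
 have lim0: "((%r. K / sqrt r) \<longlongrightarrow> 0) at_top"
  by (intro tendsto_divide_0[OF tendsto_const] filterlim_at_top_imp_at_infinity sqrt_at_top)
 show ?thesis
 proof (rule Lim_transform2[OF tendsto_const])
  show "((%r. TT M c d z - TS M c d (S r) z) \<longlongrightarrow> 0) at_top"
  proof (rule Lim_null_comparison[OF _ lim0])
   show "\<forall>\<^sub>F r in at_top. norm (TT M c d z - TS M c d (S r) z) <= K / sqrt r"
    using eventually_ge_at_top[of r1] by eventually_elim (rule K(3)[OF p D order_refl _ S])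
  qed
 qed
qed

lemma TT_0 [simp]: "TT M c d 0 = 0"
 by (simp add: TT_def TS_def)

text \<open>Recentring the discs of summation at \<open>x\<close> affects O(r) indices whose terms
  are O(r^-2), so the limit is unchanged.\<close>

lemma TT_shift:
 assumes p: "pairs c d M N" and D: "dens c d \<gamma> C"
 shows "TT M (%n. c n - x) d z = TT M c d (x + z) - TT M c d x"
proof -
 note M = pairsD(1)[OF p] and N = pairsD(2)[OF p]
 define R where "R = norm z + norm x"
 have R: "0 <= R" "norm z <= R" "norm x <= R" by (auto simp: R_def)
 define q where "q = (%n. kap M (d n) (c n - (x + z)) - kap M (d n) (c n - x))"
 define A where "A = (%r. {n. norm (c n - x) < r})"
 define B where "B = (%r. {n. norm (c n) < r})"
 have fin: "finite (A r)" "finite (B r)" for r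
  using pairs_finite(2)[OF p, of x r] pairs_finite(2)[OF p, of 0 r] by (auto simp: A_def B_def)
 have "((%r. TS M (%n. c n - x) d (A r) z) \<longlongrightarrow> TT M (%n. c n - x) d z) at_top"
  by (rule TT_tendsto[OF pairs_shift[OF p] dens_shift[OF D]]) (auto simp: A_def)
 moreover have "TS M (%n. c n - x) d (A r) z = sum q (A r)" for r by (simp add: TS_def q_def diff_diff_eq)
 ultimately have l1: "((%r. sum q (A r)) \<longlongrightarrow> TT M (%n. c n - x) d z) at_top" by simp
 have "((%r. TS M c d (B r) (x + z) - TS M c d (B r) x) \<longlongrightarrow> TT M c d (x + z) - TT M c d x) at_top"
  by (intro tendsto_diff TT_tendsto[OF p D]) (auto simp: B_def)
 moreover have "TS M c d (B r) (x + z) - TS M c d (B r) x = sum q (B r)" for r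
  by (simp add: TS_def q_def sum_subtractf)
 ultimately have l2: "((%r. sum q (B r)) \<longlongrightarrow> TT M c d (x + z) - TT M c d x) at_top" by simp
 define K where "K = 350 * N * (R+1)^2 * (8 * M * R + 8 * (9 * M^3 + 2 * M * R^2))"
 have "((%r. sum q (A r) - sum q (B r)) \<longlongrightarrow> 0) at_top"
 proof (rule Lim_null_comparison)
  show "((%r. K / r) \<longlongrightarrow> 0) at_top"
   by (intro tendsto_divide_0[OF tendsto_const] filterlim_at_top_imp_at_infinity filterlim_ident)
  show "\<forall>\<^sub>F r in at_top. norm (sum q (A r) - sum q (B r)) <= K / r"
   using eventually_ge_at_top[of "4 * R + 8 * M + 1"]
  proof eventually_elim
   fix r assume r: "4 * R + 8 * M + 1 <= r"
   have r1: "1 <= r" "0 < r" using r R M by linarith+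
   let ?D = "(A r - B r) \<union> (B r - A r)"
   have "sum q (A r) - sum q (B r) = sum q (A r - B r) - sum q (B r - A r)"
    using sum.Int_Diff[OF fin(1), of q r "B r"] sum.Int_Diff[OF fin(2), of q r "A r"] by (simp add: Int_commute)
   hence "norm (sum q (A r) - sum q (B r)) <= norm (sum q (A r - B r)) + norm (sum q (B r - A r))"
    by (simp add: norm_triangle_ineq4)
   also have "... <= (\<Sum>n\<in>A r - B r. norm (q n)) + (\<Sum>n\<in>B r - A r. norm (q n))"
    by (intro add_mono norm_sum)
   also have "... = (\<Sum>n\<in>?D. norm (q n))" using fin by (intro sum.union_disjoint[symmetric]) auto
   also have "... <= (\<Sum>n\<in>?D. (8 * M * R + 8 * (9 * M^3 + 2 * M * R^2)) / r^2)"
   proof (rule sum_mono)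
    fix n assume n: "n \<in> ?D"
    have "r / 2 <= norm (c n - x)"
    using n norm_triangle_ineq2[of "c n" x] R r r1 M by (auto simp: A_def B_def)
    hence cx: "r/2 <= norm (c n - x)" "2 * norm z + 4 * M <= norm (c n - x)" using r R by linarith+
    have e: "norm (q n - d n * z * (1 / (c n - x)^2)) <= (9 * M^3 + 2 * M * norm z ^ 2) * (1 / norm (c n - x) ^ 3)"
    using kap_expand[OF M pairsD(3)[OF p] cx(2), of n] by (simp add: q_def diff_diff_eq)
    have i3: "1 / norm (c n - x) ^ 3 <= 8 / r^2"
    proof -
    have "1 / norm (c n - x) ^ 3 <= 1 / (r/2)^3" using cx(1) r1 by (intro divide_left_mono power_mono mult_pos_pos zero_less_power) auto
    also have "... = 8 / (r^2 * r)" by (simp add: power_divide power3_eq_cube power2_eq_square)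
    also have "... <= 8 / (r^2 * 1)" using r1 by (intro divide_left_mono mult_left_mono) auto
    finally show ?thesis by simp
    qed
    have i2: "1 / norm (c n - x) ^ 2 <= 8 / r^2"
    proof -
    have "1 / norm (c n - x) ^ 2 <= 1 / (r/2)^2" using cx(1) r1 by (intro divide_left_mono power_mono mult_pos_pos zero_less_power) auto
    also have "... <= 8 / r^2" using r1 by (simp add: power_divide divide_right_mono)
    finally show ?thesis .
    qed
    have "norm (d n * z * (1 / (c n - x)^2)) = norm (d n) * norm z * (1 / norm (c n - x)^2)"
    by (simp add: norm_mult norm_divide norm_power)
    also have "... <= M * R * (8 / r^2)" using i2 pairsD(3)[OF p] R M by (intro mult_mono) auto
    finally have 2: "norm (d n * z * (1 / (c n - x)^2)) <= M * R * (8 / r^2)" .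
    have "(9 * M^3 + 2 * M * norm z ^ 2) * (1 / norm (c n - x) ^ 3) <= (9 * M^3 + 2 * M * R^2) * (8 / r^2)"
    using i3 R M by (intro mult_mono add_left_mono mult_left_mono power_mono) auto
    hence "norm (q n) <= (9 * M^3 + 2 * M * R^2) * (8 / r^2) + M * R * (8 / r^2)"
    using e 2 norm_triangle_ineq[of "q n - d n * z * (1 / (c n - x)^2)" "d n * z * (1 / (c n - x)^2)"] by simp
    thus "norm (q n) <= (8 * M * R + 8 * (9 * M^3 + 2 * M * R^2)) / r^2"
    by (simp add: add_divide_distrib algebra_simps)
   qed
   also have "... = real (card ?D) * ((8 * M * R + 8 * (9 * M^3 + 2 * M * R^2)) / r^2)" by simp
   also have "... <= (350 * N * (R+1)^2 * r) * ((8 * M * R + 8 * (9 * M^3 + 2 * M * R^2)) / r^2)"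
   proof (rule mult_right_mono)
    show "real (card ?D) <= 350 * N * (R+1)^2 * r"
    proof (rule pairs_count_frontier(2)[OF p convex_cball order_refl r1(1) R(1)])
    fix n assume n: "n \<in> ?D"
    have "c n ~= 0"
    proof
    assume c0: "c n = 0"
    have "norm (c n) < r" unfolding c0 using r1(2) by simp
    moreover have "norm (c n - x) < r"
    proof -
    have "norm x < r" using R r M by linarith
    thus ?thesis unfolding c0 by simp
    qed
    ultimately show False using n by (simp add: A_def B_def)
    qed
    moreover have "\<bar>norm (c n) - r\<bar> <= R"
    proof -
    have "\<bar>norm (c n) - norm (c n - x)\<bar> <= R"
    using norm_triangle_ineq3[of "c n" "c n - x"] R(3) by simp
    thus ?thesis using n unfolding A_def B_def by (auto simp: abs_le_iff not_less)
    qed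
    ultimately have cn: "\<bar>norm (c n) - r\<bar> <= R" "c n ~= 0" by auto
    define y where "y = (r / norm (c n)) *\<^sub>R c n"
    have "norm y = r" using cn r1 by (simp add: y_def)
    moreover have "c n - y = ((norm (c n) - r) / norm (c n)) *\<^sub>R c n"
    using cn by (simp add: y_def diff_divide_distrib scaleR_diff_left)
    hence "norm (c n - y) = \<bar>norm (c n) - r\<bar>" using cn by simp
    ultimately show "\<exists>p\<in>frontier (cball 0 r). norm (c n - p) <= R" using cn r1
    by (intro bexI[of _ y]) (auto simp: frontier_cball)
    qed
   qed (use M R in auto)
   also have "... = K / r" using r1 by (simp add: K_def power2_eq_square)
   finally show "norm (sum q (A r) - sum q (B r)) <= K / r" .
  qed
 qed
 hence "((%r. sum q (A r)) \<longlongrightarrow> TT M c d (x + z) - TT M c d x) at_top"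
  by (rule Lim_transform[OF l2])
 with l1 show ?thesis by (rule tendsto_unique[OF trivial_limit_at_top_linorder])
qed

text \<open>Kernels with \<open>norm (c n - w) >= 2 * M + 2\<close> are holomorphic on the disc of
  radius 2 about \<open>w\<close>; the nearer ones all belong to \<open>F\<close> and are removed.
  The rest is a locally uniform limit of holomorphic functions.\<close>

lemma TT_holomorphic:
 assumes p: "pairs c d M N" and D: "dens c d \<gamma> C" and F: "finite F" "{n. norm (c n - w) < 2 * M + 2} \<subseteq> F"
 shows "(%z. TT M c d z - (kapS M c d F z)) holomorphic_on ball w 2"
proof -
 note M = pairsD(1)[OF p]
 obtain K r1 where K: "0 <= K" "1 <= r1" "!!c d z \<rho> S. pairs c d M N ==> dens c d \<gamma> C ==> norm z <= norm w + 2 ==> r1 <= \<rho> ==>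
   {n. norm (c n) < \<rho>} \<subseteq> S ==> S \<subseteq> {n. norm (c n) < \<rho> + 2} ==> norm (TT M c d z - TS M c d S z) <= K / sqrt \<rho>"
  by (rule TT_approx[OF pairsD(1,2)[OF p] densD(1)[OF D], of "norm w + 2" \<gamma>]) auto
 define k0 where "k0 = Max (insert 1 ((%n. norm (c n)) ` F))"
 have k0: "norm (c n) <= k0" if "n \<in> F" for n using that F(1) by (auto simp: k0_def)
 have k01: "1 <= k0" using F(1) by (auto simp: k0_def)
 define B where "B = (%k::nat. {n. norm (c n) < real k + k0 + 1})"
 have fB: "finite (B k)" for k using pairs_finite(2)[OF p, of 0] by (simp add: B_def)
 have FB: "F \<subseteq> B k" for k using k0 by (force simp: B_def)
 define h where "h = (%k z. TS M c d (B k) z - (kapS M c d F z))"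
 show ?thesis
 proof (rule holomorphic_uniform_sequence)
  fix k
  have "h k = (%z. (\<Sum>n\<in>B k - F. kap M (d n) (c n - z)) - (\<Sum>n\<in>B k. kap M (d n) (c n)))"
   by (rule ext) (simp add: h_def TS_def sum_subtractf sum_diff[OF fB FB])
  moreover have "(%z. (\<Sum>n\<in>B k - F. kap M (d n) (c n - z)) - (\<Sum>n\<in>B k. kap M (d n) (c n))) holomorphic_on ball w 2"
  proof (intro holomorphic_intros holomorphic_kap M pairsD(3)[OF p])
   fix n z assume n: "n \<in> B k - F" "z \<in> ball w 2"
   hence "2 * M + 2 <= norm (c n - w)" using F(2) by force
   thus "2 * M < norm (c n - z)" using n(2) norm_triangle_ineq2[of "c n - w" "z - w"]
    by (auto simp: dist_norm norm_minus_commute)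
  qed
  ultimately show "h k holomorphic_on ball w 2" by simp
 next
  fix x assume "x \<in> ball w 2"
  then obtain e where e: "e > 0" "cball x e \<subseteq> ball w 2" using open_contains_cball by (metis open_ball)
  have "uniform_limit (cball x e) h (%z. TT M c d z - (kapS M c d F z)) sequentially"
   unfolding uniform_limit_iff
  proof (intro allI impI)
   fix \<epsilon> :: real assume "\<epsilon> > 0"
   have lim0: "((%r. K / sqrt r) \<longlongrightarrow> 0) at_top"
    by (intro tendsto_divide_0[OF tendsto_const] filterlim_at_top_imp_at_infinity sqrt_at_top)
   have "eventually (%r. K / sqrt r < \<epsilon> \<and> r1 <= r) at_top"
    by (intro eventually_conj order_tendstoD(2)[OF lim0 \<open>\<epsilon> > 0\<close>] eventually_ge_at_top)
   moreover have "filterlim (%k. real k + (k0 + 1)) at_top sequentially"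
    by (rule filterlim_at_top_mono[OF filterlim_real_sequentially]) (use k01 in auto)
   ultimately have "eventually (%k. K / sqrt (real k + (k0 + 1)) < \<epsilon> \<and> r1 <= real k + (k0 + 1)) sequentially"
    unfolding filterlim_iff by blast
   thus "\<forall>\<^sub>F k in sequentially. \<forall>z\<in>cball x e. dist (h k z) (TT M c d z - (kapS M c d F z)) < \<epsilon>"
   proof eventually_elim
    fix k assume k: "K / sqrt (real k + (k0 + 1)) < \<epsilon> \<and> r1 <= real k + (k0 + 1)"
    show "\<forall>z\<in>cball x e. dist (h k z) (TT M c d z - (kapS M c d F z)) < \<epsilon>"
    proof
    fix z assume "z \<in> cball x e"
    hence "z \<in> ball w 2" using e by blast
    hence z: "norm z <= norm w + 2" using norm_triangle_ineq2[of z w] by (auto simp: dist_norm norm_minus_commute)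
    have "norm (TT M c d z - TS M c d (B k) z) <= K / sqrt (real k + (k0 + 1))"
    by (rule K(3)[OF p D z]) (use k in \<open>auto simp: B_def add.assoc\<close>)
    thus "dist (h k z) (TT M c d z - (kapS M c d F z)) < \<epsilon>"
    using k by (simp add: h_def dist_norm norm_minus_commute)
    qed
   qed
  qed
  thus "\<exists>e>0. cball x e \<subseteq> ball w 2 \<and> uniform_limit (cball x e) h (%z. TT M c d z - (kapS M c d F z)) sequentially"
   using e by (intro exI[of _ e]) auto
 qed simp
qed

text \<open>The conjugate-linear term is the effect of moving the centre of summation found in
  \<open>lune_sum\<close>; with it, \<open>Phi\<close> equals the difference of the integrals in (c)
  up to a bounded error.\<close>

definition Phi :: "real => (nat => complex) => (nat => complex) => complex => complex => complex" where
 "Phi M c d \<gamma> z = TT M c d z + \<gamma> * of_real pi * cnj z"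

definition shift_int :: "(nat => complex) => (nat => complex) => complex => real => complex" where
 "shift_int c d z r = (\<Sum>n\<in>{n. 1 <= norm (c n - z) \<and> norm (c n - z) <= r}. d n / (c n - z))"

text \<open>Within distance 2M both kinds of terms are bounded and boundedly many; beyond it they
  differ by a cubic error. The bound involves neither \<open>z\<close> nor \<open>r\<close>.\<close>

lemma shift_int_kap:
 assumes p: "pairs c d M N" and r: "r \<ge> 1"
 shows "norm ((\<Sum>n\<in>{n. norm (c n - z) <= r}. kap M (d n) (c n - z)) - shift_int c d z r) <= 100 * N * M^2 * (1 + M) + 200 * N * M^3"
proof -
 note M = pairsD(1)[OF p] and N = pairsD(2)[OF p] and dM = pairsD(3)[OF p]
 define t where "t = (%n. kap M (d n) (c n - z) - (if 1 <= norm (c n - z) then d n / (c n - z) else 0))"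
 let ?S = "{n. norm (c n - z) <= r}"
 have fS: "finite ?S" using pairs_finite(1)[OF p] .
 have "shift_int c d z r = (\<Sum>n\<in>{n\<in>?S. 1 <= norm (c n - z)}. d n / (c n - z))"
  unfolding shift_int_def by (intro sum.cong) auto
 also have "... = (\<Sum>n\<in>?S. if 1 <= norm (c n - z) then d n / (c n - z) else 0)" by (rule sum.inter_filter[OF fS])
 finally have "(\<Sum>n\<in>?S. kap M (d n) (c n - z)) - shift_int c d z r = sum t ?S" by (simp add: t_def sum_subtractf)
 also have "... = sum t (?S \<inter> {n. norm (c n - z) < 2 * M}) + sum t (?S - {n. norm (c n - z) < 2 * M})"
  by (rule sum.Int_Diff[OF fS])
 finally have "norm ((\<Sum>n\<in>?S. kap M (d n) (c n - z)) - shift_int c d z r) <=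
   norm (sum t (?S \<inter> {n. norm (c n - z) < 2 * M})) + norm (sum t (?S - {n. norm (c n - z) < 2 * M}))"
  by (simp add: norm_triangle_ineq)
 moreover have "norm (sum t (?S \<inter> {n. norm (c n - z) < 2 * M})) <= 100 * N * M^2 * (1 + M)"
 proof -
  have "norm (sum t (?S \<inter> {n. norm (c n - z) < 2 * M})) <= (\<Sum>n\<in>?S \<inter> {n. norm (c n - z) < 2 * M}. 1 + M)"
  proof (rule sum_norm_le)
   fix n
   have "norm (if 1 <= norm (c n - z) then d n / (c n - z) else 0) <= M"
   proof (cases "1 <= norm (c n - z)")
    case True
    hence "norm (d n) / norm (c n - z) <= M / 1" using dM M by (intro frac_le) auto
    thus ?thesis using True by (simp add: norm_divide)
   qed (use M in auto)
   thus "norm (t n) <= 1 + M" using norm_kap_le[OF M dM, of n "c n - z"]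
    norm_triangle_ineq4[of "kap M (d n) (c n - z)" "(if 1 <= norm (c n - z) then d n / (c n - z) else 0)"]
    unfolding t_def by linarith
  qed
  also have "... = real (card (?S \<inter> {n. norm (c n - z) < 2 * M})) * (1 + M)" by simp
  also have "... <= (25 * N * (2 * M)^2) * (1 + M)"
   using M by (intro mult_right_mono pairs_count(2)[OF p, of _ _ z]) auto
  finally show ?thesis by (simp add: power_mult_distrib)
 qed
 moreover have "norm (sum t (?S - {n. norm (c n - z) < 2 * M})) <= 200 * N * M^3"
 proof -
  have "norm (sum t (?S - {n. norm (c n - z) < 2 * M})) <= (\<Sum>n\<in>?S - {n. norm (c n - z) < 2 * M}. M^3 * (1 / norm (c n - z)^3))"
  proof (rule sum_norm_le)
   fix n assume "n \<in> ?S - {n. norm (c n - z) < 2 * M}"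
   hence n: "2 * M <= norm (c n - z)" "1 <= norm (c n - z)" using M by auto
   thus "norm (t n) <= M^3 * (1 / norm (c n - z)^3)" using kap_approx[OF M dM n(1)] by (simp add: t_def)
  qed
  also have "... = M^3 * (\<Sum>n\<in>?S - {n. norm (c n - z) < 2 * M}. 1 / norm (c n - z)^3)" by (rule sum_distrib_left[symmetric])
  also have "... <= M^3 * (200 * N / 1)"
   using M fS by (intro mult_left_mono pairs_sum_cube[OF p]) auto
  finally show ?thesis by (simp add: mult_ac)
 qed
 ultimately show ?thesis by linarith
qed

lemma shift_int_Phi:
 assumes p: "pairs c d M N" and D: "dens c d \<gamma> C"
 obtains B where "!!z. eventually (%r. norm (shift_int c d z r - shift_int c d 0 r - Phi M c d \<gamma> z) <= B) at_top"
proof -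
 define A where "A = 100 * N * M^2 * (1 + M) + 200 * N * M^3"
 have "eventually (%r. norm (shift_int c d z r - shift_int c d 0 r - Phi M c d \<gamma> z) <= 2 * A + (512 * C + 3) + 1) at_top" for z
 proof -
  have "((%r. TS M c d {n. norm (c n) <= r} z) \<longlongrightarrow> TT M c d z) at_top"
   by (rule TT_tendsto[OF p D]) auto
  hence "eventually (%r. dist (TS M c d {n. norm (c n) <= r} z) (TT M c d z) < 1) at_top"
   by (rule tendstoD) simp
  thus ?thesis using lune_sum[OF p D, of z] eventually_ge_at_top[of 1]
  proof eventually_elim
   fix r assume 1: "dist (TS M c d {n. norm (c n) <= r} z) (TT M c d z) < 1"
    and 2: "norm ((\<Sum>n\<in>{n. norm (c n - z) <= r}. kap M (d n) (c n - z)) - (\<Sum>n\<in>{n. norm (c n) <= r}. kap M (d n) (c n - z))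
   - \<gamma> * of_real pi * cnj z) <= 512 * C + 3" and r: "1 <= r"
   define X where "X = (\<Sum>n\<in>{n. norm (c n - z) <= r}. kap M (d n) (c n - z))"
   define Y where "Y = (\<Sum>n\<in>{n. norm (c n) <= r}. kap M (d n) (c n))"
   define W where "W = (\<Sum>n\<in>{n. norm (c n) <= r}. kap M (d n) (c n - z))"
   have 3: "norm (X - shift_int c d z r) <= A" unfolding X_def A_def by (rule shift_int_kap[OF p r])
   have 4: "norm (Y - shift_int c d 0 r) <= A" using shift_int_kap[OF p r, of 0] unfolding Y_def A_def by simp
   have T: "TS M c d {n. norm (c n) <= r} z = W - Y" by (simp add: TS_def W_def Y_def sum_subtractf)
   \<comment> \<open>\<open>X - W\<close> compares the two discs for the kernel at \<open>z\<close>;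
     \<open>W - Y\<close> compares the kernels at \<open>z\<close> and at 0 on the disc about
     0.\<close>
   have "shift_int c d z r - shift_int c d 0 r - Phi M c d \<gamma> z =
    (Y - shift_int c d 0 r) - (X - shift_int c d z r) + ((X - W - \<gamma> * of_real pi * cnj z) + ((W - Y) - TT M c d z))"
    by (simp add: Phi_def algebra_simps)
   also have "norm ... <= norm (Y - shift_int c d 0 r) + norm (X - shift_int c d z r) + (norm (X - W - \<gamma> * of_real pi * cnj z) + norm ((W - Y) - TT M c d z))"
    by (intro norm_triangle_le add_mono norm_triangle_ineq4 norm_triangle_ineq)
   also have "... <= 2 * A + (512 * C + 3) + 1"
    using 1 2 3 4 unfolding T dist_norm X_def[symmetric] W_def[symmetric] by linarith
   finally show "norm (shift_int c d z r - shift_int c d 0 r - Phi M c d \<gamma> z) <= 2 * A + (512 * C + 3) + 1" .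
  qed
 qed
 thus thesis by (rule that)
qed

section \<open>Almost periods of the family of pairs and near invariance of the potential\<close>

definition ap :: "(nat => complex) => (nat => complex) => real => complex => bool" where
 "ap c d \<delta> \<tau> \<longleftrightarrow> (\<exists>\<sigma>. bij \<sigma> \<and> (\<forall>n. norm (c n + \<tau> - c (\<sigma> n)) < \<delta> \<and> norm (d n - d (\<sigma> n)) < \<delta>))"

lemma ap_mono: "ap c d \<delta> \<tau> ==> \<delta> <= \<delta>' ==> ap c d \<delta>' \<tau>"
 unfolding ap_def by (meson less_le_trans)

lemma ap_add:
 assumes "ap c d \<delta> \<tau>" "ap c d \<delta>' \<tau>'" shows "ap c d (\<delta> + \<delta>') (\<tau> + \<tau>')"
proof -
 obtain \<sigma> \<sigma>' where s: "bij \<sigma>" "bij \<sigma>'" "!!n. norm (c n + \<tau> - c (\<sigma> n)) < \<delta>" "!!n. norm (d n - d (\<sigma> n)) < \<delta>"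
  "!!n. norm (c n + \<tau>' - c (\<sigma>' n)) < \<delta>'" "!!n. norm (d n - d (\<sigma>' n)) < \<delta>'"
  using assms unfolding ap_def by metis
 have "norm (c n + (\<tau> + \<tau>') - c ((\<sigma>' \<circ> \<sigma>) n)) < \<delta> + \<delta>'" for n
  using s(3)[of n] s(5)[of "\<sigma> n"] norm_triangle_ineq[of "c n + \<tau> - c (\<sigma> n)" "c (\<sigma> n) + \<tau>' - c (\<sigma>' (\<sigma> n))"]
  by (simp add: algebra_simps)
 moreover have "norm (d n - d ((\<sigma>' \<circ> \<sigma>) n)) < \<delta> + \<delta>'" for n
  using s(4)[of n] s(6)[of "\<sigma> n"] norm_triangle_ineq[of "d n - d (\<sigma> n)" "d (\<sigma> n) - d (\<sigma>' (\<sigma> n))"] by simp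
 ultimately show ?thesis unfolding ap_def using bij_comp[OF s(1,2)] by blast
qed

lemma ap_minus:
 assumes "ap c d \<delta> \<tau>" shows "ap c d \<delta> (- \<tau>)"
proof -
 obtain \<sigma> where s: "bij \<sigma>" "!!n. norm (c n + \<tau> - c (\<sigma> n)) < \<delta>" "!!n. norm (d n - d (\<sigma> n)) < \<delta>"
  using assms unfolding ap_def by metis
 have i: "\<sigma> (inv \<sigma> n) = n" for n using s(1) by (simp add: bij_is_surj surj_f_inv_f)
 have "norm (c n + (- \<tau>) - c (inv \<sigma> n)) < \<delta> \<and> norm (d n - d (inv \<sigma> n)) < \<delta>" for n
 proof -
  have e: "c n + (- \<tau>) - c (inv \<sigma> n) = - (c (inv \<sigma> n) + \<tau> - c n)" by simp
  show ?thesis unfolding e norm_minus_cancel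
   using s(2)[of "inv \<sigma> n"] s(3)[of "inv \<sigma> n"] i[of n] by (simp add: norm_minus_commute)
 qed
 thus ?thesis unfolding ap_def using bij_imp_bij_inv[OF s(1)] by blast
qed

text \<open>Up to a tail that is uniform over translates, an increment of \<open>TT\<close> over a
  bounded step is a finite kernel sum. The permutation \<sigma> matches the terms at x + \<tau> with
  those at x, and since \<delta> <= 1 the image of \<open>S\<close> lies between the discs of radii
  r and r + 2, as \<open>TT_approx\<close> permits.\<close>

lemma TT_almost_invariant:
 assumes MN: "pairs c d M N" "dens c d \<gamma> C" and R: "0 <= R" and \<eta>: "0 < \<eta>"
 obtains \<delta> where "0 < \<delta>" "!!\<tau> x z. ap c d \<delta> \<tau> ==> norm z <= R ==>
   norm ((TT M c d (x + \<tau> + z) - TT M c d (x + \<tau>)) - (TT M c d (x + z) - TT M c d x)) <= \<eta>"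
proof -
 note p = MN(1) and D = MN(2)
 note M = pairsD(1)[OF p] and N = pairsD(2)[OF p] and dM = pairsD(3)[OF p]
 obtain K r1 where K: "0 <= K" "1 <= r1" "!!c d z \<rho> S. pairs c d M N ==> dens c d \<gamma> C ==> norm z <= R ==> r1 <= \<rho> ==>
   {n. norm (c n) < \<rho>} \<subseteq> S ==> S \<subseteq> {n. norm (c n) < \<rho> + 2} ==> norm (TT M c d z - TS M c d S z) <= K / sqrt \<rho>"
  by (rule TT_approx[OF M N densD(1)[OF D] R, of \<gamma>]) blast
 have lim0: "((%r. K / sqrt r) \<longlongrightarrow> 0) at_top"
  by (intro tendsto_divide_0[OF tendsto_const] filterlim_at_top_imp_at_infinity sqrt_at_top)
 have "eventually (%r. K / sqrt r < \<eta>/3 \<and> r1 <= r) at_top"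
  by (intro eventually_conj order_tendstoD(2)[OF lim0] eventually_ge_at_top) (use \<eta> in auto)
 then obtain r where r: "K / sqrt r < \<eta>/3" "r1 <= r" using eventually_happens'[OF trivial_limit_at_top_linorder] by blast
 have r1: "1 <= r" using r K by linarith
 define \<delta> where "\<delta> = min 1 (\<eta> / (3 * (25 * N * (r+1)^2) * 8))"
 have den: "0 < 3 * (25 * N * (r+1)^2) * 8" using N r1 by auto
 have d1: "0 < \<delta>" "\<delta> <= 1" using \<eta> den by (auto simp: \<delta>_def)
 have d2: "25 * N * (r+1)^2 * (8 * \<delta>) <= \<eta>/3"
 proof -
  have "\<delta> <= \<eta> / (3 * (25 * N * (r+1)^2) * 8)" by (simp add: \<delta>_def)
  hence "\<delta> * (3 * (25 * N * (r+1)^2) * 8) <= \<eta>" using den by (simp add: pos_le_divide_eq)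
  thus ?thesis by (simp add: mult_ac)
 qed
 show thesis
 proof (rule that[OF d1(1)])
  fix \<tau> x z :: complex assume ap: "ap c d \<delta> \<tau>" and z: "norm z <= R"
  obtain \<sigma> where s: "bij \<sigma>" "!!n. norm (c n + \<tau> - c (\<sigma> n)) < \<delta>" "!!n. norm (d n - d (\<sigma> n)) < \<delta>"
   using ap unfolding ap_def by metis
  define S where "S = {n. norm (c n - x) < r + 1}"
  have fS: "finite S" using pairs_finite(2)[OF p] by (simp add: S_def)
  have near: "\<bar>norm (c (\<sigma> n) - (x + \<tau>)) - norm (c n - x)\<bar> <= 1" for n
  proof -
   have "norm ((c (\<sigma> n) - (x + \<tau>)) - (c n - x)) <= 1"
    using s(2)[of n] d1 by (simp add: norm_minus_commute algebra_simps)
   thus ?thesis using norm_triangle_ineq3 order_trans by blast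
  qed
  have "norm (TT M (%n. c n - x) d z - TS M (%n. c n - x) d S z) <= K / sqrt r"
   by (rule K(3)[OF pairs_shift[OF p] dens_shift[OF D] z r(2)]) (auto simp: S_def)
  moreover have "norm (TT M (%n. c n - (x + \<tau>)) d z - TS M (%n. c n - (x + \<tau>)) d (\<sigma> ` S) z) <= K / sqrt r"
  proof (rule K(3)[OF pairs_shift[OF p] dens_shift[OF D] z r(2)])
   show "{n. norm (c n - (x + \<tau>)) < r} \<subseteq> \<sigma> ` S"
   proof
    fix m assume m: "m \<in> {n. norm (c n - (x + \<tau>)) < r}"
    obtain n where n: "m = \<sigma> n" using s(1) by (metis bij_pointE)
    hence "n \<in> S" using near[of n] m by (auto simp: S_def)
    thus "m \<in> \<sigma> ` S" using n by blast
   qed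
   show "\<sigma> ` S \<subseteq> {n. norm (c n - (x + \<tau>)) < r + 2}"
   proof (intro image_subsetI)
    fix n assume "n \<in> S"
    hence "norm (c n - x) < r + 1" by (simp add: S_def)
    thus "\<sigma> n \<in> {n. norm (c n - (x + \<tau>)) < r + 2}" unfolding mem_Collect_eq using near[of n] by linarith
   qed
  qed
  moreover have "norm (TS M (%n. c n - (x + \<tau>)) d (\<sigma> ` S) z - TS M (%n. c n - x) d S z) <= \<eta>/3"
  proof -
   have inj: "inj_on \<sigma> S" using s(1) by (meson bij_is_inj inj_on_subset subset_UNIV)
   have "TS M (%n. c n - (x + \<tau>)) d (\<sigma> ` S) z - TS M (%n. c n - x) d S z =
    (\<Sum>n\<in>S. (kap M (d (\<sigma> n)) (c (\<sigma> n) - (x + \<tau>) - z) - kap M (d n) (c n - x - z))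
    - (kap M (d (\<sigma> n)) (c (\<sigma> n) - (x + \<tau>)) - kap M (d n) (c n - x)))"
    unfolding TS_def sum.reindex[OF inj] o_def sum_subtractf[symmetric] by (intro sum.cong) auto
   \<comment> \<open>Two kernel differences per index, each at most 2 (\<delta> + \<delta>).\<close>
   also have "norm ... <= (\<Sum>n\<in>S. 8 * \<delta>)"
   proof (rule sum_norm_le)
    fix n
    have c: "norm (c (\<sigma> n) - (x + \<tau>) - (c n - x)) <= \<delta>" "norm (c (\<sigma> n) - (x + \<tau>) - z - (c n - x - z)) <= \<delta>"
    using s(2)[of n] by (simp_all add: norm_minus_commute algebra_simps)
    have kl: "norm (kap M (d (\<sigma> n)) v - kap M (d n) v') <= 4 * \<delta>"
    if "norm (v - v') <= \<delta>" "norm (d (\<sigma> n) - d n) <= \<delta>" for v v'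
    proof -
    have "2 * (norm (v - v') + norm (d (\<sigma> n) - d n)) <= 2 * (\<delta> + \<delta>)" using that by (intro mult_left_mono add_mono) auto
    thus ?thesis using order_trans[OF kap_lipschitz[OF M dM dM]] by simp
    qed
    have dd: "norm (d (\<sigma> n) - d n) <= \<delta>" using s(3)[of n] by (simp add: norm_minus_commute)
    have "norm (kap M (d (\<sigma> n)) (c (\<sigma> n) - (x + \<tau>) - z) - kap M (d n) (c n - x - z)) <= 4 * \<delta>"
    by (rule kl[OF c(2) dd])
    moreover have "norm (kap M (d (\<sigma> n)) (c (\<sigma> n) - (x + \<tau>)) - kap M (d n) (c n - x)) <= 4 * \<delta>"
    by (rule kl[OF c(1) dd])
    ultimately have "norm ((kap M (d (\<sigma> n)) (c (\<sigma> n) - (x + \<tau>) - z) - kap M (d n) (c n - x - z))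
    - (kap M (d (\<sigma> n)) (c (\<sigma> n) - (x + \<tau>)) - kap M (d n) (c n - x))) <= 4 * \<delta> + 4 * \<delta>"
    by (rule order_trans[OF norm_triangle_ineq4 add_mono])
    thus "norm ((kap M (d (\<sigma> n)) (c (\<sigma> n) - (x + \<tau>) - z) - kap M (d n) (c n - x - z))
    - (kap M (d (\<sigma> n)) (c (\<sigma> n) - (x + \<tau>)) - kap M (d n) (c n - x))) <= 8 * \<delta>" by simp
   qed
   also have "... = real (card S) * (8 * \<delta>)" by simp
   also have "... <= 25 * N * (r+1)^2 * (8 * \<delta>)"
    using r1 d1 by (intro mult_right_mono pairs_count(2)[OF p, of _ _ x]) (auto simp: S_def)
   finally show ?thesis using d2 by linarith
  qed
  ultimately have "norm (TT M (%n. c n - (x + \<tau>)) d z - TT M (%n. c n - x) d z) <= K / sqrt r + K / sqrt r + \<eta>/3"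
  proof -
   have tri: "norm (a - b) <= e1 + e2 + e3" if "norm (b - b') <= e1" "norm (a - a') <= e2" "norm (a' - b') <= e3" for a a' b b' :: complex and e1 e2 e3
    using that norm_triangle_ineq[of "(a - a') + (a' - b')" "b' - b"] norm_triangle_ineq[of "a - a'" "a' - b'"]
    by (simp add: norm_minus_commute)
   assume "norm (TT M (%n. c n - x) d z - TS M (%n. c n - x) d S z) <= K / sqrt r"
    "norm (TT M (%n. c n - (x + \<tau>)) d z - TS M (%n. c n - (x + \<tau>)) d (\<sigma> ` S) z) <= K / sqrt r"
    "norm (TS M (%n. c n - (x + \<tau>)) d (\<sigma> ` S) z - TS M (%n. c n - x) d S z) <= \<eta>/3"
   thus ?thesis by (rule tri)
  qed
  hence "norm (TT M (%n. c n - (x + \<tau>)) d z - TT M (%n. c n - x) d z) <= \<eta>" using r(1) by linarith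
  thus "norm ((TT M c d (x + \<tau> + z) - TT M c d (x + \<tau>)) - (TT M c d (x + z) - TT M c d x)) <= \<eta>"
   by (simp add: TT_shift[OF p D])
 qed
qed

text \<open>Bohr's argument: where \<open>u\<close> is nearly maximal, all almost periods keep it nearly maximal,
 since the difference to a nearly minimal value is almost preserved.\<close>
lemma bounded_almost_periodic:
 fixes u :: "complex => real" and A :: "real => complex => bool"
 assumes bd: "!!x. \<bar>u x\<bar> <= B"
  and inv: "!!R \<eta>. 0 <= R ==> 0 < \<eta> ==> \<exists>\<delta>>0. \<forall>\<tau> x z. A \<delta> \<tau> \<longrightarrow> norm z <= R \<longrightarrow> \<bar>(u (x + \<tau> + z) - u (x + \<tau>)) - (u (x + z) - u x)\<bar> <= \<eta>"
  and mono: "!!\<delta> \<delta>' \<tau>. A \<delta> \<tau> ==> \<delta> <= \<delta>' ==> A \<delta>' \<tau>"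
  and add: "!!\<delta> \<delta>' \<tau> \<tau>'. A \<delta> \<tau> ==> A \<delta>' \<tau>' ==> A (\<delta> + \<delta>') (\<tau> + \<tau>')"
  and rd: "!!\<delta>. 0 < \<delta> ==> \<exists>L. \<forall>x. \<exists>\<tau>\<in>ball x L. A \<delta> \<tau>"
  and \<eta>: "0 < \<eta>"
 obtains \<delta> where "0 < \<delta>" "!!\<tau> x. A \<delta> \<tau> ==> \<bar>u (x + \<tau>) - u x\<bar> <= \<eta>"
proof -
 have bdd: "bdd_above (range u)" "bdd_below (range u)"
  using bd by (auto simp: bdd_above_def bdd_below_def abs_le_iff) (metis abs_le_iff bd minus_le_iff)+
 define m1 where "m1 = (SUP x. u x)"
 define m0 where "m0 = (INF x. u x)"
 have le: "u x <= m1" "m0 <= u x" for x unfolding m1_def m0_def using bdd by (auto intro: cSUP_upper cINF_lower)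
 obtain x1 where x1: "m1 - \<eta>/8 < u x1" using less_cSUP_iff[of UNIV u "m1 - \<eta>/8"] bdd \<eta> by (auto simp: m1_def)
 obtain x0 where x0: "u x0 < m0 + \<eta>/8" using cINF_less_iff[of UNIV u "m0 + \<eta>/8"] bdd \<eta> by (auto simp: m0_def)
 obtain \<delta>\<^sub>1 where d1: "0 < \<delta>\<^sub>1" "!!\<tau> x z. A \<delta>\<^sub>1 \<tau> ==> norm z <= norm (x1 - x0) ==> \<bar>(u (x + \<tau> + z) - u (x + \<tau>)) - (u (x + z) - u x)\<bar> <= \<eta>/8"
  using inv[of "norm (x1 - x0)" "\<eta>/8"] \<eta> by auto
 \<comment> \<open>The increment from x0 + s to x1 + s is almost the full oscillation m1 - m0, which
   forces the value at x1 + s close to the supremum.\<close>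
 have high: "m1 - 3 * \<eta>/8 <= u (x1 + s)" if "A \<delta>\<^sub>1 s" for s
 proof -
  have "\<bar>(u (x0 + s + (x1 - x0)) - u (x0 + s)) - (u (x0 + (x1 - x0)) - u x0)\<bar> <= \<eta>/8"
   by (rule d1(2)[OF that order_refl])
  moreover have "x0 + s + (x1 - x0) = x1 + s" "x0 + (x1 - x0) = x1" by auto
  ultimately have "\<bar>(u (x1 + s) - u (x0 + s)) - (u x1 - u x0)\<bar> <= \<eta>/8" by simp
  thus ?thesis using x1 x0 le(1)[of x1] le(2)[of "x0 + s"] unfolding abs_le_iff by linarith
 qed
 obtain L where L: "!!x. \<exists>\<tau>\<in>ball x L. A (\<delta>\<^sub>1/2) \<tau>" using rd[of "\<delta>\<^sub>1/2"] d1(1) by auto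
 obtain \<delta>\<^sub>2 where d2: "0 < \<delta>\<^sub>2" "!!\<tau> x z. A \<delta>\<^sub>2 \<tau> ==> norm z <= \<bar>L\<bar> ==> \<bar>(u (x + \<tau> + z) - u (x + \<tau>)) - (u (x + z) - u x)\<bar> <= \<eta>/8"
  using inv[of "\<bar>L\<bar>" "\<eta>/8"] \<eta> by auto
 show thesis
 proof (rule that[of "min (\<delta>\<^sub>1/2) \<delta>\<^sub>2"])
  show "0 < min (\<delta>\<^sub>1/2) \<delta>\<^sub>2" using d1 d2 by simp
  fix \<tau> x assume t: "A (min (\<delta>\<^sub>1/2) \<delta>\<^sub>2) \<tau>"
  hence t1: "A (\<delta>\<^sub>1/2) \<tau>" and t2: "A \<delta>\<^sub>2 \<tau>" using mono by auto
  \<comment> \<open>\<open>s\<close> brings x1 within distance L of x, so the comparison of x with x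
    + \<tau> reduces to that of x1 + s with x1 + s + \<tau>, where \<open>u\<close> is nearly
    maximal both times.\<close>
  obtain s where s: "s \<in> ball (x - x1) L" "A (\<delta>\<^sub>1/2) s" using L by blast
  have "A \<delta>\<^sub>1 s" using mono[OF s(2), of \<delta>\<^sub>1] d1(1) by simp
  hence h1: "m1 - 3 * \<eta>/8 <= u (x1 + s)" by (rule high)
  have "A \<delta>\<^sub>1 (s + \<tau>)" using add[OF s(2) t1] by simp
  hence h2: "m1 - 3 * \<eta>/8 <= u (x1 + s + \<tau>)" using high by (simp add: add.assoc)
  have "norm (x - x1 - s) <= \<bar>L\<bar>" using s(1) by (simp add: dist_norm)
  hence "\<bar>(u (x1 + s + \<tau> + (x - x1 - s)) - u (x1 + s + \<tau>)) - (u (x1 + s + (x - x1 - s)) - u (x1 + s))\<bar> <= \<eta>/8"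
   using d2(2)[OF t2] by blast
  moreover have "x1 + s + \<tau> + (x - x1 - s) = x + \<tau>" "x1 + s + (x - x1 - s) = x" by auto
  ultimately show "\<bar>u (x + \<tau>) - u x\<bar> <= \<eta>" using h1 h2 le(1)[of "x1 + s"] le(1)[of "x1 + s + \<tau>"] \<eta>
   unfolding abs_le_iff by (simp only:) linarith
 qed
qed

text \<open>The second differences of \<open>Phi\<close> and \<open>TT\<close> coincide because the
  extra term is additive. Bohr's argument is applied to real and imaginary parts.\<close>

lemma Phi_almost_periodic:
 assumes p: "pairs c d M N" and D: "dens c d \<gamma> C" and bd: "!!z. norm (Phi M c d \<gamma> z) <= B"
  and rd: "!!\<delta>. 0 < \<delta> ==> \<exists>L. \<forall>x. \<exists>\<tau>\<in>ball x L. ap c d \<delta> \<tau>" and \<eta>: "0 < \<eta>"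
 obtains \<delta> where "0 < \<delta>" "!!\<tau> x. ap c d \<delta> \<tau> ==> norm (Phi M c d \<gamma> (x + \<tau>) - Phi M c d \<gamma> x) <= \<eta>"
proof -
 define P where "P = Phi M c d \<gamma>"
 have inv: "\<exists>\<delta>>0. \<forall>\<tau> x z. ap c d \<delta> \<tau> \<longrightarrow> norm z <= R \<longrightarrow> norm ((P (x + \<tau> + z) - P (x + \<tau>)) - (P (x + z) - P x)) <= \<eta>"
  if R: "0 <= R" and e: "0 < \<eta>" for R \<eta>
 proof -
  have eq: "(P (x + \<tau> + z) - P (x + \<tau>)) - (P (x + z) - P x) = (TT M c d (x + \<tau> + z) - TT M c d (x + \<tau>)) - (TT M c d (x + z) - TT M c d x)" for x \<tau> z
   by (simp add: P_def Phi_def algebra_simps)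
  obtain \<delta> where "0 < \<delta>" "!!\<tau> x z. ap c d \<delta> \<tau> ==> norm z <= R ==>
   norm ((TT M c d (x + \<tau> + z) - TT M c d (x + \<tau>)) - (TT M c d (x + z) - TT M c d x)) <= \<eta>"
   by (rule TT_almost_invariant[OF p D R e]) blast
  thus ?thesis unfolding eq by blast
 qed
 have part: "\<exists>\<delta>>0. \<forall>\<tau> x. ap c d \<delta> \<tau> \<longrightarrow> \<bar>g (P (x + \<tau>)) - g (P x)\<bar> <= \<eta>/2"
  if g: "!!a b. g (a - b) = g a - g b" "!!a. \<bar>g a\<bar> <= norm a" for g :: "complex => real"
 proof -
  obtain \<delta> where "0 < \<delta>" "!!\<tau> x. ap c d \<delta> \<tau> ==> \<bar>g (P (x + \<tau>)) - g (P x)\<bar> <= \<eta>/2"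
  proof (rule bounded_almost_periodic[of "%x. g (P x)" B "ap c d" "\<eta>/2"])
   show "\<bar>g (P x)\<bar> <= B" for x using g(2)[of "P x"] bd[of x] unfolding P_def by linarith
   show "\<exists>\<delta>>0. \<forall>\<tau> x z. ap c d \<delta> \<tau> \<longrightarrow> norm z <= R \<longrightarrow> \<bar>(g (P (x + \<tau> + z)) - g (P (x + \<tau>))) - (g (P (x + z)) - g (P x))\<bar> <= \<eta>"
    if "0 <= R" "0 < \<eta>" for R \<eta>
    unfolding g(1)[symmetric] using inv[OF that] g(2) by (meson order_trans)
   show "!!\<delta> \<delta>' \<tau>. ap c d \<delta> \<tau> ==> \<delta> <= \<delta>' ==> ap c d \<delta>' \<tau>" by (rule ap_mono)
   show "!!\<delta> \<delta>' \<tau> \<tau>'. ap c d \<delta> \<tau> ==> ap c d \<delta>' \<tau>' ==> ap c d (\<delta> + \<delta>') (\<tau> + \<tau>')" by (rule ap_add)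
  qed (use rd \<eta> in auto)
  thus ?thesis by blast
 qed
 obtain \<delta>\<^sub>1 where d1: "\<delta>\<^sub>1 > 0" "!!\<tau> x. ap c d \<delta>\<^sub>1 \<tau> ==> \<bar>Re (P (x + \<tau>)) - Re (P x)\<bar> <= \<eta>/2"
  using part[of Re] abs_Re_le_cmod by auto
 obtain \<delta>\<^sub>2 where d2: "\<delta>\<^sub>2 > 0" "!!\<tau> x. ap c d \<delta>\<^sub>2 \<tau> ==> \<bar>Im (P (x + \<tau>)) - Im (P x)\<bar> <= \<eta>/2"
  using part[of Im] abs_Im_le_cmod by auto
 show thesis
 proof (rule that[of "min \<delta>\<^sub>1 \<delta>\<^sub>2"])
  fix \<tau> x assume "ap c d (min \<delta>\<^sub>1 \<delta>\<^sub>2) \<tau>"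
  hence "ap c d \<delta>\<^sub>1 \<tau>" "ap c d \<delta>\<^sub>2 \<tau>" by (auto elim: ap_mono)
  thus "norm (Phi M c d \<gamma> (x + \<tau>) - Phi M c d \<gamma> x) <= \<eta>"
   using d1(2)[of \<tau> x] d2(2)[of \<tau> x] cmod_le[of "P (x + \<tau>) - P x"] unfolding P_def by simp
 qed (use d1 d2 in auto)
qed

subsection \<open>The local product\<close>

text \<open>The factor of a zero-pole pair divided by the exponential of its kernel; it is 1 as soon
  as \<open>norm (c n - z) >= 2 * M\<close>. At the pole itself division by zero makes it 0.\<close>

definition wfac :: "real => (nat => complex) => (nat => complex) => nat => complex => complex" where
 "wfac M c d n z = (c n + d n / 2 - z) / (c n - d n / 2 - z) * exp (- kap M (d n) (c n - z))"

definition PP :: "real => (nat => complex) => (nat => complex) => complex => complex" where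
 "PP M c d z = (\<Prod>n\<in>{n. norm (c n - z) < 2 * M}. wfac M c d n z)"

lemma wfac_far:
 assumes p: "pairs c d M N" and "2 * M <= norm (c n - z)"
 shows "wfac M c d n z = 1"
proof -
 have e: "c n + d n / 2 - z = c n - z + d n / 2" "c n - d n / 2 - z = c n - z - d n / 2" by auto
 note k = exp_kap[OF pairsD(1,3)[OF p] assms(2)]
 show ?thesis unfolding wfac_def e exp_minus k(1) using k(2,3) by simp
qed

lemma PP_eq:
 assumes p: "pairs c d M N" and "finite F" "{n. norm (c n - z) < 2 * M} \<subseteq> F"
 shows "PP M c d z = (\<Prod>n\<in>F. wfac M c d n z)"
 unfolding PP_def
proof (rule prod.mono_neutral_left[OF assms(2,3)], intro ballI)
 fix n assume "n \<in> F - {n. norm (c n - z) < 2 * M}"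
 thus "wfac M c d n z = 1" by (intro wfac_far[OF p]) auto
qed

lemma PP_nonzero:
 assumes "!!n. c n + d n / 2 ~= z \<and> c n - d n / 2 ~= z"
 shows "PP M c d z ~= 0"
proof (cases "finite {n. norm (c n - z) < 2 * M}")
 case True
 thus ?thesis using assms by (auto simp: PP_def wfac_def)
qed (simp add: PP_def)

text \<open>Exchanging zeros and poles inverts each factor, also where both sides are 0; statements
  about poles follow from those about zeros.\<close>

lemma PP_minus: "PP M c (%n. - d n) z = inverse (PP M c d z)"
proof -
 have "wfac M c (%n. - d n) n z = inverse (wfac M c d n z)" for n
  by (simp add: wfac_def kap_def Lq_minus exp_minus field_simps)
 thus ?thesis using prod_inversef[of "%n. wfac M c d n z"] by (simp add: PP_def o_def)
qed

lemma pairs_minus: "pairs c d M N ==> pairs c (%n. - d n) M N"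
 by (simp add: pairs_def)

lemma norm_prod_one_plus_minus_one:
 fixes x :: "nat => complex"
 assumes "!!n. n \<in> F ==> norm (x n) <= t" "real (card F) * t <= 1" "0 <= t"
 shows "norm ((\<Prod>n\<in>F. 1 + x n) - 1) <= 2 * (real (card F) * t)"
proof -
 have "norm ((\<Prod>n\<in>F. 1 + x n) - 1) <= (\<Prod>n\<in>F. 1 + norm (x n)) - 1" by (rule norm_prod_minus1_le_prod_minus1)
 also have "(\<Prod>n\<in>F. 1 + norm (x n)) <= (\<Prod>n\<in>F. exp t)"
 proof (rule prod_mono)
  fix n assume "n \<in> F"
  hence "1 + norm (x n) <= exp t" using assms(1)[of n] exp_ge_add_one_self[of t] by linarith
  thus "0 <= 1 + norm (x n) \<and> 1 + norm (x n) <= exp t" by simp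
 qed
 also have "... = exp (real (card F) * t)" by (simp add: exp_of_nat_mult)
 also have "... <= 1 + real (card F) * t + (real (card F) * t)^2" using assms by (intro exp_bound) auto
 also have "(real (card F) * t)^2 <= real (card F) * t * 1" unfolding power2_eq_square using assms by (intro mult_left_mono) auto
 finally show ?thesis by (simp add: mult.commute)
qed

lemma norm_exp_minus_one:
 assumes "norm (e::complex) <= 1/4" shows "norm (exp e - 1) <= 2 * norm e"
proof -
 have "norm (exp e - exp 0) <= 2 * norm (e - 0)"
 proof (rule field_differentiable_bound[of "cball 0 (1/4)"])
  fix z :: complex assume "z \<in> cball 0 (1/4)"
  hence "norm (exp z) <= exp (1/4)" using norm_exp[of z] by (auto intro: order_trans)
  also have "... <= 1 + 1/4 + (1/4)^2" by (rule exp_bound) auto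
  also have "... <= 2" by (simp add: power2_eq_square)
  finally show "norm (exp z) <= 2" .
  show "(exp has_field_derivative exp z) (at z within cball 0 (1/4))" by (auto intro!: derivative_eq_intros)
 qed (use assms in auto)
 thus ?thesis by simp
qed

text \<open>The common shape of the perturbations below: relative changes u of a zero factor and v
  of a pole factor, and a kernel change e. The constant is 3 + 2 + 3/2, rounded up.\<close>

lemma factor_ratio_bound:
 fixes u v e :: complex
 assumes "norm u <= t" "norm v <= t" "norm e <= t" "t <= 1/4"
 shows "norm ((1 + u) / (1 + v) * exp e - 1) <= 7 * t"
proof -
 have t: "0 <= t" using assms(1) norm_ge_zero order_trans by blast
 have v: "3/4 <= norm (1 + v)" using norm_triangle_ineq2[of 1 "- v"] assms by simp
 hence nz: "1 + v ~= 0" by auto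
 define X where "X = (1 + u) / (1 + v)"
 define p where "p = X - 1"
 define q where "q = exp e - 1"
 have "p = (u - v) / (1 + v)" using nz by (simp add: p_def X_def field_simps)
 hence "norm p = norm (u - v) / norm (1 + v)" by (simp add: norm_divide)
 also have "... <= (2 * t) / (3/4)" using v t assms norm_triangle_ineq4[of u v] by (intro frac_le) auto
 finally have p: "norm p <= 3 * t" using t by simp
 have q: "norm q <= 2 * t" unfolding q_def using norm_exp_minus_one[of e] assms by simp
 have "X * exp e - 1 = p + q + p * q" by (simp add: p_def q_def algebra_simps)
 also have "norm ... <= norm p + norm q + norm p * norm q"
  by (metis norm_mult norm_triangle_ineq norm_triangle_mono order_refl)
 also have "norm p * norm q <= (3 * t) * (2 * (1/4))" using p q t assms by (intro mult_mono) auto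
 finally show ?thesis using p q t unfolding X_def by linarith
qed

text \<open>At distance \<open>\<delta>\<^sub>0\<close> from zeros and poles, the relative change of
  each factor is at most of order \<delta> divided by \<open>\<delta>\<^sub>0\<close>, and boundedly
  many factors are active. \<open>F\<close> has radius 2M + 1 rather than 2M so that its image under
  \<sigma> contains all indices active at z + \<tau>.\<close>

lemma PP_ratio:
 assumes p: "pairs c d M N" and d0: "0 < \<delta>\<^sub>0" and \<eta>: "0 < \<eta>"
 obtains \<delta> where "0 < \<delta>" "!!\<tau> \<sigma> z. bij \<sigma> ==> (!!n. norm (c n + \<tau> - c (\<sigma> n)) < \<delta> \<and> norm (d n - d (\<sigma> n)) < \<delta>) ==>
   (!!n. apart \<delta>\<^sub>0 c d n z) ==>
   PP M c d z ~= 0 \<and> norm (PP M c d (z + \<tau>) / PP M c d z - 1) <= \<eta>"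
proof -
 note M = pairsD(1)[OF p] and N = pairsD(2)[OF p] and dM = pairsD(3)[OF p]
 define K where "K = 25 * N * (2 * M + 1)^2"
 have K: "K > 0" using M N by (simp add: K_def)
 \<comment> \<open>At most \<open>K\<close> factors within 7t of 1 have a product within 2 K 7t of
   1.\<close>
 define t where "t = min (1/4) (min 1 (\<eta>/2) / (7 * K))"
 have t: "0 < t" "t <= 1/4" using \<eta> K by (auto simp: t_def)
 have t2: "K * (7 * t) <= min 1 (\<eta>/2)"
 proof -
  have "t <= min 1 (\<eta>/2) / (7 * K)" by (simp add: t_def)
  hence "t * (7 * K) <= min 1 (\<eta>/2)" using K by (simp only: pos_le_divide_eq)
  thus ?thesis by (simp only: mult_ac)
 qed
 define \<delta> where "\<delta> = min 1 (t / (4 * (1 + 1/\<delta>\<^sub>0)))"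
 have den: "0 < 4 * (1 + 1/\<delta>\<^sub>0)" using d0 by (simp add: add_pos_pos)
 have del: "0 < \<delta>" "\<delta> <= 1" "4 * \<delta> * (1 + 1/\<delta>\<^sub>0) <= t"
 proof -
  show "0 < \<delta>" "\<delta> <= 1" using t den by (auto simp: \<delta>_def)
  have "\<delta> <= t / (4 * (1 + 1/\<delta>\<^sub>0))" by (simp add: \<delta>_def)
  hence "\<delta> * (4 * (1 + 1/\<delta>\<^sub>0)) <= t" using den by (simp only: pos_le_divide_eq)
  thus "4 * \<delta> * (1 + 1/\<delta>\<^sub>0) <= t" by (simp only: mult_ac)
 qed
 have d1: "4 * \<delta> <= t" "2 * \<delta> / \<delta>\<^sub>0 <= t"
 proof -
  have "0 <= \<delta> / \<delta>\<^sub>0" using del d0 by simp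
  moreover have "4 * \<delta> * (1 + 1/\<delta>\<^sub>0) = 4 * \<delta> + 4 * (\<delta> / \<delta>\<^sub>0)" by (simp add: algebra_simps)
  moreover have "2 * \<delta> / \<delta>\<^sub>0 = 2 * (\<delta> / \<delta>\<^sub>0)" by simp
  ultimately show "4 * \<delta> <= t" "2 * \<delta> / \<delta>\<^sub>0 <= t" using del by linarith+
 qed
 show thesis
 proof (rule that[OF del(1)])
  fix \<tau> \<sigma> z assume s: "bij \<sigma>" and cl: "!!n. norm (c n + \<tau> - c (\<sigma> n)) < \<delta> \<and> norm (d n - d (\<sigma> n)) < \<delta>"
   and far: "!!n. apart \<delta>\<^sub>0 c d n z"
  have nz: "c n + d n / 2 ~= z \<and> c n - d n / 2 ~= z" for n using far[of n] d0 by auto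
  hence P0: "PP M c d z ~= 0" by (rule PP_nonzero)
  define F where "F = {n. norm (c n - z) < 2 * M + 1}"
  have fF: "finite F" using pairs_finite(2)[OF p] by (simp add: F_def)
  have inj: "inj_on \<sigma> F" using s by (meson bij_is_inj inj_on_subset subset_UNIV)
  have e1: "PP M c d z = (\<Prod>n\<in>F. wfac M c d n z)" by (rule PP_eq[OF p fF]) (auto simp: F_def)
  have "PP M c d (z + \<tau>) = (\<Prod>m\<in>\<sigma> ` F. wfac M c d m (z + \<tau>))"
  proof (rule PP_eq[OF p])
   show "{n. norm (c n - (z + \<tau>)) < 2 * M} \<subseteq> \<sigma> ` F"
   proof
    fix m assume m: "m \<in> {n. norm (c n - (z + \<tau>)) < 2 * M}"
    obtain n where n: "m = \<sigma> n" using s by (metis bij_pointE)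
    have "norm (c n - z) <= norm (c n + \<tau> - c (\<sigma> n)) + norm (c (\<sigma> n) - (z + \<tau>))"
    using norm_triangle_ineq[of "c n + \<tau> - c (\<sigma> n)" "c (\<sigma> n) - (z + \<tau>)"] by (simp add: algebra_simps)
    hence "n \<in> F" using cl[of n] m n del by (auto simp: F_def)
    thus "m \<in> \<sigma> ` F" using n by blast
   qed
  qed (use fF in auto)
  also have "... = (\<Prod>n\<in>F. wfac M c d (\<sigma> n) (z + \<tau>))" by (simp add: prod.reindex[OF inj])
  finally have e2: "PP M c d (z + \<tau>) = (\<Prod>n\<in>F. wfac M c d (\<sigma> n) (z + \<tau>))" .
  define x where "x = (%n. wfac M c d (\<sigma> n) (z + \<tau>) / wfac M c d n z - 1)"
  have "PP M c d (z + \<tau>) / PP M c d z = (\<Prod>n\<in>F. 1 + x n)"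
   unfolding e1 e2 x_def by (simp add: prod_dividef)
  moreover have "norm ((\<Prod>n\<in>F. 1 + x n) - 1) <= 2 * (real (card F) * (7 * t))"
  proof (rule norm_prod_one_plus_minus_one)
   have "real (card F) <= K" unfolding K_def using M by (intro pairs_count(2)[OF p, of _ _ z]) (auto simp: F_def)
   hence "real (card F) * (7 * t) <= K * (7 * t)" using t by (intro mult_right_mono) auto
   thus "real (card F) * (7 * t) <= 1" using t2 by linarith
   fix n assume "n \<in> F"
   define A where "A = c n + d n / 2 - z"
   define B where "B = c n - d n / 2 - z"
   define A' where "A' = c (\<sigma> n) + d (\<sigma> n) / 2 - (z + \<tau>)"
   define B' where "B' = c (\<sigma> n) - d (\<sigma> n) / 2 - (z + \<tau>)"
   define e where "e = kap M (d n) (c n - z) - kap M (d (\<sigma> n)) (c (\<sigma> n) - (z + \<tau>))"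
   have AB: "A ~= 0" "B ~= 0" "\<delta>\<^sub>0 <= norm A" "\<delta>\<^sub>0 <= norm B" using nz[of n] far[of n] by (auto simp: A_def B_def)
   have df: "norm (A' - A) <= 2 * \<delta>" "norm (B' - B) <= 2 * \<delta>"
   proof -
    have eqs: "A' - A = - (c n + \<tau> - c (\<sigma> n)) - (d n - d (\<sigma> n)) / 2" "B' - B = - (c n + \<tau> - c (\<sigma> n)) + (d n - d (\<sigma> n)) / 2"
    by (auto simp: A_def A'_def B_def B'_def field_simps)
    have "norm ((d n - d (\<sigma> n)) / 2) <= \<delta>" using cl[of n] del(1) by (simp add: norm_divide)
    thus "norm (A' - A) <= 2 * \<delta>" "norm (B' - B) <= 2 * \<delta>" unfolding eqs
    using cl[of n] norm_triangle_ineq4[of "- (c n + \<tau> - c (\<sigma> n))" "(d n - d (\<sigma> n)) / 2"]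
    norm_triangle_ineq[of "- (c n + \<tau> - c (\<sigma> n))" "(d n - d (\<sigma> n)) / 2"] unfolding norm_minus_cancel by linarith+
   qed
   have uv: "norm ((A' - A) / A) <= t" "norm ((B' - B) / B) <= t"
   proof -
    have "norm ((A' - A) / A) <= 2 * \<delta> / \<delta>\<^sub>0" unfolding norm_divide using df AB d0 del(1) by (intro frac_le) auto
    thus "norm ((A' - A) / A) <= t" using d1 by linarith
    have "norm ((B' - B) / B) <= 2 * \<delta> / \<delta>\<^sub>0" unfolding norm_divide using df AB d0 del(1) by (intro frac_le) auto
    thus "norm ((B' - B) / B) <= t" using d1 by linarith
   qed
   have "norm e <= 2 * (norm (c n - z - (c (\<sigma> n) - (z + \<tau>))) + norm (d n - d (\<sigma> n)))"
    unfolding e_def by (rule kap_lipschitz[OF M dM dM])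
   also have "c n - z - (c (\<sigma> n) - (z + \<tau>)) = c n + \<tau> - c (\<sigma> n)" by simp
   also have "2 * (norm (c n + \<tau> - c (\<sigma> n)) + norm (d n - d (\<sigma> n))) <= 2 * (\<delta> + \<delta>)"
    using cl[of n] by (intro mult_left_mono add_mono) auto
   also have "2 * (\<delta> + \<delta>) <= t" using d1(1) by simp
   finally have e: "norm e <= t" .
   have "(1 + (A' - A) / A) / (1 + (B' - B) / B) * exp e = (A' / A) / (B' / B) * exp e"
    using AB by (simp add: field_simps)
   also have "... = (A' / B' * exp (- kap M (d (\<sigma> n)) (c (\<sigma> n) - (z + \<tau>)))) / (A / B * exp (- kap M (d n) (c n - z)))"
   proof -
    have "(a' / a) / (b' / b) * exp (k - k') = (a' / b' * exp (- k')) / (a / b * exp (- k))"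
    if "a ~= 0" "b ~= 0" for a a' b b' k k' :: complex
    using that by (simp add: exp_diff exp_minus field_simps)
    from this[OF AB(1,2)] show ?thesis unfolding e_def .
   qed
   also have "... = wfac M c d (\<sigma> n) (z + \<tau>) / wfac M c d n z"
    unfolding wfac_def A_def B_def A'_def B'_def ..
   finally show "norm (x n) <= 7 * t" unfolding x_def using factor_ratio_bound[OF uv e t(2)] by simp
  qed (use t in auto)
  moreover have "2 * (real (card F) * (7 * t)) <= \<eta>"
  proof -
   have "real (card F) <= K" unfolding K_def using M by (intro pairs_count(2)[OF p, of _ _ z]) (auto simp: F_def)
   hence "real (card F) * (7 * t) <= K * (7 * t)" using t by (intro mult_right_mono) auto
   thus ?thesis using t2 by linarith
  qed
  ultimately show "PP M c d z ~= 0 \<and> norm (PP M c d (z + \<tau>) / PP M c d z - 1) <= \<eta>" using P0 by simp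
 qed
qed

text \<open>Near a zero, separation keeps every denominator at least \<eta>/2, and at most
  \<open>m\<close> factors occur, each bounded by \<open>Q\<close>; one of them contains the small
  numerator.\<close>

lemma PP_small_near_zero:
 assumes p: "pairs c d M N" and sep: "0 < \<eta>" "!!n k. \<eta> <= norm ((c n + d n / 2) - (c k - d k / 2))"
 obtains K where "0 < K" "!!n z. norm (c n + d n / 2 - z) <= \<eta>/2 ==> norm (c n + d n / 2 - z) <= 1 ==>
   norm (PP M c d z) <= K * norm (c n + d n / 2 - z)"
proof -
 note M = pairsD(1)[OF p] and N = pairsD(2)[OF p] and dM = pairsD(3)[OF p]
 define Q where "Q = max 1 (4 * M / (\<eta>/2) * exp 1)"
 define m where "m = nat \<lceil>25 * N * (2 * M)^2\<rceil>"
 have Q: "1 <= Q" by (simp add: Q_def)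
 show thesis
 proof (rule that[of "1 / (\<eta>/2) * exp 1 * Q ^ m"])
  show "0 < 1 / (\<eta>/2) * exp 1 * Q ^ m" using sep Q by (auto intro!: mult_pos_pos zero_less_power)
  fix n z assume n: "norm (c n + d n / 2 - z) <= \<eta>/2" "norm (c n + d n / 2 - z) <= 1"
  define F where "F = {n. norm (c n - z) < 2 * M}"
  have fF: "finite F" using pairs_finite(2)[OF p] by (simp add: F_def)
  have "norm (c n - z) <= norm (c n + d n / 2 - z) + norm (d n / 2)"
   using norm_triangle_ineq4[of "c n + d n / 2 - z" "d n / 2"] by simp
  also have "... < 2 * M" using n dM[of n] M by (simp add: norm_divide)
  finally have nF: "n \<in> F" by (simp add: F_def)
  have den: "\<eta>/2 <= norm (c k - d k / 2 - z)" for k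
  proof -
   have "norm ((c n + d n / 2) - (c k - d k / 2)) <= norm (c n + d n / 2 - z) + norm (c k - d k / 2 - z)"
    using norm_triangle_ineq4[of "c n + d n / 2 - z" "c k - d k / 2 - z"] by (simp add: algebra_simps)
   thus ?thesis using sep(2)[of n k] n by linarith
  qed
  have ek: "norm (exp (- kap M (d k) (c k - z))) <= exp 1" for k
   using norm_exp[of "- kap M (d k) (c k - z)"] norm_kap_le[OF M dM, of k "c k - z"] by (auto intro: order_trans)
  have wb: "norm (wfac M c d k z) <= Q" if "k \<in> F" for k
  proof -
   have "norm (c k + d k / 2 - z) <= norm (c k - z) + norm (d k / 2)"
    using norm_triangle_ineq[of "c k - z" "d k / 2"] by (simp add: algebra_simps)
   also have "... <= 4 * M" using that dM[of k] M by (simp add: F_def norm_divide)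
   finally have "norm (wfac M c d k z) <= 4 * M / (\<eta>/2) * exp 1"
    unfolding wfac_def norm_mult norm_divide[of "c k + d k / 2 - z"] using den[of k] ek[of k] sep M by (intro mult_mono frac_le) auto
   thus ?thesis by (simp add: Q_def)
  qed
  have "PP M c d z = wfac M c d n z * (\<Prod>k\<in>F - {n}. wfac M c d k z)"
   unfolding PP_def F_def[symmetric] using fF nF by (rule prod.remove)
  hence "norm (PP M c d z) = norm (wfac M c d n z) * (\<Prod>k\<in>F - {n}. norm (wfac M c d k z))"
   by (simp add: norm_mult prod_norm)
  also have "... <= (norm (c n + d n / 2 - z) / (\<eta>/2) * exp 1) * Q ^ m"
  proof (rule mult_mono)
   show "norm (wfac M c d n z) <= norm (c n + d n / 2 - z) / (\<eta>/2) * exp 1"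
    unfolding wfac_def norm_mult norm_divide[of "c n + d n / 2 - z"] using den[of n] ek[of n] sep by (intro mult_mono frac_le) auto
   have "(\<Prod>k\<in>F - {n}. norm (wfac M c d k z)) <= (\<Prod>k\<in>F - {n}. Q)" using wb by (intro prod_mono) auto
   also have "... = Q ^ card (F - {n})" by simp
   also have "... <= Q ^ m"
   proof (rule power_increasing[OF _ Q])
    have "real (card F) <= 25 * N * (2 * M)^2" using M by (intro pairs_count(2)[OF p, of _ _ z]) (auto simp: F_def)
    hence "card F <= m" unfolding m_def by linarith
    thus "card (F - {n}) <= m" using card_Diff1_le[of F n] by linarith
   qed
   finally show "(\<Prod>k\<in>F - {n}. norm (wfac M c d k z)) <= Q ^ m" .
  qed (use sep in \<open>auto intro!: prod_nonneg\<close>)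
  finally show "norm (PP M c d z) <= 1 / (\<eta>/2) * exp 1 * Q ^ m * norm (c n + d n / 2 - z)"
   by (simp add: mult_ac)
 qed
qed

text \<open>Each factor of the finite product is the exponential of a kernel increment times a
  quotient of \<open>wfac\<close>. Once r >= |z| + 2M the latter already multiply to
  \<open>PP M c d z / PP M c d 0\<close>, so only \<open>TS\<close> still varies with r.\<close>

lemma product_formula:
 assumes p: "pairs c d M N" and D: "dens c d \<gamma> C"
  and nz: "!!n. c n + d n / 2 ~= 0" "!!n. c n - d n / 2 ~= 0" and z: "!!n. c n - d n / 2 ~= z"
 shows "((%r. \<Prod>n\<in>{n. norm (c n) < r}. (c n - d n / 2) * (c n + d n / 2 - z) / ((c n + d n / 2) * (c n - d n / 2 - z)))
   \<longlongrightarrow> exp (TT M c d z) * PP M c d z / PP M c d 0) at_top"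
proof -
 note M = pairsD(1)[OF p]
 let ?B = "%r. {n. norm (c n) < r}"
 have fB: "finite (?B r)" for r using pairs_finite(2)[OF p, of 0 r] by simp
 have q: "(c n - d n / 2) * (c n + d n / 2 - z) / ((c n + d n / 2) * (c n - d n / 2 - z))
   = exp (kap M (d n) (c n - z) - kap M (d n) (c n)) * wfac M c d n z / wfac M c d n 0" for n
 proof -
  have "b0 * a1 / (a0 * b1) = exp (k - k0) * (a1 / b1 * exp (- k)) / (a0 / b0 * exp (- k0))"
   if "a0 ~= 0" "b0 ~= 0" "b1 ~= 0" for a0 a1 b0 b1 k k0 :: complex
   using that by (simp add: exp_diff exp_minus field_simps)
  from this[OF nz(1)[of n] nz(2)[of n], of "c n - d n / 2 - z" "c n + d n / 2 - z" "kap M (d n) (c n - z)" "kap M (d n) (c n)"] z[of n]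
  show ?thesis by (simp add: wfac_def)
 qed
 have "eventually (%r. exp (TS M c d (?B r) z) * PP M c d z / PP M c d 0 =
   (\<Prod>n\<in>?B r. (c n - d n / 2) * (c n + d n / 2 - z) / ((c n + d n / 2) * (c n - d n / 2 - z)))) at_top"
  using eventually_ge_at_top[of "norm z + 2 * M"]
 proof eventually_elim
  fix r assume r: "norm z + 2 * M <= r"
  have "PP M c d z = (\<Prod>n\<in>?B r. wfac M c d n z)"
  proof (rule PP_eq[OF p fB], safe)
   fix n assume "norm (c n - z) < 2 * M"
   thus "norm (c n) < r" using r norm_triangle_ineq2[of "c n" z] by simp
  qed
  moreover have "PP M c d 0 = (\<Prod>n\<in>?B r. wfac M c d n 0)"
  proof (rule PP_eq[OF p fB], safe)
   fix n assume "norm (c n - 0) < 2 * M"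
   hence "norm (c n) < 2 * M" by simp
   thus "norm (c n) < r" using r norm_ge_zero[of z] by linarith
  qed
  moreover have "exp (TS M c d (?B r) z) = (\<Prod>n\<in>?B r. exp (kap M (d n) (c n - z) - kap M (d n) (c n)))"
   unfolding TS_def by (rule exp_sum[OF fB])
  ultimately show "exp (TS M c d (?B r) z) * PP M c d z / PP M c d 0 =
   (\<Prod>n\<in>?B r. (c n - d n / 2) * (c n + d n / 2 - z) / ((c n + d n / 2) * (c n - d n / 2 - z)))"
   unfolding q by (simp add: prod.distrib prod_dividef)
 qed
 moreover have "((%r. exp (TS M c d (?B r) z) * PP M c d z / PP M c d 0) \<longlongrightarrow> exp (TT M c d z) * PP M c d z / PP M c d 0) at_top"
  unfolding divide_inverse by (intro tendsto_mult tendsto_exp TT_tendsto[OF p D] tendsto_const) auto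
 ultimately show ?thesis by (rule Lim_transform_eventually[rotated])
qed

lemma rational_factor_local:
 fixes a b :: "nat => complex"
 assumes F: "finite F" "{n. a n = w} \<subseteq> F" "{n. b n = w} \<subseteq> F"
 obtains r Z where "0 < r" "r <= 1" "Z holomorphic_on ball w r" "!!z. z \<in> ball w r ==> Z z ~= 0"
  "!!z. z \<in> ball w r ==> z ~= w ==> (\<forall>n\<in>F. a n ~= z \<and> b n ~= z) \<and>
    (\<Prod>n\<in>F. (a n - z) / (b n - z)) = (z - w) powi (int (card {n. a n = w}) - int (card {n. b n = w})) * Z z"
  "{n. a n = w} = {} ==> {n. b n = w} = {} ==> (\<Prod>n\<in>F. (a n - w) / (b n - w)) = Z w"
proof -
 define X where "X = a ` F \<union> b ` F - {w}"
 have "finite X" using F by (auto simp: X_def)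
 then obtain e where e: "e > 0" "\<forall>x\<in>X. x ~= w \<longrightarrow> e <= dist w x" using finite_set_avoid[of X w] by auto
 define r where "r = min 1 e"
 have far: "x ~= z" if "x \<in> X" "z \<in> ball w r" for x z using e that by (force simp: r_def X_def)
 \<comment> \<open>A factor vanishing at \<open>w\<close> is a n - z = -(z - w), so -1 remains after
   \<open>z - w\<close> is extracted.\<close>
 define fa where "fa = (%n z. if a n = w then -1 else a n - z)"
 define fb where "fb = (%n z. if b n = w then -1 else b n - z)"
 define Z where "Z = (%z. \<Prod>n\<in>F. fa n z / fb n z)"
 have fnz: "fa n z ~= 0" "fb n z ~= 0" if "n \<in> F" "z \<in> ball w r" for n z
  using that far[of "a n" z] far[of "b n" z] by (auto simp: fa_def fb_def X_def)
 show thesis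
 proof (rule that[of r Z])
  show "0 < r" "r <= 1" using e by (auto simp: r_def)
  have "(%z. fa n z) holomorphic_on S" for n S
   by (cases "a n = w") (auto simp: fa_def intro!: holomorphic_intros)
  moreover have "(%z. fb n z) holomorphic_on S" for n S
   by (cases "b n = w") (auto simp: fb_def intro!: holomorphic_intros)
  ultimately show "Z holomorphic_on ball w r" unfolding Z_def using fnz by (intro holomorphic_intros) auto
  show "Z z ~= 0" if "z \<in> ball w r" for z using fnz that F by (auto simp: Z_def)
  show "(\<forall>n\<in>F. a n ~= z \<and> b n ~= z) \<and> (\<Prod>n\<in>F. (a n - z) / (b n - z)) = (z - w) powi (int (card {n. a n = w}) - int (card {n. b n = w})) * Z z"
   if z: "z \<in> ball w r" "z ~= w" for z
  proof
   show "\<forall>n\<in>F. a n ~= z \<and> b n ~= z"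
   proof (intro ballI conjI)
    fix n assume "n \<in> F"
    thus "a n ~= z" "b n ~= z" using z far[of "a n" z] far[of "b n" z] by (auto simp: X_def)
   qed
   have "(\<Prod>n\<in>F. (a n - z) / (b n - z)) = (\<Prod>n\<in>F. (if a n = w then z - w else 1) / (if b n = w then z - w else 1) * (fa n z / fb n z))"
    using z by (intro prod.cong) (auto simp: fa_def fb_def field_simps)
   also have "... = (\<Prod>n\<in>F. (if a n = w then z - w else 1)) / (\<Prod>n\<in>F. (if b n = w then z - w else 1)) * Z z"
    by (simp add: prod.distrib prod_dividef Z_def)
   also have "(\<Prod>n\<in>F. (if a n = w then z - w else 1)) = (z - w) ^ card {n. a n = w}"
   proof -
    have "(\<Prod>n\<in>F. (if a n = w then z - w else 1)) = (\<Prod>n\<in>{n\<in>F. a n = w}. z - w)" by (rule prod.inter_filter[OF F(1), symmetric])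
    also have "{n\<in>F. a n = w} = {n. a n = w}" using F by auto
    finally show ?thesis by simp
   qed
   also have "(\<Prod>n\<in>F. (if b n = w then z - w else 1)) = (z - w) ^ card {n. b n = w}"
   proof -
    have "(\<Prod>n\<in>F. (if b n = w then z - w else 1)) = (\<Prod>n\<in>{n\<in>F. b n = w}. z - w)" by (rule prod.inter_filter[OF F(1), symmetric])
    also have "{n\<in>F. b n = w} = {n. b n = w}" using F by auto
    finally show ?thesis by simp
   qed
   also have "(z - w) ^ card {n. a n = w} / (z - w) ^ card {n. b n = w} = (z - w) powi (int (card {n. a n = w}) - int (card {n. b n = w}))"
    using z by (simp add: power_int_diff power_int_of_nat)
   finally show "(\<Prod>n\<in>F. (a n - z) / (b n - z)) = (z - w) powi (int (card {n. a n = w}) - int (card {n. b n = w})) * Z z" .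
  qed
  show "(\<Prod>n\<in>F. (a n - w) / (b n - w)) = Z w" if "{n. a n = w} = {}" "{n. b n = w} = {}"
   unfolding Z_def using that by (intro prod.cong) (auto simp: fa_def fb_def)
 qed
qed

subsection \<open>The spherical metric and relative density\<close>

lemma sqrt_one_plus_ge: "1 <= sqrt (1 + (norm u)^2)" "norm u <= sqrt (1 + (norm u)^2)" for u :: complex
 by (auto intro!: real_le_rsqrt)

text \<open>One bound for each region of the sphere: values near 0, moderate values, values near
  infinity.\<close>

lemma rhoS_Some_le:
 shows "rhoS (Some u) (Some v) <= 2 * norm (u - v)"
  and "u ~= 0 ==> rhoS (Some u) (Some v) <= 2 * (norm (u - v) / norm u)"
  and "u ~= 0 ==> v ~= 0 ==> rhoS (Some u) (Some v) <= 2 / norm u + 2 / norm v"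
proof -
 have u: "1 <= sqrt (1 + (norm u)^2)" "norm u <= sqrt (1 + (norm u)^2)" by (rule sqrt_one_plus_ge)+
 have v: "1 <= sqrt (1 + (norm v)^2)" "norm v <= sqrt (1 + (norm v)^2)" by (rule sqrt_one_plus_ge)+
 have pos: "0 < 1 + (norm u)^2" "0 < 1 + (norm v)^2" by (auto intro: add_pos_nonneg)
 have e: "rhoS (Some u) (Some v) = 2 * norm (u - v) / (sqrt (1 + (norm u)^2) * sqrt (1 + (norm v)^2))" by (simp add: rhoS_def)
 have "2 * norm (u - v) / (sqrt (1 + (norm u)^2) * sqrt (1 + (norm v)^2)) <= 2 * norm (u - v) / (1 * 1)"
  using u v pos by (intro divide_left_mono mult_mono mult_pos_pos) auto
 thus "rhoS (Some u) (Some v) <= 2 * norm (u - v)" unfolding e by simp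
 assume u0: "u ~= 0"
 have "2 * norm (u - v) / (sqrt (1 + (norm u)^2) * sqrt (1 + (norm v)^2)) <= 2 * norm (u - v) / (norm u * 1)"
  using u v u0 pos by (intro divide_left_mono mult_mono mult_pos_pos) auto
 thus "rhoS (Some u) (Some v) <= 2 * (norm (u - v) / norm u)" unfolding e by simp
 assume v0: "v ~= 0"
 have "2 * norm (u - v) / (sqrt (1 + (norm u)^2) * sqrt (1 + (norm v)^2)) <= 2 * (norm u + norm v) / (norm u * norm v)"
  using u v u0 v0 norm_triangle_ineq4[of u v] by (intro frac_le mult_mono mult_pos_pos) auto
 also have "... = 2 / norm u + 2 / norm v" using u0 v0 by (simp add: field_simps)
 finally show "rhoS (Some u) (Some v) <= 2 / norm u + 2 / norm v" unfolding e .
qed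

lemma rhoS_None_le:
 "v ~= 0 ==> rhoS None (Some v) <= 2 / norm v" "v ~= 0 ==> rhoS (Some v) None <= 2 / norm v" "rhoS None None = 0"
 using sqrt_one_plus_ge(2)[of v] by (auto simp: rhoS_def intro!: divide_left_mono mult_pos_pos add_pos_nonneg)

definition rdense :: "(complex => bool) => bool" where
 "rdense A \<longleftrightarrow> (\<exists>L. \<forall>x. \<exists>\<tau>\<in>ball x L. A \<tau>)"

lemma rdense_mono: "rdense A ==> (!!\<tau>. A \<tau> ==> B \<tau>) ==> rdense B"
 unfolding rdense_def by blast

text \<open>Pigeonhole: among the elements of a relatively dense set, the differences of elements with the same
 colour are again relatively dense if there are only finitely many colours.\<close>
lemma rdense_colour:
 fixes col :: "complex => 'c"
 assumes A: "rdense A" and K: "finite K" "!!\<tau>. A \<tau> ==> col \<tau> \<in> K"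
 shows "rdense (%\<tau>. \<exists>\<tau>1 \<tau>2. A \<tau>1 \<and> A \<tau>2 \<and> col \<tau>1 = col \<tau>2 \<and> \<tau> = \<tau>1 - \<tau>2)"
proof -
 obtain L where L: "!!x. \<exists>\<tau>\<in>ball x L. A \<tau>" using A unfolding rdense_def by auto
 define rep where "rep = (%k. SOME \<tau>. A \<tau> \<and> col \<tau> = k)"
 have rep: "A (rep (col \<tau>)) \<and> col (rep (col \<tau>)) = col \<tau>" if "A \<tau>" for \<tau>
  unfolding rep_def by (rule someI[of _ \<tau>]) (use that in auto)
 define m where "m = Max (insert 0 ((%k. norm (rep k)) ` K))"
 have m: "norm (rep k) <= m" if "k \<in> K" for k unfolding m_def using K(1) that by auto
 show ?thesis unfolding rdense_def
 proof (intro exI[of _ "L + m"] allI)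
  fix x
  obtain \<tau> where t: "\<tau> \<in> ball x L" "A \<tau>" using L by blast
  have "norm (x - (\<tau> - rep (col \<tau>))) <= norm (x - \<tau>) + norm (rep (col \<tau>))"
   using norm_triangle_ineq[of "x - \<tau>" "rep (col \<tau>)"] by (simp add: algebra_simps)
  hence "\<tau> - rep (col \<tau>) \<in> ball x (L + m)" using t m[OF K(2)[OF t(2)]] by (simp add: dist_norm)
  moreover have "\<exists>\<tau>1 \<tau>2. A \<tau>1 \<and> A \<tau>2 \<and> col \<tau>1 = col \<tau>2 \<and> \<tau> - rep (col \<tau>) = \<tau>1 - \<tau>2" using rep[OF t(2)] t(2) by metis
  ultimately show "\<exists>\<tau>\<in>ball x (L + m). \<exists>\<tau>1 \<tau>2. A \<tau>1 \<and> A \<tau>2 \<and> col \<tau>1 = col \<tau>2 \<and> \<tau> = \<tau>1 - \<tau>2" by blast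
 qed
qed

section \<open>Grid cells as finite colourings of bounded sets\<close>

definition cell :: "real => complex => int \<times> int" where
 "cell m u = (\<lfloor>Re u * m\<rfloor>, \<lfloor>Im u * m\<rfloor>)"

lemma cell_close:
 assumes "0 < m" "cell m u = cell m v" shows "norm (u - v) <= 2 / m"
proof -
 have 1: "\<bar>x - y\<bar> <= 1 / m" if "\<lfloor>x * m\<rfloor> = \<lfloor>y * m\<rfloor>" for x y
 proof -
  have "\<bar>x * m - y * m\<bar> <= 1" using that by linarith
  hence "\<bar>x - y\<bar> * m <= 1" using assms(1) by (simp add: left_diff_distrib[symmetric] abs_mult)
  thus ?thesis using assms(1) by (simp add: pos_le_divide_eq)
 qed
 have "norm (u - v) <= \<bar>Re u - Re v\<bar> + \<bar>Im u - Im v\<bar>" using cmod_le[of "u - v"] by simp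
 also have "... <= 1/m + 1/m" using assms(2) by (intro add_mono 1) (auto simp: cell_def)
 finally show ?thesis by simp
qed

lemma cell_finite:
 assumes "0 < m" shows "finite (cell m ` cball 0 L)"
proof -
 have "cell m ` cball 0 L \<subseteq> {\<lfloor>- \<bar>L\<bar> * m\<rfloor>..\<lfloor>\<bar>L\<bar> * m\<rfloor>} \<times> {\<lfloor>- \<bar>L\<bar> * m\<rfloor>..\<lfloor>\<bar>L\<bar> * m\<rfloor>}"
 proof (rule image_subsetI)
  fix u :: complex assume "u \<in> cball 0 L"
  hence "\<bar>Re u\<bar> <= \<bar>L\<bar>" "\<bar>Im u\<bar> <= \<bar>L\<bar>" using abs_Re_le_cmod[of u] abs_Im_le_cmod[of u] by auto
  hence "- \<bar>L\<bar> * m <= Re u * m" "Re u * m <= \<bar>L\<bar> * m" "- \<bar>L\<bar> * m <= Im u * m" "Im u * m <= \<bar>L\<bar> * m"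
   using mult_right_mono[of "- \<bar>L\<bar>" "Re u" m] mult_right_mono[of "Re u" "\<bar>L\<bar>" m]
    mult_right_mono[of "- \<bar>L\<bar>" "Im u" m] mult_right_mono[of "Im u" "\<bar>L\<bar>" m] assms by (simp_all add: abs_le_iff)
  thus "cell m u \<in> {\<lfloor>- \<bar>L\<bar> * m\<rfloor>..\<lfloor>\<bar>L\<bar> * m\<rfloor>} \<times> {\<lfloor>- \<bar>L\<bar> * m\<rfloor>..\<lfloor>\<bar>L\<bar> * m\<rfloor>}"
   unfolding cell_def by (auto intro!: floor_mono)
 qed
 thus ?thesis by (rule finite_subset) auto
qed

subsection \<open>Functions of the form \<open>E * PP\<close>\<close>

text \<open>Otherwise \<open>g\<close> would be a positive power of z - w times a continuous
  function and would vanish at \<open>w\<close>.\<close>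

lemma mero_local_less:
 assumes "mero_local f w k" "mero_local f w k'" "k < k'"
 shows False
proof -
 obtain r g where g: "r > 0" "g holomorphic_on ball w r" "!!z. z \<in> ball w r ==> g z ~= 0"
   "!!z. z \<in> ball w r - {w} ==> f z = Some ((z - w) powi k * g z)" using assms(1) unfolding mero_local_def by blast
 obtain r' g' where g': "r' > 0" "g' holomorphic_on ball w r'" "!!z. z \<in> ball w r' - {w} ==> f z = Some ((z - w) powi k' * g' z)"
  using assms(2) unfolding mero_local_def by blast
 define m where "m = nat (k' - k)"
 have m: "m > 0" "k' = k + int m" using assms(3) by (auto simp: m_def)
 have c: "isCont g w" "isCont g' w"
  using holomorphic_on_imp_continuous_on[OF g(2)] holomorphic_on_imp_continuous_on[OF g'(2)] g(1) g'(1)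
  by (auto simp: continuous_on_eq_continuous_at)
 have t1: "(g \<longlongrightarrow> g w) (at w)" using c(1) by (simp add: isCont_def)
 have "((%z. (z - w) ^ m * g' z) \<longlongrightarrow> (w - w) ^ m * g' w) (at w)"
  using c(2) by (intro tendsto_intros) (simp add: isCont_def)
 hence t2: "((%z. (z - w) ^ m * g' z) \<longlongrightarrow> 0) (at w)" using m by (simp add: zero_power)
 have "eventually (%z. z \<in> ball w (min r r') - {w}) (at w)"
  using g(1) g'(1) by (intro eventually_at_in_open) auto
 hence "eventually (%z. (z - w) ^ m * g' z = g z) (at w)"
 proof eventually_elim
  fix z assume z: "z \<in> ball w (min r r') - {w}"
  hence "(z - w) powi k * g z = (z - w) powi k' * g' z" using g(4)[of z] g'(3)[of z] by auto
  also have "... = (z - w) powi k * ((z - w) ^ m * g' z)" using z m(2) by (simp add: power_int_add power_int_of_nat)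
  finally show "(z - w) ^ m * g' z = g z" using z by simp
 qed
 hence "(g \<longlongrightarrow> 0) (at w)" by (rule Lim_transform_eventually[OF t2])
 hence "g w = 0" using tendsto_unique[OF _ t1] by simp
 thus False using g(3)[of w] g(1) by simp
qed

lemma mero_order_eq:
 assumes "mero_local f w k" shows "mero_order f w = k"
 unfolding mero_order_def using assms mero_local_less by (intro the_equality) (metis linorder_neqE)+

text \<open>\<open>E\<close> carries the exponentials of the kernels that \<open>wfac\<close>
  divides out, so it need not be holomorphic itself; near \<open>w\<close> it becomes so when the
  kernels near \<open>w\<close> are removed. This makes \<open>E * PP\<close> meromorphic.\<close>

definition Eloc :: "real => (nat => complex) => (nat => complex) => (complex => complex) => bool" where
 "Eloc M c d E \<longleftrightarrow> (\<forall>z. E z ~= 0) \<and> (\<forall>w. \<exists>F. finite F \<and> {n. norm (c n - w) < 2 * M + 2} \<subseteq> F \<and>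
   (%z. E z * exp (- (kapS M c d F z))) holomorphic_on ball w 2)"

text \<open>Infinity is assigned explicitly at the poles because \<open>PP\<close> is 0 there by the
  convention x / 0 = 0.\<close>

definition EPf :: "real => (nat => complex) => (nat => complex) => (complex => complex) => complex => complex option" where
 "EPf M c d E z = (if z \<in> range (%n. c n - d n / 2) then None else Some (E z * PP M c d z))"

lemma PP_split:
 assumes p: "pairs c d M N" and "finite F" "{n. norm (c n - z) < 2 * M} \<subseteq> F"
 shows "PP M c d z = (\<Prod>n\<in>F. (c n + d n / 2 - z) / (c n - d n / 2 - z)) * exp (- (kapS M c d F z))"
 unfolding PP_eq[OF assms] wfac_def prod.distrib sum_negf[symmetric] exp_sum[OF assms(2)] by (rule refl)

lemma half_pair_dist:
 assumes p: "pairs c d M N" and "c n + d n / 2 = z \<or> c n - d n / 2 = z"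
 shows "norm (c n - z) <= M / 2"
proof -
 have "c n - z = - (d n / 2) \<or> c n - z = d n / 2" using assms(2) by (auto simp: algebra_simps)
 hence "norm (c n - z) = norm (d n / 2)" by (elim disjE) (simp_all only: norm_minus_cancel)
 also have "... = norm (d n) / 2" by (simp add: norm_divide)
 finally show ?thesis using pairsD(3)[OF p, of n] by simp
qed

lemma PP_zero:
 assumes p: "pairs c d M N" and m: "c m + d m / 2 = z \<or> c m - d m / 2 = z"
 shows "PP M c d z = 0"
proof -
 have "norm (c m - z) < 2 * M" using half_pair_dist[OF p m] pairsD(1)[OF p] by simp
 hence "m \<in> {n. norm (c n - z) < 2 * M}" by simp
 moreover have "wfac M c d m z = 0" using m unfolding wfac_def by (elim disjE) simp_all
 ultimately show ?thesis unfolding PP_def by (intro prod_zero[OF pairs_finite(2)[OF p]] bexI[of _ m])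
qed

text \<open>Near \<open>w\<close> the exponentials in \<open>PP\<close> combine with
  \<open>E\<close> to the zero-free holomorphic \<open>Y\<close>, and a finite rational product is
  left, from which the power of z - w is extracted.\<close>

lemma EPf_mero:
 assumes p: "pairs c d M N" and E: "Eloc M c d E" and disj: "!!n k. c n + d n / 2 ~= c k - d k / 2"
 shows "mero_local (EPf M c d E) w (int (card {n. c n + d n / 2 = w}) - int (card {n. c n - d n / 2 = w}))"
  and "finite {n. c n + d n / 2 = w}" "finite {n. c n - d n / 2 = w}"
proof -
 note M = pairsD(1)[OF p]
 obtain F where F: "finite F" "{n. norm (c n - w) < 2 * M + 2} \<subseteq> F"
   and Yh: "(%z. E z * exp (- (kapS M c d F z))) holomorphic_on ball w 2"
  using E unfolding Eloc_def by blast
 define Y where "Y = (%z. E z * exp (- (kapS M c d F z)))"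
 have inF: "n \<in> F" if "c n + d n / 2 = z \<or> c n - d n / 2 = z" "norm (z - w) < 1" for n z
 proof -
  have "norm (c n - w) <= norm (c n - z) + norm (z - w)" using norm_triangle_ineq[of "c n - z" "z - w"] by simp
  thus ?thesis using half_pair_dist[OF p that(1)] that(2) M F(2) by auto
 qed
 have sub: "{n. c n + d n / 2 = w} \<subseteq> F" "{n. c n - d n / 2 = w} \<subseteq> F" using inF[of _ w] by auto
 thus fin: "finite {n. c n + d n / 2 = w}" "finite {n. c n - d n / 2 = w}" using F(1) finite_subset by blast+
 define k where "k = int (card {n. c n + d n / 2 = w}) - int (card {n. c n - d n / 2 = w})"
 obtain r Z where Z: "0 < r" "r <= 1" "Z holomorphic_on ball w r" "!!z. z \<in> ball w r ==> Z z ~= 0"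
  "!!z. z \<in> ball w r ==> z ~= w ==> (\<forall>n\<in>F. c n + d n / 2 ~= z \<and> c n - d n / 2 ~= z) \<and>
    (\<Prod>n\<in>F. (c n + d n / 2 - z) / (c n - d n / 2 - z)) = (z - w) powi k * Z z"
  "{n. c n + d n / 2 = w} = {} ==> {n. c n - d n / 2 = w} = {} ==> (\<Prod>n\<in>F. (c n + d n / 2 - w) / (c n - d n / 2 - w)) = Z w"
  unfolding k_def by (rule rational_factor_local[OF F(1) sub]) blast
 have PPF: "E z * PP M c d z = Y z * (\<Prod>n\<in>F. (c n + d n / 2 - z) / (c n - d n / 2 - z))" if "z \<in> ball w 1" for z
 proof -
  have "{n. norm (c n - z) < 2 * M} \<subseteq> {n. norm (c n - w) < 2 * M + 2}"
  proof safe
   fix n assume "norm (c n - z) < 2 * M"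
   thus "norm (c n - w) < 2 * M + 2" using that norm_triangle_ineq[of "c n - z" "z - w"] by (simp add: dist_norm norm_minus_commute)
  qed
  hence "{n. norm (c n - z) < 2 * M} \<subseteq> F" using F(2) by (rule order_trans)
  thus ?thesis by (simp add: PP_split[OF p F(1)] Y_def)
 qed
 have "mero_local (EPf M c d E) w k" unfolding mero_local_def
 proof (intro exI[of _ r] exI[of _ "%z. Y z * Z z"] conjI ballI)
  show "r > 0" by (rule Z)
  show "(%z. Y z * Z z) holomorphic_on ball w r"
   unfolding Y_def by (rule holomorphic_on_mult[OF holomorphic_on_subset[OF Yh] Z(3)]) (use Z(2) in auto)
  show "Y z * Z z ~= 0" if "z \<in> ball w r" for z using Z(4)[OF that] E by (simp add: Y_def Eloc_def)
  show "EPf M c d E z = Some ((z - w) powi k * (Y z * Z z))" if z: "z \<in> ball w r - {w}" for z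
  proof -
   have zw: "norm (z - w) < 1" using z Z(2) by (simp add: dist_norm norm_minus_commute)
   have "z \<notin> range (%n. c n - d n / 2)" using Z(5)[of z] z inF[of _ z] zw by auto
   moreover have "E z * PP M c d z = (z - w) powi k * (Y z * Z z)"
    using PPF[of z] zw Z(5)[of z] z by (simp add: dist_norm norm_minus_commute)
   ultimately show ?thesis by (simp add: EPf_def)
  qed
  show "EPf M c d E w = (if k < 0 then None else if k = 0 then Some (Y w * Z w) else Some 0)"
  proof (cases "w \<in> range (%n. c n - d n / 2)")
   case True
   hence "{n. c n + d n / 2 = w} = {}" "{n. c n - d n / 2 = w} ~= {}" using disj by auto
   hence "k < 0" using fin(2) by (simp add: k_def card_gt_0_iff)
   thus ?thesis using True by (simp add: EPf_def)
  next
   case False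
   hence pe: "{n. c n - d n / 2 = w} = {}" by auto
   show ?thesis
   proof (cases "{n. c n + d n / 2 = w} = {}")
    case True
    thus ?thesis using False pe PPF[of w] Z(6) by (simp add: EPf_def k_def)
   next
    case nonempty: False
    then obtain n where n: "c n + d n / 2 = w" by blast
    have "k > 0" using nonempty fin(1) pe by (simp add: k_def card_gt_0_iff)
    moreover have "(\<Prod>n\<in>F. (c n + d n / 2 - w) / (c n - d n / 2 - w)) = 0"
    using n sub(1) F(1) by (intro prod_zero bexI[of _ n]) auto
    ultimately show ?thesis using False PPF[of w] by (simp add: EPf_def)
   qed
  qed
 qed
 thus "mero_local (EPf M c d E) w (int (card {n. c n + d n / 2 = w}) - int (card {n. c n - d n / 2 = w}))"
  by (simp add: k_def)
qed

lemma EPf_divisor: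
 assumes p: "pairs c d M N" and E: "Eloc M c d E" and disj: "!!n k. c n + d n / 2 ~= c k - d k / 2"
 shows "meromorphic_C (EPf M c d E)" "divisor_of (EPf M c d E) (%n. c n + d n / 2) (%n. c n - d n / 2)"
proof -
 note m = EPf_mero[OF p E disj]
 show "meromorphic_C (EPf M c d E)" unfolding meromorphic_C_def using m(1) by blast
 show "divisor_of (EPf M c d E) (%n. c n + d n / 2) (%n. c n - d n / 2)" unfolding divisor_of_def
 proof (intro allI conjI)
  fix w
  show "finite {n. c n + d n / 2 = w}" "finite {n. c n - d n / 2 = w}" using m by auto
  have "{n. c n + d n / 2 = w} = {} \<or> {n. c n - d n / 2 = w} = {}" using disj by auto
  hence "card {n. c n + d n / 2 = w} = 0 \<or> card {n. c n - d n / 2 = w} = 0" by (auto simp del: card_eq_0_iff)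
  thus "card {n. c n + d n / 2 = w} = nat (mero_order (EPf M c d E) w)"
    "card {n. c n - d n / 2 = w} = nat (- mero_order (EPf M c d E) w)"
   unfolding mero_order_eq[OF m(1)] by linarith+
 qed
qed

lemma pair_close:
 fixes c d :: "nat => complex"
 assumes "norm (c n + \<tau> - c m) < \<delta>" "norm (d n - d m) < \<delta>"
 shows "norm (c m + d m / 2 - (c n + d n / 2 + \<tau>)) <= 2 * \<delta>" "norm (c m - d m / 2 - (c n - d n / 2 + \<tau>)) <= 2 * \<delta>"
proof -
 have "0 < \<delta>" using assms(1) norm_ge_zero by (rule le_less_trans[rotated])
 hence h: "norm ((d n - d m) / 2) <= \<delta>" using assms(2) by (simp add: norm_divide)
 have eqs: "c m + d m / 2 - (c n + d n / 2 + \<tau>) = - (c n + \<tau> - c m) - (d n - d m) / 2"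
  "c m - d m / 2 - (c n - d n / 2 + \<tau>) = - (c n + \<tau> - c m) + (d n - d m) / 2" by (auto simp: field_simps)
 show "norm (c m + d m / 2 - (c n + d n / 2 + \<tau>)) <= 2 * \<delta>" "norm (c m - d m / 2 - (c n - d n / 2 + \<tau>)) <= 2 * \<delta>"
  unfolding eqs using h assms(1) norm_triangle_ineq4[of "- (c n + \<tau> - c m)" "(d n - d m) / 2"] norm_triangle_ineq[of "- (c n + \<tau> - c m)" "(d n - d m) / 2"]
  unfolding norm_minus_cancel by linarith+
qed

text \<open>Three regions: within \<delta>1 of a zero both values are small, within \<delta>1 of a
  pole both are large, and elsewhere their ratio is close to 1 by \<open>PP_ratio\<close> and the
  hypothesis on \<open>E\<close>. In the first two the permutation supplies a zero or pole near z +
  \<tau>, and separation of zeros from poles yields the size of \<open>PP\<close>.\<close>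

lemma EPf_almost_elliptic:
 assumes p: "pairs c d M N" and E: "Eloc M c d E" and sep: "0 < \<eta>\<^sub>0" "!!n k. \<eta>\<^sub>0 <= norm ((c n + d n / 2) - (c k - d k / 2))"
  and B: "!!z. norm (E z) <= B" "!!z. 1 / B <= norm (E z)" "0 < B"
  and rd: "!!\<epsilon>. 0 < \<epsilon> ==> rdense (%\<tau>. ap c d \<epsilon> \<tau> \<and> (\<forall>z. norm (E (z + \<tau>) / E z - 1) <= \<epsilon>))"
 shows "almost_elliptic (EPf M c d E)"
proof -
 define za where "za = (%n. c n + d n / 2)"
 define pb where "pb = (%n. c n - d n / 2)"
 have disj: "c n + d n / 2 ~= c k - d k / 2" for n k using sep(1) sep(2)[of n k] by auto
 have sep': "\<eta>\<^sub>0 <= norm ((c n + (- d n) / 2) - (c k - (- d k) / 2))" for n k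
  using sep(2)[of k n] by (simp add: norm_minus_commute)
 have E0: "E z ~= 0" for z using E by (simp add: Eloc_def)
 obtain K1 where K1: "0 < K1" "!!n z. norm (c n + d n / 2 - z) <= \<eta>\<^sub>0/2 ==> norm (c n + d n / 2 - z) <= 1 ==>
   norm (PP M c d z) <= K1 * norm (c n + d n / 2 - z)" by (rule PP_small_near_zero[OF p sep]) blast
 obtain K2 where K2: "0 < K2" "!!n z. norm (c n + (- d n) / 2 - z) <= \<eta>\<^sub>0/2 ==> norm (c n + (- d n) / 2 - z) <= 1 ==>
   norm (PP M c (%n. - d n) z) <= K2 * norm (c n + (- d n) / 2 - z)"
  by (rule PP_small_near_zero[OF pairs_minus[OF p] sep(1) sep']) blast
 have nonc: "EPf M c d E (za 0) ~= EPf M c d E (pb 0)"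
 proof -
  have "za 0 \<notin> range (%n. c n - d n / 2)" using disj by (auto simp: za_def)
  thus ?thesis by (simp add: EPf_def pb_def)
 qed
 have ae: "\<exists>L. \<forall>x. \<exists>\<tau>\<in>ball x L. \<forall>z. rhoS (EPf M c d E (z + \<tau>)) (EPf M c d E z) < \<epsilon>" if e: "0 < \<epsilon>" for \<epsilon>
 proof -
  define K where "K = max K1 K2"
  have K: "0 < K" "K1 <= K" "K2 <= K" using K1 by (auto simp: K_def)
  \<comment> \<open>If z is within \<delta>1 of a zero, then z + \<tau> is within 2 \<delta>1 of
    one; at that distance \<open>PP_small_near_zero\<close> applies and the values are at most
    \<epsilon>/8.\<close>
  define \<delta>1 where "\<delta>1 = min (\<eta>\<^sub>0/4) (min (1/2) (\<epsilon> / (16 * B * K)))"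
  have d1: "0 < \<delta>1" "2 * \<delta>1 <= \<eta>\<^sub>0/2" "2 * \<delta>1 <= 1" using sep e B K by (auto simp: \<delta>1_def)
  have d1e: "B * (K * (2 * \<delta>1)) <= \<epsilon>/8"
  proof -
   have "\<delta>1 <= \<epsilon> / (16 * B * K)" by (simp add: \<delta>1_def)
   hence "\<delta>1 * (16 * B * K) <= \<epsilon>" using B K by (simp only: pos_le_divide_eq mult_pos_pos zero_less_numeral)
   thus ?thesis by (simp add: mult_ac)
  qed
  define \<eta> where "\<eta> = min 1 (\<epsilon>/12)"
  have eta: "0 < \<eta>" "\<eta> <= 1" "6 * \<eta> <= \<epsilon>/2" using e by (auto simp: \<eta>_def)
  obtain \<delta> where del: "0 < \<delta>" "!!\<tau> \<sigma> z. bij \<sigma> ==> (!!n. norm (c n + \<tau> - c (\<sigma> n)) < \<delta> \<and> norm (d n - d (\<sigma> n)) < \<delta>) ==>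
   (!!n. \<delta>1 <= norm (c n + d n / 2 - z) \<and> \<delta>1 <= norm (c n - d n / 2 - z)) ==>
   PP M c d z ~= 0 \<and> norm (PP M c d (z + \<tau>) / PP M c d z - 1) <= \<eta>"
   by (rule PP_ratio[OF p d1(1) eta(1)]) blast
  define \<epsilon>' where "\<epsilon>' = min (min \<delta> (\<delta>1/4)) \<eta>"
  have "\<epsilon>' <= \<delta>1/4" by (simp add: \<epsilon>'_def)
  hence e': "0 < \<epsilon>'" "\<epsilon>' <= \<delta>" "2 * \<epsilon>' <= \<delta>1" "\<epsilon>' <= \<eta>" "2 * \<epsilon>' < \<delta>1" using del d1 eta by (auto simp: \<epsilon>'_def)
  have close: "rhoS (EPf M c d E (z + \<tau>)) (EPf M c d E z) < \<epsilon>"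
   if t: "ap c d \<epsilon>' \<tau>" "!!z. norm (E (z + \<tau>) / E z - 1) <= \<epsilon>'" for \<tau> z
  proof -
   obtain \<sigma> where s: "bij \<sigma>" "!!n. norm (c n + \<tau> - c (\<sigma> n)) < \<epsilon>'" "!!n. norm (d n - d (\<sigma> n)) < \<epsilon>'"
    using t(1) unfolding ap_def by metis
   have shift: "norm (za (\<sigma> n) - (z + \<tau>)) <= norm (za n - z) + \<delta>1" "norm (pb (\<sigma> n) - (z + \<tau>)) <= norm (pb n - z) + \<delta>1" for n
   proof -
    have "norm (za (\<sigma> n) - (za n + \<tau>)) <= \<delta>1" "norm (pb (\<sigma> n) - (pb n + \<tau>)) <= \<delta>1"
    using pair_close[of c n \<tau> "\<sigma> n" \<epsilon>' d, OF s(2,3)] e'(3) by (auto simp: za_def pb_def)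
    thus "norm (za (\<sigma> n) - (z + \<tau>)) <= norm (za n - z) + \<delta>1" "norm (pb (\<sigma> n) - (z + \<tau>)) <= norm (pb n - z) + \<delta>1"
    using norm_triangle_ineq[of "za (\<sigma> n) - (za n + \<tau>)" "za n - z"] norm_triangle_ineq[of "pb (\<sigma> n) - (pb n + \<tau>)" "pb n - z"]
    by (simp_all add: algebra_simps)
   qed
   have zerob: "\<exists>u. EPf M c d E x = Some u \<and> norm u <= \<epsilon>/8" if n: "norm (za n - x) <= 2 * \<delta>1" for n x
   proof -
    have "x \<notin> range (%n. c n - d n / 2)"
    proof
    assume "x \<in> range (%n. c n - d n / 2)"
    then obtain k where "x = c k - d k / 2" by auto
    thus False using sep(2)[of n k] n d1 sep(1) by (simp add: za_def)
    qed
    moreover have "norm (PP M c d x) <= K1 * norm (za n - x)" using K1(2)[of n x] n d1 by (simp add: za_def)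
    hence "norm (PP M c d x) <= K * (2 * \<delta>1)" using K n K1 by (smt (verit) mult_mono norm_ge_zero)
    hence "norm (E x) * norm (PP M c d x) <= B * (K * (2 * \<delta>1))" using B by (intro mult_mono) auto
    ultimately show ?thesis using d1e by (simp add: EPf_def norm_mult)
   qed
   have poleb: "EPf M c d E x = None \<or> (\<exists>u. EPf M c d E x = Some u \<and> u ~= 0 \<and> 2 / norm u <= \<epsilon>/4)" if n: "norm (pb n - x) <= 2 * \<delta>1" for n x
   proof (cases "x \<in> range (%n. c n - d n / 2)")
    case False
    have "c k + d k / 2 ~= x" for k
    proof
    assume "c k + d k / 2 = x"
    thus False using sep(2)[of k n] n d1 sep(1) by (simp add: pb_def norm_minus_commute)
    qed
    hence P0: "PP M c d x ~= 0" using False by (intro PP_nonzero) auto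
    have "norm (PP M c (%n. - d n) x) <= K2 * norm (pb n - x)" using K2(2)[of n x] n d1 by (simp add: pb_def)
    hence "norm (inverse (PP M c d x)) <= K * (2 * \<delta>1)" unfolding PP_minus using K n K2 by (smt (verit) mult_mono norm_ge_zero)
    moreover have "norm (inverse (E x)) <= B"
    proof -
    have "1 <= norm (E x) * B" using B(2)[of x] B(3) by (simp add: pos_divide_le_eq)
    thus ?thesis using E0[of x] unfolding norm_inverse by (simp add: inverse_eq_divide pos_divide_le_eq mult.commute)
    qed
    ultimately have "norm (inverse (E x)) * norm (inverse (PP M c d x)) <= B * (K * (2 * \<delta>1))" using B(3) by (intro mult_mono) auto
    hence "norm (inverse (E x * PP M c d x)) <= \<epsilon>/8" using d1e by (simp add: norm_mult norm_inverse)
    moreover have "2 / norm y = 2 * norm (inverse y)" for y :: complex by (simp only: norm_inverse divide_inverse)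
    ultimately have "2 / norm (E x * PP M c d x) <= \<epsilon>/4" by (simp only:)
    thus ?thesis using False P0 E0[of x] by (simp add: EPf_def)
   qed (simp add: EPf_def)
   have "(\<exists>n. norm (za n - z) < \<delta>1) \<or> (\<exists>n. norm (pb n - z) < \<delta>1) \<or> (\<forall>n. \<delta>1 <= norm (za n - z) \<and> \<delta>1 <= norm (pb n - z))"
    by (auto simp: not_less[symmetric])
   then consider n where "norm (za n - z) < \<delta>1" | n where "norm (pb n - z) < \<delta>1"
    | "!!n. \<delta>1 <= norm (za n - z) \<and> \<delta>1 <= norm (pb n - z)" by blast
   thus ?thesis
   proof cases
    case (1 n)
    obtain u where u: "EPf M c d E z = Some u" "norm u <= \<epsilon>/8" using zerob[of n z] 1 d1 by auto
    obtain v where v: "EPf M c d E (z + \<tau>) = Some v" "norm v <= \<epsilon>/8" using zerob[of "\<sigma> n" "z + \<tau>"] shift(1)[of n] 1 d1 by auto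
    have "rhoS (Some v) (Some u) <= 2 * norm (v - u)" by (rule rhoS_Some_le)
    also have "... <= 2 * (\<epsilon>/8 + \<epsilon>/8)" using u v norm_triangle_ineq4[of v u] by simp
    finally show ?thesis using u v e by simp
   next
    case (2 n)
    have u: "EPf M c d E z = None \<or> (\<exists>u. EPf M c d E z = Some u \<and> u ~= 0 \<and> 2 / norm u <= \<epsilon>/4)" using poleb[of n z] 2 d1 by auto
    have v: "EPf M c d E (z + \<tau>) = None \<or> (\<exists>u. EPf M c d E (z + \<tau>) = Some u \<and> u ~= 0 \<and> 2 / norm u <= \<epsilon>/4)"
    using poleb[of "\<sigma> n" "z + \<tau>"] shift(2)[of n] 2 d1 by auto
    have le: "rhoS x y <= \<epsilon>/2" if "x = None \<or> (\<exists>u. x = Some u \<and> u ~= 0 \<and> 2 / norm u <= \<epsilon>/4)"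
    "y = None \<or> (\<exists>u. y = Some u \<and> u ~= 0 \<and> 2 / norm u <= \<epsilon>/4)" for x y
    proof -
    have N1: "rhoS None (Some v) <= \<epsilon>/2" if "v ~= 0" "2 / norm v <= \<epsilon>/4" for v using rhoS_None_le(1)[OF that(1)] that(2) e by linarith
    have N2: "rhoS (Some v) None <= \<epsilon>/2" if "v ~= 0" "2 / norm v <= \<epsilon>/4" for v using rhoS_None_le(2)[OF that(1)] that(2) e by linarith
    have N3: "rhoS (Some u) (Some v) <= \<epsilon>/2" if "u ~= 0" "v ~= 0" "2 / norm u <= \<epsilon>/4" "2 / norm v <= \<epsilon>/4" for u v
    using rhoS_Some_le(3)[OF that(1,2)] that(3,4) by linarith
    show ?thesis using that N1 N2 N3 rhoS_None_le(3) e by (cases x; cases y) auto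
    qed
    show ?thesis using le[OF v u] e by linarith
   next
    case 3
    have P: "PP M c d z ~= 0 \<and> norm (PP M c d (z + \<tau>) / PP M c d z - 1) <= \<eta>"
    proof (rule del(2)[OF s(1)])
    show "norm (c n + \<tau> - c (\<sigma> n)) < \<delta> \<and> norm (d n - d (\<sigma> n)) < \<delta>" for n using s(2,3)[of n] e' by auto
    show "\<delta>1 <= norm (c n + d n / 2 - z) \<and> \<delta>1 <= norm (c n - d n / 2 - z)" for n using 3[of n] by (simp add: za_def pb_def)
    qed
    have np: "z \<notin> range (%n. c n - d n / 2)"
    proof
    assume "z \<in> range (%n. c n - d n / 2)"
    then obtain n where "z = pb n" by (auto simp: pb_def)
    thus False using 3[of n] d1 by simp
    qed
    \<comment> \<open>A pole at z + \<tau> would come, under \<sigma>, from a pole within \<delta>1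
      of z.\<close>
    have np2: "z + \<tau> \<notin> range (%n. c n - d n / 2)"
    proof
    assume "z + \<tau> \<in> range (%n. c n - d n / 2)"
    then obtain m where m: "z + \<tau> = pb m" by (auto simp: pb_def)
    hence "PP M c d (z + \<tau>) = 0"
    by (intro PP_zero[OF p, of m]) (simp add: pb_def)
    hence "1 <= \<eta>" using P by simp
    obtain n where "m = \<sigma> n" using s(1) by (metis bij_pointE)
    have "norm (pb n - z) <= norm (pb n + \<tau> - pb m) + norm (pb m - (z + \<tau>))"
    using norm_triangle_ineq[of "pb n + \<tau> - pb m" "pb m - (z + \<tau>)"] by (simp add: algebra_simps)
    also have "norm (pb n + \<tau> - pb m) < \<delta>1"
    proof -
    have "norm (pb m - (pb n + \<tau>)) <= 2 * \<epsilon>'"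
    using pair_close(2)[of c n \<tau> "\<sigma> n" \<epsilon>' d, OF s(2,3)] \<open>m = \<sigma> n\<close> by (simp add: pb_def)
    thus ?thesis using e'(5) by (simp add: norm_minus_commute)
    qed
    finally show False using m 3[of n] by simp
    qed
    define p' where "p' = PP M c d (z + \<tau>) / PP M c d z - 1"
    define q' where "q' = E (z + \<tau>) / E z - 1"
    have pq: "norm p' <= \<eta>" "norm q' <= \<eta>" using P t(2)[of z] e'(4) unfolding p'_def q'_def by auto
    define u where "u = E z * PP M c d z"
    define v where "v = E (z + \<tau>) * PP M c d (z + \<tau>)"
    have u0: "u ~= 0" using P E0 by (simp add: u_def)
    have "v - u = u * (p' + q' + p' * q')" using P E0[of z] by (simp add: u_def v_def p'_def q'_def field_simps)
    hence "norm (u - v) / norm u = norm (p' + q' + p' * q')" using u0 by (simp add: norm_mult norm_minus_commute[of u])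
    also have "... <= norm p' + norm q' + norm p' * norm q'"
    by (metis norm_mult norm_triangle_ineq norm_triangle_mono order_refl)
    also have "norm p' * norm q' <= 1 * \<eta>" using pq eta by (intro mult_mono) auto
    finally have "norm (u - v) / norm u <= 3 * \<eta>" using pq by linarith
    hence "rhoS (Some u) (Some v) <= 6 * \<eta>" using rhoS_Some_le(2)[OF u0, of v] by linarith
    moreover have "rhoS (Some v) (Some u) = rhoS (Some u) (Some v)" by (simp add: rhoS_def norm_minus_commute mult.commute)
    ultimately show ?thesis using np np2 eta e by (simp add: EPf_def u_def v_def)
   qed
  qed
  have "rdense (%\<tau>. \<forall>z. rhoS (EPf M c d E (z + \<tau>)) (EPf M c d E z) < \<epsilon>)"
   by (rule rdense_mono[OF rd[OF e'(1)]], intro allI close) auto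
  thus ?thesis unfolding rdense_def .
 qed
 show ?thesis unfolding almost_elliptic_def using EPf_divisor(1)[OF p E disj] nonc ae by blast
qed

text \<open>The factor exp (\<beta> z / 2) and the density conj \<beta> / (2 pi) are matched here:
  with this \<gamma> the term \<open>\<gamma> * of_real pi * cnj z\<close> is the conjugate of
  \<beta> z / 2, and \<beta> z / 2 minus its conjugate is i Im (\<beta> z).\<close>

lemma exponent_split: "\<beta> * z / 2 + TT M c d z = \<i> * of_real (Im (\<beta> * z)) + Phi M c d (cnj \<beta> / of_real (2 * pi)) z"
proof -
 have e: "\<i> * of_real (Im (\<beta> * z)) = (\<beta> * z - cnj \<beta> * cnj z) / 2" by (simp add: complex_eq_iff)
 have g: "cnj \<beta> / of_real (2 * pi) * of_real pi = cnj \<beta> / 2" by simp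
 show ?thesis unfolding Phi_def e g by (simp add: diff_divide_distrib)
qed

text \<open>By the splitting, \<open>E\<close> is the phase cis (Im (\<beta> z)) times the
  exponential of the bounded, almost periodic \<open>Phi\<close>. An almost period \<tau> of the
  pairs need not make cis (Im (\<beta> \<tau>)) close to 1; the pigeonhole lemma with phases as
  colours supplies those that do.\<close>

theorem almost_elliptic_exists:
 assumes p: "pairs c d M N" and D: "dens c d (cnj \<beta> / of_real (2 * pi)) C"
  and sep: "0 < \<eta>\<^sub>0" "!!n k. \<eta>\<^sub>0 <= norm ((c n + d n / 2) - (c k - d k / 2))"
  and bd: "!!z. norm (Phi M c d (cnj \<beta> / of_real (2 * pi)) z) <= B"
  and rd: "!!\<delta>. 0 < \<delta> ==> rdense (ap c d \<delta>)"
 shows "\<exists>f. almost_elliptic f \<and> divisor_of f (%n. c n + d n / 2) (%n. c n - d n / 2)"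
proof -
 define \<Phi> where "\<Phi> = Phi M c d (cnj \<beta> / of_real (2 * pi))"
 define E where "E = (%z. exp (\<beta> * z / 2 + TT M c d z))"
 have E2: "E z = cis (Im (\<beta> * z)) * exp (\<Phi> z)" for z
  by (simp add: E_def exponent_split \<Phi>_def exp_add cis_conv_exp)
 have Eloc: "Eloc M c d E" unfolding Eloc_def
 proof (intro conjI allI)
  show "E z ~= 0" for z by (simp add: E_def)
  fix w
  have fin: "finite {n. norm (c n - w) < 2 * M + 2}" by (rule pairs_finite(2)[OF p])
  have "(%z. exp (\<beta> * z / 2 + (TT M c d z - (\<Sum>n\<in>{n. norm (c n - w) < 2 * M + 2}. kap M (d n) (c n - z))))) holomorphic_on ball w 2"
   by (intro holomorphic_intros TT_holomorphic[OF p D fin]) auto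
  hence "(%z. E z * exp (- (\<Sum>n\<in>{n. norm (c n - w) < 2 * M + 2}. kap M (d n) (c n - z)))) holomorphic_on ball w 2"
   by (simp add: E_def exp_add[symmetric] diff_conv_add_uminus add.assoc del: add_uminus_conv_diff)
  thus "\<exists>F. finite F \<and> {n. norm (c n - w) < 2 * M + 2} \<subseteq> F \<and>
   (%z. E z * exp (- (kapS M c d F z))) holomorphic_on ball w 2" using fin by blast
 qed
 have disj: "c n + d n / 2 ~= c k - d k / 2" for n k using sep(1) sep(2)[of n k] by auto
 have nE: "norm (E z) = exp (Re (\<Phi> z))" for z by (simp add: E2 norm_mult)
 have Reb: "\<bar>Re (\<Phi> z)\<bar> <= B" for z using abs_Re_le_cmod[of "\<Phi> z"] bd[of z] unfolding \<Phi>_def by linarith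
 have "almost_elliptic (EPf M c d E)"
 proof (rule EPf_almost_elliptic[OF p Eloc sep, of "exp B"])
  show "norm (E z) <= exp B" for z unfolding nE using Reb[of z] by simp
  show "1 / exp B <= norm (E z)" for z unfolding nE using Reb[of z] by (simp add: exp_minus[symmetric] divide_inverse)
  fix \<epsilon> :: real assume e: "0 < \<epsilon>"
  define \<eta> where "\<eta> = min (1/4) (\<epsilon>/7)"
  have eta: "0 < \<eta>" "\<eta> <= 1/4" "7 * \<eta> <= \<epsilon>" using e by (auto simp: \<eta>_def)
  obtain \<delta> where del: "0 < \<delta>" "!!\<tau> x. ap c d \<delta> \<tau> ==> norm (Phi M c d (cnj \<beta> / of_real (2 * pi)) (x + \<tau>) - Phi M c d (cnj \<beta> / of_real (2 * pi)) x) <= \<eta>"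
   by (rule Phi_almost_periodic[OF p D bd rd[unfolded rdense_def] eta(1)]) blast+
  define \<delta>' where "\<delta>' = min \<epsilon> \<delta> / 2"
  have d': "0 < \<delta>'" "\<delta>' + \<delta>' <= \<epsilon>" "\<delta>' + \<delta>' <= \<delta>" using e del by (auto simp: \<delta>'_def)
  define m where "m = 2 / \<eta>"
  have m: "0 < m" "2 / m = \<eta>" using eta by (auto simp: m_def)
  define col where "col = (%\<tau>. cell m (cis (Im (\<beta> * \<tau>))))"
  have "rdense (%\<tau>. \<exists>\<tau>1 \<tau>2. ap c d \<delta>' \<tau>1 \<and> ap c d \<delta>' \<tau>2 \<and> col \<tau>1 = col \<tau>2 \<and> \<tau> = \<tau>1 - \<tau>2)"
   by (rule rdense_colour[OF rd[OF d'(1)] cell_finite[OF m(1), of 1]]) (auto simp: col_def)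
  thus "rdense (%\<tau>. ap c d \<epsilon> \<tau> \<and> (\<forall>z. norm (E (z + \<tau>) / E z - 1) <= \<epsilon>))"
  proof (rule rdense_mono)
   fix \<tau> assume "\<exists>\<tau>1 \<tau>2. ap c d \<delta>' \<tau>1 \<and> ap c d \<delta>' \<tau>2 \<and> col \<tau>1 = col \<tau>2 \<and> \<tau> = \<tau>1 - \<tau>2"
   then obtain \<tau>1 \<tau>2 where t: "ap c d \<delta>' \<tau>1" "ap c d \<delta>' \<tau>2" "col \<tau>1 = col \<tau>2" "\<tau> = \<tau>1 - \<tau>2" by blast
   have apt: "ap c d (\<delta>' + \<delta>') \<tau>" using ap_add[OF t(1) ap_minus[OF t(2)]] t(4) by simp
   have "norm (cis (Im (\<beta> * \<tau>1)) - cis (Im (\<beta> * \<tau>2))) <= \<eta>"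
    using cell_close[OF m(1), of "cis (Im (\<beta> * \<tau>1))" "cis (Im (\<beta> * \<tau>2))"] t(3) m(2) by (simp add: col_def)
   moreover have "cis (Im (\<beta> * \<tau>1)) - cis (Im (\<beta> * \<tau>2)) = cis (Im (\<beta> * \<tau>2)) * (cis (Im (\<beta> * \<tau>)) - 1)"
    by (simp add: t(4) right_diff_distrib cis_mult)
   ultimately have u: "norm (cis (Im (\<beta> * \<tau>)) - 1) <= \<eta>" by (simp add: norm_mult)
   have "norm (E (z + \<tau>) / E z - 1) <= \<epsilon>" for z
   proof -
    have ph: "norm (\<Phi> (z + \<tau>) - \<Phi> z) <= \<eta>" unfolding \<Phi>_def by (rule del(2)[OF ap_mono[OF apt d'(3)]])
    have "E (z + \<tau>) / E z = (1 + (cis (Im (\<beta> * \<tau>)) - 1)) / (1 + 0) * exp (\<Phi> (z + \<tau>) - \<Phi> z)"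
    by (simp add: E2 exp_diff distrib_left cis_mult[symmetric])
    hence "norm (E (z + \<tau>) / E z - 1) <= 7 * \<eta>" using factor_ratio_bound[OF u _ ph eta(2), of 0] eta by simp
    thus ?thesis using eta by linarith
   qed
   thus "ap c d \<epsilon> \<tau> \<and> (\<forall>z. norm (E (z + \<tau>) / E z - 1) <= \<epsilon>)" using ap_mono[OF apt d'(2)] by blast
  qed
 qed simp
 thus ?thesis using EPf_divisor(2)[OF p Eloc disj] by blast
qed

subsection \<open>The sphere\<close>

text \<open>Inverse stereographic projection onto the unit sphere with infinity at the north pole.
  \<open>rhoS\<close> becomes the Euclidean distance, which yields its triangle inequality.\<close>

definition ster :: "complex option => complex \<times> real" where
 "ster x = (case x of None => (0, 1) | Some u => (2 * u / of_real (1 + (norm u)^2), ((norm u)^2 - 1) / (1 + (norm u)^2)))"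

lemma chord_identity:
 fixes a b x y :: real
 shows "(2*a/(1+(a^2+b^2)) - 2*x/(1+(x^2+y^2)))^2 + (2*b/(1+(a^2+b^2)) - 2*y/(1+(x^2+y^2)))^2
  + ((a^2+b^2-1)/(1+(a^2+b^2)) - (x^2+y^2-1)/(1+(x^2+y^2)))^2 = 4*((a-x)^2+(b-y)^2)/((1+(a^2+b^2))*(1+(x^2+y^2)))"
proof -
 define P where "P = 1 + (a^2+b^2)"
 define Q where "Q = 1 + (x^2+y^2)"
 have P: "P ~= 0" and Q: "Q ~= 0" unfolding P_def Q_def by (smt (verit) zero_le_power2)+
 have pq: "a^2+b^2-1 = P - 2" "x^2+y^2-1 = Q - 2" by (auto simp: P_def Q_def)
 have key: "(2*a*Q - 2*x*P)^2 + (2*b*Q - 2*y*P)^2 + ((P-2)*Q - (Q-2)*P)^2 = 4*((a-x)^2+(b-y)^2)*(P*Q)"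
  unfolding P_def Q_def by algebra
 have "(2*a/P - 2*x/Q)^2 + (2*b/P - 2*y/Q)^2 + ((P-2)/P - (Q-2)/Q)^2
   = ((2*a*Q - 2*x*P)^2 + (2*b*Q - 2*y*P)^2 + ((P-2)*Q - (Q-2)*P)^2) / (P*Q)^2"
  using P Q by (simp add: diff_frac_eq power_divide add_divide_distrib)
 also have "... = 4*((a-x)^2+(b-y)^2)/(P*Q)" unfolding key using P Q by (simp add: power2_eq_square)
 finally show ?thesis unfolding pq P_def[symmetric] Q_def[symmetric] .
qed

lemma rhoS_ster: "rhoS x y = dist (ster x) (ster y)"
proof -
 have SS: "rhoS (Some u) (Some v) = dist (ster (Some u)) (ster (Some v))" for u v
 proof -
  have pos: "0 < 1 + (norm u)^2" "0 < 1 + (norm v)^2" by (auto intro: add_pos_nonneg)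
  have "(dist (ster (Some u)) (ster (Some v)))^2 = 4 * (norm (u - v))^2 / ((1 + (norm u)^2) * (1 + (norm v)^2))"
  proof -
   have "(dist (ster (Some u)) (ster (Some v)))^2 = (norm (2 * u / of_real (1 + (norm u)^2) - 2 * v / of_real (1 + (norm v)^2)))^2
    + (((norm u)^2 - 1) / (1 + (norm u)^2) - ((norm v)^2 - 1) / (1 + (norm v)^2))^2"
    by (simp add: ster_def dist_prod_def dist_norm del: of_real_add of_real_power)
   also have "(norm (2 * u / of_real (1 + (norm u)^2) - 2 * v / of_real (1 + (norm v)^2)))^2
    = (2 * Re u / (1 + (norm u)^2) - 2 * Re v / (1 + (norm v)^2))^2 + (2 * Im u / (1 + (norm u)^2) - 2 * Im v / (1 + (norm v)^2))^2"
    unfolding cmod_power2 by (simp add: Re_divide_of_real Im_divide_of_real del: of_real_add of_real_power)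
   finally show ?thesis unfolding cmod_power2 using chord_identity[of "Re u" "Im u" "Re v" "Im v"] by simp
  qed
  moreover have "(rhoS (Some u) (Some v))^2 = 4 * (norm (u - v))^2 / ((1 + (norm u)^2) * (1 + (norm v)^2))"
   using pos by (simp add: rhoS_def power_divide power_mult_distrib)
  moreover have "0 <= rhoS (Some u) (Some v)" using pos by (simp add: rhoS_def)
  ultimately show ?thesis by (metis power2_eq_iff_nonneg zero_le_dist)
 qed
 have SN: "rhoS (Some u) None = dist (ster (Some u)) (ster None)" for u
 proof -
  have pos: "0 < 1 + (norm u)^2" by (auto intro: add_pos_nonneg)
  define U where "U = (norm u)^2"
  have U: "0 < 1 + U" using pos by (simp add: U_def)
  have "(dist (ster (Some u)) (ster None))^2 = (norm (2 * u / of_real (1 + U)))^2 + ((U - 1) / (1 + U) - 1)^2"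
   by (simp add: ster_def dist_prod_def dist_norm U_def del: of_real_add of_real_power)
  also have "(norm (2 * u / of_real (1 + U)))^2 = 4 * U / (1 + U)^2"
   unfolding norm_divide norm_of_real using U by (simp add: norm_mult power_divide power_mult_distrib U_def)
  also have "(U - 1) / (1 + U) - 1 = - 2 / (1 + U)" using U by (simp add: field_simps)
  also have "4 * U / (1 + U)^2 + (- 2 / (1 + U))^2 = 4 * (1 + U) / (1 + U)^2" by (simp add: power_divide add_divide_distrib)
  also have "... = 4 / (1 + U)" unfolding power2_eq_square by (rule nonzero_mult_divide_mult_cancel_right) (use U in auto)
  finally have "(dist (ster (Some u)) (ster None))^2 = 4 / (1 + U)" .
  moreover have "(rhoS (Some u) None)^2 = 4 / (1 + U)" using U by (simp add: rhoS_def power_divide U_def)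
  moreover have "0 <= rhoS (Some u) None" using pos by (simp add: rhoS_def)
  ultimately show ?thesis by (metis power2_eq_iff_nonneg zero_le_dist)
 qed
 have NS: "rhoS None (Some u) = rhoS (Some u) None" for u by (simp add: rhoS_def)
 show ?thesis using SS SN NS by (cases x; cases y) (auto simp: rhoS_def dist_commute)
qed

lemma rhoS_triangle: "rhoS x z <= rhoS x y + rhoS y z" and rhoS_sym: "rhoS x y = rhoS y x"
 unfolding rhoS_ster by (auto simp: dist_commute intro: dist_triangle)

text \<open>The same projection in the coordinate 1 / u, for continuity at poles.\<close>

definition ster' :: "complex => complex \<times> real" where
 "ster' v = (2 * cnj v / of_real (1 + (norm v)^2), (1 - (norm v)^2) / (1 + (norm v)^2))"

lemma ster'_inverse: "u ~= 0 ==> ster (Some u) = ster' (inverse u)" and ster'_0: "ster None = ster' 0"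
proof -
 show "ster None = ster' 0" by (simp add: ster_def ster'_def)
 assume u: "u ~= 0"
 define U where "U = (norm u)^2"
 have U: "U > 0" "1 + U ~= 0" "1 + 1/U = (1 + U)/U" using u by (auto simp: U_def field_simps add_nonneg_eq_0_iff)
 have n: "(norm (inverse u))^2 = 1 / U" by (simp add: U_def norm_inverse power_inverse divide_inverse)
 have uu: "u * cnj u = of_real U" unfolding U_def by (rule complex_norm_square[symmetric])
 have cj: "cnj (inverse u) = u / of_real U" unfolding uu[symmetric] using u by (simp add: inverse_eq_divide)
 have "2 * cnj (inverse u) / of_real (1 + 1/U) = 2 * u / of_real (1 + U)"
  unfolding U(3) cj using U(1,2) by (simp add: divide_simps del: of_real_add)
 moreover have "1 - 1/U = (U - 1)/U" using U by (simp add: diff_divide_distrib)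
 hence "(1 - 1/U) / (1 + 1/U) = (U - 1) / (1 + U)" unfolding U(3) using U by simp
 ultimately show "ster (Some u) = ster' (inverse u)" unfolding ster'_def n by (simp add: ster_def U_def)
qed

lemma continuous_ster_Some:
 assumes "isCont g w" shows "isCont (%z. ster (Some (g z))) w"
proof -
 have "1 + (norm u)^2 ~= 0" for u :: complex by (smt (verit) zero_le_power2)
 thus ?thesis using assms unfolding ster_def by (auto intro!: continuous_intros simp del: of_real_add of_real_power)
qed

lemma continuous_ster':
 assumes "isCont g w" shows "isCont (%z. ster' (g z)) w"
proof -
 have "1 + (norm u)^2 ~= 0" for u :: complex by (smt (verit) zero_le_power2)
 thus ?thesis using assms unfolding ster'_def by (auto intro!: continuous_intros simp del: of_real_add of_real_power)
qed

lemma mero_local_continuous: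
 assumes "mero_local f w k" shows "isCont (%z. ster (f z)) w"
proof -
 obtain r g where g: "r > 0" "g holomorphic_on ball w r" "!!z. z \<in> ball w r ==> g z ~= 0"
   "!!z. z \<in> ball w r - {w} ==> f z = Some ((z - w) powi k * g z)"
   and fw: "f w = (if k < 0 then None else if k = 0 then Some (g w) else Some 0)" using assms unfolding mero_local_def by blast
 have c: "isCont g w" using holomorphic_on_imp_continuous_on[OF g(2)] g(1) by (auto simp: continuous_on_eq_continuous_at)
 have gw: "g w ~= 0" using g(1,3) by auto
 have ev: "eventually (%z. z \<in> ball w r) (nhds w)" using g(1) by (intro eventually_nhds_in_open) auto
 show ?thesis
 proof (cases "k < 0")
  case True
  define m where "m = nat (- k)"
  have m: "k = - int m" "m > 0" using True by (auto simp: m_def)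
  have "isCont (%z. ster' ((z - w) ^ m * inverse (g z))) w"
   using c gw by (intro continuous_ster' continuous_intros) auto
  moreover have "eventually (%z. ster' ((z - w) ^ m * inverse (g z)) = ster (f z)) (nhds w)"
   using ev
  proof eventually_elim
   fix z assume z: "z \<in> ball w r"
   show "ster' ((z - w) ^ m * inverse (g z)) = ster (f z)"
   proof (cases "z = w")
    case True thus ?thesis using fw m \<open>k < 0\<close> by (simp add: ster'_0 power_0_left)
   next
    case False
    hence "f z = Some ((z - w) powi k * g z)" using g(4) z by simp
    moreover have "inverse ((z - w) powi k * g z) = (z - w) ^ m * inverse (g z)"
    by (simp add: m power_int_minus power_int_of_nat)
    moreover have "(z - w) powi k * g z ~= 0" using False g(3)[OF z] by simp
    ultimately show ?thesis using ster'_inverse by metis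
   qed
  qed
  ultimately show ?thesis by (rule iffD1[OF isCont_cong, rotated])
 next
  case False
  define m where "m = nat k"
  have m: "k = int m" using False by (auto simp: m_def)
  have "isCont (%z. ster (Some ((z - w) ^ m * g z))) w"
   using c by (intro continuous_ster_Some continuous_intros) auto
  moreover have "eventually (%z. ster (Some ((z - w) ^ m * g z)) = ster (f z)) (nhds w)"
   using ev
  proof eventually_elim
   fix z assume z: "z \<in> ball w r"
   show "ster (Some ((z - w) ^ m * g z)) = ster (f z)"
    using g(4)[of z] z fw m by (cases "z = w"; cases "m = 0") (auto simp: power_int_of_nat power_0_left)
  qed
  ultimately show ?thesis by (rule iffD1[OF isCont_cong, rotated])
 qed
qed

definition sph_uc :: "(complex => complex option) => bool" where
 "sph_uc f \<longleftrightarrow> (\<forall>\<epsilon>>0. \<exists>\<delta>>0. \<forall>z z'. norm (z - z') < \<delta> \<longrightarrow> rhoS (f z) (f z') < \<epsilon>)"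

text \<open>Uniform continuity on a compact disc is transported by almost periods to the whole
  plane.\<close>

lemma almost_elliptic_sph_uc:
 assumes "almost_elliptic f" shows "sph_uc f"
 unfolding sph_uc_def
proof (intro allI impI)
 fix \<epsilon> :: real assume e: "\<epsilon> > 0"
 obtain L where L: "!!x. \<exists>\<tau>\<in>ball x L. \<forall>z. rhoS (f (z + \<tau>)) (f z) < \<epsilon>/3"
  using assms e unfolding almost_elliptic_def by (meson divide_pos_pos zero_less_numeral)
 have "continuous_on UNIV (%z. ster (f z))"
  using assms mero_local_continuous unfolding almost_elliptic_def meromorphic_C_def
  by (meson continuous_at_imp_continuous_on)
 hence "continuous_on (cball 0 (\<bar>L\<bar> + 1)) (%z. ster (f z))" by (rule continuous_on_subset) auto
 hence "uniformly_continuous_on (cball 0 (\<bar>L\<bar> + 1)) (%z. ster (f z))" by (intro compact_uniformly_continuous) auto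
 then obtain \<delta> where d: "\<delta> > 0" "!!z z'. z \<in> cball 0 (\<bar>L\<bar> + 1) ==> z' \<in> cball 0 (\<bar>L\<bar> + 1) ==> dist z' z < \<delta> ==> dist (ster (f z')) (ster (f z)) < \<epsilon>/3"
  unfolding uniformly_continuous_on_def using e by (metis divide_pos_pos zero_less_numeral)
 show "\<exists>\<delta>>0. \<forall>z z'. norm (z - z') < \<delta> \<longrightarrow> rhoS (f z) (f z') < \<epsilon>"
 proof (intro exI[of _ "min \<delta> 1"] conjI allI impI)
  show "0 < min \<delta> 1" using d by simp
  fix z z' :: complex assume zz: "norm (z - z') < min \<delta> 1"
  obtain \<tau> where t: "\<tau> \<in> ball (- z) L" "!!y. rhoS (f (y + \<tau>)) (f y) < \<epsilon>/3" using L by blast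
  have n: "norm (z + \<tau>) <= \<bar>L\<bar>" using t(1) by (simp add: dist_norm norm_minus_commute) (metis (no_types) abs_ge_self add.commute less_imp_le minus_diff_eq norm_minus_cancel order_trans add_uminus_conv_diff diff_minus_eq_add)
  hence n': "norm (z' + \<tau>) <= \<bar>L\<bar> + 1" using zz norm_triangle_ineq[of "z + \<tau>" "z' - z"] by (simp add: norm_minus_commute add.commute)
  have "dist (ster (f (z + \<tau>))) (ster (f (z' + \<tau>))) < \<epsilon>/3"
  proof (rule d(2))
   show "z' + \<tau> \<in> cball 0 (\<bar>L\<bar> + 1)" "z + \<tau> \<in> cball 0 (\<bar>L\<bar> + 1)" using n n' by (simp_all add: mem_cball_0)
   show "dist (z + \<tau>) (z' + \<tau>) < \<delta>" using zz by (simp add: dist_norm)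
  qed
  hence "rhoS (f (z + \<tau>)) (f (z' + \<tau>)) < \<epsilon>/3" by (simp add: rhoS_ster)
  thus "rhoS (f z) (f z') < \<epsilon>"
   using t(2)[of z] t(2)[of z'] rhoS_triangle[of "f z" "f z'" "f (z + \<tau>)"] rhoS_triangle[of "f (z + \<tau>)" "f z'" "f (z' + \<tau>)"] rhoS_sym[of "f z" "f (z + \<tau>)"]
   by linarith
 qed
qed

text \<open>To each almost period \<tau> of the pairs an almost period \<open>per \<tau>\<close> of
  \<open>f\<close> within a fixed distance is chosen, and \<tau> is coloured by the cell of \<tau> -
  \<open>per \<tau>\<close>. For two of one colour, \<tau>1 - \<tau>2 nearly equals
  \<open>per \<tau>1 - per \<tau>2\<close>, and spherical uniform continuity lets the former inherit
  the property of the latter.\<close>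

lemma common_almost_periods:
 assumes f: "almost_elliptic f" and rd: "!!\<delta>. 0 < \<delta> ==> rdense (ap c d \<delta>)" and e: "0 < \<epsilon>"
 shows "rdense (%\<tau>. ap c d \<epsilon> \<tau> \<and> (\<forall>z. rhoS (f (z + \<tau>)) (f z) < \<epsilon>))"
proof -
 obtain L where L: "!!x. \<exists>\<tau>\<in>ball x L. \<forall>z. rhoS (f (z + \<tau>)) (f z) < \<epsilon>/3"
  using f e unfolding almost_elliptic_def by (meson divide_pos_pos zero_less_numeral)
 obtain \<delta> where d: "\<delta> > 0" "!!z z'. norm (z - z') < \<delta> ==> rhoS (f z) (f z') < \<epsilon>/3"
  using almost_elliptic_sph_uc[OF f] e unfolding sph_uc_def by (meson divide_pos_pos zero_less_numeral)
 define per where "per = (%\<tau>. SOME q. q \<in> ball \<tau> L \<and> (\<forall>z. rhoS (f (z + q)) (f z) < \<epsilon>/3))"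
 have per: "per \<tau> \<in> ball \<tau> L \<and> (\<forall>z. rhoS (f (z + per \<tau>)) (f z) < \<epsilon>/3)" for \<tau>
  unfolding per_def by (rule someI_ex) (use L in blast)
 define m where "m = 3 / \<delta>"
 have m: "0 < m" "2 / m < \<delta>" using d(1) by (auto simp: m_def field_simps)
 define col where "col = (%\<tau>. cell m (\<tau> - per \<tau>))"
 have "rdense (%\<tau>. \<exists>\<tau>1 \<tau>2. ap c d (\<epsilon>/2) \<tau>1 \<and> ap c d (\<epsilon>/2) \<tau>2 \<and> col \<tau>1 = col \<tau>2 \<and> \<tau> = \<tau>1 - \<tau>2)"
 proof (rule rdense_colour[OF rd cell_finite[OF m(1), of L]])
  show "col \<tau> \<in> cell m ` cball 0 L" for \<tau>
   unfolding col_def by (rule imageI, unfold mem_cball_0) (use per[of \<tau>] in \<open>simp add: dist_norm\<close>)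
 qed (use e in auto)
 thus ?thesis
 proof (rule rdense_mono)
  fix \<tau> assume "\<exists>\<tau>1 \<tau>2. ap c d (\<epsilon>/2) \<tau>1 \<and> ap c d (\<epsilon>/2) \<tau>2 \<and> col \<tau>1 = col \<tau>2 \<and> \<tau> = \<tau>1 - \<tau>2"
  then obtain \<tau>1 \<tau>2 where t: "ap c d (\<epsilon>/2) \<tau>1" "ap c d (\<epsilon>/2) \<tau>2" "col \<tau>1 = col \<tau>2" "\<tau> = \<tau>1 - \<tau>2" by blast
  have apt: "ap c d \<epsilon> \<tau>" using ap_add[OF t(1) ap_minus[OF t(2)]] t(4) by simp
  define q where "q = per \<tau>1 - per \<tau>2"
  have "norm ((\<tau>1 - per \<tau>1) - (\<tau>2 - per \<tau>2)) < \<delta>"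
   using cell_close[OF m(1), of "\<tau>1 - per \<tau>1" "\<tau>2 - per \<tau>2"] t(3) m(2) by (simp add: col_def)
  hence tq: "norm (\<tau> - q) < \<delta>" by (simp add: t(4) q_def algebra_simps)
  have "rhoS (f (z + \<tau>)) (f z) < \<epsilon>" for z
  proof -
   have 1: "rhoS (f (z + \<tau>)) (f (z + q)) < \<epsilon>/3" using tq by (intro d(2)) simp
   have 2: "rhoS (f (z + q)) (f (z - per \<tau>2)) < \<epsilon>/3" using per[of \<tau>1] unfolding q_def
    by (metis add_diff_eq diff_add_eq)
   have 3: "rhoS (f z) (f (z - per \<tau>2)) < \<epsilon>/3" using per[of \<tau>2] by (metis diff_add_cancel)
   show ?thesis using 1 2 3 rhoS_triangle[of "f (z + \<tau>)" "f z" "f (z + q)"] rhoS_triangle[of "f (z + q)" "f z" "f (z - per \<tau>2)"]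
    rhoS_sym[of "f z" "f (z - per \<tau>2)"] by linarith
  qed
  thus "ap c d \<epsilon> \<tau> \<and> (\<forall>z. rhoS (f (z + \<tau>)) (f z) < \<epsilon>)" using apt by blast
 qed
qed

subsection \<open>Every function with the given divisor has the form \<open>E * PP\<close>\<close>

text \<open>Two admissible index sets differ by finitely many kernels that are holomorphic on the
  disc of radius 2 about \<open>w\<close>.\<close>

lemma Eloc_any:
 assumes p: "pairs c d M N" and E: "Eloc M c d E" and F: "finite F" "{n. norm (c n - w) < 2 * M + 2} \<subseteq> F"
 shows "(%z. E z * exp (- (kapS M c d F z))) holomorphic_on ball w 2"
proof -
 note M = pairsD(1)[OF p]
 obtain F0 where F0: "finite F0" "{n. norm (c n - w) < 2 * M + 2} \<subseteq> F0"
   and h: "(%z. E z * exp (- (kapS M c d F0 z))) holomorphic_on ball w 2"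
  using E unfolding Eloc_def by blast
 have kh: "(%z. kap M (d n) (c n - z)) holomorphic_on ball w 2" if "\<not> norm (c n - w) < 2 * M + 2" for n
 proof (intro holomorphic_kap[OF M pairsD(3)[OF p]] holomorphic_intros)
  fix z assume "z \<in> ball w 2"
  thus "2 * M < norm (c n - z)" using that norm_triangle_ineq2[of "c n - w" "z - w"] by (auto simp: dist_norm norm_minus_commute)
 qed
 have "(%z. E z * exp (- (kapS M c d F0 z)) * exp ((\<Sum>n\<in>F0 - F. kap M (d n) (c n - z)) - (\<Sum>n\<in>F - F0. kap M (d n) (c n - z)))) holomorphic_on ball w 2"
  using F F0 by (intro holomorphic_intros h kh) auto
 moreover have "E z * exp (- (kapS M c d F0 z)) * exp ((\<Sum>n\<in>F0 - F. kap M (d n) (c n - z)) - (\<Sum>n\<in>F - F0. kap M (d n) (c n - z)))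
   = E z * exp (- (kapS M c d F z))" for z
 proof -
  have "(kapS M c d F0 z) = (\<Sum>n\<in>F0 \<inter> F. kap M (d n) (c n - z)) + (\<Sum>n\<in>F0 - F. kap M (d n) (c n - z))"
   by (rule sum.Int_Diff[OF F0(1)])
  moreover have "(kapS M c d F z) = (\<Sum>n\<in>F \<inter> F0. kap M (d n) (c n - z)) + (\<Sum>n\<in>F - F0. kap M (d n) (c n - z))"
   by (rule sum.Int_Diff[OF F(1)])
  ultimately have eq: "- (kapS M c d F0 z) + ((\<Sum>n\<in>F0 - F. kap M (d n) (c n - z)) - (\<Sum>n\<in>F - F0. kap M (d n) (c n - z))) = - (kapS M c d F z)"
   by (simp add: Int_commute)
  show ?thesis unfolding mult.assoc exp_add[symmetric] eq ..
 qed
 ultimately show ?thesis by simp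
qed

lemma divisor_disjoint:
 assumes "divisor_of f a b" shows "a n ~= b k"
proof
 assume e: "a n = b k"
 have fin: "finite {m. a m = a n}" "finite {m. b m = a n}" and
  cd: "card {m. a m = a n} = nat (mero_order f (a n))" "card {m. b m = a n} = nat (- mero_order f (a n))"
  using assms unfolding divisor_of_def by auto
 have "{m. a m = a n} ~= {}" "{m. b m = a n} ~= {}" using e by auto
 hence "card {m. a m = a n} > 0" "card {m. b m = a n} > 0" using fin by (auto simp: card_gt_0_iff)
 thus False using cd by linarith
qed

lemma divisor_representation:
 assumes p: "pairs c d M N" and f: "meromorphic_C f" and dv: "divisor_of f (%n. c n + d n / 2) (%n. c n - d n / 2)"
 obtains E where "Eloc M c d E" "f = EPf M c d E"
proof -
 note M = pairsD(1)[OF p]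
 \<comment> \<open>At zeros and poles \<open>PP\<close> is 0 and the quotient has no meaning; the
   limit fills in these isolated points.\<close>
 define E where "E = (%w. Lim (at w) (%z. the (f z) / PP M c d z))"
 have disj: "c n + d n / 2 ~= c k - d k / 2" for n k using divisor_disjoint[OF dv] by simp
 define Fw where "Fw = (%w. {n. norm (c n - w) < 2 * M + 2})"
 have fF: "finite (Fw w)" for w unfolding Fw_def by (rule pairs_finite(2)[OF p])
 have loc: "\<exists>r g Z. 0 < r \<and> r <= 1 \<and> g holomorphic_on ball w r \<and> Z holomorphic_on ball w r \<and> (\<forall>z\<in>ball w r. g z ~= 0 \<and> Z z ~= 0 \<and>
   E z = g z / Z z * exp (\<Sum>n\<in>Fw w. kap M (d n) (c n - z))) \<and> f w = EPf M c d E w" for w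
 proof -
  define k where "k = int (card {n. c n + d n / 2 = w}) - int (card {n. c n - d n / 2 = w})"
  have fin: "finite {n. c n + d n / 2 = w}" "finite {n. c n - d n / 2 = w}"
   and cd: "card {n. c n + d n / 2 = w} = nat (mero_order f w)" "card {n. c n - d n / 2 = w} = nat (- mero_order f w)"
   using dv unfolding divisor_of_def by auto
  obtain k' where "mero_local f w k'" using f unfolding meromorphic_C_def by blast
  moreover have "k' = k" using mero_order_eq[OF \<open>mero_local f w k'\<close>] cd by (simp add: k_def)
  ultimately have "mero_local f w k" by simp
  then obtain r1 g where g: "r1 > 0" "g holomorphic_on ball w r1" "!!z. z \<in> ball w r1 ==> g z ~= 0"
    "!!z. z \<in> ball w r1 - {w} ==> f z = Some ((z - w) powi k * g z)"
    and fw: "f w = (if k < 0 then None else if k = 0 then Some (g w) else Some 0)" unfolding mero_local_def by blast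
  have inF: "n \<in> Fw w" if "c n + d n / 2 = z \<or> c n - d n / 2 = z" "norm (z - w) < 1" for n z
  proof -
   have "norm (c n - w) <= norm (c n - z) + norm (z - w)" using norm_triangle_ineq[of "c n - z" "z - w"] by simp
   thus ?thesis using half_pair_dist[OF p that(1)] that(2) M by (auto simp: Fw_def)
  qed
  have sub: "{n. c n + d n / 2 = w} \<subseteq> Fw w" "{n. c n - d n / 2 = w} \<subseteq> Fw w" using inF[of _ w] by auto
  obtain r2 Z where Z: "0 < r2" "r2 <= 1" "Z holomorphic_on ball w r2" "!!z. z \<in> ball w r2 ==> Z z ~= 0"
   "!!z. z \<in> ball w r2 ==> z ~= w ==> (\<forall>n\<in>Fw w. c n + d n / 2 ~= z \<and> c n - d n / 2 ~= z) \<and>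
    (\<Prod>n\<in>Fw w. (c n + d n / 2 - z) / (c n - d n / 2 - z)) = (z - w) powi k * Z z"
   "{n. c n + d n / 2 = w} = {} ==> {n. c n - d n / 2 = w} = {} ==> (\<Prod>n\<in>Fw w. (c n + d n / 2 - w) / (c n - d n / 2 - w)) = Z w"
   unfolding k_def by (rule rational_factor_local[OF fF sub]) blast
  define r where "r = min r1 r2"
  have r: "0 < r" "r <= 1" "ball w r \<subseteq> ball w r1" "ball w r \<subseteq> ball w r2" using g Z by (auto simp: r_def)
  have near: "{n. norm (c n - z) < 2 * M} \<subseteq> Fw w" if "z \<in> ball w 1" for z
  proof safe
   fix n assume "norm (c n - z) < 2 * M"
   thus "n \<in> Fw w" using that norm_triangle_ineq[of "c n - z" "z - w"] by (simp add: Fw_def dist_norm norm_minus_commute)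
  qed
  define G where "G = (%z. g z / Z z * exp (\<Sum>n\<in>Fw w. kap M (d n) (c n - z)))"
  have PPe: "PP M c d z = (\<Prod>n\<in>Fw w. (c n + d n / 2 - z) / (c n - d n / 2 - z)) * exp (- (\<Sum>n\<in>Fw w. kap M (d n) (c n - z)))" if "z \<in> ball w 1" for z
   by (rule PP_split[OF p fF near[OF that]])
  have rat: "the (f z) / PP M c d z = G z" if z: "z \<in> ball w r - {w}" for z
  proof -
   have "z \<in> ball w 1" using z r by auto
   hence PPv: "PP M c d z = (z - w) powi k * Z z * exp (- (\<Sum>n\<in>Fw w. kap M (d n) (c n - z)))" using PPe Z(5)[of z] z r by auto
   have tf: "the (f z) = (z - w) powi k * g z" using g(4)[of z] z r by auto
   have "p * x / (p * y * exp (- s)) = x / y * exp s" if "p ~= 0" for p x y s :: complex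
    using that by (simp add: exp_minus field_simps)
   from this[of "(z - w) powi k"] show ?thesis unfolding PPv tf G_def using z by simp
  qed
  have Gc: "continuous_on (ball w r) G"
   unfolding G_def using Z(4) r M pairsD(3)[OF p] holomorphic_on_imp_continuous_on[OF holomorphic_on_subset[OF g(2) r(3)]]
    holomorphic_on_imp_continuous_on[OF holomorphic_on_subset[OF Z(3) r(4)]]
   by (intro continuous_intros) auto
  have EG: "E z = G z" if z: "z \<in> ball w r" for z
  proof -
   have "(G \<longlongrightarrow> G z) (at z)" using Gc z by (auto simp: continuous_on_eq_continuous_at isCont_def)
   moreover have "eventually (%y. y \<in> ball w r - {w}) (at z)"
   proof (cases "z = w")
    case True show ?thesis unfolding True using r by (intro eventually_at_in_open) auto
   next
    case False
    hence "eventually (%y. y \<in> ball w r - {w}) (nhds z)" using z by (intro eventually_nhds_in_open) auto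
    thus ?thesis by (simp add: eventually_at_filter eventually_mono)
   qed
   hence "eventually (%y. G y = the (f y) / PP M c d y) (at z)" by eventually_elim (use rat in auto)
   ultimately have "((%y. the (f y) / PP M c d y) \<longlongrightarrow> G z) (at z)" by (rule Lim_transform_eventually)
   thus ?thesis unfolding E_def by (intro tendsto_Lim) auto
  qed
  have "f w = EPf M c d E w"
  proof (cases "w \<in> range (%n. c n - d n / 2)")
   case True
   hence "{n. c n + d n / 2 = w} = {}" "{n. c n - d n / 2 = w} ~= {}" using disj by auto
   hence "k < 0" using fin(2) by (simp add: k_def card_gt_0_iff)
   thus ?thesis using True fw by (simp add: EPf_def)
  next
   case False
   hence pe: "{n. c n - d n / 2 = w} = {}" by auto
   have wb: "w \<in> ball w 1" "w \<in> ball w r" "w \<in> ball w r2" using r Z by auto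
   show ?thesis
   proof (cases "{n. c n + d n / 2 = w} = {}")
    case True
    hence "k = 0" "PP M c d w = Z w * exp (- (\<Sum>n\<in>Fw w. kap M (d n) (c n - w)))" using pe PPe[OF wb(1)] Z(6) by (auto simp: k_def)
    thus ?thesis using False fw EG[OF wb(2)] Z(4)[OF wb(3)] by (simp add: EPf_def G_def exp_minus)
   next
    case nonempty: False
    then obtain n where n: "c n + d n / 2 = w" by blast
    have "k > 0" using nonempty fin(1) pe by (simp add: k_def card_gt_0_iff)
    moreover have "(\<Prod>n\<in>Fw w. (c n + d n / 2 - w) / (c n - d n / 2 - w)) = 0"
    using n sub(1) fF by (intro prod_zero bexI[of _ n]) auto
    ultimately show ?thesis using False PPe[OF wb(1)] fw by (simp add: EPf_def)
   qed
  qed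
  thus ?thesis using r g Z EG
   by (intro exI[of _ r] exI[of _ g] exI[of _ Z]) (auto simp: G_def intro: holomorphic_on_subset)
 qed
 have E0: "E z ~= 0" for z
 proof -
  obtain r g Z where "0 < r" "\<forall>y\<in>ball z r. g y ~= 0 \<and> Z y ~= 0 \<and> E y = g y / Z y * exp (\<Sum>n\<in>Fw z. kap M (d n) (c n - y))" using loc[of z] by blast
  thus ?thesis by auto
 qed
 have "Eloc M c d E" unfolding Eloc_def
 proof (intro conjI allI E0)
  fix w0
  \<comment> \<open>Radius 2M + 4, so that \<open>F\<close> contains the near indices of every
    centre in the disc of radius 2 about \<open>w0\<close>.\<close>
  define F where "F = {n. norm (c n - w0) < 2 * M + 4}"
  have fin: "finite F" unfolding F_def by (rule pairs_finite(2)[OF p])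
  have "(%z. E z * exp (- (kapS M c d F z))) analytic_on ball w0 2" unfolding analytic_on_def
  proof
   fix w assume w: "w \<in> ball w0 2"
   have FF: "Fw w \<subseteq> F"
   proof
    fix n assume "n \<in> Fw w"
    thus "n \<in> F" using w norm_triangle_ineq[of "c n - w" "w - w0"] by (simp add: Fw_def F_def dist_norm norm_minus_commute)
   qed
   obtain r g Z where r: "0 < r" "r <= 1" "g holomorphic_on ball w r" "Z holomorphic_on ball w r"
    and e: "\<forall>z\<in>ball w r. g z ~= 0 \<and> Z z ~= 0 \<and> E z = g z / Z z * exp (\<Sum>n\<in>Fw w. kap M (d n) (c n - z))" using loc[of w] by blast
   have kh: "(%z. kap M (d n) (c n - z)) holomorphic_on ball w r" if "n \<in> F - Fw w" for n
   proof (intro holomorphic_kap[OF M pairsD(3)[OF p]] holomorphic_intros)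
    fix z assume "z \<in> ball w r"
    hence "norm (z - w) < 1" using r(2) by (simp add: dist_norm norm_minus_commute)
    thus "2 * M < norm (c n - z)" using that norm_triangle_ineq2[of "c n - w" "z - w"] by (auto simp: Fw_def)
   qed
   have "(%z. g z / Z z * exp (- (\<Sum>n\<in>F - Fw w. kap M (d n) (c n - z)))) holomorphic_on ball w r"
    using r e by (intro holomorphic_intros kh) auto
   moreover have "g z / Z z * exp (- (\<Sum>n\<in>F - Fw w. kap M (d n) (c n - z))) = E z * exp (- (kapS M c d F z))" if "z \<in> ball w r" for z
   proof -
    have "E z = g z / Z z * exp (\<Sum>n\<in>Fw w. kap M (d n) (c n - z))" using e that by blast
    moreover have "(kapS M c d F z) = (\<Sum>n\<in>F - Fw w. kap M (d n) (c n - z)) + (\<Sum>n\<in>Fw w. kap M (d n) (c n - z))"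
    using sum.subset_diff[OF FF fin] .
    moreover have "g z / Z z * exp (- s) = g z / Z z * exp t * exp (- (s + t))" for s t by (simp add: mult.assoc exp_add[symmetric])
    ultimately show ?thesis by simp
   qed
   ultimately have "(%z. E z * exp (- (kapS M c d F z))) holomorphic_on ball w r"
    by (rule holomorphic_transform)
   thus "\<exists>\<epsilon>>0. (%z. E z * exp (- (kapS M c d F z))) holomorphic_on ball w \<epsilon>" using r(1) by blast
  qed
  hence "(%z. E z * exp (- (kapS M c d F z))) holomorphic_on ball w0 2" by (rule analytic_imp_holomorphic)
  thus "\<exists>F. finite F \<and> {n. norm (c n - w0) < 2 * M + 2} \<subseteq> F \<and> (%z. E z * exp (- (kapS M c d F z))) holomorphic_on ball w0 2"
   using fin by (intro exI[of _ F]) (auto simp: F_def)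
 qed
 moreover have "f = EPf M c d E" using loc by (auto simp: fun_eq_iff)
 ultimately show thesis by (rule that)
qed

subsection \<open>Lower bounds away from the zeros\<close>

text \<open>The map q carries the left half-plane to the unit disc and the centre to 0, so Schwarz's
  lemma gives |q| <= 1/4. Then |F - a| <= (|F - a| + 2 |Re a|) / 4, whence the constant 2/3.\<close>

lemma schwarz_half_plane:
 assumes F: "F holomorphic_on ball z\<^sub>0 r" "!!z. z \<in> ball z\<^sub>0 r ==> Re (F z) < 0" and r: "0 < r" and z: "norm (z - z\<^sub>0) <= r/4"
 shows "norm (F z - F z\<^sub>0) <= 2/3 * (- Re (F z\<^sub>0))"
proof -
 define a where "a = F z\<^sub>0"
 have a: "Re a < 0" using F(2)[of z\<^sub>0] r by (simp add: a_def)
 have inb: "z\<^sub>0 + of_real r * t \<in> ball z\<^sub>0 r" if "norm t < 1" for t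
 proof -
  have "norm (of_real r * t) < r" using that r by (simp add: norm_mult)
  thus ?thesis by (simp add: dist_norm)
 qed
 define q where "q = (%t. (F (z\<^sub>0 + of_real r * t) - a) / (F (z\<^sub>0 + of_real r * t) + cnj a))"
 have nz: "F w + cnj a ~= 0" if "w \<in> ball z\<^sub>0 r" for w
 proof
  assume "F w + cnj a = 0"
  hence "Re (F w + cnj a) = 0" by simp
  thus False using F(2)[OF that] a by simp
 qed
 have "(F \<circ> (%t. z\<^sub>0 + of_real r * t)) holomorphic_on ball 0 1"
 proof (rule holomorphic_on_compose_gen[OF _ F(1)])
  show "(%t. z\<^sub>0 + of_real r * t) ` ball 0 1 \<subseteq> ball z\<^sub>0 r"
  proof (rule image_subsetI)
   fix t :: complex assume "t \<in> ball 0 1"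
   hence "norm t < 1" by simp
   thus "z\<^sub>0 + of_real r * t \<in> ball z\<^sub>0 r" by (rule inb)
  qed
 qed (intro holomorphic_intros)
 hence hF: "(%t. F (z\<^sub>0 + of_real r * t)) holomorphic_on ball 0 1" unfolding o_def .
 have q: "q holomorphic_on ball 0 1" unfolding q_def
 proof (intro holomorphic_intros)
  show "(%t. F (z\<^sub>0 + of_real r * t)) holomorphic_on ball 0 1" "(%t. F (z\<^sub>0 + of_real r * t)) holomorphic_on ball 0 1"
   by (fact hF)+
  show "F (z\<^sub>0 + complex_of_real r * x) + cnj a ~= 0" if "x \<in> ball 0 1" for x using nz[OF inb, of x] that by simp
 qed
 have q1: "norm (q t) < 1" if "norm t < 1" for t
 proof -
  define w where "w = F (z\<^sub>0 + of_real r * t)"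
  have w: "Re w < 0" "w + cnj a ~= 0" using F(2)[OF inb[OF that]] nz[OF inb[OF that]] by (auto simp: w_def)
  have "(norm (w + cnj a))^2 - (norm (w - a))^2 = 4 * (Re w * Re a)"
   unfolding cmod_power2 by (simp add: power2_eq_square algebra_simps)
  moreover have "0 < Re w * Re a" using w a by (simp add: mult_neg_neg)
  ultimately have "(norm (w - a))^2 < (norm (w + cnj a))^2" by linarith
  hence "norm (w - a) < norm (w + cnj a)" by (rule power2_less_imp_less) simp
  thus ?thesis unfolding q_def w_def[symmetric] using w(2) by (simp add: norm_divide)
 qed
 define t where "t = (z - z\<^sub>0) / of_real r"
 have t: "norm t <= 1/4" "z\<^sub>0 + of_real r * t = z" using z r by (auto simp: t_def norm_divide field_simps)
 have "norm (q t) <= norm t" using t(1) by (intro Schwarz_Lemma(1)[OF q _ q1]) (auto simp: q_def a_def)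
 hence "norm (q t) <= 1/4" using t(1) by simp
 hence "norm (F z - a) <= 1/4 * norm (F z + cnj a)"
  using nz[OF inb[of t]] t by (simp add: q_def norm_divide divide_le_eq mult.commute)
 moreover have "norm (F z + cnj a) <= norm (F z - a) + norm (a + cnj a)"
  using norm_triangle_ineq[of "F z - a" "a + cnj a"] by simp
 moreover have "norm (a + cnj a) = 2 * (- Re a)" unfolding complex_add_cnj norm_of_real using a by simp
 ultimately show ?thesis unfolding a_def by linarith
qed

lemma mero_finite_holomorphic:
 assumes f: "meromorphic_C f" and S: "open S" "!!z. z \<in> S ==> f z ~= None"
 shows "(%z. the (f z)) holomorphic_on S"
proof (rule analytic_imp_holomorphic, unfold analytic_on_def, rule ballI)
 fix w assume w: "w \<in> S"
 obtain k where "mero_local f w k" using f unfolding meromorphic_C_def by blast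
 then obtain r g where g: "r > 0" "g holomorphic_on ball w r"
   "!!z. z \<in> ball w r - {w} ==> f z = Some ((z - w) powi k * g z)"
   and fw: "f w = (if k < 0 then None else if k = 0 then Some (g w) else Some 0)" unfolding mero_local_def by blast
 have k: "k \<ge> 0" using fw S(2)[OF w] by (auto split: if_splits)
 define m where "m = nat k"
 have m: "k = int m" using k by (simp add: m_def)
 have "(%z. (z - w) ^ m * g z) holomorphic_on ball w r" by (intro holomorphic_intros g)
 moreover have "(z - w) ^ m * g z = the (f z)" if z: "z \<in> ball w r" for z
  using g(3)[of z] z fw by (cases "z = w"; cases "m = 0") (auto simp: m power_int_of_nat power_0_left)
 ultimately have "(%z. the (f z)) holomorphic_on ball w r" by (rule holomorphic_transform)
 thus "\<exists>\<epsilon>>0. (%z. the (f z)) holomorphic_on ball w \<epsilon>" using g(1) by blast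
qed

text \<open>The height on the sphere is at most -1/2 at \<open>u\<close>, hence negative at
  \<open>x\<close>, which places \<open>x\<close> over the unit disc.\<close>

lemma rhoS_Some_small:
 assumes "norm u <= 1/10" "rhoS x (Some u) < 1/2"
 shows "x ~= None \<and> norm (the x) <= 1"
proof -
 define T where "T = (%v::complex. ((norm v)^2 - 1) / (1 + (norm v)^2))"
 have "(norm u)^2 <= (1/10)^2" using assms(1) by (intro power_mono) auto
 moreover have "(V - 1) / (1 + V) <= - 1/2" if "0 <= V" "V <= (1/10)^2" for V :: real
  using that by (simp add: divide_simps power2_eq_square)
 ultimately have Tu: "T u <= - 1/2" unfolding T_def by simp
 have d: "\<bar>snd (ster x) - T u\<bar> < 1/2"
  using assms(2) dist_snd_le[of "ster x" "ster (Some u)"] unfolding rhoS_ster by (simp add: dist_real_def ster_def T_def)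
 show ?thesis
 proof (cases x)
  case None thus ?thesis using d Tu by (simp add: ster_def)
 next
  case (Some v)
  have "norm v <= 1"
  proof (rule ccontr)
   assume "\<not> norm v <= 1"
   hence "(norm v)^2 > 1" by (simp add: one_less_power)
   hence "T v > 0" by (simp add: T_def)
   moreover have "snd (ster x) = T v" by (simp add: Some ster_def T_def)
   ultimately show False using d Tu by linarith
  qed
  thus ?thesis using Some by simp
 qed
qed

text \<open>A three-circles estimate: by the maximum principle g / (y - z)^k is at most \<rho>^-k
  between the radii \<rho>/3 = \<delta>/4 and \<rho> = 3 \<delta>/4, so g is at most (2/3)^k at
  distance 2 \<rho>/3 = \<delta>/2. In contrast to an argument through log g it tolerates zeros of
  g.\<close>

lemma annulus_step:
 assumes g: "g holomorphic_on ball z \<delta>" "!!y. y \<in> ball z \<delta> ==> norm (g y) <= 1" and \<delta>: "0 < \<delta>"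
  and k: "(2/3)^k <= \<eta>" and e: "\<eta>' <= 1/3^k" "\<eta>' <= \<eta>"
  and s: "!!y. norm (y - z) <= \<delta>/4 ==> norm (g y) <= \<eta>'" and y: "norm (y - z) <= \<delta>/2"
 shows "norm (g y) <= \<eta>"
proof (cases "norm (y - z) <= \<delta>/4")
 case True thus ?thesis using s[of y] e by linarith
next
 case False
 define \<rho> where "\<rho> = 3/4 * \<delta>"
 have \<rho>: "0 < \<rho>" "\<rho> < \<delta>" "\<delta>/4 = \<rho>/3" "\<delta>/2 = 2/3 * \<rho>" using \<delta> by (auto simp: \<rho>_def)
 define S where "S = ball z \<rho> - cball z (\<delta>/4)"
 define T where "T = cball z \<rho> - ball z (\<delta>/4)"
 define \<Phi> where "\<Phi> = (%y. g y / (y - z)^k)"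
 have S: "open S" "bounded S" "y \<in> S" using False y \<delta> unfolding S_def \<rho>_def
  by (auto simp: dist_norm norm_minus_commute intro: bounded_diff)
 have cl: "closure S \<subseteq> T" by (rule closure_minimal) (auto simp: S_def T_def intro: closed_Diff)
 have Tz: "w ~= z" "w \<in> ball z \<delta>" if "w \<in> T" for w using that \<rho> \<delta> by (auto simp: T_def)
 have hT: "\<Phi> holomorphic_on T" unfolding \<Phi>_def
  using Tz by (intro holomorphic_intros holomorphic_on_subset[OF g(1)]) auto
 have "norm (\<Phi> y) <= 1 / \<rho>^k"
 proof (rule maximum_modulus_frontier[OF _ _ S(2) _ S(3)])
  show "\<Phi> holomorphic_on interior S"
   by (rule holomorphic_on_subset[OF hT]) (use S(1) cl closure_subset[of S] in \<open>simp add: interior_open\<close>)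
  show "continuous_on (closure S) \<Phi>" using holomorphic_on_imp_continuous_on[OF hT] cl by (rule continuous_on_subset)
  fix w assume "w \<in> frontier S"
  hence w: "w \<in> T" "w \<notin> S" using cl S(1) by (auto simp: frontier_def interior_open)
  then consider "norm (w - z) = \<rho>" | "norm (w - z) = \<delta>/4" by (force simp: S_def T_def dist_norm norm_minus_commute)
  thus "norm (\<Phi> w) <= 1 / \<rho>^k"
  proof cases
   case 1
   thus ?thesis using g(2)[OF Tz(2)[OF w(1)]] \<rho>(1) by (simp add: \<Phi>_def norm_divide norm_power divide_right_mono)
  next
   case 2
   have "norm (g w) <= 1 / 3^k" using s[of w] 2 e by simp
   hence "norm (\<Phi> w) <= (1/3^k) / (\<rho>/3)^k" unfolding \<Phi>_def norm_divide norm_power 2 \<rho>(3) using \<rho>(1) by (intro divide_right_mono) auto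
   also have "... = 1 / \<rho>^k" by (simp add: power_divide)
   finally show ?thesis .
  qed
 qed
 hence "norm (g y) <= norm (y - z)^k / \<rho>^k"
  using Tz(1)[of y] S(3) by (auto simp: \<Phi>_def norm_divide norm_power divide_simps S_def T_def split: if_splits)
 also have "... <= (2/3 * \<rho>)^k / \<rho>^k" using y \<rho> by (intro divide_right_mono power_mono) auto
 also have "... = (2/3)^k" unfolding power_mult_distrib using \<rho>(1) by simp
 finally show ?thesis using k by simp
qed

text \<open>A Harnack estimate: g / 2 = exp F with F in the left half-plane, and
  \<open>schwarz_half_plane\<close> gives Re F(y) <= Re F(z) / 3. Thus |g(y) / 2| is at most the
  cube root of |g(z) / 2|, which explains the cube in the hypothesis.\<close>

lemma zero_free_start:
 assumes g: "g holomorphic_on ball z r" "!!y. y \<in> ball z r ==> norm (g y) <= 1" "!!y. y \<in> ball z r ==> g y ~= 0" and r: "0 < r"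
  and e: "0 < \<eta>" "norm (g z) <= 2 * (\<eta>/2)^3" and y: "norm (y - z) <= r/4"
 shows "norm (g y) <= \<eta>"
proof -
 have h2: "(%w. g w / 2) holomorphic_on ball z r" by (intro holomorphic_intros g) auto
 have nz2: "!!w. w \<in> ball z r ==> g w / 2 ~= 0" using g(3) by simp
 obtain F where F: "F holomorphic_on ball z r" "!!w. w \<in> ball z r ==> g w / 2 = exp (F w)"
  using contractible_imp_holomorphic_log[OF h2 convex_imp_contractible[OF convex_ball] nz2] by blast
 have n: "norm (g w) / 2 = exp (Re (F w))" if "w \<in> ball z r" for w
  using F(2)[OF that] norm_exp_eq_Re[of "F w"] by (metis norm_divide norm_numeral)
 have neg: "Re (F w) < 0" if "w \<in> ball z r" for w
 proof -
  have "exp (Re (F w)) < 1" using n[OF that] g(2)[OF that] by linarith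
  thus ?thesis by simp
 qed
 have yb: "y \<in> ball z r" "z \<in> ball z r" using y r by (auto simp: dist_norm norm_minus_commute)
 have "norm (F y - F z) <= 2/3 * (- Re (F z))" using schwarz_half_plane[OF F(1) neg r y] .
 hence "Re (F y) <= Re (F z) / 3" using abs_Re_le_cmod[of "F y - F z"] by simp
 hence "exp (Re (F y))^3 <= exp (Re (F z) / 3)^3" by (intro power_mono) auto
 also have "... = exp (Re (F z))" by (simp add: exp_of_nat_mult[symmetric])
 also have "... <= (\<eta>/2)^3" using n[OF yb(2)] e(2) by linarith
 finally have "exp (Re (F y)) <= \<eta>/2" using power_mono_iff[of "exp (Re (F y))" "\<eta>/2" 3] e by simp
 thus ?thesis using n[OF yb(1)] by linarith
qed

text \<open>A tiny value without zeros nearby forces smallness on a disc by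
  \<open>zero_free_start\<close>; \<open>annulus_step\<close> carries it from disc to disc, across
  zeros if necessary, until a pole is reached after boundedly many steps of length \<delta>/4, which
  is absurd. Spherical uniform continuity provides discs of fixed radius with |f| <= 1 about every
  small value.\<close>

lemma lower_bound_away_from_zeros:
 assumes f: "meromorphic_C f" "sph_uc f" and pole: "!!x. \<exists>p. norm (p - x) <= L \<and> f p = None" and d0: "0 < \<delta>\<^sub>0"
 obtains m where "0 < m" "!!z u. f z = Some u ==> (!!y. norm (y - z) < \<delta>\<^sub>0 ==> f y ~= Some 0) ==> m <= norm u"
proof -
 obtain \<delta>1 where d1: "0 < \<delta>1" "!!z z'. norm (z - z') < \<delta>1 ==> rhoS (f z) (f z') < 1/2"
  using f(2)[unfolded sph_uc_def, rule_format, of "1/2"] by auto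
 define \<delta> where "\<delta> = min \<delta>\<^sub>0 \<delta>1"
 have \<delta>: "0 < \<delta>" "\<delta> <= \<delta>\<^sub>0" "\<delta> <= \<delta>1" using d0 d1 by (auto simp: \<delta>_def)
 have loc: "(%y. the (f y)) holomorphic_on ball p \<delta>" "!!y. y \<in> ball p \<delta> ==> f y ~= None \<and> norm (the (f y)) <= 1"
  if "f p = Some u" "norm u <= 1/10" for p u
 proof -
  have b: "f y ~= None \<and> norm (the (f y)) <= 1" if "y \<in> ball p \<delta>" for y
  proof (rule rhoS_Some_small[OF \<open>norm u <= 1/10\<close>])
   show "rhoS (f y) (Some u) < 1/2" using d1(2)[of y p] that \<delta>(3) \<open>f p = Some u\<close> by (simp add: dist_norm norm_minus_commute)
  qed
  thus "!!y. y \<in> ball p \<delta> ==> f y ~= None \<and> norm (the (f y)) <= 1" .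
  show "(%y. the (f y)) holomorphic_on ball p \<delta>" by (rule mero_finite_holomorphic[OF f(1)]) (use b in auto)
 qed
 define A where "A = (%z \<eta>. \<forall>y. norm (y - z) <= \<delta>/4 \<longrightarrow> f y ~= None \<and> norm (the (f y)) <= \<eta>)"
 define Z where "Z = (%z. \<forall>y. norm (y - z) < \<delta>\<^sub>0 \<longrightarrow> f y ~= Some 0)"
 have base: "A z \<eta>" if "0 < \<eta>" "\<eta> <= 1/10" "f z = Some u" "norm u <= 2 * (\<eta>/2)^3" "Z z" for z u \<eta>
 proof -
  have "(\<eta>/2)^3 <= (1/20)^3" using that by (intro power_mono) auto
  hence u: "norm u <= 1/10" using that(4) by (simp add: power3_eq_cube)
  note l = loc[OF that(3) u]
  have nz: "the (f y) ~= 0" if "y \<in> ball z \<delta>" for y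
  proof -
   have "norm (y - z) < \<delta>\<^sub>0" using that \<delta>(2) by (simp add: dist_norm norm_minus_commute)
   hence "f y ~= Some 0" using \<open>Z z\<close> by (simp add: Z_def)
   thus ?thesis using l(2)[OF that] by auto
  qed
  show ?thesis unfolding A_def
  proof (intro allI impI conjI)
   fix y assume y: "norm (y - z) <= \<delta>/4"
   hence "y \<in> ball z \<delta>" using \<delta>(1) by (simp add: dist_norm norm_minus_commute)
   thus "f y ~= None" using l(2) by simp
   have g1: "!!y. y \<in> ball z \<delta> ==> norm (the (f y)) <= 1" using l(2) by simp
   have e: "norm (the (f z)) <= 2 * (\<eta>/2)^3" using that by simp
   show "norm (the (f y)) <= \<eta>"
    using zero_free_start[OF l(1) g1 nz \<delta>(1) that(1) e y] by simp
  qed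
 qed
 have step: "\<exists>\<eta>'>0. \<eta>' <= 1/10 \<and> (\<forall>z p. A z \<eta>' \<longrightarrow> norm (p - z) <= \<delta>/4 \<longrightarrow> A p \<eta>)" if "0 < \<eta>" for \<eta>
 proof -
  obtain k where k: "(2/3)^k < \<eta>" using real_arch_pow_inv[OF \<open>0 < \<eta>\<close>, of "2/3"] by auto
  define \<eta>' where "\<eta>' = min (1/10) (min \<eta> (1/3^k))"
  have e: "0 < \<eta>'" "\<eta>' <= 1/10" "\<eta>' <= \<eta>" "\<eta>' <= 1/3^k" using that by (auto simp: \<eta>'_def)
  have "A p \<eta>" if a: "A z \<eta>'" and p: "norm (p - z) <= \<delta>/4" for z p
   unfolding A_def
  proof (intro allI impI)
   fix y assume "norm (y - p) <= \<delta>/4"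
   hence y: "norm (y - z) <= \<delta>/2" using p norm_triangle_ineq[of "y - p" "p - z"] by simp
   have az: "f z ~= None" "norm (the (f z)) <= \<eta>'" using a \<delta>(1) by (auto simp: A_def)
   hence "f z = Some (the (f z))" "norm (the (f z)) <= 1/10" using e by auto
   note l = loc[OF this]
   have g1: "!!y. y \<in> ball z \<delta> ==> norm (the (f y)) <= 1" using l(2) by simp
   have s: "!!y. norm (y - z) <= \<delta>/4 ==> norm (the (f y)) <= \<eta>'" using a by (simp add: A_def)
   have "norm (the (f y)) <= \<eta>" by (rule annulus_step[OF l(1) g1 \<delta>(1) less_imp_le[OF k] e(4,3) s y])
   moreover have "y \<in> ball z \<delta>" using y \<delta>(1) by (simp add: dist_norm norm_minus_commute)
   ultimately show "f y ~= None \<and> norm (the (f y)) <= \<eta>" using l(2) by simp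
  qed
  thus ?thesis using e by blast
 qed
 \<comment> \<open>Thresholds are chosen backwards: smallness \<eta> after j + 1 steps is derived
   from a smaller \<eta>' after j steps.\<close>
 have ind: "\<exists>m>0. \<forall>z u. f z = Some u \<longrightarrow> norm u <= m \<longrightarrow> Z z \<longrightarrow> (\<forall>p. norm (p - z) <= real j * (\<delta>/4) \<longrightarrow> A p \<eta>)"
  if "0 < \<eta>" "\<eta> <= 1/10" for j \<eta>
  using that
 proof (induction j arbitrary: \<eta>)
  case 0
  show ?case
  proof (intro exI[of _ "2 * (\<eta>/2)^3"] conjI allI impI)
   show "0 < 2 * (\<eta>/2)^3" using 0 by simp
   fix z u p assume h: "f z = Some u" "norm u <= 2 * (\<eta>/2)^3" "Z z" "norm (p - z) <= real 0 * (\<delta>/4)"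
   hence "p = z" by simp
   thus "A p \<eta>" using base[OF 0 h(1-3)] by simp
  qed
 next
  case (Suc j)
  obtain \<eta>' where e: "0 < \<eta>'" "\<eta>' <= 1/10" "!!z p. A z \<eta>' ==> norm (p - z) <= \<delta>/4 ==> A p \<eta>" using step[OF Suc.prems(1)] by blast
  obtain m where m: "m > 0" "!!z u p. f z = Some u ==> norm u <= m ==> Z z ==> norm (p - z) <= real j * (\<delta>/4) ==> A p \<eta>'"
   using Suc.IH[OF e(1,2)] by blast
  show ?case
  proof (intro exI[of _ m] conjI allI impI)
   show "0 < m" by fact
   fix z u p assume h: "f z = Some u" "norm u <= m" "Z z" and p: "norm (p - z) <= real (Suc j) * (\<delta>/4)"
   define t where "t = real j / real (Suc j)"
   have t: "0 <= t" "t <= 1" "t * real (Suc j) = real j" "(1 - t) * real (Suc j) = 1" by (auto simp: t_def field_simps)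
   define q where "q = z + of_real t * (p - z)"
   have "norm (q - z) = t * norm (p - z)" using t by (simp add: q_def norm_mult)
   also have "... <= t * (real (Suc j) * (\<delta>/4))" using p t by (intro mult_left_mono)
   also have "... = real j * (\<delta>/4)" unfolding mult.assoc[symmetric] t(3) ..
   finally have 1: "A q \<eta>'" by (rule m(2)[OF h])
   have "p - q = of_real (1 - t) * (p - z)" by (simp add: q_def algebra_simps)
   hence "norm (p - q) = (1 - t) * norm (p - z)" using t by (simp add: norm_mult del: of_real_diff)
   also have "... <= (1 - t) * (real (Suc j) * (\<delta>/4))" using p t by (intro mult_left_mono) auto
   also have "... = \<delta>/4" unfolding mult.assoc[symmetric] t(4) by simp
   finally show "A p \<eta>" by (rule e(3)[OF 1])
  qed
 qed
 obtain J :: nat where J: "L / (\<delta>/4) <= real J" using real_arch_simple by blast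
 hence J': "L <= real J * (\<delta>/4)" using \<delta>(1) by (simp add: field_simps)
 obtain m where m: "m > 0" "!!z u p. f z = Some u ==> norm u <= m ==> Z z ==> norm (p - z) <= real J * (\<delta>/4) ==> A p (1/10)"
  using ind[of "1/10" J] by auto
 show thesis
 proof (rule that[OF m(1)], rule ccontr)
  fix z u assume h: "f z = Some u" "!!y. norm (y - z) < \<delta>\<^sub>0 ==> f y ~= Some 0" "\<not> m <= norm u"
  obtain p where p: "norm (p - z) <= L" "f p = None" using pole by blast
  have "A p (1/10)" using h p(1) J' by (intro m(2)[OF h(1)]) (auto simp: Z_def)
  thus False using p(2) \<delta>(1) by (auto simp: A_def dest: spec[of _ p])
 qed
qed

text \<open>The reciprocal as an isometry of the sphere; it converts lower bounds into upper
  bounds.\<close>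

definition sinv :: "complex option => complex option" where
 "sinv x = (case x of None => Some 0 | Some u => if u = 0 then None else Some (inverse u))"

lemma rhoS_sinv: "rhoS (sinv x) (sinv y) = rhoS x y"
proof -
 have e: "ster x = (cnj (fst (ster (sinv x))), - snd (ster (sinv x)))" for x
 proof (cases x)
  case None thus ?thesis by (simp add: sinv_def ster_def)
 next
  case (Some u)
  show ?thesis
  proof (cases "u = 0")
   case True thus ?thesis using Some by (simp add: sinv_def ster_def)
  next
   case False
   have fl: "- ((U - 1) / V) = (1 - U) / V" for U V :: real by (simp add: minus_divide_left)
   show ?thesis using Some False ster'_inverse[OF False] by (simp add: sinv_def ster_def ster'_def fl)
  qed
 qed
 have "dist (cnj a, - b) (cnj a', - b') = dist (a, b) (a', b')" for a a' :: complex and b b' :: real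
 proof -
  have "norm (cnj a - cnj a') = norm (a - a')" by (metis complex_cnj_diff complex_mod_cnj)
  thus ?thesis by (simp add: dist_prod_def dist_norm dist_real_def abs_minus_commute)
 qed
 from this[of "fst (ster (sinv x))" "snd (ster (sinv x))" "fst (ster (sinv y))" "snd (ster (sinv y))"]
 show ?thesis unfolding rhoS_ster e[of x] e[of y] by simp
qed

lemma sinv_meromorphic:
 assumes "meromorphic_C f" shows "meromorphic_C (%z. sinv (f z))"
 unfolding meromorphic_C_def
proof
 fix w
 obtain k where "mero_local f w k" using assms unfolding meromorphic_C_def by blast
 then obtain r g where g: "r > 0" "g holomorphic_on ball w r" "!!z. z \<in> ball w r ==> g z ~= 0"
   "!!z. z \<in> ball w r - {w} ==> f z = Some ((z - w) powi k * g z)"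
   and fw: "f w = (if k < 0 then None else if k = 0 then Some (g w) else Some 0)" unfolding mero_local_def by blast
 have gw: "g w ~= 0" using g(1,3) by simp
 have "mero_local (%z. sinv (f z)) w (- k)" unfolding mero_local_def
 proof (intro exI[of _ r] exI[of _ "%z. inverse (g z)"] conjI ballI)
  show "(%z. inverse (g z)) holomorphic_on ball w r" by (intro holomorphic_intros g) auto
  fix z assume z: "z \<in> ball w r - {w}"
  thus "sinv (f z) = Some ((z - w) powi - k * inverse (g z))"
   using g(3)[of z] g(4)[OF z] by (simp add: sinv_def power_int_minus)
 qed (use g gw fw in \<open>auto simp: sinv_def\<close>)
 thus "\<exists>k. mero_local (%z. sinv (f z)) w k" by blast
qed

subsection \<open>The exponential factor is bounded\<close>

text \<open>There are K + 1 candidate radii with spacing 1 / (2 (K + 1)) and at most K values to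
  avoid. One value cannot spoil two candidates, since these would be closer than 1 / (4 (K +
  1)).\<close>

lemma gap_radius:
 fixes X :: "real set"
 assumes X: "finite X" "card X <= K"
 obtains r where "1/2 <= r" "r <= 1" "!!x. x \<in> X ==> 1 / (8 * (real K + 1)) <= \<bar>x - r\<bar>"
proof -
 define r where "r = (%j::nat. 1/2 + real j / (2 * (real K + 1)))"
 have "\<exists>j\<le>K. \<forall>x\<in>X. 1 / (8 * (real K + 1)) <= \<bar>x - r j\<bar>"
 proof (rule ccontr)
  assume "\<not> ?thesis"
  hence ex: "\<exists>x. x \<in> X \<and> \<bar>x - r j\<bar> < 1 / (8 * (real K + 1))" if "j <= K" for j using that unfolding Bex_def Ball_def by (meson not_le)
  define x where "x = (%j. SOME x. x \<in> X \<and> \<bar>x - r j\<bar> < 1 / (8 * (real K + 1)))"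
  have x: "x j \<in> X \<and> \<bar>x j - r j\<bar> < 1 / (8 * (real K + 1))" if "j <= K" for j unfolding x_def by (rule someI_ex[OF ex[OF that]])
  have "inj_on x {..K}"
  proof (rule inj_onI, rule ccontr)
   fix i j assume ij: "i \<in> {..K}" "j \<in> {..K}" "x i = x j" "i ~= j"
   have "\<bar>r i - r j\<bar> < 2 * (1 / (8 * (real K + 1)))" using x[of i] x[of j] ij by auto
   also have "r i - r j = (real i - real j) / (2 * (real K + 1))" by (simp add: r_def diff_divide_distrib)
   finally have "\<bar>(real i - real j) / (2 * (real K + 1))\<bar> * (2 * (real K + 1)) < 2 * (1 / (8 * (real K + 1))) * (2 * (real K + 1))"
    by (rule mult_strict_right_mono) simp
   moreover have "\<bar>(real i - real j) / (2 * (real K + 1))\<bar> * (2 * (real K + 1)) = \<bar>real i - real j\<bar>"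
    unfolding abs_divide by (simp add: nonzero_eq_divide_eq)
   moreover have "2 * (1 / (8 * (real K + 1))) * (2 * (real K + 1)) = 1/2" by (simp add: divide_simps)
   ultimately have "\<bar>real i - real j\<bar> < 1/2" by linarith
   thus False using ij(4) by linarith
  qed
  hence "card {..K} <= card X" using X x by (intro card_inj_on_le[of x]) auto
  thus False using X(2) by simp
 qed
 then obtain j where j: "j <= K" "!!x. x \<in> X ==> 1 / (8 * (real K + 1)) <= \<bar>x - r j\<bar>" by blast
 have "real j / (2 * (real K + 1)) <= 1/2" using j(1) by (simp add: divide_simps)
 hence "r j <= 1" unfolding r_def by linarith
 moreover have "1/2 <= r j" by (simp add: r_def)
 ultimately show thesis using j(2) by (intro that[of "r j"])
qed

text \<open>Zeros may come arbitrarily close to one another, but boundedly many zeros and poles lie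
  near a given unit disc, so \<open>gap_radius\<close> applied to their distances from
  \<open>z\<close> finds a circle that avoids them by a fixed amount.\<close>

lemma good_circle:
 assumes p: "pairs c d M N"
 obtains \<delta>\<^sub>0 where "0 < \<delta>\<^sub>0" "!!z. \<exists>r. 1/2 <= r \<and> r <= 1 \<and> (\<forall>y n. norm (y - z) = r \<longrightarrow> apart \<delta>\<^sub>0 c d n y)"
proof -
 note M = pairsD(1)[OF p]
 define K where "K = nat \<lceil>2 * (25 * N * (2 + M)^2)\<rceil>"
 define \<delta>\<^sub>0 where "\<delta>\<^sub>0 = 1 / (8 * (real K + 1))"
 have d0: "0 < \<delta>\<^sub>0" "\<delta>\<^sub>0 <= 1/2" by (auto simp: \<delta>\<^sub>0_def divide_simps)
 show thesis
 proof (rule that[OF d0(1)])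
  fix z
  define A where "A = {n. norm (c n - z) <= 2 + M}"
  have A: "finite A" "real (card A) <= 25 * N * (2 + M)^2" unfolding A_def by (rule pairs_count[OF p, of "2 + M" _ z]; use M in simp)+
  define X where "X = (%n. norm (c n + d n / 2 - z)) ` A \<union> (%n. norm (c n - d n / 2 - z)) ` A"
  have "card X <= card A + card A" unfolding X_def
   by (intro order_trans[OF card_Un_le] add_mono card_image_le A)
  hence "real (card X) <= 2 * (25 * N * (2 + M)^2)" using A(2) by linarith
  hence X: "finite X" "card X <= K" using A(1) unfolding K_def X_def by (auto, linarith)
  obtain r where r: "1/2 <= r" "r <= 1" "!!x. x \<in> X ==> \<delta>\<^sub>0 <= \<bar>x - r\<bar>" unfolding \<delta>\<^sub>0_def by (rule gap_radius[OF X]) blast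
  have "\<delta>\<^sub>0 <= norm (q - y)" if y: "norm (y - z) = r" and q: "q = c n + d n / 2 \<or> q = c n - d n / 2" for y n q
  proof (cases "n \<in> A")
   case True
   hence "norm (q - z) \<in> X" using q by (auto simp: X_def)
   hence "\<delta>\<^sub>0 <= \<bar>norm (q - z) - r\<bar>" by (rule r(3))
   also have "... <= norm (q - y)" using norm_triangle_ineq3[of "q - z" "y - z"] y by simp
   finally show ?thesis .
  next
   case False
   hence "2 + M < norm (c n - z)" by (simp add: A_def)
   moreover have "norm (c n - q) <= M / 2" using half_pair_dist[OF p] q by blast
   moreover have "norm (c n - z) <= norm (c n - q) + norm (q - y) + norm (y - z)"
    using norm_triangle_ineq[of "c n - q" "q - y"] norm_triangle_ineq[of "c n - y" "y - z"] by simp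
   ultimately show ?thesis using y r d0 M by linarith
  qed
  thus "\<exists>r. 1/2 <= r \<and> r <= 1 \<and> (\<forall>y n. norm (y - z) = r \<longrightarrow> apart \<delta>\<^sub>0 c d n y)"
   using r(1,2) by blast
 qed
qed

text \<open>The same upper bound is used for the differences d and -d; the second one bounds the
  inverse.\<close>

lemma PP_bounded_away:
 assumes p: "pairs c d M N" and d0: "0 < \<delta>\<^sub>0"
 obtains B where "0 < B" "!!z. (!!n. apart \<delta>\<^sub>0 c d n z) ==>
   PP M c d z ~= 0 \<and> norm (PP M c d z) <= B \<and> norm (inverse (PP M c d z)) <= B"
proof -
 note M = pairsD(1)[OF p]
 define b where "b = max 1 (3 * M / \<delta>\<^sub>0 * exp 1)"
 define K where "K = nat \<lceil>25 * N * (2 * M)^2\<rceil>"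
 have ub: "norm (PP M c d' z) <= b ^ K" if p': "pairs c d' M N"
   and far: "!!n. \<delta>\<^sub>0 <= norm (c n + d' n / 2 - z) \<and> \<delta>\<^sub>0 <= norm (c n - d' n / 2 - z)" for z d'
 proof -
  define A where "A = {n. norm (c n - z) < 2 * M}"
  have A: "finite A" "real (card A) <= 25 * N * (2 * M)^2" unfolding A_def
   by (rule pairs_count[OF p, of "2 * M" _ z]; use M in simp)+
  have "card A <= K" using A(2) unfolding K_def by linarith
  have "norm (wfac M c d' n z) <= b" if n: "n \<in> A" for n
  proof -
   have "norm (c n + d' n / 2 - z) <= norm (c n - z) + norm (d' n / 2)" using norm_triangle_ineq[of "c n - z" "d' n / 2"] by (simp add: algebra_simps)
   hence 1: "norm (c n + d' n / 2 - z) <= 3 * M" using n pairsD(3)[OF p', of n] M by (simp add: A_def norm_divide)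
   have 2: "norm (exp (- kap M (d' n) (c n - z))) <= exp 1"
    using norm_exp[of "- kap M (d' n) (c n - z)"] norm_kap_le[OF M pairsD(3)[OF p'], of n "c n - z"]
    by (metis (no_types) exp_le_cancel_iff norm_minus_cancel order_trans)
   have "norm (wfac M c d' n z) <= (3 * M) / \<delta>\<^sub>0 * exp 1" unfolding wfac_def norm_mult norm_divide
    using 1 2 far[of n] d0 M by (intro mult_mono frac_le) auto
   thus ?thesis by (simp add: b_def)
  qed
  hence "norm (PP M c d' z) <= (\<Prod>n\<in>A. b)" unfolding PP_def A_def[symmetric] prod_norm[symmetric] by (intro prod_mono) auto
  also have "... = b ^ card A" by simp
  also have "... <= b ^ K" by (rule power_increasing[OF \<open>card A <= K\<close>]) (simp add: b_def)
  finally show ?thesis .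
 qed
 show thesis
 proof (rule that[of "b ^ K"])
  show "0 < b ^ K" by (simp add: b_def)
  fix z assume far: "!!n. apart \<delta>\<^sub>0 c d n z"
  have "PP M c d z ~= 0"
  proof (rule PP_nonzero)
   fix n show "c n + d n / 2 ~= z \<and> c n - d n / 2 ~= z" using far[of n] d0 by auto
  qed
  moreover have "norm (PP M c (%n. - d n) z) <= b ^ K" using far by (intro ub[OF pairs_minus[OF p]]) auto
  ultimately show "PP M c d z ~= 0 \<and> norm (PP M c d z) <= b ^ K \<and> norm (inverse (PP M c d z)) <= b ^ K"
   using ub[OF p far] unfolding PP_minus by simp
 qed
qed

section \<open>Pointwise bounds for the exponential factor\<close>

lemma kap_neg: "kap M (- d) w = - kap M d w"
 using Lq_minus[of "d * phi M w / 2"] by (simp add: kap_def)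

lemma Eloc_inverse:
 assumes E: "Eloc M c d E" shows "Eloc M c (%n. - d n) (%z. inverse (E z))"
 unfolding Eloc_def
proof (intro conjI allI)
 show "inverse (E z) ~= 0" for z using E by (simp add: Eloc_def)
 fix w obtain F where F: "finite F" "{n. norm (c n - w) < 2 * M + 2} \<subseteq> F"
   "(%z. E z * exp (- (kapS M c d F z))) holomorphic_on ball w 2" using E unfolding Eloc_def by blast
 have "(%z. inverse (E z * exp (- (kapS M c d F z)))) holomorphic_on ball w 2"
  by (intro holomorphic_on_inverse F(3)) (use E in \<open>simp add: Eloc_def\<close>)
 hence "(%z. inverse (E z) * exp (- (\<Sum>n\<in>F. kap M (- d n) (c n - z)))) holomorphic_on ball w 2"
  by (simp add: kap_neg sum_negf exp_minus)
 thus "\<exists>F. finite F \<and> {n. norm (c n - w) < 2 * M + 2} \<subseteq> F \<and> (%z. inverse (E z) * exp (- (\<Sum>n\<in>F. kap M (- d n) (c n - z)))) holomorphic_on ball w 2"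
  using F by blast
qed

lemma kap_sum_bound:
 assumes p: "pairs c d M N" and R: "1 <= R" and F: "!!n. n \<in> F ==> norm (c n - z) <= R"
 shows "norm (\<Sum>n\<in>F. kap M (d n) (f n)) <= 25 * N * R^2"
proof -
 have "norm (\<Sum>n\<in>F. kap M (d n) (f n)) <= (\<Sum>n\<in>F. 1)"
  by (intro sum_norm_le norm_kap_le pairsD[OF p])
 also have "... <= 25 * N * R^2" using pairs_count(2)[OF p R F] by simp
 finally show ?thesis .
qed

lemma norm_exp_le: "norm x <= b ==> norm (exp (x::complex)) <= exp b"
 using norm_exp[of x] by (meson exp_le_cancel_iff order_trans)

lemma disc_max_modulus:
 assumes "g holomorphic_on ball z 2" "0 < r" "r <= 1" "!!y. norm (y - z) = r ==> norm (g y) <= B"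
 shows "norm (g z) <= B"
proof (rule maximum_modulus_frontier[of g "ball z r"])
 show "g holomorphic_on interior (ball z r)" using assms by (auto intro: holomorphic_on_subset)
 show "continuous_on (closure (ball z r)) g" using assms
  by (intro continuous_on_subset[OF holomorphic_on_imp_continuous_on[OF assms(1)]]) auto
qed (use assms in \<open>auto simp: dist_norm norm_minus_commute\<close>)

text \<open>The maximum principle applies only after the near kernels are removed; removing and
  restoring them costs one exponential factor each.\<close>

lemma Eloc_circle_bound:
 assumes p: "pairs c d M N" and E: "Eloc M c d E" and r: "1/2 <= r" "r <= 1" and B: "!!y. norm (y - z) = r ==> norm (E y) <= B"
 shows "norm (E z) <= B * exp (25 * N * (2 * M + 2)^2) * exp (25 * N * (2 * M + 2)^2)"
proof -
 note M = pairsD(1)[OF p]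
 define K where "K = 25 * N * (2 * M + 2)^2"
 define F where "F = {n. norm (c n - z) < 2 * M + 2}"
 have F: "finite F" unfolding F_def by (rule pairs_finite(2)[OF p])
 have sb: "norm (kapS M c d F y) <= K" for y
  unfolding K_def by (rule kap_sum_bound[OF p, of _ _ z]) (use M in \<open>auto simp: F_def\<close>)
 have B0: "0 <= B"
 proof -
  have "norm (E (z + of_real r)) <= B" using r by (intro B) simp
  thus ?thesis by (meson norm_ge_zero order_trans)
 qed
 define q where "q = (%y. E y * exp (- (kapS M c d F y)))"
 have "norm (q z) <= B * exp K"
 proof (rule disc_max_modulus[of q z r])
  show "q holomorphic_on ball z 2" unfolding q_def by (rule Eloc_any[OF p E F]) (simp add: F_def)
  fix y assume "norm (y - z) = r"
  thus "norm (q y) <= B * exp K" unfolding q_def norm_mult using B0 sb[of y]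
   by (intro mult_mono B norm_exp_le) auto
 qed (use r in auto)
 have "E z = q z * exp (kapS M c d F z)" by (simp add: q_def exp_minus)
 hence "norm (E z) = norm (q z) * norm (exp (kapS M c d F z))" by (simp add: norm_mult)
 also have "... <= (B * exp K) * exp K" using \<open>norm (q z) <= B * exp K\<close> B0 sb by (intro mult_mono norm_exp_le) auto
 finally show ?thesis unfolding K_def .
qed

lemma EPf_values:
 assumes "!!z. E z ~= 0"
 shows "EPf M c d E y = Some 0 ==> \<exists>n. c n + d n / 2 = y"
  and "EPf M c d E y = None \<longleftrightarrow> (\<exists>n. c n - d n / 2 = y)"
  and "pairs c d M N ==> (!!n k. c n + d n / 2 ~= c k - d k / 2) ==> EPf M c d E (c n + d n / 2) = Some 0"
proof -
 show *: "EPf M c d E y = None \<longleftrightarrow> (\<exists>n. c n - d n / 2 = y)" by (auto simp: EPf_def)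
 show "\<exists>n. c n + d n / 2 = y" if e: "EPf M c d E y = Some 0"
 proof (rule ccontr)
  assume "\<not> ?thesis"
  moreover have "\<not> (\<exists>n. c n - d n / 2 = y)" using e * by simp
  ultimately have "PP M c d y ~= 0" by (intro PP_nonzero) blast
  thus False using e assms by (simp add: EPf_def split: if_splits)
 qed
 show "EPf M c d E (c n + d n / 2) = Some 0" if "pairs c d M N" "!!n k. c n + d n / 2 ~= c k - d k / 2"
 proof -
  have "PP M c d (c n + d n / 2) = 0" by (rule PP_zero[OF that(1), of n]) simp
  thus ?thesis using that(2) by (auto simp: EPf_def)
 qed
qed

text \<open>The lower bound is \<open>lower_bound_away_from_zeros\<close> for f, the upper bound the
  same lemma for 1 / f. Almost periods of the pairs put a pole and a zero within distance 2 + L of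
  every point, as the lemma requires.\<close>

lemma EPf_moderate:
 assumes p: "pairs c d M N" and E: "Eloc M c d E" and disj: "!!n k. c n + d n / 2 ~= c k - d k / 2"
  and uc: "sph_uc (EPf M c d E)" and rd: "rdense (ap c d 1)" and d0: "0 < \<delta>\<^sub>0"
 obtains m where "0 < m" "!!z. (!!n. apart \<delta>\<^sub>0 c d n z) ==>
   \<exists>u. EPf M c d E z = Some u \<and> m <= norm u \<and> norm u <= 1/m"
proof -
 define f where "f = EPf M c d E"
 have E0: "!!z. E z ~= 0" using E by (simp add: Eloc_def)
 note V = EPf_values[where M = M and c = c and d = d and E = E, OF E0, folded f_def]
 have f: "meromorphic_C f" unfolding f_def by (rule EPf_divisor(1)[OF p E disj])
 have uc: "sph_uc f" using uc by (simp add: f_def)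
 obtain L where L: "!!x. \<exists>\<tau>\<in>ball x L. ap c d 1 \<tau>" using rd unfolding rdense_def by blast
 have near: "\<exists>n. norm (c n + d n / 2 - x) <= 2 + L" "\<exists>n. norm (c n - d n / 2 - x) <= 2 + L" for x
 proof -
  have "\<exists>n. norm (c n + s * d n / 2 - x) <= 2 + L" if s: "s = 1 \<or> s = -1" for s
  proof -
   obtain \<tau> where t: "\<tau> \<in> ball (x - (c 0 + s * d 0 / 2)) L" "ap c d 1 \<tau>" using L by blast
   obtain \<sigma> where "\<forall>n. norm (c n + \<tau> - c (\<sigma> n)) < 1 \<and> norm (d n - d (\<sigma> n)) < 1" using t(2) unfolding ap_def by blast
   hence s2: "norm (c 0 + \<tau> - c (\<sigma> 0)) < 1" "norm (d 0 - d (\<sigma> 0)) < 1" by simp_all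
   define k where "k = \<sigma> 0"
   have "norm (c k + s * d k / 2 - (c 0 + s * d 0 / 2 + \<tau>)) <= 2" using pair_close[of c 0 \<tau> k 1 d] s2 s by (auto simp: k_def)
   moreover have "norm (c 0 + s * d 0 / 2 + \<tau> - x) <= L" using t(1) by (simp add: dist_norm norm_minus_commute algebra_simps)
   ultimately have "norm (c k + s * d k / 2 - x) <= 2 + L"
    using norm_triangle_le[of "c k + s * d k / 2 - (c 0 + s * d 0 / 2 + \<tau>)" "c 0 + s * d 0 / 2 + \<tau> - x" "2 + L"] by (simp only: diff_add_cancel add_diff_eq)
   thus ?thesis by blast
  qed
  from this[of 1] this[of "-1"] show "\<exists>n. norm (c n + d n / 2 - x) <= 2 + L" "\<exists>n. norm (c n - d n / 2 - x) <= 2 + L" by simp_all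
 qed
 have pole: "\<exists>q. norm (q - x) <= 2 + L \<and> f q = None" for x
  using near(2)[of x] V(2) by blast
 obtain m1 where m1: "0 < m1" "!!z u. f z = Some u ==> (!!y. norm (y - z) < \<delta>\<^sub>0 ==> f y ~= Some 0) ==> m1 <= norm u"
  by (rule lower_bound_away_from_zeros[OF f uc pole d0]) blast
 have uc': "sph_uc (%z. sinv (f z))" using uc unfolding sph_uc_def rhoS_sinv .
 have pole': "\<exists>q. norm (q - x) <= 2 + L \<and> sinv (f q) = None" for x
 proof -
  obtain n where "norm (c n + d n / 2 - x) <= 2 + L" using near(1) by blast
  moreover have "f (c n + d n / 2) = Some 0" by (rule V(3)[OF p disj])
  ultimately show ?thesis by (intro exI[of _ "c n + d n / 2"]) (simp add: sinv_def)
 qed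
 obtain m2 where m2: "0 < m2" "!!z u. sinv (f z) = Some u ==> (!!y. norm (y - z) < \<delta>\<^sub>0 ==> sinv (f y) ~= Some 0) ==> m2 <= norm u"
  by (rule lower_bound_away_from_zeros[OF sinv_meromorphic[OF f] uc' pole' d0]) blast
 show thesis
 proof (rule that[of "min m1 m2"])
  show "0 < min m1 m2" using m1 m2 by simp
  fix z assume far: "!!n. apart \<delta>\<^sub>0 c d n z"
  have nz: "f y ~= Some 0" if "norm (y - z) < \<delta>\<^sub>0" for y
  proof
   assume "f y = Some 0"
   then obtain n where "c n + d n / 2 = y" using V(1) by blast
   thus False using far[of n] that by auto
  qed
  have np: "f y ~= None" if "norm (y - z) < \<delta>\<^sub>0" for y
  proof
   assume "f y = None"
   then obtain n where "c n - d n / 2 = y" using V(2) by blast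
   thus False using far[of n] that by auto
  qed
  obtain u where u: "f z = Some u" using np[of z] d0 by auto
  have u0: "u ~= 0" using nz[of z] d0 u by auto
  have "m1 <= norm u" by (rule m1(2)[OF u nz])
  moreover have "m2 <= norm (inverse u)"
  proof (rule m2(2)[of z])
   show "sinv (f z) = Some (inverse u)" using u u0 by (simp add: sinv_def)
   fix y assume "norm (y - z) < \<delta>\<^sub>0"
   thus "sinv (f y) ~= Some 0" using np[of y] by (auto simp: sinv_def split: option.splits)
  qed
  moreover have "norm u <= 1 / m2"
  proof -
   have "m2 <= 1 / norm u" using \<open>m2 <= norm (inverse u)\<close> by (simp add: norm_inverse inverse_eq_divide norm_divide)
   hence "m2 * norm u <= 1" using u0 by (simp add: pos_le_divide_eq)
   thus ?thesis using m2(1) by (simp add: pos_le_divide_eq mult.commute)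
  qed
  moreover have "1 / m2 <= 1 / min m1 m2" using m1(1) m2(1) by (intro frac_le) auto
  ultimately show "\<exists>u. EPf M c d E z = Some u \<and> min m1 m2 <= norm u \<and> norm u <= 1 / min m1 m2"
   using u unfolding f_def by (intro exI[of _ u]) auto
 qed
qed

lemma EPf_exponential_bounded:
 assumes p: "pairs c d M N" and E: "Eloc M c d E" and disj: "!!n k. c n + d n / 2 ~= c k - d k / 2"
  and uc: "sph_uc (EPf M c d E)" and rd: "rdense (ap c d 1)"
 obtains B where "0 < B" "!!z. norm (E z) <= B" "!!z. norm (inverse (E z)) <= B"
proof -
 have E0: "!!z. E z ~= 0" using E by (simp add: Eloc_def)
 obtain \<delta>\<^sub>0 where d0: "0 < \<delta>\<^sub>0" and circ: "!!z. \<exists>r. 1/2 <= r \<and> r <= 1 \<and> (\<forall>y n. norm (y - z) = r \<longrightarrow> apart \<delta>\<^sub>0 c d n y)"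
  by (rule good_circle[OF p]) blast
 obtain m where m: "0 < m" "!!z. (!!n. apart \<delta>\<^sub>0 c d n z) ==>
   \<exists>u. EPf M c d E z = Some u \<and> m <= norm u \<and> norm u <= 1/m" by (rule EPf_moderate[OF p E disj uc rd d0]) blast
 obtain b where b: "0 < b" "!!z. (!!n. apart \<delta>\<^sub>0 c d n z) ==>
   PP M c d z ~= 0 \<and> norm (PP M c d z) <= b \<and> norm (inverse (PP M c d z)) <= b" by (rule PP_bounded_away[OF p d0]) blast
 have far: "norm (E y) <= 1/m * b \<and> norm (inverse (E y)) <= 1/m * b"
  if far0: "!!n. apart \<delta>\<^sub>0 c d n y" for y
 proof -
  obtain u where u: "EPf M c d E y = Some u" "m <= norm u" "norm u <= 1/m" using m(2)[OF far0] by blast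
  note bb = b(2)[OF far0]
  have ue: "u = E y * PP M c d y" using u(1) by (simp add: EPf_def split: if_splits)
  hence "E y = u * inverse (PP M c d y)" using bb by simp
  hence "norm (E y) = norm u * norm (inverse (PP M c d y))" by (simp only: norm_mult)
  also have "... <= 1/m * b" using u bb m(1) by (intro mult_mono) auto
  finally have 1: "norm (E y) <= 1/m * b" .
  have "inverse (E y) = inverse u * PP M c d y" using ue bb by simp
  hence "norm (inverse (E y)) = norm (inverse u) * norm (PP M c d y)" by (simp only: norm_mult)
  also have "... <= 1/m * b"
  proof (rule mult_mono)
   show "norm (inverse u) <= 1/m" using frac_le[of 1 1 m "norm u"] u m(1) by (simp add: norm_inverse inverse_eq_divide norm_divide)
  qed (use bb m(1) in auto)
  finally show ?thesis using 1 by simp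
 qed
 define B where "B = 1/m * b * exp (25 * N * (2 * M + 2)^2) * exp (25 * N * (2 * M + 2)^2)"
 show thesis
 proof (rule that[of B])
  show "0 < B" using m(1) b(1) by (simp add: B_def)
  fix z
  obtain r where r: "1/2 <= r" "r <= 1" "!!y n. norm (y - z) = r ==> apart \<delta>\<^sub>0 c d n y"
   using circ[of z] by blast
  show "norm (E z) <= B" unfolding B_def
   by (rule Eloc_circle_bound[OF p E r(1,2)]) (rule conjunct1[OF far[OF r(3)]])
  show "norm (inverse (E z)) <= B" unfolding B_def
   by (rule Eloc_circle_bound[OF pairs_minus[OF p] Eloc_inverse[OF E] r(1,2)]) (rule conjunct2[OF far[OF r(3)]])
 qed
qed

text \<open>On moderate values spherical closeness controls ratios. \<open>P\<close> bounds sqrt (1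
  + |u|^2); \<epsilon> P <= 1 excludes infinity and lets the term \<epsilon> P X be absorbed into 2
  X.\<close>

lemma rhoS_ratio:
 assumes m: "0 < m" and e: "0 < \<eta>"
 obtains \<epsilon> where "0 < \<epsilon>" "!!x u. m <= norm u ==> norm u <= 1/m ==> rhoS x (Some u) < \<epsilon> ==> \<exists>v. x = Some v \<and> norm (v / u - 1) <= \<eta>"
proof -
 define P where "P = 1 + 1/m"
 have P: "P > 1" using m by (simp add: P_def)
 define \<epsilon> where "\<epsilon> = min (1/P) (\<eta> * m / P^2)"
 have eps: "0 < \<epsilon>" "\<epsilon> * P <= 1" "\<epsilon> * P^2 <= \<eta> * m"
 proof -
  show "0 < \<epsilon>" using P e m by (simp add: \<epsilon>_def)
  have "\<epsilon> * P <= (1/P) * P" using P by (intro mult_right_mono) (auto simp: \<epsilon>_def)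
  thus "\<epsilon> * P <= 1" using P by simp
  have "\<epsilon> * P^2 <= (\<eta> * m / P^2) * P^2" using P by (intro mult_right_mono) (auto simp: \<epsilon>_def)
  thus "\<epsilon> * P^2 <= \<eta> * m" using P by simp
 qed
 have sq: "sqrt (1 + (norm w)^2) <= 1 + norm w" for w :: complex
  by (rule real_le_lsqrt[THEN order_trans[OF real_sqrt_le_mono, rotated]]) (auto simp: power2_eq_square algebra_simps)
 have sq0: "0 < sqrt (1 + (norm w)^2)" for w :: complex by (simp add: add_pos_nonneg)
 show thesis
 proof (rule that[OF eps(1)])
  fix x u assume u: "m <= norm u" "norm u <= 1/m" and r: "rhoS x (Some u) < \<epsilon>"
  have su: "sqrt (1 + (norm u)^2) <= P" using sq[of u] u by (simp add: P_def)
  show "\<exists>v. x = Some v \<and> norm (v / u - 1) <= \<eta>"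
  proof (cases x)
   case None
   have "2 / P <= 2 / sqrt (1 + (norm u)^2)" using su sq0[of u] by (intro frac_le) auto
   hence "2 / P < \<epsilon>" using r None by (simp add: rhoS_def)
   hence "2 < \<epsilon> * P" using P by (simp add: field_simps)
   thus ?thesis using eps(2) by simp
  next
   case (Some v)
   define X where "X = norm (v - u)"
   have X0: "0 <= X" by (simp add: X_def)
   have "norm v <= norm u + X" using norm_triangle_ineq[of u "v - u"] by (simp add: X_def)
   hence sv: "sqrt (1 + (norm v)^2) <= P + X" using sq[of v] u by (simp add: P_def)
   have "2 * X / (sqrt (1 + (norm v)^2) * sqrt (1 + (norm u)^2)) < \<epsilon>" using r Some by (simp add: rhoS_def X_def)
   hence "2 * X < \<epsilon> * (sqrt (1 + (norm v)^2) * sqrt (1 + (norm u)^2))" using sq0[of u] sq0[of v] by (simp add: pos_divide_less_eq)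
   also have "... <= \<epsilon> * ((P + X) * P)" using eps(1) su sv sq0[of u] sq0[of v] P X0 by (intro mult_left_mono mult_mono) auto
   also have "... = \<epsilon> * P^2 + (\<epsilon> * P) * X" by (simp add: power2_eq_square algebra_simps)
   also have "... <= \<eta> * m + 1 * X" using eps X0 by (intro add_mono mult_right_mono) auto
   finally have "X <= \<eta> * m" by simp
   also have "... <= \<eta> * norm u" using u e by (intro mult_left_mono) auto
   finally have Xu: "X <= \<eta> * norm u" .
   have "0 < norm u" using u m by linarith
   hence "X / norm u <= \<eta>" using Xu by (simp only: pos_divide_le_eq)
   moreover have "v / u - 1 = (v - u) / u" using u m by (auto simp: diff_divide_distrib)
   ultimately show ?thesis using Some by (simp add: X_def norm_divide)
  qed
 qed
qed

text \<open>On a good circle the quotients of f and of \<open>PP\<close> along \<tau> are close to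
  1, hence so is that of \<open>E\<close>. The kernel change \<open>e\<close> turns the latter into
  the holomorphic \<open>q\<close>, and the maximum principle brings the estimate to the
  centre.\<close>

lemma exponential_almost_periods:
 assumes p: "pairs c d M N" and E: "Eloc M c d E" and disj: "!!n k. c n + d n / 2 ~= c k - d k / 2"
  and f: "almost_elliptic (EPf M c d E)" and rd: "!!\<delta>. 0 < \<delta> ==> rdense (ap c d \<delta>)"
 shows "rdense (%\<tau>. \<forall>z. norm (E (z + \<tau>) / E z - 1) <= 1/10)"
proof -
 note M = pairsD(1)[OF p] and N = pairsD(2)[OF p]
 have E0: "!!z. E z ~= 0" using E by (simp add: Eloc_def)
 note uc = almost_elliptic_sph_uc[OF f]
 obtain \<delta>\<^sub>0 where d0: "0 < \<delta>\<^sub>0" and circ: "!!z. \<exists>r. 1/2 <= r \<and> r <= 1 \<and> (\<forall>y n. norm (y - z) = r \<longrightarrow> apart \<delta>\<^sub>0 c d n y)"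
  by (rule good_circle[OF p]) blast
 obtain m where m: "0 < m" "!!z. (!!n. apart \<delta>\<^sub>0 c d n z) ==>
   \<exists>u. EPf M c d E z = Some u \<and> m <= norm u \<and> norm u <= 1/m" by (rule EPf_moderate[OF p E disj uc rd[OF zero_less_one] d0]) blast
 \<comment> \<open>\<open>factor_ratio_bound\<close> is used twice, on the circle and at the centre,
   so 49 t has to be at most 1/10.\<close>
 define t :: real where "t = 1/490"
 have t: "0 < t" "t <= 1/4" "7 * t <= 1/4" "7 * (7 * t) <= 1/10" by (auto simp: t_def)
 obtain \<epsilon> where eps: "0 < \<epsilon>" "!!x u. m <= norm u ==> norm u <= 1/m ==> rhoS x (Some u) < \<epsilon> ==> \<exists>v. x = Some v \<and> norm (v / u - 1) <= t"
  by (rule rhoS_ratio[OF m(1) t(1)]) blast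
 obtain \<delta>1 where d1: "0 < \<delta>1" "!!\<tau> \<sigma> z. bij \<sigma> ==> (!!n. norm (c n + \<tau> - c (\<sigma> n)) < \<delta>1 \<and> norm (d n - d (\<sigma> n)) < \<delta>1) ==>
   (!!n. apart \<delta>\<^sub>0 c d n z) ==>
   PP M c d z ~= 0 \<and> norm (PP M c d (z + \<tau>) / PP M c d z - 1) <= t" by (rule PP_ratio[OF p d0 t(1)]) blast
 define K where "K = 25 * N * (2 * M + 3)^2"
 have K: "1 <= K" unfolding K_def using N M by (intro order_trans[OF _ mult_mono[of "25" "25 * N" 1 "(2 * M + 3)^2"]]) (auto simp: one_le_power)
 define \<delta> where "\<delta> = min \<epsilon> (min \<delta>1 (t / (4 * K)))"
 have dl: "0 < \<delta>" "\<delta> <= \<epsilon>" "\<delta> <= \<delta>1" "\<delta> <= t / (4 * K)" using eps d1 t K by (auto simp: \<delta>_def)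
 have "t / (4 * K) <= 1/1" using K t by (intro frac_le) auto
 hence dl1: "\<delta> <= 1" using dl(4) by simp
 have "K * (4 * \<delta>) <= K * (4 * (t / (4 * K)))" using dl K by (intro mult_left_mono) auto
 hence dlK: "K * (4 * \<delta>) <= t" using K by simp
 have "rdense (%\<tau>. ap c d \<delta> \<tau> \<and> (\<forall>z. rhoS (EPf M c d E (z + \<tau>)) (EPf M c d E z) < \<delta>))"
  by (rule common_almost_periods[OF f _ dl(1)]) (rule rd)
 thus ?thesis
 proof (rule rdense_mono)
  fix \<tau> assume h: "ap c d \<delta> \<tau> \<and> (\<forall>z. rhoS (EPf M c d E (z + \<tau>)) (EPf M c d E z) < \<delta>)"
  then obtain \<sigma> where s: "bij \<sigma>" "!!n. norm (c n + \<tau> - c (\<sigma> n)) < \<delta>" "!!n. norm (d n - d (\<sigma> n)) < \<delta>" unfolding ap_def by blast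
  show "\<forall>z. norm (E (z + \<tau>) / E z - 1) <= 1/10"
  proof
  fix z
  obtain r where r: "1/2 <= r" "r <= 1" "!!y n. norm (y - z) = r ==> apart \<delta>\<^sub>0 c d n y"
   using circ[of z] by blast
  define F where "F = {n. norm (c n - z) < 2 * M + 3}"
  have F: "finite F" unfolding F_def by (rule pairs_finite(2)[OF p])
  define e where "e = (%y. \<Sum>n\<in>F. kap M (d n) (c n - y) - kap M (d (\<sigma> n)) (c (\<sigma> n) - (y + \<tau>)))"
  have eb: "norm (e y) <= t" for y
  proof -
   have "norm (e y) <= (\<Sum>n\<in>F. 4 * \<delta>)" unfolding e_def
   proof (rule sum_norm_le)
    fix n
    have "norm (kap M (d n) (c n - y) - kap M (d (\<sigma> n)) (c (\<sigma> n) - (y + \<tau>)))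
    <= 2 * (norm ((c n - y) - (c (\<sigma> n) - (y + \<tau>))) + norm (d n - d (\<sigma> n)))"
    by (rule kap_lipschitz[OF M pairsD(3)[OF p] pairsD(3)[OF p]])
    also have "(c n - y) - (c (\<sigma> n) - (y + \<tau>)) = c n + \<tau> - c (\<sigma> n)" by simp
    also have "2 * (norm (c n + \<tau> - c (\<sigma> n)) + norm (d n - d (\<sigma> n))) <= 2 * (\<delta> + \<delta>)"
    using s(2,3)[of n] by (intro mult_left_mono add_mono) auto
    finally show "norm (kap M (d n) (c n - y) - kap M (d (\<sigma> n)) (c (\<sigma> n) - (y + \<tau>))) <= 4 * \<delta>" by simp
   qed
   also have "... = real (card F) * (4 * \<delta>)" by simp
   also have "... <= K * (4 * \<delta>)" unfolding K_def F_def using dl(1) M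
    by (intro mult_right_mono pairs_count(2)[OF p, of _ _ z]) auto
   finally show ?thesis using dlK by linarith
  qed
  define q where "q = (%y. E (y + \<tau>) / E y * exp (e y))"
  have "norm (q z - 1) <= 7 * t"
  proof (rule disc_max_modulus[of "%y. q y - 1" z r])
   have 1: "(%y. E y * exp (- (kapS M c d F y))) holomorphic_on ball z 2"
    by (rule Eloc_any[OF p E F]) (auto simp: F_def)
   have injF: "inj_on \<sigma> F" by (rule inj_on_subset[OF bij_is_inj[OF s(1)] subset_UNIV])
   have re: "(\<Sum>k\<in>\<sigma> ` F. kap M (d k) (c k - y)) = (\<Sum>n\<in>F. kap M (d (\<sigma> n)) (c (\<sigma> n) - y))" for y
    unfolding sum.reindex[OF injF] o_def ..
   have sub: "{k. norm (c k - (z + \<tau>)) < 2 * M + 2} \<subseteq> \<sigma> ` F"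
   proof
    fix k assume k: "k \<in> {k. norm (c k - (z + \<tau>)) < 2 * M + 2}"
    obtain n where n: "k = \<sigma> n" using s(1) by (metis bij_pointE)
    have "norm (c n - z) <= norm (c n + \<tau> - c (\<sigma> n)) + norm (c (\<sigma> n) - (z + \<tau>))"
    using norm_triangle_ineq[of "c n + \<tau> - c (\<sigma> n)" "c (\<sigma> n) - (z + \<tau>)"] by simp
    hence "norm (c n - z) < 2 * M + 3" using s(2)[of n] dl1 k n by simp
    thus "k \<in> \<sigma> ` F" using n by (auto simp: F_def)
   qed
   have "(%y. E y * exp (- (\<Sum>k\<in>\<sigma> ` F. kap M (d k) (c k - y)))) holomorphic_on ball (z + \<tau>) 2"
    by (rule Eloc_any[OF p E finite_imageI[OF F] sub])
   hence "((%y. E y * exp (- (\<Sum>k\<in>\<sigma> ` F. kap M (d k) (c k - y)))) \<circ> (%y. y + \<tau>)) holomorphic_on ball z 2"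
    by (rule holomorphic_on_compose_gen[rotated]) (auto simp: dist_norm intro!: holomorphic_intros)
   hence 2: "(%y. E (y + \<tau>) * exp (- (\<Sum>n\<in>F. kap M (d (\<sigma> n)) (c (\<sigma> n) - (y + \<tau>))))) holomorphic_on ball z 2"
    unfolding o_def re .
   have "(%y. (E (y + \<tau>) * exp (- (\<Sum>n\<in>F. kap M (d (\<sigma> n)) (c (\<sigma> n) - (y + \<tau>))))) / (E y * exp (- (kapS M c d F y))) - 1) holomorphic_on ball z 2"
    by (intro holomorphic_intros 1 2) (simp add: E0)
   moreover have "(E (y + \<tau>) * exp (- (\<Sum>n\<in>F. kap M (d (\<sigma> n)) (c (\<sigma> n) - (y + \<tau>))))) / (E y * exp (- (kapS M c d F y))) = q y" for y
   proof -
    have "A * exp (- S) / (B * exp (- T)) = A / B * exp (T - S)" for A B S T :: complex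
    by (simp add: exp_diff exp_minus field_simps)
    thus ?thesis unfolding q_def e_def sum_subtractf .
   qed
   ultimately show "(%y. q y - 1) holomorphic_on ball z 2" by simp
   fix y assume y: "norm (y - z) = r"
   note far = r(3)[OF y]
   obtain u where u: "EPf M c d E y = Some u" "m <= norm u" "norm u <= 1/m" using m(2)[OF far] by blast
   have "rhoS (EPf M c d E (y + \<tau>)) (Some u) < \<epsilon>" using h dl(2) u(1) by (metis order_less_le_trans)
   then obtain v where v: "EPf M c d E (y + \<tau>) = Some v" "norm (v / u - 1) <= t" using eps(2)[OF u(2,3)] by blast
   have s1: "!!n. norm (c n + \<tau> - c (\<sigma> n)) < \<delta>1 \<and> norm (d n - d (\<sigma> n)) < \<delta>1" using s(2,3) dl(3) by (meson order_less_le_trans)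
   note PPr = d1(2)[OF s(1) s1 far]
   define w where "w = PP M c d (y + \<tau>) / PP M c d y"
   have ue: "u = E y * PP M c d y" "v = E (y + \<tau>) * PP M c d (y + \<tau>)" using u(1) v(1) by (simp_all add: EPf_def split: if_splits)
   have w: "norm (w - 1) <= t" "w ~= 0" using PPr t(2) by (auto simp: w_def)
   have pn: "PP M c d (y + \<tau>) ~= 0" using w(2) by (auto simp: w_def)
   have "q y = (1 + (v / u - 1)) / (1 + (w - 1)) * exp (e y)"
    unfolding q_def ue w_def using PPr pn E0[of y] by (simp add: field_simps)
   thus "norm (q y - 1) <= 7 * t" using factor_ratio_bound[OF v(2) w(1) eb t(2)] by simp
  qed (use r in auto)
  moreover have "E (z + \<tau>) / E z = (1 + (q z - 1)) / (1 + 0) * exp (- e z)" by (simp add: q_def exp_minus)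
  ultimately have "norm (E (z + \<tau>) / E z - 1) <= 7 * (7 * t)"
   using factor_ratio_bound[of "q z - 1" "7 * t" 0 "- e z"] eb[of z] t by simp
  thus "norm (E (z + \<tau>) / E z - 1) <= 1/10" using t(4) by linarith
  qed
 qed
qed

subsection \<open>The logarithm of the exponential factor\<close>

text \<open>The values of \<open>g\<close> lie in the discrete set of multiples of 2 pi i.\<close>

lemma exp_one_const:
 fixes g :: "complex => complex"
 assumes S: "convex S" "continuous_on S g" "!!z. z \<in> S ==> exp (g z) = 1" and xy: "x \<in> S" "y \<in> S"
 shows "g x = g y"
proof -
 have "g constant_on S"
 proof (rule continuous_discrete_range_constant[OF convex_connected[OF S(1)] S(2)])
  fix x assume x: "x \<in> S"
  have "1 <= norm (g y - g x)" if y: "y \<in> S" "g y ~= g x" for y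
  proof -
   define w where "w = g y - g x"
   have "exp w = 1" using S(3)[OF x] S(3)[OF y(1)] by (simp add: w_def exp_diff)
   then obtain n :: int where n: "Re w = 0" "Im w = of_int (2 * n) * pi" unfolding exp_eq_1 by blast
   have "n ~= 0" using n y(2) by (auto simp: w_def complex_eq_iff)
   hence "1 <= \<bar>real_of_int (2 * n)\<bar>" by linarith
   hence "1 * 1 <= \<bar>real_of_int (2 * n)\<bar> * pi" using pi_gt3 by (intro mult_mono) auto
   hence "1 <= \<bar>Im w\<bar>" unfolding n(2) abs_mult by simp
   thus ?thesis using abs_Im_le_cmod[of w] by (simp add: w_def)
  qed
  thus "\<exists>e>0. \<forall>y. y \<in> S \<and> g y ~= g x \<longrightarrow> e <= norm (g y - g x)" by (intro exI[of _ 1]) auto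
 qed
 thus ?thesis using xy unfolding constant_on_def by metis
qed

text \<open>Hyers' stability argument. Computing u (m n) in two ways shows that every (u m - C) / m
  lies below every (u n + C) / n, and the slope \<alpha> is the infimum of the latter.
  \<open>U n\<close> is the value at n + 1, which avoids division by 0.\<close>

lemma hyers_real:
 fixes u :: "real => real"
 assumes q: "!!x y. \<bar>u (x + y) - u x - u y\<bar> <= C" and b: "!!t. 0 <= t ==> t <= 1 ==> \<bar>u t\<bar> <= K"
 obtains \<alpha> B where "!!t. \<bar>u t - \<alpha> * t\<bar> <= B"
proof -
 have C: "0 <= C" using q[of 0 0] by linarith
 have mult: "\<bar>u (real (Suc m) * x) - real (Suc m) * u x\<bar> <= real (Suc m) * C" for m x
 proof (induction m)
  case 0 thus ?case using C by simp
 next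
  case (Suc m)
  have "real (Suc (Suc m)) * x = real (Suc m) * x + x" by (simp add: algebra_simps)
  hence "\<bar>u (real (Suc (Suc m)) * x) - u (real (Suc m) * x) - u x\<bar> <= C" using q[of "real (Suc m) * x" x] by simp
  moreover have "real (Suc (Suc m)) * u x = real (Suc m) * u x + u x" "real (Suc (Suc m)) * C = real (Suc m) * C + C" by (simp_all add: algebra_simps)
  ultimately show ?case using Suc by linarith
 qed
 define U where "U = (%n. u (real (Suc n)))"
 have cmp: "(U m - C) / real (Suc m) <= (U n + C) / real (Suc n)" for m n
 proof -
  have 1: "\<bar>u (real (Suc m) * real (Suc n)) - real (Suc m) * U n\<bar> <= real (Suc m) * C" using mult[of m "real (Suc n)"] by (simp add: U_def)
  have 2: "\<bar>u (real (Suc m) * real (Suc n)) - real (Suc n) * U m\<bar> <= real (Suc n) * C" using mult[of n "real (Suc m)"] by (simp only: U_def mult.commute)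
  have "real (Suc n) * U m - real (Suc n) * C <= real (Suc m) * U n + real (Suc m) * C" using 1 2 by linarith
  hence "(U m - C) * real (Suc n) <= (U n + C) * real (Suc m)"
   by (simp only: left_diff_distrib distrib_right mult.commute[of "real (Suc n)"] mult.commute[of "real (Suc m)"])
  hence "(U m - C) * real (Suc n) / (real (Suc m) * real (Suc n)) <= (U n + C) * real (Suc m) / (real (Suc m) * real (Suc n))"
   by (rule divide_right_mono) simp
  thus ?thesis by (simp del: of_nat_Suc)
 qed
 define \<alpha> where "\<alpha> = (INF n. (U n + C) / real (Suc n))"
 have bdd: "bdd_below (range (%n. (U n + C) / real (Suc n)))" using cmp[of 0] by (intro bdd_belowI2) blast
 have a1: "\<alpha> <= (U n + C) / real (Suc n)" for n unfolding \<alpha>_def by (rule cINF_lower[OF bdd]) simp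
 have a2: "(U m - C) / real (Suc m) <= \<alpha>" for m unfolding \<alpha>_def by (rule cINF_greatest) (use cmp in auto)
 have nat: "\<bar>u (real n) - \<alpha> * real n\<bar> <= C" for n
 proof (cases n)
  case 0 thus ?thesis using q[of 0 0] by simp
 next
  case (Suc m)
  have "\<alpha> * real (Suc m) <= U m + C" using a1[of m] by (simp add: pos_le_divide_eq del: of_nat_Suc)
  moreover have "U m - C <= \<alpha> * real (Suc m)" using a2[of m] by (simp add: pos_divide_le_eq del: of_nat_Suc)
  ultimately show ?thesis unfolding Suc U_def by linarith
 qed
 have pos: "\<bar>u t - \<alpha> * t\<bar> <= 2 * C + K + \<bar>\<alpha>\<bar>" if t: "0 <= t" for t
 proof -
  define n where "n = nat \<lfloor>t\<rfloor>"
  define s where "s = t - real n"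
  have nf: "real n = real_of_int \<lfloor>t\<rfloor>" using t by (simp add: n_def)
  have s: "0 <= s" "s <= 1" "t = real n + s" unfolding s_def nf by linarith+
  have "\<bar>\<alpha> * s\<bar> <= \<bar>\<alpha>\<bar> * 1" unfolding abs_mult using s by (intro mult_left_mono) auto
  moreover have "\<alpha> * t = \<alpha> * real n + \<alpha> * s" by (simp add: s(3) algebra_simps)
  moreover have "\<bar>u t - u (real n) - u s\<bar> <= C" using q[of "real n" s] s(3) by simp
  ultimately show ?thesis using nat[of n] b[OF s(1,2)] by linarith
 qed
 have b0: "\<bar>u 0\<bar> <= K" by (rule b) auto
 have "\<bar>u t - \<alpha> * t\<bar> <= 3 * C + 2 * K + \<bar>\<alpha>\<bar>" for t
 proof (cases "0 <= t")
  case True thus ?thesis using pos[OF True] C b0 by linarith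
 next
  case False
  have "\<bar>u 0 - u t - u (- t)\<bar> <= C" using q[of t "- t"] by simp
  moreover have "\<bar>u (- t) + \<alpha> * t\<bar> <= 2 * C + K + \<bar>\<alpha>\<bar>" using pos[of "- t"] False by simp
  ultimately show ?thesis using b0 by linarith
 qed
 thus thesis by (rule that)
qed

lemma hyers_complex:
 fixes u :: "complex => real"
 assumes q: "!!x y. \<bar>u (x + y) - u x - u y\<bar> <= C" and b: "!!z. norm z <= 1 ==> \<bar>u z\<bar> <= K"
 obtains \<beta> B where "!!z. \<bar>u z - Im (\<beta> * z)\<bar> <= B"
proof -
 obtain \<alpha> B1 where a: "!!t. \<bar>u (of_real t) - \<alpha> * t\<bar> <= B1"
  by (rule hyers_real[of "%t. u (of_real t)" C K]) (use q b in auto)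
 obtain \<alpha>' B2 where a': "!!t. \<bar>u (\<i> * of_real t) - \<alpha>' * t\<bar> <= B2"
 proof (rule hyers_real[of "%t. u (\<i> * of_real t)" C K])
  show "\<bar>u (\<i> * complex_of_real (x + y)) - u (\<i> * complex_of_real x) - u (\<i> * complex_of_real y)\<bar> <= C" for x y
   using q[of "\<i> * of_real x" "\<i> * of_real y"] by (simp add: distrib_left)
  show "\<bar>u (\<i> * complex_of_real t)\<bar> <= K" if "0 <= t" "t <= 1" for t using that by (intro b) (simp add: norm_mult)
 qed blast
 show thesis
 proof (rule that[of "Complex \<alpha>' \<alpha>" "B1 + B2 + C"])
  fix z
  have "\<bar>u z - u (of_real (Re z)) - u (\<i> * of_real (Im z))\<bar> <= C"
   using q[of "of_real (Re z)" "\<i> * of_real (Im z)"] by (simp add: complex_eq[symmetric])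
  moreover have "Im (Complex \<alpha>' \<alpha> * z) = \<alpha> * Re z + \<alpha>' * Im z" by simp
  ultimately show "\<bar>u z - Im (Complex \<alpha>' \<alpha> * z)\<bar> <= B1 + B2 + C" using a[of "Re z"] a'[of "Im z"] by linarith
 qed
qed

lemma Eloc_continuous:
 assumes p: "pairs c d M N" and E: "Eloc M c d E" shows "continuous_on UNIV E"
proof -
 have "isCont E w" for w
 proof -
  obtain F where F: "finite F" "(%z. E z * exp (- (kapS M c d F z))) holomorphic_on ball w 2"
   using E unfolding Eloc_def by blast
  have "continuous_on (ball w 2) (%z. (E z * exp (- (kapS M c d F z))) * exp (kapS M c d F z))"
   by (intro continuous_intros holomorphic_on_imp_continuous_on[OF F(2)] pairsD[OF p])
  moreover have "(%z. (E z * exp (- (kapS M c d F z))) * exp (kapS M c d F z)) = E"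
   by (simp add: fun_eq_iff mult.assoc exp_add[symmetric])
  ultimately have "continuous_on (ball w 2) E" by (simp only:)
  thus ?thesis by (simp add: continuous_on_eq_continuous_at)
 qed
 thus ?thesis by (simp add: continuous_on_eq_continuous_at)
qed

text \<open>The function is a continuous logarithm of a zero-free holomorphic one, so on the disc it
  differs from a holomorphic logarithm by a constant.\<close>

lemma log_local_holomorphic:
 assumes p: "pairs c d M N" and E: "Eloc M c d E" and h: "continuous_on UNIV h" "!!z. exp (h z) = E z"
  and F: "finite F" "{n. norm (c n - w) < 2 * M + 2} \<subseteq> F"
 shows "(%z. h z - (kapS M c d F z)) holomorphic_on ball w 2"
proof -
 define q where "q = (%z. E z * exp (- (kapS M c d F z)))"
 have q: "q holomorphic_on ball w 2" unfolding q_def by (rule Eloc_any[OF p E F])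
 have q0: "q z ~= 0" for z using E by (simp add: q_def Eloc_def)
 obtain lg where l: "lg holomorphic_on ball w 2" "!!z. z \<in> ball w 2 ==> q z = exp (lg z)"
  using contractible_imp_holomorphic_log[OF q convex_imp_contractible[OF convex_ball] q0] by blast
 define R where "R = (%z. h z - (kapS M c d F z))"
 have Rc: "continuous_on (ball w 2) R" unfolding R_def
  by (intro continuous_intros continuous_on_subset[OF h(1)] pairsD[OF p]) auto
 have "R z - lg z = R w - lg w" if z: "z \<in> ball w 2" for z
 proof (rule exp_one_const[OF convex_ball, of w 2 "%z. R z - lg z"])
  show "continuous_on (ball w 2) (%z. R z - lg z)" by (intro continuous_intros Rc holomorphic_on_imp_continuous_on l)
  fix y assume y: "y \<in> ball w 2"
  have "exp (R y) = q y" by (simp add: R_def q_def exp_diff h(2) exp_minus divide_inverse)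
  thus "exp (R y - lg y) = 1" using l(2)[OF y] by (simp add: exp_diff)
 qed (use z in auto)
 hence lR: "lg z + (R w - lg w) = R z" if "z \<in> ball w 2" for z using that by (simp add: algebra_simps)
 have "(%z. lg z + (R w - lg w)) holomorphic_on ball w 2" by (intro holomorphic_intros l)
 hence "R holomorphic_on ball w 2" by (rule holomorphic_transform) (rule lR)
 thus ?thesis unfolding R_def .
qed

text \<open>The real part of the logarithm \<open>h\<close> is bounded, so
  \<open>schwarz_half_plane\<close> bounds increments of \<open>h\<close> over bounded distances.
  Along an almost period \<tau> of \<open>E\<close>, the difference of h (z + \<tau>) - h (z) and a
  principal logarithm of modulus at most 1/5 is constant by connectedness. Together these make
  \<open>h\<close> quasi-additive, and Hyers' argument gives the linear form in its imaginary
  part.\<close>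

lemma exponential_structure:
 assumes p: "pairs c d M N" and E: "Eloc M c d E" and B: "0 < B" "!!z. norm (E z) <= B" "!!z. norm (inverse (E z)) <= B"
  and T: "rdense (%\<tau>. \<forall>z. norm (E (z + \<tau>) / E z - 1) <= 1/10)"
 obtains \<beta> k K where "continuous_on UNIV k" "!!z. norm (k z) <= K" "!!z. E z = exp (\<i> * of_real (Im (\<beta> * z)) + k z)"
proof -
 note M = pairsD(1)[OF p]
 have E0: "!!z. E z ~= 0" using E by (simp add: Eloc_def)
 have Ec: "continuous_on UNIV E" by (rule Eloc_continuous[OF p E])
 obtain h where h: "continuous_on UNIV h" "!!z. E z = exp (h z)"
  using continuous_logarithm_on_contractible[OF Ec convex_imp_contractible[OF convex_UNIV]] E0 by (metis UNIV_I)
 have nE: "norm (E z) = exp (Re (h z))" for z by (simp add: h(2))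
 have Reh: "\<bar>Re (h z)\<bar> <= ln B" for z
 proof -
  have "exp (Re (h z)) <= exp (ln B)" "exp (- Re (h z)) <= exp (ln B)"
   using B(2)[of z] B(3)[of z] B(1) nE[of z] by (simp_all add: norm_inverse exp_minus)
  thus ?thesis unfolding exp_le_cancel_iff by linarith
 qed
 define K where "K = 25 * N * (2 * M + 2)^2"
 have K: "0 <= K" using pairsD(2)[OF p] by (simp add: K_def)
 define K0 where "K0 = 2/3 * (2 * ln B + 2 * K + 1) + 2 * K"
 have lnB: "0 <= ln B" using Reh[of 0] by linarith
 have K0: "0 <= K0" using K lnB by (simp add: K0_def)
 have loc: "norm (h y - h z) <= K0" if y: "norm (y - z) <= 1/2" for y z
 proof -
  define F where "F = {n. norm (c n - z) < 2 * M + 2}"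
  have F: "finite F" unfolding F_def by (rule pairs_finite(2)[OF p])
  define s where "s = (%y. \<Sum>n\<in>F. kap M (d n) (c n - y))"
  have s: "norm (s y) <= K" for y unfolding s_def K_def by (rule kap_sum_bound[OF p, of _ _ z]) (use M in \<open>auto simp: F_def\<close>)
  \<comment> \<open>The subtracted constant exceeds the real part of h - s by at least 1, which puts
    \<open>G\<close> into the left half-plane.\<close>
  define G where "G = (%y. (h y - s y) - of_real (ln B + K + 1))"
  have "(%y. h y - s y) holomorphic_on ball z 2" unfolding s_def
   by (rule log_local_holomorphic[OF p E h(1) h(2)[symmetric] F]) (simp add: F_def)
  hence G: "G holomorphic_on ball z 2" unfolding G_def by (rule holomorphic_on_diff[OF _ holomorphic_on_const])
  have Gr: "Re (G y) < 0" for y using Reh[of y] s[of y] abs_Re_le_cmod[of "s y"] by (simp add: G_def)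
  have "norm (G y - G z) <= 2/3 * (- Re (G z))" by (rule schwarz_half_plane[OF G Gr]) (use y in auto)
  also have "... <= 2/3 * (2 * ln B + 2 * K + 1)" using Reh[of z] s[of z] abs_Re_le_cmod[of "s z"] by (simp add: G_def)
  finally have 1: "norm (G y - G z) <= 2/3 * (2 * ln B + 2 * K + 1)" .
  have "h y - h z = (G y - G z) + (s y - s z)" by (simp add: G_def)
  hence "norm (h y - h z) <= norm (G y - G z) + norm (s y - s z)" by (simp only: norm_triangle_ineq)
  moreover have "norm (s y - s z) <= K + K" by (rule norm_triangle_le_diff) (use s[of y] s[of z] in linarith)
  ultimately show ?thesis using 1 unfolding K0_def by linarith
 qed
 have chain: "norm (h y - h z) <= real n * K0" if "norm (y - z) <= real n / 2" for n y z
  using that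
 proof (induction n arbitrary: y)
  case 0 thus ?case by simp
 next
  case (Suc n)
  define t where "t = real n / real (Suc n)"
  have t: "0 <= t" "t * real (Suc n) = real n" "(1 - t) * real (Suc n) = 1" "t <= 1" by (auto simp: t_def field_simps)
  define w where "w = z + of_real t * (y - z)"
  have "norm (w - z) = t * norm (y - z)" using t by (simp add: w_def norm_mult)
  also have "... <= t * (real (Suc n) / 2)" using Suc.prems t by (intro mult_left_mono)
  also have "... = real n / 2" using t(2) by simp
  finally have 1: "norm (h w - h z) <= real n * K0" by (rule Suc.IH)
  have "y - w = of_real (1 - t) * (y - z)" by (simp add: w_def algebra_simps)
  hence "norm (y - w) = (1 - t) * norm (y - z)" using t(4) by (simp add: norm_mult del: of_real_diff)
  also have "... <= (1 - t) * (real (Suc n) / 2)" using Suc.prems t by (intro mult_left_mono) auto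
  also have "... = 1/2" using t(3) by simp
  finally have "norm (h y - h w) <= K0" by (rule loc)
  moreover have "norm (h y - h z) <= norm (h y - h w) + norm (h w - h z)" using norm_triangle_ineq[of "h y - h w" "h w - h z"] by simp
  ultimately show ?case using 1 by (simp add: algebra_simps)
 qed
 obtain L where L: "!!x. \<exists>\<tau>\<in>ball x L. \<forall>z. norm (E (z + \<tau>) / E z - 1) <= 1/10" using T unfolding rdense_def by blast
 obtain n :: nat where n: "2 * L <= real n" using real_arch_simple by blast
 have quasi: "norm ((h (z + w) - h z) - (h w - h 0)) <= 1 + 2 * (real n * K0)" for z w
 proof -
  obtain \<tau> where t: "\<tau> \<in> ball w L" "!!z. norm (E (z + \<tau>) / E z - 1) <= 1/10" using L by blast
  \<comment> \<open>Within 1/10 of 1 the quotient stays off the branch cut, so its principal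
    logarithm is continuous in z.\<close>
  have Re1: "E (z + \<tau>) / E z \<notin> \<real>\<^sub>\<le>\<^sub>0" for z
  proof -
   have "\<bar>Re (E (z + \<tau>) / E z - 1)\<bar> <= 1/10" using t(2)[of z] abs_Re_le_cmod order_trans by blast
   hence "Re (E (z + \<tau>) / E z) > 0" by (simp add: abs_if split: if_splits)
   thus ?thesis by (auto simp: complex_nonpos_Reals_iff)
  qed
  have ln: "norm (Ln (E (z + \<tau>) / E z)) <= 1/5" for z
   using norm_Ln_le[of "E (z + \<tau>) / E z - 1"] t(2)[of z] by simp
  define g where "g = (%z. h (z + \<tau>) - h z - Ln (E (z + \<tau>) / E z))"
  have "g z = g 0"
  proof (rule exp_one_const[OF convex_UNIV, of g])
   show "continuous_on UNIV g" unfolding g_def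
    by (intro continuous_intros continuous_on_compose2[OF h(1)] continuous_on_compose2[OF Ec] h(1) Ec Re1) (auto simp: E0)
   show "exp (g y) = 1" for y using E0 by (simp add: g_def exp_diff h(2))
  qed auto
  hence ge: "(h (z + \<tau>) - h z) - (h \<tau> - h 0) = Ln (E (z + \<tau>) / E z) - Ln (E (0 + \<tau>) / E 0)" by (simp add: g_def algebra_simps)
  have 1: "norm ((h (z + \<tau>) - h z) - (h \<tau> - h 0)) <= 1/5 + 1/5" unfolding ge
   by (intro order_trans[OF norm_triangle_ineq4] add_mono ln)
  have "norm (w - \<tau>) <= real n / 2" using t(1) n by (simp add: dist_norm)
  hence 2: "norm (h (z + w) - h (z + \<tau>)) <= real n * K0" "norm (h w - h \<tau>) <= real n * K0" by (auto intro!: chain)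
  have "(h (z + w) - h z) - (h w - h 0) = ((h (z + \<tau>) - h z) - (h \<tau> - h 0)) + ((h (z + w) - h (z + \<tau>)) - (h w - h \<tau>))" by simp
  hence "norm ((h (z + w) - h z) - (h w - h 0)) <= norm ((h (z + \<tau>) - h z) - (h \<tau> - h 0)) + norm ((h (z + w) - h (z + \<tau>)) - (h w - h \<tau>))"
   by (simp only: norm_triangle_ineq)
  moreover have "norm ((h (z + w) - h (z + \<tau>)) - (h w - h \<tau>)) <= real n * K0 + real n * K0"
   by (rule norm_triangle_le_diff) (use 2 in linarith)
  ultimately show ?thesis using 1 by linarith
 qed
 define u where "u = (%z. Im (h z - h 0))"
 obtain \<beta> B' where be: "!!z. \<bar>u z - Im (\<beta> * z)\<bar> <= B'"
 proof (rule hyers_complex[of u "1 + 2 * (real n * K0)" "2 * K0"])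
  fix x y
  have "u (x + y) - u x - u y = Im ((h (x + y) - h x) - (h y - h 0))" by (simp add: u_def)
  thus "\<bar>u (x + y) - u x - u y\<bar> <= 1 + 2 * (real n * K0)" using quasi[of x y] abs_Im_le_cmod order_trans by metis
 next
  fix z :: complex assume "norm z <= 1"
  hence "norm (h z - h 0) <= 2 * K0" using chain[of z 0 2] by simp
  thus "\<bar>u z\<bar> <= 2 * K0" unfolding u_def using abs_Im_le_cmod order_trans by blast
 qed blast
 define k where "k = (%z. h z - \<i> * of_real (Im (\<beta> * z)))"
 show thesis
 proof (rule that[of k "ln B + (B' + \<bar>Im (h 0)\<bar>)" \<beta>])
  show "continuous_on UNIV k" unfolding k_def by (intro continuous_intros h(1))
  show "E z = exp (\<i> * of_real (Im (\<beta> * z)) + k z)" for z by (simp add: k_def h(2))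
  fix z
  have "\<bar>Re (k z)\<bar> <= ln B" using Reh[of z] by (simp add: k_def)
  moreover have "Im (k z) = (u z - Im (\<beta> * z)) + Im (h 0)" by (simp add: k_def u_def)
  hence "\<bar>Im (k z)\<bar> <= B' + \<bar>Im (h 0)\<bar>" using be[of z] by linarith
  ultimately show "norm (k z) <= ln B + (B' + \<bar>Im (h 0)\<bar>)" using cmod_le[of "k z"] by linarith
 qed
qed

subsection \<open>Circle means and the density of the divisor\<close>

lemma LINT_circle_bound:
 assumes "!!t. t \<in> {0..2*pi} ==> norm (w t) <= B" "0 <= B"
 shows "norm (LINT t:{0..2*pi}|lborel. (w t :: complex)) <= 2 * pi * B"
proof -
 have "norm (LINT t:{0..2*pi}|lborel. w t) <= (\<integral>t. norm (indicator {0..2*pi} t *\<^sub>R w t) \<partial>lborel)"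
  unfolding set_lebesgue_integral_def by (rule integral_norm_bound)
 also have "... <= (\<integral>t. indicator {0..2*pi} t *\<^sub>R B \<partial>lborel)"
 proof (rule integral_mono')
  show "integrable lborel (%t. indicator {0..2*pi} t *\<^sub>R B)"
   by (intro integrableI_bounded_set_indicator[of _ _ _ B]) (use assms in auto)
 qed (use assms in \<open>auto simp: indicator_def\<close>)
 also have "... = 2 * pi * B" by simp
 finally show ?thesis .
qed

lemma circle_integrable:
 assumes "continuous_on UNIV f"
 shows "set_integrable lborel {0..2*pi} (f :: real => complex)" "(LINT t:{0..2*pi}|lborel. f t) = integral {0..2*pi} f"
proof -
 show s: "set_integrable lborel {0..2*pi} f" by (rule borel_integrable_atLeastAtMost') (rule continuous_on_subset[OF assms], simp)
 show "(LINT t:{0..2*pi}|lborel. f t) = integral {0..2*pi} f" by (rule set_borel_integral_eq_integral(2)[OF s])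
qed

lemma Fubini_circle:
 fixes q :: "complex => real => complex"
 assumes q: "continuous_on UNIV (%x. q (fst x) (snd x))" and A: "A \<in> sets borel" "bounded A"
 shows "SI A (%z. integral {0..2*pi} (q z)) = (LINT t:{0..2*pi}|lborel. SI A (%z. q z t))"
  and "set_integrable lborel {0..2*pi} (%t. SI A (%z. q z t))"
proof -
 define I where "I = {0..2*pi::real}"
 define g where "g = (%z t. indicator (A \<times> I) (z, t) *\<^sub>R q z t)"
 obtain R where R: "A \<subseteq> cball 0 R" using bounded_subset_ballD[OF A(2), of 0] by (meson ball_subset_cball subset_trans)
 have "compact ((%x. q (fst x) (snd x)) ` (cball 0 R \<times> I))"
  by (intro compact_continuous_image continuous_on_subset[OF q] compact_Times) (auto simp: I_def)
 hence "bounded ((%x. q (fst x) (snd x)) ` (cball 0 R \<times> I))" by (rule compact_imp_bounded)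
 then obtain G where "\<forall>y\<in>(%x. q (fst x) (snd x)) ` (cball 0 R \<times> I). norm y <= G" unfolding bounded_iff by blast
 hence G: "!!x. x \<in> cball 0 R \<times> I ==> norm (q (fst x) (snd x)) <= G" by blast
 have "integrable lborel (%x::complex \<times> real. indicator (A \<times> I) x *\<^sub>R q (fst x) (snd x))"
 proof (rule integrableI_bounded_set_indicator[where B = G])
  show "A \<times> I \<in> sets lborel" using A(1) by (simp add: borel_Times I_def)
  show "(%x. q (fst x) (snd x)) \<in> borel_measurable lborel" using borel_measurable_continuous_onI[OF q] by simp
  show "emeasure lborel (A \<times> I) < \<infinity>" by (rule emeasure_bounded_finite) (auto simp: I_def intro: bounded_Times A(2))
  show "AE x in lborel. x \<in> A \<times> I \<longrightarrow> norm (q (fst x) (snd x)) <= G" using G R by (intro AE_I2) blast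
 qed
 hence int: "integrable (lborel \<Otimes>\<^sub>M lborel) (case_prod g)" unfolding lborel_prod g_def by (simp add: case_prod_unfold)
 have in1: "(\<integral>z. g z t \<partial>lborel) = indicator I t *\<^sub>R SI A (%z. q z t)" for t
 proof -
  have "(%z. g z t) = (%z. indicator I t *\<^sub>R (indicator A z *\<^sub>R q z t))" by (auto simp: g_def indicator_def)
  hence "(\<integral>z. g z t \<partial>lborel) = (\<integral>z. indicator I t *\<^sub>R (indicator A z *\<^sub>R q z t) \<partial>lborel)" by (simp only:)
  thus ?thesis unfolding set_lebesgue_integral_def integral_scaleR_right .
 qed
 have in2: "(\<integral>t. g z t \<partial>lborel) = indicator A z *\<^sub>R integral I (q z)" for z
 proof -
  have c: "continuous_on UNIV (q z)"
  proof -
   have "continuous_on UNIV (%t. (z, t))" by (intro continuous_intros)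
   from continuous_on_compose2[OF q this] show ?thesis by simp
  qed
  have "(%t. g z t) = (%t. indicator A z *\<^sub>R (indicator I t *\<^sub>R q z t))" by (auto simp: g_def indicator_def)
  hence "(\<integral>t. g z t \<partial>lborel) = (\<integral>t. indicator A z *\<^sub>R (indicator I t *\<^sub>R q z t) \<partial>lborel)" by (simp only:)
  hence "(\<integral>t. g z t \<partial>lborel) = indicator A z *\<^sub>R (LINT t:I|lborel. q z t)" unfolding set_lebesgue_integral_def integral_scaleR_right .
  thus ?thesis using circle_integrable(2)[OF c] by (simp add: I_def)
 qed
 have "(\<integral>t. (\<integral>z. g z t \<partial>lborel) \<partial>lborel) = (\<integral>z. (\<integral>t. g z t \<partial>lborel) \<partial>lborel)" by (rule lborel_pair.Fubini_integral[OF int])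
 thus "SI A (%z. integral {0..2*pi} (q z)) = (LINT t:{0..2*pi}|lborel. SI A (%z. q z t))"
  unfolding in1 in2 unfolding set_lebesgue_integral_def I_def by simp
 have "integrable lborel (%t. \<integral>z. g z t \<partial>lborel)" by (rule lborel_pair.integrable_snd[OF int])
 thus "set_integrable lborel {0..2*pi} (%t. SI A (%z. q z t))" unfolding in1 set_integrable_def I_def .
qed

text \<open>The contour integral of \<open>g\<close> over the unit circle about
  \<open>z\<close>.\<close>

definition circ :: "(complex => complex) => complex => complex" where
 "circ g z = integral {0..2*pi} (%t. g (z + cis t) * (\<i> * cis t))"

lemma circ_continuous:
 assumes "continuous_on UNIV g" shows "continuous_on UNIV (%t. g (z + cis t) * (\<i> * cis t))"
 by (intro continuous_intros continuous_on_compose2[OF assms]) auto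

lemma circ_integrable:
 assumes "continuous_on UNIV g" shows "(%t. g (z + cis t) * (\<i> * cis t)) integrable_on {0..2*pi}"
 by (rule integrable_continuous_interval) (rule continuous_on_subset[OF circ_continuous[OF assms]], simp)

lemma circ_holomorphic:
 assumes "g holomorphic_on ball z 2" shows "circ g z = 0"
proof -
 have "(g has_contour_integral 0) (circlepath z 1)"
  by (rule Cauchy_theorem_disc_simple[OF assms]) (auto simp: dist_norm)
 hence "((%t. g (z + of_real 1 * cis t) * of_real 1 * \<i> * cis t) has_integral 0) {0..2*pi}"
  unfolding circlepath_def by (subst (asm) has_contour_integral_part_circlepath_iff) auto
 hence "((%t. g (z + cis t) * (\<i> * cis t)) has_integral 0) {0..2*pi}" by (simp add: mult.assoc)
 thus ?thesis unfolding circ_def by (rule integral_unique)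
qed

lemma circ_sum:
 assumes R: "continuous_on UNIV R" and k: "!!n. n \<in> F ==> continuous_on UNIV (k n)" and F: "finite F"
 shows "circ (%z. R z + (\<Sum>n\<in>F. k n z)) z = circ R z + (\<Sum>n\<in>F. circ (k n) z)"
proof -
 have "circ (%z. R z + (\<Sum>n\<in>F. k n z)) z = integral {0..2*pi} (%t. R (z + cis t) * (\<i> * cis t) + (\<Sum>n\<in>F. k n (z + cis t) * (\<i> * cis t)))"
  unfolding circ_def by (simp add: distrib_right sum_distrib_right)
 also have "... = circ R z + integral {0..2*pi} (%t. \<Sum>n\<in>F. k n (z + cis t) * (\<i> * cis t))"
  unfolding circ_def by (intro Henstock_Kurzweil_Integration.integral_add integrable_sum F circ_integrable R k)
 also have "integral {0..2*pi} (%t. \<Sum>n\<in>F. k n (z + cis t) * (\<i> * cis t)) = (\<Sum>n\<in>F. circ (k n) z)"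
  unfolding circ_def by (intro integral_sum F circ_integrable k)
 finally show ?thesis .
qed

lemma circ_bound:
 assumes "continuous_on UNIV g" "!!t. norm (g (z + cis t)) <= B"
 shows "norm (circ g z) <= 2 * pi * B"
proof -
 have "norm (circ g z) <= B * (2 * pi - 0)" unfolding circ_def
  by (rule integral_bound) (use continuous_on_subset[OF circ_continuous[OF assms(1)]] assms(2) in \<open>auto simp: norm_mult\<close>)
 thus ?thesis by (simp add: mult.commute)
qed

text \<open>After a holomorphic part is split off, the integrand is -cnj \<beta> / 2 times the
  conjugate of the position on the circle relative to its centre, and that conjugate has contour
  integral 2 pi i.\<close>

lemma circ_linear: "circ (%z. \<i> * of_real (Im (\<beta> * z))) z = - of_real pi * \<i> * cnj \<beta>"
proof -
 define g where "g = (%w. \<beta> * w / 2 - cnj \<beta> * cnj z / 2)"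
 have im: "\<i> * of_real (Im w) = (w - cnj w) / 2" for w by (simp add: complex_eq_iff)
 have "\<i> * of_real (Im (\<beta> * (z + cis t))) * (\<i> * cis t) = g (z + cis t) * (\<i> * cis t) + (- cnj \<beta> * \<i> / 2)" for t
 proof -
  have 1: "cnj (cis t) * cis t = 1" by (simp add: cis_cnj cis_mult)
  have "\<i> * of_real (Im (\<beta> * (z + cis t))) * (\<i> * cis t) = g (z + cis t) * (\<i> * cis t) - cnj \<beta> * \<i> / 2 * (cnj (cis t) * cis t)"
   unfolding im g_def by (simp add: field_simps)
  thus ?thesis unfolding 1 by simp
 qed
 hence "circ (%z. \<i> * of_real (Im (\<beta> * z))) z = integral {0..2*pi} (%t. g (z + cis t) * (\<i> * cis t) + (- cnj \<beta> * \<i> / 2))"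
  unfolding circ_def by (simp only:)
 also have "... = circ g z + integral {0..2*pi} (%t::real. - cnj \<beta> * \<i> / 2)" unfolding circ_def
  by (intro Henstock_Kurzweil_Integration.integral_add circ_integrable integrable_const_ivl) (auto simp: g_def intro!: continuous_intros)
 also have "circ g z = 0" by (rule circ_holomorphic) (auto simp: g_def intro!: holomorphic_intros)
 also have "integral {0..2*pi} (%t::real. - cnj \<beta> * \<i> / 2) = - of_real pi * \<i> * cnj \<beta>" by (simp add: scaleR_conv_of_real)
 finally show ?thesis by simp
qed

lemma SI_reflect:
 fixes g :: "complex => complex"
 assumes [measurable]: "g \<in> borel_measurable borel"
 shows "SI (cball c t) (%z. g (c - z)) = SI (cball 0 t) g"
proof -
 have 1: "SI (cball 0 t) (%w. g (\<i> * w)) = SI (cball 0 t) g" by (rule SI_rotate) (auto simp: norm_mult)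
 have 2: "SI (cball 0 t) (%w. g (\<i> * (\<i> * w))) = SI (cball 0 t) (%w. g (\<i> * w))" by (rule SI_rotate) (auto simp: norm_mult)
 have 3: "SI (cball 0 t) (%w. g (c - (w + c))) = SI ((%w. w + c) ` cball 0 t) (%z. g (c - z))" by (rule SI_shift) auto
 have "(%w. w + c) ` cball 0 t = cball c t" using cball_translation[of c 0 t] by (simp add: add.commute)
 moreover have "(%w. g (c - (w + c))) = (%w. g (\<i> * (\<i> * w)))" by (simp add: mult.assoc[symmetric])
 ultimately show ?thesis using 1 2 3 by simp
qed

lemma SI_supported:
 fixes f :: "complex => complex"
 assumes "!!z. z \<in> A ==> z \<notin> B ==> f z = 0" "B \<subseteq> A" shows "SI A f = SI B f"
 unfolding set_lebesgue_integral_def by (intro Bochner_Integration.integral_cong) (use assms in \<open>auto simp: indicator_def\<close>)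

text \<open>A kernel supported in the disc of radius \<open>t\<close> puts all of its mass into
  \<open>A\<close>, or none, unless \<open>c n\<close> is within \<open>t\<close> of the frontier;
  such exceptional indices are O(s) in number.\<close>

lemma local_sum:
 assumes p: "pairs c d M N" and A: "convex A" "A \<in> sets borel" "A \<subseteq> cball x s" and s: "1 <= s" and t: "0 <= t"
  and g: "!!n. g n \<in> borel_measurable borel" "!!n v. norm (g n v) <= B" "!!n v. t < norm v ==> g n v = 0"
  and full: "!!n. norm (SI (cball 0 t) (g n) - q * d n) <= e" and I: "finite I" "{n. norm (c n - x) <= s + t} \<subseteq> I"
 shows "norm (SI A (%z. \<Sum>n\<in>I. g n (c n - z)) - q * nu c d A) <= real (card {n. c n \<in> A}) * e + (350 * N * (t + 1)^2 * s) * (B * (pi * t^2) + norm q * M)"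
proof -
 note [measurable] = g(1) A(2)
 have bA: "bounded A" using A(3) bounded_subset by blast
 have B0: "0 <= B" using g(2)[of 0 0] norm_ge_zero order_trans by blast
 have e0: "0 <= e" using full[of 0] norm_ge_zero order_trans by blast
 define T where "T = (%n. SI A (%z. g n (c n - z)) - (if c n \<in> A then q * d n else 0))"
 define S where "S = {n. \<exists>y\<in>frontier A. norm (c n - y) <= t}"
 have S: "finite S" "real (card S) <= 350 * N * (t + 1)^2 * s"
  by (rule pairs_count_frontier[OF p A(1,3) s t]; simp add: S_def)+
 define D where "D = {n. c n \<in> A}"
 have D: "finite D" "D \<subseteq> I"
 proof -
  have "D \<subseteq> {n. norm (c n - x) <= s}" using A(3) by (auto simp: D_def dist_norm norm_minus_commute)
  thus "finite D" by (rule finite_subset[OF _ pairs_finite(1)[OF p]])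
  show "D \<subseteq> I"
  proof
   fix n assume "n \<in> D"
   hence "norm (c n - x) <= s + t" using \<open>D \<subseteq> _\<close> t by force
   thus "n \<in> I" using I(2) by blast
  qed
 qed
 have si: "set_integrable lborel A (%z. g n (c n - z))" for n
  by (rule SI_integrable[of _ _ B]) (use bA g(2) in auto)
 have sum: "SI A (%z. \<Sum>n\<in>I. g n (c n - z)) = (\<Sum>n\<in>I. SI A (%z. g n (c n - z)))"
  unfolding set_lebesgue_integral_def scaleR_sum_right
  by (rule Bochner_Integration.integral_sum) (use si in \<open>simp add: set_integrable_def\<close>)
 have "q * nu c d A = (\<Sum>n\<in>I. if c n \<in> A then q * d n else 0)"
 proof -
  have "{n \<in> I. c n \<in> A} = {n. c n \<in> A}" using D(2) by (auto simp: D_def)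
  thus ?thesis using sum.inter_filter[OF I(1), of "%n. q * d n" "%n. c n \<in> A"] by (simp add: nu_def sum_distrib_left)
 qed
 hence eq: "SI A (%z. \<Sum>n\<in>I. g n (c n - z)) - q * nu c d A = (\<Sum>n\<in>I. T n)" unfolding sum T_def by (simp add: sum_subtractf)
 have deep: "cball (c n) t \<subseteq> A \<or> cball (c n) t \<inter> A = {}" if "n \<notin> S" for n
 proof (rule ccontr)
  assume "\<not> ?thesis"
  hence "cball (c n) t \<inter> frontier A ~= {}" by (intro connected_Int_frontier) (auto simp: convex_connected)
  thus False using that by (auto simp: S_def dist_norm)
 qed
 have T0: "norm (T n) <= (if n \<in> D then e else 0) + (if n \<in> S then B * (pi * t^2) + norm q * M else 0)" for n
 proof (cases "n \<in> S")
  case False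
  have in0: "c n \<in> cball (c n) t" using t by simp
  show ?thesis
  proof (cases "cball (c n) t \<subseteq> A")
   case True
   have "SI A (%z. g n (c n - z)) = SI (cball (c n) t) (%z. g n (c n - z))"
    by (rule SI_supported[OF _ True]) (rule g(3), simp add: dist_norm)
   also have "... = SI (cball 0 t) (g n)" by (rule SI_reflect) simp
   finally have e: "SI A (%z. g n (c n - z)) = SI (cball 0 t) (g n)" .
   have cA: "c n \<in> A" using in0 True by blast
   have "T n = SI (cball 0 t) (g n) - q * d n" unfolding T_def e using cA by simp
   thus ?thesis using full[of n] False cA by (simp add: D_def)
  next
   case notsub: False
   hence dj: "cball (c n) t \<inter> A = {}" using deep[OF False] by blast
   have "SI A (%z. g n (c n - z)) = SI {} (%z. g n (c n - z))"
   proof (rule SI_supported)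
    fix z assume "z \<in> A"
    hence "z \<notin> cball (c n) t" using dj by blast
    thus "g n (c n - z) = 0" by (intro g(3)) (simp add: dist_norm)
   qed simp
   hence e: "SI A (%z. g n (c n - z)) = 0" by (simp add: set_lebesgue_integral_def)
   have "c n \<notin> A" using dj in0 by blast
   hence "T n = 0" unfolding T_def e by simp
   thus ?thesis using e0 False by simp
  qed
 next
  case True
  have "SI A (%z. g n (c n - z)) = SI (A \<inter> cball (c n) t) (%z. g n (c n - z))"
   by (rule SI_supported) (auto intro!: g(3) simp: dist_norm)
  also have "norm ... <= B * measure lborel (A \<inter> cball (c n) t)"
   by (rule norm_SI_le) (use g(2) B0 A in \<open>auto intro: bounded_Int\<close>)
  also have "... <= B * measure lborel (cball (c n) t)" using B0 A by (intro mult_left_mono measure_lborel_mono) auto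
  also have "... = B * (pi * t^2)" using content_cball_complex[OF t] by simp
  finally have 1: "norm (SI A (%z. g n (c n - z))) <= B * (pi * t^2)" .
  have "norm (q * d n) <= norm q * M" unfolding norm_mult using pairsD(3)[OF p] by (intro mult_left_mono) auto
  moreover have "0 <= norm q * M" using pairsD(1)[OF p] by simp
  ultimately have "norm (T n) <= B * (pi * t^2) + norm q * M" unfolding T_def
   using 1 norm_triangle_ineq4[of "SI A (%z. g n (c n - z))" "q * d n"] by auto
  thus ?thesis using True e0 by auto
 qed
 have "norm (\<Sum>n\<in>I. T n) <= (\<Sum>n\<in>I. (if n \<in> D then e else 0) + (if n \<in> S then B * (pi * t^2) + norm q * M else 0))"
  by (rule sum_norm_le) (rule T0)
 also have "... = real (card (I \<inter> D)) * e + real (card (I \<inter> S)) * (B * (pi * t^2) + norm q * M)"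
  using I(1) by (simp add: sum.distrib sum.If_cases Int_def)
 also have "... <= real (card D) * e + (350 * N * (t + 1)^2 * s) * (B * (pi * t^2) + norm q * M)"
 proof (intro add_mono mult_right_mono)
  show "real (card (I \<inter> D)) <= real (card D)" using D(1) by (simp add: card_mono)
  have "real (card (I \<inter> S)) <= real (card S)" using S(1) by (simp add: card_mono)
  thus "real (card (I \<inter> S)) <= 350 * N * (t + 1)^2 * s" using S(2) by linarith
  show "0 <= B * (pi * t^2) + norm q * M" using B0 pairsD(1)[OF p] by simp
 qed (rule e0)
 finally show ?thesis unfolding eq D_def .
qed

text \<open>Cauchy's theorem makes the circle integral vanish for distant \<open>v\<close>, so the
  total mass may be computed over arbitrarily large discs. There \<open>SI_kap\<close> gives -pi d
  cnj (cis t) for each point of the circle up to O(1 / \<rho>), and letting \<rho> grow makes the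
  value exact.\<close>

lemma kap_circle_kernel:
 assumes M: "1 <= M" "norm d <= M"
 defines "g \<equiv> %v. integral {0..2*pi} (%t. kap M d (v - cis t) * (\<i> * cis t))"
 shows "g \<in> borel_measurable borel" "norm (g v) <= 2 * pi" "2 * M + 2 < norm v ==> g v = 0"
  "SI (cball 0 (2 * M + 2)) g = (- 2 * of_real (pi^2) * \<i>) * d"
proof -
 have kc: "continuous_on UNIV (%y. kap M d (v - y))" for v by (intro continuous_intros M)
 have int: "(%t. kap M d (v - cis t) * (\<i> * cis t)) integrable_on {0..2*pi}" for v
  using circ_integrable[OF kc[of v], of 0] by simp
 have gc: "g v = circ (%y. kap M d (v - y)) 0" for v by (simp add: g_def circ_def)
 show "norm (g v) <= 2 * pi" using circ_bound[OF kc, of v 0 1] norm_kap_le[OF M] unfolding gc by simp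
 show g0: "g v = 0" if "2 * M + 2 < norm v" for v unfolding gc
 proof (rule circ_holomorphic, intro holomorphic_kap[OF M] holomorphic_intros)
  fix z :: complex assume "z \<in> ball 0 2"
  thus "2 * M < norm (v - z)" using that norm_triangle_ineq2[of v z] by simp
 qed
 have lip: "norm (g v - g w) <= (2 * norm (v - w)) * (2 * pi)" for v w
 proof -
  have "g v - g w = integral {0..2*pi} (%t. kap M d (v - cis t) * (\<i> * cis t) - kap M d (w - cis t) * (\<i> * cis t))"
   unfolding g_def by (rule Henstock_Kurzweil_Integration.integral_diff[OF int int, symmetric])
  also have "norm ... <= (2 * norm (v - w)) * (2 * pi - 0)"
  proof (rule integral_bound)
   show "continuous_on {0..2*pi} (%t. kap M d (v - cis t) * (\<i> * cis t) - kap M d (w - cis t) * (\<i> * cis t))"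
    by (intro continuous_intros M)
   fix t :: real
   have "kap M d (v - cis t) * (\<i> * cis t) - kap M d (w - cis t) * (\<i> * cis t) = (kap M d (v - cis t) - kap M d (w - cis t)) * (\<i> * cis t)"
    by (simp add: left_diff_distrib)
   hence "norm (kap M d (v - cis t) * (\<i> * cis t) - kap M d (w - cis t) * (\<i> * cis t)) = norm (kap M d (v - cis t) - kap M d (w - cis t))"
    by (simp add: norm_mult)
   also have "... <= 2 * norm (v - w)" using kap_lipschitz[OF M M(2), of "v - cis t" "w - cis t"] by simp
   finally show "norm (kap M d (v - cis t) * (\<i> * cis t) - kap M d (w - cis t) * (\<i> * cis t)) <= 2 * norm (v - w)" .
  qed simp
  finally show ?thesis by simp
 qed
 have "continuous_on UNIV g"
 proof (rule lipschitz_on_continuous_on[of "4 * pi"], rule lipschitz_onI)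
  show "dist (g v) (g w) <= 4 * pi * dist v w" for v w using lip[of v w] by (simp add: dist_norm mult_ac)
 qed simp
 thus "g \<in> borel_measurable borel" by (rule borel_measurable_continuous_onI)
 define K where "K = 2 * pi * (128 * M * 1^2 + 256 * M^3 * 1)"
 have K0: "0 <= K" using M(1) by (simp add: K_def)
 have est: "norm (SI (cball 0 (2 * M + 2)) g - (- 2 * of_real (pi^2) * \<i>) * d) <= K / \<rho>" if \<rho>: "2 + 4 * M <= \<rho>" for \<rho>
 proof -
  have r0: "0 < \<rho>" using \<rho> M(1) by linarith
  define e where "e = (128 * M * 1^2 + 256 * M^3 * 1) / \<rho>"
  have e0: "0 <= e" using r0 M(1) by (simp add: e_def)
  have "SI (cball 0 (2 * M + 2)) g = SI (cball 0 \<rho>) g"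
   by (rule SI_supported[symmetric]) (use \<rho> M(1) in \<open>auto intro!: g0\<close>)
  also have "... = (LINT t:{0..2*pi}|lborel. SI (cball 0 \<rho>) (%v. kap M d (v - cis t) * (\<i> * cis t)))" unfolding g_def
   by (rule Fubini_circle(1)) (auto intro!: continuous_intros M)
  finally have 1: "SI (cball 0 (2 * M + 2)) g = (LINT t:{0..2*pi}|lborel. SI (cball 0 \<rho>) (%v. kap M d (v - cis t) * (\<i> * cis t)))" .
  have si: "set_integrable lborel {0..2*pi} (%t. SI (cball 0 \<rho>) (%v. kap M d (v - cis t) * (\<i> * cis t)))"
   by (rule Fubini_circle(2)) (auto intro!: continuous_intros M)
  have ci: "(LINT t:{0..2*pi}|lborel. - of_real pi * d * \<i>) = (- 2 * of_real (pi^2) * \<i>) * d"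
   using circle_integrable(2)[of "%t. - of_real pi * d * \<i>"] by (simp add: scaleR_conv_of_real power2_eq_square)
  have "SI (cball 0 (2 * M + 2)) g - (- 2 * of_real (pi^2) * \<i>) * d = (LINT t:{0..2*pi}|lborel. SI (cball 0 \<rho>) (%v. kap M d (v - cis t) * (\<i> * cis t)) - (- of_real pi * d * \<i>))"
   unfolding 1 ci[symmetric] by (rule set_integral_diff(2)[symmetric, OF si circle_integrable(1)]) simp
  also have "norm ... <= 2 * pi * e"
  proof (rule LINT_circle_bound[OF _ e0])
   fix t
   have "SI (cball 0 \<rho>) (%v. kap M d (v - cis t) * (\<i> * cis t)) - (- of_real pi * d * \<i>)
    = (SI (cball 0 \<rho>) (%v. kap M d (v - cis t)) + of_real pi * d * cnj (cis t)) * (\<i> * cis t)"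
   proof -
    have c1: "cnj (cis t) * cis t = 1" by (simp add: cis_cnj cis_mult)
    have "(S + P * cnj (cis t)) * (\<i> * cis t) = S * (\<i> * cis t) + P * \<i> * (cnj (cis t) * cis t)" for S P by (simp add: algebra_simps)
    thus ?thesis unfolding c1 by simp
   qed
   hence "norm (SI (cball 0 \<rho>) (%v. kap M d (v - cis t) * (\<i> * cis t)) - (- of_real pi * d * \<i>))
    = norm (SI (cball 0 \<rho>) (%v. kap M d (v - cis t)) + of_real pi * d * cnj (cis t))" by (simp add: norm_mult)
   also have "... <= e" unfolding e_def by (rule SI_kap[OF M]) (use \<rho> in auto)
   finally show "norm (SI (cball 0 \<rho>) (%v. kap M d (v - cis t) * (\<i> * cis t)) - (- of_real pi * d * \<i>)) <= e" .
  qed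
  finally show ?thesis by (simp add: e_def K_def)
 qed
 define X where "X = norm (SI (cball 0 (2 * M + 2)) g - (- 2 * of_real (pi^2) * \<i>) * d)"
 have "X = 0"
 proof (rule ccontr)
  assume "X ~= 0"
  hence X: "X > 0" by (simp add: X_def)
  define \<rho> where "\<rho> = (2 + 4 * M) + K / X + 1"
  have KX: "0 <= K / X" using K0 X by simp
  have "X <= K / \<rho>" unfolding X_def by (rule est) (use KX in \<open>simp add: \<rho>_def\<close>)
  hence "X * \<rho> <= K" using KX M(1) by (subst (asm) pos_le_divide_eq) (auto simp: \<rho>_def)
  moreover have "X * \<rho> = X * (3 + 4 * M) + K" using X by (simp add: \<rho>_def algebra_simps)
  ultimately have "X * (3 + 4 * M) <= 0" by linarith
  moreover have "0 < X * (3 + 4 * M)" using X M(1) by simp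
  ultimately show False by linarith
 qed
 thus "SI (cball 0 (2 * M + 2)) g = (- 2 * of_real (pi^2) * \<i>) * d" unfolding X_def norm_eq_zero right_minus_eq .
qed

text \<open>The integral of k (z + cis t) over \<open>A\<close> differs from that of k by a strip
  along the frontier, and a constant has contour integral 0. The constant 224 is four times 56, the
  case t = 1 of \<open>area_near_frontier\<close>.\<close>

lemma SI_circ_bounded:
 assumes k: "continuous_on UNIV k" "!!z. norm (k z) <= K" and A: "convex A" "A \<in> sets borel" "A \<subseteq> cball x s" and s: "1 <= s"
 shows "norm (SI A (circ k)) <= 2 * pi * (K * (224 * s) + K * (224 * s))"
proof -
 note [measurable] = A(2)
 have km [measurable]: "k \<in> borel_measurable borel" by (rule borel_measurable_continuous_onI[OF k(1)])
 have bA: "bounded A" using A(3) bounded_subset by blast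
 have K: "0 <= K" using k(2)[of 0] norm_ge_zero order_trans by blast
 have qc: "continuous_on UNIV (%x. k (fst x + cis (snd x)) * (\<i> * cis (snd x)))"
  by (intro continuous_intros continuous_on_compose2[OF k(1)]) auto
 have F: "SI A (circ k) = (LINT t:{0..2*pi}|lborel. SI A (%z. k (z + cis t) * (\<i> * cis t)))"
  unfolding circ_def by (rule Fubini_circle(1)[OF qc A(2) bA])
 have si: "set_integrable lborel {0..2*pi} (%t. SI A (%z. k (z + cis t) * (\<i> * cis t)))" by (rule Fubini_circle(2)[OF qc A(2) bA])
 have c0: "continuous_on UNIV (%t. SI A k * (\<i> * cis t))" by (intro continuous_intros)
 have "circ (%_. SI A k) 0 = 0" by (intro circ_holomorphic holomorphic_intros)
 hence z: "(LINT t:{0..2*pi}|lborel. SI A k * (\<i> * cis t)) = 0" unfolding circle_integrable(2)[OF c0] by (simp add: circ_def)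
 have "SI A (circ k) = (LINT t:{0..2*pi}|lborel. SI A (%z. k (z + cis t) * (\<i> * cis t)) - SI A k * (\<i> * cis t))"
  unfolding F using set_integral_diff(2)[OF si circle_integrable(1)[OF c0]] z by simp
 also have "norm ... <= 2 * pi * (K * (224 * s) + K * (224 * s))"
 proof (rule LINT_circle_bound)
  fix t
  define B where "B = (%w. w + cis t) ` A"
  have Bi: "w \<in> B \<longleftrightarrow> w - cis t \<in> A" for w unfolding B_def by (auto simp: image_iff algebra_simps intro!: bexI[of _ "w - cis t"])
  have "(%w. w - cis t) -` A \<inter> space borel \<in> sets borel" by (rule measurable_sets[OF _ A(2)]) simp
  moreover have "(%w. w - cis t) -` A \<inter> space borel = B" using Bi by auto
  ultimately have Bm [measurable]: "B \<in> sets borel" by simp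
  have bB: "bounded B" unfolding B_def using bounded_translation[OF bA, of "cis t"] by (simp add: add.commute)
  have sint: "set_integrable lborel A k" "set_integrable lborel B k" using bA bB k(2) by (auto intro!: SI_integrable[of _ _ K])
  have fr: "\<exists>y\<in>frontier A. norm (w - y) <= 1" if "w \<in> B - A \<or> w \<in> A - B" for w
  proof -
   have "closed_segment (w - cis t) w \<inter> frontier A ~= {}" by (rule connected_Int_frontier) (use that Bi in auto)
   then obtain y where y: "y \<in> frontier A" "y \<in> closed_segment (w - cis t) w" by blast
   hence "norm (y - w) <= norm ((w - cis t) - w)" using segment_bound(2)[OF y(2)] by (simp add: norm_minus_commute)
   thus ?thesis using y(1) by (auto simp: norm_minus_commute)
  qed
  have m1: "measure lborel (B - A) <= 224 * s" using area_near_frontier(1)[OF A(1,3) s, of 1 "B - A"] fr by auto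
  have m2: "measure lborel (A - B) <= 224 * s" using area_near_frontier(1)[OF A(1,3) s, of 1 "A - B"] fr by auto
  have "SI A (%z. k (z + cis t)) - SI A k = SI (B - A) k - SI (A - B) k"
   using SI_shift[of k A "cis t"] SI_split[OF Bm A(2) sint(2,1)] by (simp add: B_def)
  moreover have "norm (SI (B - A) k) <= K * (224 * s)"
   using norm_SI_le[of "B - A" k K] k(2) K bB m1 mult_left_mono[OF m1 K] by (simp add: bounded_diff)
  moreover have "norm (SI (A - B) k) <= K * (224 * s)"
   using norm_SI_le[of "A - B" k K] k(2) K bA m2 mult_left_mono[OF m2 K] by (simp add: bounded_diff)
  ultimately have "norm (SI A (%z. k (z + cis t)) - SI A k) <= K * (224 * s) + K * (224 * s)"
   using norm_triangle_ineq4[of "SI (B - A) k" "SI (A - B) k"] by simp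
  moreover have "SI A (%z. k (z + cis t) * (\<i> * cis t)) - SI A k * (\<i> * cis t) = (SI A (%z. k (z + cis t)) - SI A k) * (\<i> * cis t)"
   by (simp add: left_diff_distrib)
  ultimately show "norm (SI A (%z. k (z + cis t) * (\<i> * cis t)) - SI A k * (\<i> * cis t)) <= K * (224 * s) + K * (224 * s)"
   by (simp add: norm_mult)
 qed (use K s in simp)
 finally show ?thesis .
qed

text \<open>Cauchy's theorem on unit circles turns the holomorphy hypothesis into: circ k equals the
  sum of the circle kernels plus pi i cnj \<beta>. Over a convex set the left side integrates to
  O(s) and the kernels to q times the measure up to O(s); division by q = -2 pi^2 i gives the
  density cnj \<beta> / (2 pi).\<close>

lemma density_from_logarithm:
 assumes p: "pairs c d M N" and k: "continuous_on UNIV k" "!!z. norm (k z) <= K"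
  and h: "!!w F. finite F ==> {n. norm (c n - w) < 2 * M + 2} \<subseteq> F ==>
   (%z. \<i> * of_real (Im (\<beta> * z)) + k z - (kapS M c d F z)) holomorphic_on ball w 2"
 obtains C where "dens c d (cnj \<beta> / of_real (2 * pi)) C"
proof -
 note M = pairsD(1)[OF p] and N = pairsD(2)[OF p]
 have K: "0 <= K" using k(2)[of 0] norm_ge_zero order_trans by blast
 define t where "t = 2 * M + 2"
 have t: "0 <= t" using M by (simp add: t_def)
 define g where "g = (%n v. integral {0..2*pi} (%t. kap M (d n) (v - cis t) * (\<i> * cis t)))"
 have G1: "g n \<in> borel_measurable borel" for n unfolding g_def by (rule kap_circle_kernel(1)[OF M pairsD(3)[OF p]])
 have G2: "norm (g n v) <= 2 * pi" for n v unfolding g_def by (rule kap_circle_kernel(2)[OF M pairsD(3)[OF p]])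
 have G3: "g n v = 0" if "t < norm v" for n v unfolding g_def by (rule kap_circle_kernel(3)[OF M pairsD(3)[OF p]]) (use that in \<open>simp add: t_def\<close>)
 have G4: "SI (cball 0 t) (g n) = (- 2 * of_real (pi^2) * \<i>) * d n" for n unfolding g_def t_def by (rule kap_circle_kernel(4)[OF M pairsD(3)[OF p]])
 define q where "q = - 2 * complex_of_real (pi^2) * \<i>"
 have q: "norm q = 2 * pi^2" "q ~= 0" by (auto simp: q_def norm_mult norm_power)
 have hc: "continuous_on UNIV (%z. \<i> * of_real (Im (\<beta> * z)) + k z)" by (intro continuous_intros k(1))
 have lc: "continuous_on UNIV (%z. \<i> * complex_of_real (Im (\<beta> * z)))" by (intro continuous_intros)
 have V: "circ k z = (\<Sum>n\<in>F. g n (c n - z)) + of_real pi * \<i> * cnj \<beta>"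
  if F: "finite F" "{n. norm (c n - z) < 2 * M + 2} \<subseteq> F" for F z
 proof -
  define R where "R = (%y. \<i> * of_real (Im (\<beta> * y)) + k y - (kapS M c d F y))"
  have kc: "continuous_on UNIV (%y. kap M (d n) (c n - y))" for n by (intro continuous_intros pairsD[OF p])
  have Rc: "continuous_on UNIV R" unfolding R_def by (intro continuous_intros hc kc)
  have "circ R z = 0" by (rule circ_holomorphic) (unfold R_def, rule h[OF F])
  hence "circ (%y. R y + (kapS M c d F y)) z = (\<Sum>n\<in>F. circ (%y. kap M (d n) (c n - y)) z)"
   using circ_sum[where R = R and F = F and k = "%n y. kap M (d n) (c n - y)" and z = z, OF Rc kc F(1)] by simp
  moreover have "circ (%y. kap M (d n) (c n - y)) z = g n (c n - z)" for n by (simp add: circ_def g_def diff_diff_eq)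
  moreover have "(%y. R y + (kapS M c d F y)) = (%y. \<i> * of_real (Im (\<beta> * y)) + k y)" by (simp add: R_def)
  moreover have "circ (%y. \<i> * of_real (Im (\<beta> * y)) + k y) z = circ (%y. \<i> * of_real (Im (\<beta> * y))) z + circ k z"
   using circ_sum[where F = "{0::nat}" and k = "%_. k" and z = z, OF lc] k(1) by simp
  ultimately show ?thesis unfolding circ_linear by (simp add: algebra_simps)
 qed
 define C where "C = (2 * pi * (K * 224 + K * 224) + (350 * N * (t + 1)^2) * (2 * pi * (pi * t^2) + norm q * M)) / (2 * pi^2)"
 show thesis
 proof (rule that[of C], unfold dens_def, intro conjI allI impI)
  show "0 <= C" using K N M by (simp add: C_def)
  fix x s and A :: "complex set" assume "convex A \<and> A \<in> sets borel \<and> 1 <= s \<and> A \<subseteq> cball x s"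
  hence A: "convex A" "A \<in> sets borel" "A \<subseteq> cball x s" and s: "1 <= s" by auto
  have bA: "bounded A" using A(3) bounded_subset by blast
  define I where "I = {n. norm (c n - x) <= s + t}"
  have I: "finite I" unfolding I_def by (rule pairs_finite(1)[OF p])
  define S where "S = SI A (%z. \<Sum>n\<in>I. g n (c n - z))"
  have 1: "norm (S - q * nu c d A) <= real (card {n. c n \<in> A}) * 0 + (350 * N * (t + 1)^2 * s) * (2 * pi * (pi * t^2) + norm q * M)"
   unfolding S_def by (rule local_sum[OF p A s t G1 G2 G3]) (use G4 I in \<open>auto simp: q_def I_def\<close>)
  have "SI A (circ k) = SI A (%z. (\<Sum>n\<in>I. g n (c n - z)) + of_real pi * \<i> * cnj \<beta>)"
  proof (rule set_lebesgue_integral_cong)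
   show "A \<in> sets lborel" using A(2) by simp
   have "circ k z = (\<Sum>n\<in>I. g n (c n - z)) + of_real pi * \<i> * cnj \<beta>" if z: "z \<in> A" for z
   proof (rule V[OF I])
    have "norm (z - x) <= s" using z A(3) by (auto simp: dist_norm norm_minus_commute)
    thus "{n. norm (c n - z) < 2 * M + 2} \<subseteq> I"
    using norm_triangle_ineq[of "c _ - z" "z - x"] by (fastforce simp: I_def t_def intro: order_trans)
   qed
   thus "\<forall>z. z \<in> A \<longrightarrow> circ k z = (\<Sum>n\<in>I. g n (c n - z)) + of_real pi * \<i> * cnj \<beta>" by blast
  qed
  also have "... = S + SI A (%z. of_real pi * \<i> * cnj \<beta>)" unfolding S_def
  proof (rule set_integral_add(2))
   show "set_integrable lborel A (%z. \<Sum>n\<in>I. g n (c n - z))"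
   proof (rule SI_integrable[OF A(2) bA, of _ "real (card I) * (2 * pi)"])
    have [measurable]: "g n \<in> borel_measurable borel" for n by (rule G1)
    show "(%z. \<Sum>n\<in>I. g n (c n - z)) \<in> borel_measurable borel" by measurable
    show "norm (\<Sum>n\<in>I. g n (c n - w)) <= real (card I) * (2 * pi)" for w
    using sum_norm_le[of I "%n. g n (c n - w)" "%_. 2 * pi"] G2 by simp
   qed
   show "set_integrable lborel A (%z. of_real pi * \<i> * cnj \<beta>)" by (rule SI_integrable[OF A(2) bA]) auto
  qed
  also have "SI A (%z. of_real pi * \<i> * cnj \<beta>) = of_real pi * \<i> * cnj \<beta> * of_real (measure lborel A)"
  proof -
   have "SI A (%z. of_real pi * \<i> * cnj \<beta>) = (\<integral>w. (of_real pi * \<i> * cnj \<beta>) * (indicator A w :: complex) \<partial>lborel)"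
    unfolding set_lebesgue_integral_def by (intro Bochner_Integration.integral_cong) (auto simp: indicator_def)
   thus ?thesis using complex_indicator_integral(2)[OF A(2) bA] by simp
  qed
  finally have 2: "SI A (circ k) = S + of_real pi * \<i> * cnj \<beta> * of_real (measure lborel A)" .
  have 3: "norm (SI A (circ k)) <= 2 * pi * (K * (224 * s) + K * (224 * s))" by (rule SI_circ_bounded[OF k A s])
  define X where "X = nu c d A - cnj \<beta> / of_real (2 * pi) * of_real (measure lborel A)"
  have "q * X = SI A (circ k) - (S - q * nu c d A)"
  proof -
   have "q * (cnj \<beta> / of_real (2 * pi)) = - (of_real pi * \<i> * cnj \<beta>)" by (simp add: q_def power2_eq_square)
   hence "q * X = q * nu c d A - - (of_real pi * \<i> * cnj \<beta>) * of_real (measure lborel A)" unfolding X_def right_diff_distrib mult.assoc[symmetric] by simp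
   thus ?thesis unfolding 2 by simp
  qed
  hence "norm q * norm X = norm (SI A (circ k) - (S - q * nu c d A))" by (simp only: norm_mult[symmetric])
  also have "... <= 2 * pi * (K * (224 * s) + K * (224 * s)) + (350 * N * (t + 1)^2 * s) * (2 * pi * (pi * t^2) + norm q * M)"
   by (rule norm_triangle_le_diff) (use 1 3 in linarith)
  also have "... = (2 * pi * (K * 224 + K * 224) + (350 * N * (t + 1)^2) * (2 * pi * (pi * t^2) + norm q * M)) * s" by (simp add: algebra_simps)
  finally have "2 * pi^2 * norm X <= (2 * pi^2) * (C * s)" unfolding q(1) C_def by simp
  thus "norm (nu c d A - cnj \<beta> / of_real (2 * pi) * of_real (measure lborel A)) <= C * s" unfolding X_def by simp
 qed
qed

subsection \<open>Uniqueness of the density and of the logarithm\<close>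

lemma quadratic_linear_bound:
 fixes X Y b :: real
 assumes "!!s. s\<^sub>0 <= s ==> X * s^2 <= Y * s^2 + b * s" shows "X <= Y"
proof (rule ccontr)
 assume "\<not> X <= Y"
 hence XY: "0 < X - Y" by simp
 define s where "s = max s\<^sub>0 (\<bar>b\<bar> / (X - Y) + 1)"
 have "0 <= \<bar>b\<bar> / (X - Y)" using XY by simp
 hence s: "s\<^sub>0 <= s" "0 < s" by (auto simp: s_def)
 have "\<bar>b\<bar> / (X - Y) < s" by (simp add: s_def)
 hence "\<bar>b\<bar> < s * (X - Y)" using XY by (simp add: pos_divide_less_eq)
 hence "\<bar>b\<bar> * s < s * (X - Y) * s" using s by (intro mult_strict_right_mono)
 moreover have "b * s <= \<bar>b\<bar> * s" using s by (intro mult_right_mono) auto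
 moreover have "s * (X - Y) * s = X * s^2 - Y * s^2" by (simp add: power2_eq_square algebra_simps)
 ultimately show False using assms[OF s(1)] by linarith
qed

lemma inverse_sqrt_bound:
 fixes X a :: real
 assumes "!!\<rho>. \<rho>\<^sub>0 <= \<rho> ==> X <= a / sqrt \<rho>" "0 <= a" shows "X <= 0"
proof (rule ccontr)
 assume "\<not> X <= 0"
 hence X: "0 < X" by simp
 define \<rho> where "\<rho> = max \<rho>\<^sub>0 ((a / X + 1)^2)"
 have aX: "0 <= a / X" using X assms(2) by simp
 have "(a / X + 1)^2 <= \<rho>" by (simp add: \<rho>_def)
 hence "sqrt ((a / X + 1)^2) <= sqrt \<rho>" by (rule real_sqrt_le_mono)
 hence s: "a / X + 1 <= sqrt \<rho>" using aX by simp
 hence "X * (a / X + 1) <= X * sqrt \<rho>" using X by (intro mult_left_mono) auto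
 hence "a + X <= X * sqrt \<rho>" using X by (simp add: distrib_left)
 moreover have "X * sqrt \<rho> <= a"
 proof -
 have "X <= a / sqrt \<rho>" by (rule assms(1)) (simp add: \<rho>_def)
 moreover have sp: "0 < sqrt \<rho>" using s aX by linarith
 ultimately show ?thesis by (simp only: pos_le_divide_eq[OF sp])
 qed
 ultimately show False using X by linarith
qed

lemma dens_ball:
 assumes D: "dens c d \<gamma> C" and s: "1 <= s"
 shows "norm (nu c d (cball 0 s) - \<gamma> * of_real (pi * s^2)) <= C * s"
 using densD(2)[OF D convex_cball _ s, of 0 s 0] content_cball_complex[of s 0] s by simp

lemma dens_unique:
 assumes D: "dens c d \<gamma> C" "dens c d \<gamma>' C'" shows "\<gamma> = \<gamma>'"
proof -
 have "norm (\<gamma> - \<gamma>') * s^2 <= 0 * s^2 + (C + C') * s" if s: "1 <= s" for s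
 proof -
  have "(\<gamma> - \<gamma>') * of_real (pi * s^2) = (nu c d (cball 0 s) - \<gamma>' * of_real (pi * s^2)) - (nu c d (cball 0 s) - \<gamma> * of_real (pi * s^2))"
   by (simp add: left_diff_distrib)
  hence "norm (\<gamma> - \<gamma>') * norm (of_real (pi * s^2) :: complex) <= C' * s + C * s"
   unfolding norm_mult[symmetric] using dens_ball[OF D(1) s] dens_ball[OF D(2) s] by (simp only: norm_triangle_le_diff add.commute add_mono)
  moreover have "norm (of_real (pi * s^2) :: complex) = pi * s^2" unfolding norm_of_real by simp
  ultimately have "norm (\<gamma> - \<gamma>') * (pi * s^2) <= C' * s + C * s" by simp
  moreover have "norm (\<gamma> - \<gamma>') * (1 * s^2) <= norm (\<gamma> - \<gamma>') * (pi * s^2)"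
   using pi_gt3 by (intro mult_left_mono mult_right_mono) auto
  ultimately show ?thesis by (simp add: algebra_simps)
 qed
 hence "norm (\<gamma> - \<gamma>') <= 0" by (rule quadratic_linear_bound)
 thus ?thesis by simp
qed

section \<open>Means of increments over large discs\<close>

lemma SI_const:
 assumes "A \<in> sets borel" "bounded A" shows "SI A (%_. v) = v * of_real (measure lborel A)"
proof -
 have "SI A (%_. v) = (\<integral>w. v * (indicator A w :: complex) \<partial>lborel)"
  unfolding set_lebesgue_integral_def by (intro Bochner_Integration.integral_cong) (auto simp: indicator_def)
 thus ?thesis using complex_indicator_integral(2)[OF assms] by simp
qed

text \<open>Truncation at \<rho> gives the compact support that \<open>local_sum\<close> demands, at
  the price of an O(1 / \<rho>) error in the mass -pi cnj w d.\<close>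

lemma kap_shift_kernel:
 assumes M: "1 <= M" "norm d <= M" and R: "norm w <= R" and \<rho>: "2 * R + 4 * M <= \<rho>"
 defines "g \<equiv> %v. if norm v <= \<rho> then kap M d (v - w) - kap M d v else 0"
 shows "g \<in> borel_measurable borel" "norm (g v) <= 2" "\<rho> < norm v ==> g v = 0"
  "norm (SI (cball 0 \<rho>) g - (- of_real pi * cnj w) * d) <= (128 * M * R^2 + 256 * M^3 * R) / \<rho>"
proof -
 have kc: "continuous_on UNIV (%v. kap M d (v - w))" "continuous_on UNIV (kap M d)" by (intro continuous_intros M)+
 have km [measurable]: "(%v. kap M d (v - w)) \<in> borel_measurable borel" "kap M d \<in> borel_measurable borel"
  using kc by (auto intro: borel_measurable_continuous_onI)
 show "g \<in> borel_measurable borel" unfolding g_def by measurable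
 show "norm (g v) <= 2" using norm_triangle_ineq4[of "kap M d (v - w)" "kap M d v"] norm_kap_le[OF M, of "v - w"] norm_kap_le[OF M, of v] by (simp add: g_def)
 show "\<rho> < norm v ==> g v = 0" by (simp add: g_def)
 have si: "set_integrable lborel (cball 0 \<rho>) (%v. kap M d (v - w))" "set_integrable lborel (cball 0 \<rho>) (kap M d)"
  by (auto intro!: SI_integrable[of _ _ 1] norm_kap_le M)
 have "SI (cball 0 \<rho>) g = SI (cball 0 \<rho>) (%v. kap M d (v - w) - kap M d v)"
  unfolding set_lebesgue_integral_def by (intro Bochner_Integration.integral_cong) (auto simp: g_def indicator_def)
 also have "... = SI (cball 0 \<rho>) (%v. kap M d (v - w)) - SI (cball 0 \<rho>) (kap M d)" by (rule set_integral_diff(2)[OF si])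
 also have "SI (cball 0 \<rho>) (kap M d) = 0" by (rule SI_odd) (auto simp: kap_minus)
 finally have "SI (cball 0 \<rho>) g - (- of_real pi * cnj w) * d = SI (cball 0 \<rho>) (%v. kap M d (v - w)) + of_real pi * d * cnj w" by simp
 thus "norm (SI (cball 0 \<rho>) g - (- of_real pi * cnj w) * d) <= (128 * M * R^2 + 256 * M^3 * R) / \<rho>"
  using SI_kap[OF M R \<rho>] by (simp add: mult_ac)
qed

lemma TT_increment_bound:
 assumes p: "pairs c d M N" and D: "dens c d \<gamma> C"
 obtains B where "!!z. norm (TT M c d (z + w) - TT M c d z) <= B"
proof -
 note M = pairsD(1)[OF p] and N = pairsD(2)[OF p]
 obtain K \<rho>1 where K: "0 <= K" "1 <= \<rho>1" "!!c d z \<rho> S. pairs c d M N ==> dens c d \<gamma> C ==> norm z <= norm w ==> \<rho>1 <= \<rho> ==>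
   {n. norm (c n) < \<rho>} \<subseteq> S ==> S \<subseteq> {n. norm (c n) < \<rho> + 2} ==> norm (TT M c d z - TS M c d S z) <= K / sqrt \<rho>"
  by (rule TT_approx[OF M N densD(1)[OF D] norm_ge_zero, of \<gamma> w]) blast
 show thesis
 proof (rule that)
  fix z
  define S where "S = {n. norm (c n - z) < \<rho>1}"
  have 1: "norm (TT M (%n. c n - z) d w - TS M (%n. c n - z) d S w) <= K / sqrt \<rho>1"
   by (rule K(3)[OF pairs_shift[OF p] dens_shift[OF D]]) (auto simp: S_def)
  have "norm (TS M (%n. c n - z) d S w) <= (\<Sum>n\<in>S. 2)" unfolding TS_def
  proof (rule sum_norm_le)
   fix n
   show "norm (kap M (d n) (c n - z - w) - kap M (d n) (c n - z)) <= 2"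
    using norm_triangle_ineq4[of "kap M (d n) (c n - z - w)" "kap M (d n) (c n - z)"] norm_kap_le[OF M pairsD(3)[OF p], of n "c n - z - w"] norm_kap_le[OF M pairsD(3)[OF p], of n "c n - z"] by linarith
  qed
  also have "... <= 2 * (25 * N * \<rho>1^2)" using pairs_count(2)[OF p K(2), of S z] by (simp add: S_def)
  finally have 2: "norm (TS M (%n. c n - z) d S w) <= 2 * (25 * N * \<rho>1^2)" .
  have "norm (TT M (%n. c n - z) d w) <= K / sqrt \<rho>1 + 2 * (25 * N * \<rho>1^2)"
   using 1 2 norm_triangle_ineq[of "TT M (%n. c n - z) d w - TS M (%n. c n - z) d S w" "TS M (%n. c n - z) d S w"] by simp
  thus "norm (TT M c d (z + w) - TT M c d z) <= K / sqrt \<rho>1 + 2 * (25 * N * \<rho>1^2)" unfolding TT_shift[OF p D] .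
 qed
qed

text \<open>Over a disc of radius s the increments of the bounded \<open>k\<close> have mean O(1 /
  s), and those of \<open>TT\<close> have mean close to -\<gamma> pi cnj w, the mass of the shift
  kernel times the density. The linear terms cancel and leave v. First s tends to infinity for fixed
  \<rho>, then \<rho>.\<close>

lemma mean_increment_zero:
 assumes p: "pairs c d M N" and D: "dens c d \<gamma> C" and k: "continuous_on UNIV k" "!!z. norm (k z) <= K"
  and eq: "!!z. TT M c d (z + w) - TT M c d z = k (z + w) - k z - v - \<gamma> * of_real pi * cnj w"
 shows "v = 0"
proof -
 note M = pairsD(1)[OF p] and N = pairsD(2)[OF p]
 have K0: "0 <= K" using k(2)[of 0] norm_ge_zero order_trans by blast
 have C0: "0 <= C" by (rule densD(1)[OF D])
 define R where "R = norm w"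
 have R: "norm w <= R" "0 <= R" by (auto simp: R_def)
 obtain K' \<rho>1 where K': "0 <= K'" "1 <= \<rho>1" "!!c d z \<rho> S. pairs c d M N ==> dens c d \<gamma> C ==> norm z <= R ==> \<rho>1 <= \<rho> ==>
   {n. norm (c n) < \<rho>} \<subseteq> S ==> S \<subseteq> {n. norm (c n) < \<rho> + 2} ==> norm (TT M c d z - TS M c d S z) <= K' / sqrt \<rho>"
  by (rule TT_approx[OF M N densD(1)[OF D] R(2), of \<gamma>]) blast
 have km [measurable]: "k \<in> borel_measurable borel" by (rule borel_measurable_continuous_onI[OF k(1)])
 define E where "E = 128 * M * R^2 + 256 * M^3 * R"
 have E0: "0 <= E" using M R by (simp add: E_def)
 define q where "q = - complex_of_real pi * cnj w"
 have main: "norm v * pi <= (25 * N * E + K' * pi) / sqrt \<rho>" if \<rho>: "\<rho>1 + 2 * R + 4 * M <= \<rho>" for \<rho>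
 proof -
  have r: "2 * R + 4 * M <= \<rho>" "\<rho>1 <= \<rho>" "1 <= \<rho>" "0 <= \<rho>" using \<rho> K'(2) M R by linarith+
  define g where "g = (%n v. if norm v <= \<rho> then kap M (d n) (v - w) - kap M (d n) v else 0)"
  have G1: "g n \<in> borel_measurable borel" for n unfolding g_def by (rule kap_shift_kernel(1)[OF M pairsD(3)[OF p] R(1) r(1)])
  have G2: "norm (g n v) <= 2" for n v unfolding g_def by (rule kap_shift_kernel(2)[OF M pairsD(3)[OF p] R(1) r(1)])
  have G3: "g n v = 0" if "\<rho> < norm v" for n v using that by (simp add: g_def)
  have G4: "norm (SI (cball 0 \<rho>) (g n) - q * d n) <= E / \<rho>" for n unfolding g_def q_def E_def by (rule kap_shift_kernel(4)[OF M pairsD(3)[OF p] R(1) r(1)])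
  define b where "b = (350 * N * (\<rho> + 1)^2) * (2 * (pi * \<rho>^2) + norm q * M) + norm q * C + 32 * K * R"
  have "(norm v * pi) * s^2 <= (25 * N * (E / \<rho>) + K' / sqrt \<rho> * pi) * s^2 + b * s" if s0: "1 + R <= s" for s
  proof -
   have s: "1 <= s" "R <= s" using s0 R by auto
   define A where "A = cball (0::complex) s"
   have A: "convex A" "A \<in> sets borel" "A \<subseteq> cball 0 s" "bounded A" by (auto simp: A_def)
   have mA: "measure lborel A = pi * s^2" using content_cball_complex[of s 0] s by (simp add: A_def)
   define I where "I = {n. norm (c n - 0) <= s + \<rho>}"
   have I: "finite I" unfolding I_def by (rule pairs_finite(1)[OF p])
   define S where "S = (%z. \<Sum>n\<in>I. g n (c n - z))"
   have [measurable]: "g n \<in> borel_measurable borel" for n by (rule G1)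
   have Sm [measurable]: "S \<in> borel_measurable borel" unfolding S_def by measurable
   have Sb: "norm (S z) <= real (card I) * 2" for z unfolding S_def
    using sum_norm_le[of I "%n. g n (c n - z)" "%_. 2"] G2 by simp
   have 1: "norm (SI A S - q * nu c d A) <= real (card {n. c n \<in> A}) * (E / \<rho>) + (350 * N * (\<rho> + 1)^2 * s) * (2 * (pi * \<rho>^2) + norm q * M)"
    unfolding S_def by (rule local_sum[OF p A(1-3) s(1) r(4) G1 G2 G3]) (use G4 I in \<open>auto simp: I_def\<close>)
   have "real (card {n. c n \<in> A}) <= 25 * N * s^2" by (rule pairs_count(2)[OF p s(1), of _ 0]) (simp add: A_def)
   hence "real (card {n. c n \<in> A}) * (E / \<rho>) <= 25 * N * s^2 * (E / \<rho>)" using E0 r by (intro mult_right_mono) auto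
   hence 1: "norm (SI A S - q * nu c d A) <= 25 * N * s^2 * (E / \<rho>) + (350 * N * (\<rho> + 1)^2 * s) * (2 * (pi * \<rho>^2) + norm q * M)"
    using 1 by linarith
   have 2: "norm (q * nu c d A - q * (\<gamma> * of_real (pi * s^2))) <= norm q * (C * s)"
    unfolding right_diff_distrib[symmetric] norm_mult A_def by (intro mult_left_mono dens_ball[OF D s(1)]) simp
   have 3: "norm (SI A (%z. k (z + w)) - SI A k) <= 32 * K * s * R"
    unfolding A_def by (rule SI_translate_diff[OF km k(2) k(2) R(1) s(2) K0])
   define v' where "v' = v + \<gamma> * of_real pi * cnj w"
   define err where "err = (%z. (k (z + w) - k z) - v' - S z)"
   have er: "norm (err z) <= K' / sqrt \<rho>" if z: "z \<in> A" for z
   proof -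
    define T where "T = {n. norm (c n - z) <= \<rho>}"
    have sub1: "{n. norm (c n - z) < \<rho>} \<subseteq> T" and sub2: "T \<subseteq> {n. norm (c n - z) < \<rho> + 2}" by (auto simp: T_def)
    have TI: "T \<subseteq> I"
    proof
    fix n assume "n \<in> T"
    thus "n \<in> I" using norm_triangle_ineq[of "c n - z" z] z by (simp add: T_def I_def A_def)
    qed
    have "TS M (%n. c n - z) d T w = (\<Sum>n\<in>T. g n (c n - z))" unfolding TS_def by (rule sum.cong) (auto simp: g_def T_def)
    also have "... = S z" unfolding S_def by (rule sum.mono_neutral_left[OF I TI]) (auto simp: T_def g_def)
    finally have "norm (TT M (%n. c n - z) d w - S z) <= K' / sqrt \<rho>"
    using K'(3)[OF pairs_shift[OF p] dens_shift[OF D] R(1) r(2) sub1 sub2] by simp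
    thus ?thesis unfolding TT_shift[OF p D] eq err_def v'_def by (simp add: algebra_simps)
   qed
   have 4: "norm (SI A err) <= K' / sqrt \<rho> * measure lborel A"
    by (rule norm_SI_le[OF A(2,4)]) (use er K' r in auto)
   have i1: "set_integrable lborel A (%z. k (z + w))" "set_integrable lborel A k" "set_integrable lborel A (%z. v')" "set_integrable lborel A S"
    using A k(2) Sb by (auto intro!: SI_integrable)
   have i2: "set_integrable lborel A (%z. k (z + w) - k z)" by (rule set_integral_diff(1)[OF i1(1,2)])
   have i3: "set_integrable lborel A (%z. (k (z + w) - k z) - v')" by (rule set_integral_diff(1)[OF i2 i1(3)])
   have "SI A err = SI A (%z. k (z + w)) - SI A k - v' * of_real (measure lborel A) - SI A S"
    unfolding err_def set_integral_diff(2)[OF i3 i1(4)] set_integral_diff(2)[OF i2 i1(3)] set_integral_diff(2)[OF i1(1,2)] SI_const[OF A(2,4)] ..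
   moreover have "v' * of_real (measure lborel A) = v * of_real (pi * s^2) - q * (\<gamma> * of_real (pi * s^2))"
    unfolding mA v'_def q_def by (simp add: algebra_simps)
   ultimately have "v * of_real (pi * s^2) = (SI A (%z. k (z + w)) - SI A k) - SI A err - (SI A S - q * nu c d A) - (q * nu c d A - q * (\<gamma> * of_real (pi * s^2)))"
    by simp
   hence "norm (v * of_real (pi * s^2)) <= norm (SI A (%z. k (z + w)) - SI A k) + norm (SI A err) + norm (SI A S - q * nu c d A) + norm (q * nu c d A - q * (\<gamma> * of_real (pi * s^2)))"
    by (simp only:) (intro order_trans[OF norm_triangle_ineq4] add_mono order_refl)
   moreover have "norm (v * of_real (pi * s^2)) = (norm v * pi) * s^2" unfolding norm_mult norm_of_real by simp
   ultimately have "(norm v * pi) * s^2 <= 32 * K * s * R + K' / sqrt \<rho> * (pi * s^2) + (25 * N * s^2 * (E / \<rho>) + (350 * N * (\<rho> + 1)^2 * s) * (2 * (pi * \<rho>^2) + norm q * M)) + norm q * (C * s)"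
    using 1 2 3 4 unfolding mA by linarith
   also have "... = (25 * N * (E / \<rho>) + K' / sqrt \<rho> * pi) * s^2 + b * s" unfolding b_def distrib_right by (simp only: mult_ac add_ac)
   finally show ?thesis .
  qed
  hence "norm v * pi <= 25 * N * (E / \<rho>) + K' / sqrt \<rho> * pi" by (rule quadratic_linear_bound)
  also have "... <= 25 * N * (E / sqrt \<rho>) + K' / sqrt \<rho> * pi"
  proof -
   have "sqrt \<rho> <= \<rho>" using r(3) by (intro real_le_lsqrt self_le_power) auto
   hence "E / \<rho> <= E / sqrt \<rho>" using E0 r by (intro divide_left_mono) auto
   thus ?thesis using N by (intro add_mono mult_left_mono order_refl) auto
  qed
  also have "... = (25 * N * E + K' * pi) / sqrt \<rho>" by (simp add: add_divide_distrib)
  finally show ?thesis .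
 qed
 have "norm v * pi <= 0" by (rule inverse_sqrt_bound[OF main]) (use N E0 K' in auto)
 moreover have "norm v * 1 <= norm v * pi" using pi_gt3 by (intro mult_left_mono) auto
 ultimately have "norm v <= 0" by linarith
 thus ?thesis by simp
qed

text \<open>\<open>G\<close> is entire, but boundedness of \<open>Phi\<close> and hence of
  \<open>G\<close> is not yet known. The increments of \<open>G\<close> are bounded, hence constant
  by Liouville's theorem, and \<open>mean_increment_zero\<close> shows that the constants are
  0.\<close>

lemma logarithm_unique:
 assumes p: "pairs c d M N" and D: "dens c d (cnj \<beta> / of_real (2 * pi)) C" and k: "continuous_on UNIV k" "!!z. norm (k z) <= K"
  and h: "!!w F. finite F ==> {n. norm (c n - w) < 2 * M + 2} \<subseteq> F ==>
   (%z. \<i> * of_real (Im (\<beta> * z)) + k z - (kapS M c d F z)) holomorphic_on ball w 2"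
 shows "k z = Phi M c d (cnj \<beta> / of_real (2 * pi)) z + k 0"
proof -
 define \<gamma> where "\<gamma> = cnj \<beta> / of_real (2 * pi)"
 define G where "G = (%z. k z - Phi M c d \<gamma> z)"
 have Geq: "G z = (\<i> * of_real (Im (\<beta> * z)) + k z) - TT M c d z - \<beta> * z / 2" for z
  using exponent_split[of \<beta> z M c d] by (simp add: G_def \<gamma>_def algebra_simps)
 have Gh: "G holomorphic_on UNIV"
 proof (rule analytic_imp_holomorphic, unfold analytic_on_def, rule ballI)
  fix w
  define F where "F = {n. norm (c n - w) < 2 * M + 2}"
  have F: "finite F" "{n. norm (c n - w) < 2 * M + 2} \<subseteq> F" by (auto simp: F_def intro: pairs_finite(2)[OF p])
  have "(%z. (\<i> * of_real (Im (\<beta> * z)) + k z - (kapS M c d F z)) - (TT M c d z - (kapS M c d F z)) - \<beta> * z / 2) holomorphic_on ball w 2"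
   by (rule holomorphic_on_diff[OF holomorphic_on_diff[OF h[OF F] TT_holomorphic[OF p D F]]]) (intro holomorphic_intros, simp)
  moreover have "(%z. (\<i> * of_real (Im (\<beta> * z)) + k z - (kapS M c d F z)) - (TT M c d z - (kapS M c d F z)) - \<beta> * z / 2) = G"
   by (rule ext) (simp add: Geq algebra_simps)
  ultimately have "G holomorphic_on ball w 2" by (simp only:)
  thus "\<exists>\<epsilon>>0. G holomorphic_on ball w \<epsilon>" by (intro exI[of _ 2]) simp
 qed
 have "G (0 + w) - G 0 = 0" for w
 proof -
  define H where "H = (%z. G (z + w) - G z)"
  have Heq: "H z = k (z + w) - k z - (TT M c d (z + w) - TT M c d z) - \<gamma> * of_real pi * cnj w" for z
   by (simp add: H_def G_def Phi_def algebra_simps)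
  have "(G \<circ> (%z. z + w)) holomorphic_on UNIV" by (rule holomorphic_on_compose_gen[OF _ Gh]) (auto intro!: holomorphic_intros)
  hence "H holomorphic_on UNIV" unfolding H_def o_def by (intro holomorphic_intros Gh)
  moreover obtain B where B: "!!z. norm (TT M c d (z + w) - TT M c d z) <= B" by (rule TT_increment_bound[OF p D, of w]) blast
  have "norm (H z) <= K + K + B + norm (\<gamma> * of_real pi * cnj w)" for z unfolding Heq
   by (intro order_trans[OF norm_triangle_ineq4] add_mono k(2) B order_refl)
  hence "bounded (range H)" unfolding bounded_iff by blast
  ultimately have "H constant_on UNIV" by (rule Liouville_theorem)
  then obtain v where v: "!!z. H z = v" unfolding constant_on_def by auto
  have "v = 0"
  proof (rule mean_increment_zero[OF p D[folded \<gamma>_def] k, of w])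
   show "TT M c d (z + w) - TT M c d z = k (z + w) - k z - v - \<gamma> * of_real pi * cnj w" for z
    using v[of z] unfolding Heq by (simp add: algebra_simps)
  qed
  thus ?thesis using v[of 0] by (simp add: H_def)
 qed
 from this[of z] have "G z = G 0" by simp
 moreover have "G 0 = k 0" by (simp add: G_def Phi_def)
 ultimately show ?thesis by (simp add: G_def \<gamma>_def algebra_simps)
qed

subsection \<open>Translation to zeros and poles\<close>

lemma nuD_eq_nu: "nuD a b E = nu (%n. (a n + b n) / 2) (%n. a n - b n) E"
 by (simp add: nuD_def nu_def)

lemma nuD_shift_int_eq: "nuD_shift_int a b z r = shift_int (%n. (a n + b n) / 2) (%n. a n - b n) z r"
 by (simp add: nuD_shift_int_def shift_int_def)

text \<open>An almost period carries any index to one whose zero lies in a fixed disc, and there are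
  finitely many of those; this bounds the differences. In the same way the centres near
  \<open>z\<close> are mapped injectively into the finite set \<open>Q\<close>.\<close>

lemma regular_pairs:
 assumes lf: "locally_finite_div a b" and ar: "almost_periodic_regular a b"
 defines "c \<equiv> %n. (a n + b n) / 2" and "d \<equiv> %n. a n - b n"
 obtains M N where "pairs c d M N" "!!\<delta>. 0 < \<delta> ==> rdense (ap c d \<delta>)"
proof -
 have reg: "\<exists>L. \<forall>x. \<exists>\<tau>\<in>ball x L. \<exists>\<sigma>. bij (\<sigma>::nat=>nat) \<and> (\<forall>n. norm (a n + \<tau> - a (\<sigma> n)) < \<epsilon> \<and> norm (b n + \<tau> - b (\<sigma> n)) < \<epsilon>)"
  if "0 < \<epsilon>" for \<epsilon> using ar that unfolding almost_periodic_regular_def by blast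
 have tr: "norm (c n + \<tau> - c m) < \<epsilon> \<and> norm (d n - d m) < 2 * \<epsilon>" if "norm (a n + \<tau> - a m) < \<epsilon> \<and> norm (b n + \<tau> - b m) < \<epsilon>" for n m \<tau> \<epsilon>
 proof -
  have e: "c n + \<tau> - c m = ((a n + \<tau> - a m) + (b n + \<tau> - b m)) / 2" by (simp add: c_def field_simps)
  have 1: "norm (c n + \<tau> - c m) = norm ((a n + \<tau> - a m) + (b n + \<tau> - b m)) / 2" unfolding e norm_divide by simp
  have "d n - d m = (a n + \<tau> - a m) - (b n + \<tau> - b m)" by (simp add: d_def)
  hence 2: "norm (d n - d m) <= norm (a n + \<tau> - a m) + norm (b n + \<tau> - b m)" by (simp only: norm_triangle_ineq4)
  show ?thesis using that 1 2 norm_triangle_ineq[of "a n + \<tau> - a m" "b n + \<tau> - b m"] by linarith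
 qed
 have rd: "rdense (ap c d \<delta>)" if "0 < \<delta>" for \<delta>
 proof -
  obtain L where L: "!!x. \<exists>\<tau>\<in>ball x L. \<exists>\<sigma>. bij (\<sigma>::nat=>nat) \<and> (\<forall>n. norm (a n + \<tau> - a (\<sigma> n)) < \<delta>/2 \<and> norm (b n + \<tau> - b (\<sigma> n)) < \<delta>/2)"
  proof -
   have "0 < \<delta>/2" using \<open>0 < \<delta>\<close> by simp
   from reg[OF this] show thesis using that by blast
  qed
  show ?thesis unfolding rdense_def
  proof (intro exI[of _ L] allI)
   fix x obtain \<tau> \<sigma> where t: "\<tau> \<in> ball x L" "bij \<sigma>" "!!n. norm (a n + \<tau> - a (\<sigma> n)) < \<delta>/2 \<and> norm (b n + \<tau> - b (\<sigma> n)) < \<delta>/2" using L[of x] by blast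
   have "norm (c n + \<tau> - c (\<sigma> n)) < \<delta> \<and> norm (d n - d (\<sigma> n)) < \<delta>" for n using tr[OF t(3), of n] that by linarith
   thus "\<exists>\<tau>\<in>ball x L. ap c d \<delta> \<tau>" using t(1,2) unfolding ap_def by blast
  qed
 qed
 obtain L where L: "!!x. \<exists>\<tau>\<in>ball x L. \<exists>\<sigma>. bij (\<sigma>::nat=>nat) \<and> (\<forall>n. norm (a n + \<tau> - a (\<sigma> n)) < 1 \<and> norm (b n + \<tau> - b (\<sigma> n)) < 1)"
  using reg[of 1] by auto
 define F where "F = {n. norm (a n) <= L + 1}"
 have F: "finite F" using lf by (simp add: F_def locally_finite_div_def)
 \<comment> \<open>The summand 2 allows for the change of \<open>d\<close> along a 1-almost period;
   the sum dominates \<open>norm (d n)\<close> for each index in \<open>F\<close>.\<close>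
 define M where "M = 1 + 2 + (\<Sum>n\<in>F. norm (d n))"
 have sM: "0 <= (\<Sum>n\<in>F. norm (d n))" by (intro sum_nonneg) auto
 have dM: "norm (d n) <= M" for n
 proof -
  obtain \<tau> \<sigma> where t: "\<tau> \<in> ball (- a n) L" "norm (a n + \<tau> - a (\<sigma> n)) < 1 \<and> norm (b n + \<tau> - b (\<sigma> n)) < 1" using L[of "- a n"] by blast
  have "norm (a n + \<tau>) <= L" using t(1) by (simp add: dist_norm norm_minus_commute add.commute)
  hence "norm (a (\<sigma> n)) <= L + 1" using t(2) norm_triangle_ineq2[of "a (\<sigma> n)" "a n + \<tau>"] by (simp add: norm_minus_commute)
  hence "norm (d (\<sigma> n)) <= (\<Sum>n\<in>F. norm (d n))" using F by (intro member_le_sum) (auto simp: F_def)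
  moreover have "norm (d n) <= norm (d n - d (\<sigma> n)) + norm (d (\<sigma> n))" using norm_triangle_ineq[of "d n - d (\<sigma> n)" "d (\<sigma> n)"] by simp
  ultimately show ?thesis using tr[OF t(2)] by (simp add: M_def)
 qed
 define Q where "Q = {n. norm (c n) <= L + 2}"
 have "Q \<subseteq> {n. norm (a n) <= L + 2 + M}"
 proof
  fix n assume "n \<in> Q"
  moreover have "a n = c n + d n / 2" by (simp add: c_def d_def field_simps)
  hence "norm (a n) <= norm (c n) + norm (d n) / 2" using norm_triangle_ineq[of "c n" "d n / 2"] by (simp add: norm_divide)
  ultimately show "n \<in> {n. norm (a n) <= L + 2 + M}" using dM[of n] norm_ge_zero[of "d n"] unfolding Q_def mem_Collect_eq by linarith
 qed
 hence Q: "finite Q" using lf finite_subset unfolding locally_finite_div_def by blast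
 have cnt: "finite {n. norm (c n - z) <= 1} \<and> card {n. norm (c n - z) <= 1} <= card Q" for z
 proof -
  obtain \<tau> \<sigma> where t: "\<tau> \<in> ball (- z) L" "bij \<sigma>" "!!n. norm (a n + \<tau> - a (\<sigma> n)) < 1 \<and> norm (b n + \<tau> - b (\<sigma> n)) < 1" using L[of "- z"] by blast
  have "\<sigma> ` {n. norm (c n - z) <= 1} \<subseteq> Q"
  proof (rule image_subsetI)
   fix n assume n: "n \<in> {n. norm (c n - z) <= 1}"
   have "norm (z + \<tau>) <= L" using t(1) by (simp add: dist_norm norm_minus_commute add.commute)
   moreover have "norm (c (\<sigma> n) - (c n + \<tau>)) <= 1" using tr[OF t(3), of n] by (simp add: norm_minus_commute)
   moreover have "norm ((c (\<sigma> n) - (c n + \<tau>)) + ((c n - z) + (z + \<tau>))) <= norm (c (\<sigma> n) - (c n + \<tau>)) + (norm (c n - z) + norm (z + \<tau>))"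
    by (intro order_trans[OF norm_triangle_ineq] add_left_mono norm_triangle_ineq)
   moreover have "(c (\<sigma> n) - (c n + \<tau>)) + ((c n - z) + (z + \<tau>)) = c (\<sigma> n)" by simp
   ultimately show "\<sigma> n \<in> Q" using n unfolding Q_def mem_Collect_eq by (simp only:)
  qed
  moreover have "inj_on \<sigma> {n. norm (c n - z) <= 1}" using inj_on_subset[OF bij_is_inj[OF t(2)] subset_UNIV] .
  ultimately show ?thesis using Q by (metis card_inj_on_le inj_on_finite)
 qed
 have "pairs c d M (max 1 (real (card Q)))" unfolding pairs_def
 proof (intro conjI allI dM)
  show "1 <= M" using sM by (simp add: M_def)
  show "finite {n. norm (c n - z) <= 1}" for z using cnt by simp
  show "real (card {n. norm (c n - z) <= 1}) <= max 1 (real (card Q))" for z using conjunct2[OF cnt[of z]] by (intro max.coboundedI2) simp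
 qed simp
 thus thesis using rd by (rule that)
qed

lemma area_bound_imp_dens:
 assumes b: "!!E. convex E ==> bounded E ==> norm (nu c d E - cnj \<beta> * complex_of_real (measure lebesgue E / (2 * pi)))
  <= C * (enn2real (hausdorff1 (frontier E)) + 1)"
 shows "dens c d (cnj \<beta> / of_real (2 * pi)) (\<bar>C\<bar> * (8 * pi + 1))"
 unfolding dens_def
proof (intro conjI allI impI)
 show "0 <= \<bar>C\<bar> * (8 * pi + 1)" by (intro mult_nonneg_nonneg) auto
 fix x s and E :: "complex set" assume "convex E \<and> E \<in> sets borel \<and> 1 <= s \<and> E \<subseteq> cball x s"
 hence E: "convex E" "E \<in> sets borel" "E \<subseteq> cball x s" and s: "1 <= s" by auto
 have bE: "bounded E" using E(3) bounded_subset by blast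
 have m: "measure lebesgue E = measure lborel E" using E(2) by (simp add: measure_completion)
 have "enn2real (hausdorff1 (frontier E)) <= 8 * pi * s"
  using enn2real_mono[OF hausdorff1_frontier_le[OF E(1,3)]] s by simp
 hence "enn2real (hausdorff1 (frontier E)) + 1 <= 8 * pi * s + s" using s by linarith
 hence "\<bar>C\<bar> * (enn2real (hausdorff1 (frontier E)) + 1) <= \<bar>C\<bar> * (8 * pi * s + s)" by (intro mult_left_mono) auto
 moreover have "C * (enn2real (hausdorff1 (frontier E)) + 1) <= \<bar>C\<bar> * (enn2real (hausdorff1 (frontier E)) + 1)" by (intro mult_right_mono) auto
 moreover have "cnj \<beta> * complex_of_real (measure lborel E / (2 * pi)) = cnj \<beta> / of_real (2 * pi) * of_real (measure lborel E)" by simp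
 ultimately show "norm (nu c d E - cnj \<beta> / of_real (2 * pi) * of_real (measure lborel E)) <= \<bar>C\<bar> * (8 * pi + 1) * s"
  using b[OF E(1) bE] unfolding m by (simp add: algebra_simps)
qed

text \<open>A convex set need not be Borel, so \<open>dens\<close> is applied to its interior; the
  frontier is negligible and carries only O(s) centres. The enclosing radius max 1 (4 H) comes from
  \<open>norm_le_hausdorff1_frontier\<close>.\<close>

lemma dens_imp_area_bound:
 assumes p: "pairs c d M N" and D: "dens c d (cnj \<beta> / of_real (2 * pi)) C"
 obtains C' where "!!E. convex E ==> bounded E ==> norm (nu c d E - cnj \<beta> * complex_of_real (measure lebesgue E / (2 * pi)))
  <= C' * (enn2real (hausdorff1 (frontier E)) + 1)"
proof (rule that[of "4 * (C + 350 * N * M)"])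
 fix E :: "complex set" assume E: "convex E" "bounded E"
 define H where "H = enn2real (hausdorff1 (frontier E))"
 have H: "0 <= H" by (simp add: H_def)
 define C' where "C' = 4 * (C + 350 * N * M)"
 have C0: "0 <= C" by (rule densD(1)[OF D])
 have Q0: "0 <= C + 350 * N * M" using C0 pairsD(1,2)[OF p] by simp
 have "\<exists>x. E \<subseteq> cball x (max 1 (4 * H))"
 proof (cases "E = {}")
  case False
  then obtain y where y: "y \<in> E" by blast
  have "norm (y - z) <= max 1 (4 * H)" if "z \<in> E" for z using norm_le_hausdorff1_frontier[OF E y that] by (simp add: H_def)
  thus ?thesis by (intro exI[of _ y]) (auto simp: dist_norm)
 qed simp
 then obtain x where x: "E \<subseteq> cball x (max 1 (4 * H))" by blast
 define s where "s = max 1 (4 * H)"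
 have s: "1 <= s" "s <= 4 * (H + 1)" using H by (auto simp: s_def)
 have x: "E \<subseteq> cball x s" using x by (simp add: s_def)
 define B where "B = interior E"
 have B: "convex B" "B \<in> sets borel" "B \<subseteq> cball x s" "B \<subseteq> E" using E x interior_subset[of E] by (auto simp: B_def convex_interior)
 have 1: "norm (nu c d B - cnj \<beta> / of_real (2 * pi) * of_real (measure lborel B)) <= C * s" by (rule densD(2)[OF D B(1,2) s(1) B(3)])
 have fr: "E - B \<subseteq> frontier E" using closure_subset[of E] by (auto simp: B_def frontier_def)
 have neg: "negligible (frontier E)" by (rule negligible_convex_frontier[OF E(1)])
 have "measure lebesgue E = measure lebesgue B" unfolding B_def by (rule measure_interior[OF E(2) neg, symmetric])
 also have "... = measure lborel B" using B(2) by (simp add: measure_completion)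
 finally have m: "measure lebesgue E = measure lborel B" .
 define S where "S = {n. c n \<in> E - B}"
 have S: "finite S" "real (card S) <= 350 * N * (0 + 1)^2 * s"
  by (rule pairs_count_frontier[OF p E(1) x s(1), of 0]; use fr in \<open>auto simp: S_def\<close>)+
 have fE: "finite {n. c n \<in> E}" by (rule finite_subset[OF _ pairs_finite(1)[OF p, of x s]]) (use x in \<open>auto simp: dist_norm norm_minus_commute\<close>)
 have "nu c d E = nu c d B + (\<Sum>n\<in>S. d n)"
 proof -
  have "{n. c n \<in> E} = {n. c n \<in> B} \<union> S" "{n. c n \<in> B} \<inter> S = {}" using B(4) by (auto simp: S_def)
  moreover have "finite {n. c n \<in> B}" using B(4) by (intro finite_subset[OF _ fE]) auto
  ultimately show ?thesis using S(1) by (simp add: nu_def sum.union_disjoint)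
 qed
 moreover have "norm (\<Sum>n\<in>S. d n) <= 350 * N * s * M"
 proof -
  have "norm (\<Sum>n\<in>S. d n) <= real (card S) * M" using sum_norm_le[of S d "%_. M"] pairsD(3)[OF p] by simp
  also have "... <= (350 * N * s) * M" using S(2) pairsD(1)[OF p] by (intro mult_right_mono) auto
  finally show ?thesis .
 qed
 ultimately have "norm (nu c d E - cnj \<beta> / of_real (2 * pi) * of_real (measure lborel B)) <= C * s + 350 * N * s * M"
  using 1 norm_triangle_ineq[of "nu c d B - cnj \<beta> / of_real (2 * pi) * of_real (measure lborel B)" "\<Sum>n\<in>S. d n"] by (simp add: algebra_simps)
 also have "... = (C + 350 * N * M) * s" by (simp add: algebra_simps)
 also have "... <= (C + 350 * N * M) * (4 * (H + 1))" using s(2) Q0 by (rule mult_left_mono)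
 also have "... = 4 * (C + 350 * N * M) * (H + 1)" by (simp only: mult_ac)
 finally show "norm (nu c d E - cnj \<beta> * complex_of_real (measure lebesgue E / (2 * pi))) <= 4 * (C + 350 * N * M) * (enn2real (hausdorff1 (frontier E)) + 1)"
  unfolding m H_def by simp
qed

text \<open>For all large r the integrals in (c) differ from \<open>Phi\<close> by at most
  \<open>B0\<close>, with one constant for every z; only the range of admissible r depends on
  z.\<close>

lemma Phi_bounded_iff:
 assumes p: "pairs c d M N" and D: "dens c d \<gamma> C"
 shows "(\<exists>B. \<forall>z. norm (Phi M c d \<gamma> z) <= B) \<longleftrightarrow>
  (\<exists>C::real. \<forall>z. Limsup at_top (%r. ereal (norm (shift_int c d z r - shift_int c d 0 r))) < ereal C)"
proof -
 obtain B0 where B0: "!!z. eventually (%r. norm (shift_int c d z r - shift_int c d 0 r - Phi M c d \<gamma> z) <= B0) at_top"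
  by (rule shift_int_Phi[OF p D]) blast
 show ?thesis
 proof
  assume "\<exists>B. \<forall>z. norm (Phi M c d \<gamma> z) <= B"
  then obtain B where B: "!!z. norm (Phi M c d \<gamma> z) <= B" by blast
  show "\<exists>C::real. \<forall>z. Limsup at_top (%r. ereal (norm (shift_int c d z r - shift_int c d 0 r))) < ereal C"
  proof (intro exI[of _ "B0 + B + 1"] allI)
   fix z
   have "eventually (%r. ereal (norm (shift_int c d z r - shift_int c d 0 r)) <= ereal (B0 + B)) at_top"
    using B0[of z]
   proof eventually_elim
    fix r assume "norm (shift_int c d z r - shift_int c d 0 r - Phi M c d \<gamma> z) <= B0"
    thus "ereal (norm (shift_int c d z r - shift_int c d 0 r)) <= ereal (B0 + B)"
    using B[of z] norm_triangle_ineq[of "shift_int c d z r - shift_int c d 0 r - Phi M c d \<gamma> z" "Phi M c d \<gamma> z"] by simp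
   qed
   hence "Limsup at_top (%r. ereal (norm (shift_int c d z r - shift_int c d 0 r))) <= ereal (B0 + B)" by (rule Limsup_bounded)
   also have "... < ereal (B0 + B + 1)" by simp
   finally show "Limsup at_top (%r. ereal (norm (shift_int c d z r - shift_int c d 0 r))) < ereal (B0 + B + 1)" .
  qed
 next
  assume "\<exists>C::real. \<forall>z. Limsup at_top (%r. ereal (norm (shift_int c d z r - shift_int c d 0 r))) < ereal C"
  then obtain C1 :: real where C1: "!!z. Limsup at_top (%r. ereal (norm (shift_int c d z r - shift_int c d 0 r))) < ereal C1" by blast
  have "norm (Phi M c d \<gamma> z) <= C1 + B0" for z
  proof -
   have "eventually (%r. ereal (norm (shift_int c d z r - shift_int c d 0 r)) < ereal C1) at_top" by (rule Limsup_lessD[OF C1])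
   hence "eventually (%r::real. norm (Phi M c d \<gamma> z) <= C1 + B0) at_top" using B0[of z]
   proof eventually_elim
    fix r assume "ereal (norm (shift_int c d z r - shift_int c d 0 r)) < ereal C1" "norm (shift_int c d z r - shift_int c d 0 r - Phi M c d \<gamma> z) <= B0"
    thus "norm (Phi M c d \<gamma> z) <= C1 + B0"
    using norm_triangle_ineq4[of "shift_int c d z r - shift_int c d 0 r" "shift_int c d z r - shift_int c d 0 r - Phi M c d \<gamma> z"] by simp
   qed
   thus ?thesis using eventually_const[of "at_top :: real filter"] by simp
  qed
  thus "\<exists>B. \<forall>z. norm (Phi M c d \<gamma> z) <= B" by blast
 qed
qed

subsection \<open>The representation of almost elliptic functions\<close>

lemma almost_elliptic_representation:
 assumes p: "pairs c d M N" and rd: "!!\<delta>. 0 < \<delta> ==> rdense (ap c d \<delta>)"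
  and f: "almost_elliptic f" and dv: "divisor_of f (%n. c n + d n / 2) (%n. c n - d n / 2)"
 obtains \<beta> C B g where "dens c d (cnj \<beta> / of_real (2 * pi)) C" "!!z. norm (Phi M c d (cnj \<beta> / of_real (2 * pi)) z) <= B" "g ~= 0"
  "!!z. (!!n. c n - d n / 2 ~= z) ==> f z = Some (g * exp (\<beta> * z / 2 + TT M c d z) * PP M c d z)"
proof -
 have mer: "meromorphic_C f" using f by (simp add: almost_elliptic_def)
 obtain E where E: "Eloc M c d E" "f = EPf M c d E" by (rule divisor_representation[OF p mer dv])
 have disj: "!!n k. c n + d n / 2 ~= c k - d k / 2" using divisor_disjoint[OF dv] by simp
 have f': "almost_elliptic (EPf M c d E)" using f E(2) by simp
 obtain B where B: "0 < B" "!!z. norm (E z) <= B" "!!z. norm (inverse (E z)) <= B"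
  by (rule EPf_exponential_bounded[OF p E(1) disj almost_elliptic_sph_uc[OF f'] rd[OF zero_less_one]]) blast
 have T: "rdense (%\<tau>. \<forall>z. norm (E (z + \<tau>) / E z - 1) <= 1/10)"
  by (rule exponential_almost_periods[OF p E(1) disj f' rd])
 obtain \<beta> k K where k: "continuous_on UNIV k" "!!z. norm (k z) <= K" and Ek: "!!z. E z = exp (\<i> * of_real (Im (\<beta> * z)) + k z)"
  by (rule exponential_structure[OF p E(1) B T]) blast
 have hc: "continuous_on UNIV (%z. \<i> * of_real (Im (\<beta> * z)) + k z)" by (intro continuous_intros k(1))
 have h: "(%z. \<i> * of_real (Im (\<beta> * z)) + k z - (kapS M c d F z)) holomorphic_on ball w 2"
  if "finite F" "{n. norm (c n - w) < 2 * M + 2} \<subseteq> F" for w F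
  by (rule log_local_holomorphic[OF p E(1) hc Ek[symmetric] that])
 obtain C where D: "dens c d (cnj \<beta> / of_real (2 * pi)) C" by (rule density_from_logarithm[OF p k h]) blast+
 have ku: "k z = Phi M c d (cnj \<beta> / of_real (2 * pi)) z + k 0" for z by (rule logarithm_unique[OF p D k h])
 show thesis
 proof (rule that[OF D])
  fix z
  have "Phi M c d (cnj \<beta> / of_real (2 * pi)) z = k z - k 0" using ku[of z] by simp
  thus "norm (Phi M c d (cnj \<beta> / of_real (2 * pi)) z) <= K + K"
   using norm_triangle_ineq4[of "k z" "k 0"] k(2)[of z] k(2)[of 0] by simp
 next
  show "exp (k 0) ~= 0" by simp
  fix z assume "!!n. c n - d n / 2 ~= z"
  hence "f z = Some (E z * PP M c d z)" unfolding E(2) by (auto simp: EPf_def)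
  moreover have "\<i> * of_real (Im (\<beta> * z)) + k z = k 0 + (\<beta> * z / 2 + TT M c d z)"
   unfolding exponent_split ku[of z] by (simp only: add_ac)
  hence "E z = exp (k 0) * exp (\<beta> * z / 2 + TT M c d z)" unfolding Ek by (simp only: exp_add)
  ultimately show "f z = Some (exp (k 0) * exp (\<beta> * z / 2 + TT M c d z) * PP M c d z)" by simp
 qed
qed

text \<open>Zero and infinity are at spherical distance 2, so uniform continuity keeps their
  preimages apart.\<close>

lemma almost_elliptic_separated:
 assumes p: "pairs c d M N" and f: "almost_elliptic f" and dv: "divisor_of f (%n. c n + d n / 2) (%n. c n - d n / 2)"
 obtains \<eta> where "0 < \<eta>" "!!n k. \<eta> <= norm ((c n + d n / 2) - (c k - d k / 2))"
proof -
 have mer: "meromorphic_C f" using f by (simp add: almost_elliptic_def)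
 obtain E where E: "Eloc M c d E" "f = EPf M c d E" by (rule divisor_representation[OF p mer dv])
 have E0: "!!z. E z ~= 0" using E(1) by (simp add: Eloc_def)
 have disj: "!!n k. c n + d n / 2 ~= c k - d k / 2" using divisor_disjoint[OF dv] by simp
 obtain \<delta> where d: "0 < \<delta>" "!!z z'. norm (z - z') < \<delta> ==> rhoS (f z) (f z') < 1"
  using almost_elliptic_sph_uc[OF f, unfolded sph_uc_def, rule_format, of 1] by auto
 show thesis
 proof (rule that[OF d(1)], rule ccontr)
  fix n k assume "\<not> \<delta> <= norm ((c n + d n / 2) - (c k - d k / 2))"
  hence "rhoS (f (c n + d n / 2)) (f (c k - d k / 2)) < 1" by (intro d(2)) simp
  moreover have "f (c n + d n / 2) = Some 0" unfolding E(2) by (rule EPf_values(3)[OF E0 p disj])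
  moreover have "f (c k - d k / 2) = None" unfolding E(2) by (simp add: EPf_def)
  ultimately show False by (simp add: rhoS_def)
 qed
qed

theorem mainTheorem4:
  fixes a b :: "nat \<Rightarrow> complex"
  assumes "locally_finite_div a b"
    and "almost_periodic_regular a b"
    and "\<forall>n. a n \<noteq> 0" and "\<forall>n. b n \<noteq> 0"
  shows "((\<exists>f. almost_elliptic f \<and> divisor_of f a b) \<longleftrightarrow>
      ((INF p\<in>(UNIV :: (nat \<times> nat) set). norm (a (fst p) - b (snd p))) > 0
       \<and> (\<exists>\<beta> C::real. \<forall>E::complex set. convex E \<and> bounded E \<longrightarrow>
            norm (nuD a b E - cnj \<beta> * complex_of_real (measure lebesgue E / (2 * pi)))
              \<le> C * (enn2real (hausdorff1 (frontier E)) + 1))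
       \<and> (\<exists>C::real. \<forall>z. Limsup at_top (\<lambda>r. ereal (norm (nuD_shift_int a b z r - nuD_shift_int a b 0 r)))
            < ereal C)))
    \<and> (\<forall>f \<beta> (C::real). almost_elliptic f \<and> divisor_of f a b \<and>
          (\<forall>E::complex set. convex E \<and> bounded E \<longrightarrow>
            norm (nuD a b E - cnj \<beta> * complex_of_real (measure lebesgue E / (2 * pi)))
              \<le> C * (enn2real (hausdorff1 (frontier E)) + 1))
       \<longrightarrow> (\<exists>K. K \<noteq> 0 \<and> (\<forall>z. z \<notin> range b \<longrightarrow>
             (\<exists>p. ((\<lambda>r::real. \<Prod>n\<in>{n. norm ((a n + b n) / 2) < r}. b n * (a n - z) / (a n * (b n - z)))
                      \<longlongrightarrow> p) at_top
                  \<and> f z = Some (K * exp (\<beta> * z / 2) * p)))))"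
    (is "(?AE \<longleftrightarrow> ?sep \<and> ?area \<and> ?shift) \<and> ?formula")
proof -
 define c where "c = (%n. (a n + b n) / 2)"
 define d where "d = (%n. a n - b n)"
 obtain M N where p: "pairs c d M N" and rd: "!!\<delta>. 0 < \<delta> ==> rdense (ap c d \<delta>)"
  unfolding c_def d_def by (rule regular_pairs[OF assms(1,2)]) blast
 have za: "c n + d n / 2 = a n" for n unfolding c_def d_def by (simp add: field_simps)
 have pb: "c n - d n / 2 = b n" for n unfolding c_def d_def by (simp add: field_simps)
 have nuc: "nuD a b E = nu c d E" for E unfolding c_def d_def by (rule nuD_eq_nu)
 have shc: "nuD_shift_int a b z r = shift_int c d z r" for z r unfolding c_def d_def by (rule nuD_shift_int_eq)
 have dens_of_area: "dens c d (cnj \<beta> / of_real (2 * pi)) (\<bar>C\<bar> * (8 * pi + 1))"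
  if "\<forall>E::complex set. convex E \<and> bounded E \<longrightarrow> norm (nuD a b E - cnj \<beta> * complex_of_real (measure lebesgue E / (2 * pi)))
    <= C * (enn2real (hausdorff1 (frontier E)) + 1)" for \<beta> C
  by (rule area_bound_imp_dens) (use that in \<open>simp add: nuc\<close>)
 have forward: "?sep \<and> ?area \<and> ?shift" if f: "almost_elliptic f" "divisor_of f a b" for f
 proof -
  have dv: "divisor_of f (%n. c n + d n / 2) (%n. c n - d n / 2)" unfolding za pb by (rule f(2))
  obtain \<eta> where e: "0 < \<eta>" "!!n k. \<eta> <= norm ((c n + d n / 2) - (c k - d k / 2))" by (rule almost_elliptic_separated[OF p f(1) dv]) blast
  have "\<eta> <= (INF p\<in>(UNIV :: (nat \<times> nat) set). norm (a (fst p) - b (snd p)))"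
   by (rule cINF_greatest) (use e(2) in \<open>simp_all add: za pb\<close>)
  hence sep: ?sep using e(1) by linarith
  obtain \<beta> C B where D: "dens c d (cnj \<beta> / of_real (2 * pi)) C" and B: "!!z. norm (Phi M c d (cnj \<beta> / of_real (2 * pi)) z) <= B"
   by (rule almost_elliptic_representation[OF p rd f(1) dv]) blast+
  obtain C' where C': "!!E. convex E ==> bounded E ==> norm (nu c d E - cnj \<beta> * complex_of_real (measure lebesgue E / (2 * pi)))
   <= C' * (enn2real (hausdorff1 (frontier E)) + 1)" by (rule dens_imp_area_bound[OF p D]) blast
  have area: ?area unfolding nuc by (intro exI[of _ \<beta>] exI[of _ C'] allI impI C') auto
  have shift: ?shift unfolding shc by (rule iffD1[OF Phi_bounded_iff[OF p D]]) (use B in blast)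
  show ?thesis by (intro conjI sep area shift)
 qed
 have backward: ?AE if h: ?sep ?area ?shift
 proof -
  define \<eta> where "\<eta> = (INF p\<in>(UNIV :: (nat \<times> nat) set). norm (a (fst p) - b (snd p)))"
  have e0: "0 < \<eta>" using h(1) by (simp add: \<eta>_def)
  have e: "\<eta> <= norm ((c n + d n / 2) - (c k - d k / 2))" for n k
  proof -
   have "\<eta> <= norm (a (fst (n, k)) - b (snd (n, k)))" unfolding \<eta>_def
    by (rule cINF_lower) (auto intro: bdd_belowI2[of _ 0])
   thus ?thesis by (simp add: za pb)
  qed
  obtain \<beta> C where bC: "\<forall>E::complex set. convex E \<and> bounded E \<longrightarrow>
    norm (nuD a b E - cnj \<beta> * complex_of_real (measure lebesgue E / (2 * pi)))
    <= C * (enn2real (hausdorff1 (frontier E)) + 1)" using h(2) by blast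
  note D = dens_of_area[OF bC]
  obtain B where B: "!!z. norm (Phi M c d (cnj \<beta> / of_real (2 * pi)) z) <= B"
   using iffD2[OF Phi_bounded_iff[OF p D]] h(3) unfolding shc by blast
  have "\<exists>f. almost_elliptic f \<and> divisor_of f (%n. c n + d n / 2) (%n. c n - d n / 2)"
   by (rule almost_elliptic_exists[OF p D e0 e B rd])
  thus ?thesis unfolding za pb .
 qed
 have formula: "\<exists>K. K ~= 0 \<and> (\<forall>z. z \<notin> range b \<longrightarrow>
    (\<exists>p. ((%r::real. \<Prod>n\<in>{n. norm ((a n + b n) / 2) < r}. b n * (a n - z) / (a n * (b n - z))) \<longlongrightarrow> p) at_top
    \<and> f z = Some (K * exp (\<beta> * z / 2) * p)))"
  if f: "almost_elliptic f" "divisor_of f a b" and bC: "\<forall>E::complex set. convex E \<and> bounded E \<longrightarrow>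
    norm (nuD a b E - cnj \<beta> * complex_of_real (measure lebesgue E / (2 * pi)))
    <= C * (enn2real (hausdorff1 (frontier E)) + 1)" for f \<beta> C
 proof -
  have dv: "divisor_of f (%n. c n + d n / 2) (%n. c n - d n / 2)" unfolding za pb by (rule f(2))
  obtain \<beta>' C' g where D: "dens c d (cnj \<beta>' / of_real (2 * pi)) C'" and g: "g ~= 0"
   and fz: "!!z. (!!n. c n - d n / 2 ~= z) ==> f z = Some (g * exp (\<beta>' * z / 2 + TT M c d z) * PP M c d z)"
   by (rule almost_elliptic_representation[OF p rd f(1) dv]) blast+
  \<comment> \<open>Densities are unique, so the exponent found for \<open>f\<close> is the \<beta>
    of every bound of the form (b).\<close>
  have "cnj \<beta>' / of_real (2 * pi) = cnj \<beta> / of_real (2 * pi)" by (rule dens_unique[OF D dens_of_area[OF bC]])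
  hence be: "\<beta>' = \<beta>" by simp
  have nz: "c n + d n / 2 ~= 0" "c n - d n / 2 ~= 0" for n using assms(3,4) unfolding za pb by auto
  have P0: "PP M c d 0 ~= 0" by (rule PP_nonzero) (use nz in auto)
  show ?thesis
  \<comment> \<open>The products are normalised to 1 at the origin, hence the value of
    \<open>PP\<close> at 0 in the constant.\<close>
  proof (rule exI[of _ "g * PP M c d 0"], intro conjI allI impI)
   show "g * PP M c d 0 ~= 0" using g P0 by simp
   fix z assume z: "z \<notin> range b"
   hence np: "c n - d n / 2 ~= z" for n unfolding pb by auto
   show "\<exists>p. ((%r::real. \<Prod>n\<in>{n. norm ((a n + b n) / 2) < r}. b n * (a n - z) / (a n * (b n - z))) \<longlongrightarrow> p) at_top
    \<and> f z = Some (g * PP M c d 0 * exp (\<beta> * z / 2) * p)"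
   proof (intro exI[of _ "exp (TT M c d z) * PP M c d z / PP M c d 0"] conjI)
    have "((%r. \<Prod>n\<in>{n. norm (c n) < r}. (c n - d n / 2) * (c n + d n / 2 - z) / ((c n + d n / 2) * (c n - d n / 2 - z)))
    \<longlongrightarrow> exp (TT M c d z) * PP M c d z / PP M c d 0) at_top"
    by (rule product_formula[OF p D nz np])
    thus "((%r::real. \<Prod>n\<in>{n. norm ((a n + b n) / 2) < r}. b n * (a n - z) / (a n * (b n - z)))
    \<longlongrightarrow> exp (TT M c d z) * PP M c d z / PP M c d 0) at_top" unfolding za pb unfolding c_def .
    have "G * exp (X + Y) * Q = G * P * exp X * (exp Y * Q / P)" if "P ~= 0" for G X Y Q P :: complex
    using that by (simp add: exp_add)
    from this[OF P0] show "f z = Some (g * PP M c d 0 * exp (\<beta> * z / 2) * (exp (TT M c d z) * PP M c d z / PP M c d 0))"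
    unfolding fz[OF np] be by simp
   qed
  qed
 qed
 have "?AE \<longleftrightarrow> ?sep \<and> ?area \<and> ?shift"
 proof
  assume ?AE
  then obtain f where "almost_elliptic f" "divisor_of f a b" by blast
  thus "?sep \<and> ?area \<and> ?shift" by (rule forward)
 next
  assume h: "?sep \<and> ?area \<and> ?shift"
  show ?AE by (rule backward[OF conjunct1[OF h] conjunct1[OF conjunct2[OF h]] conjunct2[OF conjunct2[OF h]]])
 qed
 moreover have ?formula
 proof (intro allI impI)
  fix f \<beta> and C :: real
  assume h: "almost_elliptic f \<and> divisor_of f a b \<and> (\<forall>E::complex set. convex E \<and> bounded E \<longrightarrow>
    norm (nuD a b E - cnj \<beta> * complex_of_real (measure lebesgue E / (2 * pi)))
    <= C * (enn2real (hausdorff1 (frontier E)) + 1))"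
  show "\<exists>K. K ~= 0 \<and> (\<forall>z. z \<notin> range b \<longrightarrow>
    (\<exists>p. ((%r::real. \<Prod>n\<in>{n. norm ((a n + b n) / 2) < r}. b n * (a n - z) / (a n * (b n - z))) \<longlongrightarrow> p) at_top
    \<and> f z = Some (K * exp (\<beta> * z / 2) * p)))"
   by (rule formula[OF conjunct1[OF h] conjunct1[OF conjunct2[OF h]] conjunct2[OF conjunct2[OF h]]])
 qed
 ultimately show ?thesis by (rule conjI)
qed

end
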